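(* Let $1\le p,q\le\infty$, $\alpha>-D\left(1-\frac1p\right)$ and $\beta<1-D\left(1-\frac1p\right)$. Let $f(x,v)\in\widetilde L^1\left(\mathbb{R}^D_x;\dot B^\alpha_{p,q}(\mathbb{R}^D_v)\right)$ be such that $$v\cdot\nabla_xf=g$$ for some $g(x,v)\in\widetilde L^1\left(\mathbb{R}^D_x;\dot B^\beta_{p,q}(\mathbb{R}^D_v)\right)$. Then $\int_{\mathbb{R}^D}f(x,v)\,dv\in\dot B^s_{p,q}(\mathbb{R}^D_x)$, where $s=\frac{\alpha+D(1-\frac1p)}{1+\alpha-\beta}-D\left(1-\frac1p\right)$, and $$\left\|\int_{\mathbb{R}^D}f(x,v)\,dv\right\|_{\dot B^s_{p,q}(\mathbb{R}^D_x)}\le C\,\|f\|_{\widetilde L^1(\mathbb{R}^D_x;\dot B^\alpha_{p,q}(\mathbb{R}^D_v))}^{\frac{1-\beta-D(1-\frac1p)}{1+\alpha-\beta}}\;\|g\|_{\widetilde L^1(\mathbb{R}^D_x;\dot B^\beta_{p,q}(\mathbb{R}^D_v))}^{\frac{\alpha+D(1-\frac1p)}{1+\alpha-\beta}},$$ where the constant $C>0$ depends only on the fixed parameters ($D,p,q,\alpha,\beta$ and the chosen Littlewood-Paley functions).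
   Context: $D\ge1$ is the dimension. Fourier transform: $\mathcal{F}f(\xi)=\int e^{-i\xi\cdot v}f(v)\,dv$. Fix radial $\psi,\varphi\in C_0^\infty(\mathbb{R}^D)$, $\psi,\varphi\ge0$, with $\mathrm{supp}\,\psi\subset\{|\xi|\le1\}$, $\mathrm{supp}\,\varphi\subset\{\frac12\le|\xi|\le2\}$ and $1=\psi(\xi)+\sum_{k\ge0}\varphi(2^{-k}\xi)$ for all $\xi$. For $\delta>0$, $\Delta_\delta$ is the Fourier multiplier with symbol $\varphi(\xi/\delta)$; a superscript $x$ or $v$ indicates the variable on which it acts. Homogeneous Besov semi-norm: $\|f\|_{\dot B^s_{p,q}(\mathbb{R}^D)}=\left(\sum_{k=-\infty}^\infty2^{ksq}\|\Delta_{2^k}f\|_{L^p}^q\right)^{1/q}$ (supremum if $q=\infty$); $\dot B^s_{p,q}$ is the space of tempered distributions for which it is finite. $\widetilde L^r(\mathbb{R}^D_x;\dot B^s_{p,q}(\mathbb{R}^D_v))$ is the space of tempered distributions $f(x,v)$ with finite semi-norm $\left(\sum_{k=-\infty}^\infty2^{ksq}\|\Delta_{2^k}^vf\|_{L^r(\mathbb{R}^D_x;L^p(\mathbb{R}^D_v))}^q\right)^{1/q}$ (obvious modification if $q=\infty$). The transport equation holds in the sense of distributions. When $f$ is not a priori globally integrable in $v$, the velocity average $\int f\,dv$ is understood through its dyadic blocks, defined (for $t>0$, $k\in\mathbb{Z}$) by $\Delta_{2^k}^x\int f\,dv=\int(\Delta_{t2^k}^vf)(x-tv,v)\,dv+\int_0^t\int(\Delta_{s2^k}^vg)(x-sv,v)\,dv\,ds$.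 *)

theory Defs
  imports "HOL-Analysis.Analysis" "HOL-Probability.Essential_Supremum"
begin

text \<open>
  The space \<open>R^D\<close> is an arbitrary type \<^typ>\<open>'a\<close> of class \<^class>\<open>euclidean_space\<close>, with
  \<open>D = DIM('a)\<close>; the phase space of pairs \<open>(x, v)\<close> is the euclidean space \<^typ>\<open>'a \<times> 'a\<close>.
  Functions and distributions are complex valued.
\<close>

definition dir_deriv ::
    "'a::real_normed_vector \<Rightarrow> ('a \<Rightarrow> 'b::real_normed_vector) \<Rightarrow> 'a \<Rightarrow> 'b" where
  "dir_deriv b f x = frechet_derivative f (at x) b"

definition iter_deriv ::
    "'a::real_normed_vector list \<Rightarrow> ('a \<Rightarrow> 'b::real_normed_vector) \<Rightarrow> 'a \<Rightarrow> 'b" where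
  "iter_deriv bs f = foldr dir_deriv bs f"

text \<open>
  The frechet derivative is a total operator; the definition is meaningful because
  differentiability is required at every stage, including the empty list.
\<close>

definition smooth :: "('a::euclidean_space \<Rightarrow> 'b::real_normed_vector) \<Rightarrow> bool" where
  "smooth f \<longleftrightarrow> (\<forall>bs\<in>lists Basis. \<forall>x. iter_deriv bs f differentiable (at x))"

definition supp :: "('a::topological_space \<Rightarrow> 'b::zero) \<Rightarrow> 'a set" where
  "supp f = closure {x. f x \<noteq> 0}"

definition test_function :: "('a::euclidean_space \<Rightarrow> 'b::real_normed_vector) \<Rightarrow> bool" where
  "test_function f \<longleftrightarrow> smooth f \<and> compact (supp f)"

definition schwartz :: "('a::euclidean_space \<Rightarrow> complex) \<Rightarrow> bool" where
  "schwartz h \<longleftrightarrow> smooth h \<and>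
     (\<forall>N. \<forall>bs\<in>lists Basis. bounded (range (\<lambda>x. (1 + norm x) ^ N *\<^sub>R iter_deriv bs h x)))"

definition schwartz_norm :: "nat \<Rightarrow> ('a::euclidean_space \<Rightarrow> complex) \<Rightarrow> real" where
  "schwartz_norm N h =
     (\<Sum>bs | bs \<in> lists Basis \<and> length bs \<le> N. SUP x. (1 + norm x) ^ N * norm (iter_deriv bs h x))"

text \<open>
  A tempered distribution is a functional of which only the values on Schwartz functions matter.
\<close>

definition tempered_distribution :: "(('a::euclidean_space \<Rightarrow> complex) \<Rightarrow> complex) \<Rightarrow> bool" where
  "tempered_distribution T \<longleftrightarrow>
     (\<forall>h1 h2. schwartz h1 \<longrightarrow> schwartz h2 \<longrightarrow> T (\<lambda>x. h1 x + h2 x) = T h1 + T h2) \<and>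
     (\<forall>c h. schwartz h \<longrightarrow> T (\<lambda>x. c * h x) = c * T h) \<and>
     (\<exists>N C. \<forall>h. schwartz h \<longrightarrow> norm (T h) \<le> C * schwartz_norm N h)"

definition represents ::
    "(('a::euclidean_space \<Rightarrow> complex) \<Rightarrow> complex) \<Rightarrow> ('a \<Rightarrow> complex) \<Rightarrow> bool" where
  "represents T F \<longleftrightarrow> F \<in> borel_measurable borel \<and>
     (\<forall>h. schwartz h \<longrightarrow>
        integrable lborel (\<lambda>x. F x * h x) \<and> T h = (LINT x|lborel. F x * h x))"

definition fourier :: "('a::euclidean_space \<Rightarrow> complex) \<Rightarrow> 'a \<Rightarrow> complex" where
  "fourier f \<xi> = (LINT v|lborel. exp (- (\<i> * complex_of_real (\<xi> \<bullet> v))) * f v)"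

definition inv_fourier :: "('a::euclidean_space \<Rightarrow> complex) \<Rightarrow> 'a \<Rightarrow> complex" where
  "inv_fourier f v =
     complex_of_real (1 / (2 * pi) ^ DIM('a)) *
     (LINT \<xi>|lborel. exp (\<i> * complex_of_real (\<xi> \<bullet> v)) * f \<xi>)"

definition fourier_dist ::
    "(('a::euclidean_space \<Rightarrow> complex) \<Rightarrow> complex) \<Rightarrow> ('a \<Rightarrow> complex) \<Rightarrow> complex" where
  "fourier_dist T h = T (fourier h)"

definition inv_fourier_dist ::
    "(('a::euclidean_space \<Rightarrow> complex) \<Rightarrow> complex) \<Rightarrow> ('a \<Rightarrow> complex) \<Rightarrow> complex" where
  "inv_fourier_dist T h = T (inv_fourier h)"

definition mult_dist ::
    "('a \<Rightarrow> complex) \<Rightarrow> (('a::euclidean_space \<Rightarrow> complex) \<Rightarrow> complex) \<Rightarrow> ('a \<Rightarrow> complex) \<Rightarrow> complex" where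
  "mult_dist m T h = T (\<lambda>\<xi>. m \<xi> * h \<xi>)"

definition fourier_multiplier ::
    "('a \<Rightarrow> complex) \<Rightarrow> (('a::euclidean_space \<Rightarrow> complex) \<Rightarrow> complex) \<Rightarrow> ('a \<Rightarrow> complex) \<Rightarrow> complex" where
  "fourier_multiplier m T = inv_fourier_dist (mult_dist m (fourier_dist T))"

definition littlewood_paley ::
    "('a::euclidean_space \<Rightarrow> real) \<Rightarrow> ('a \<Rightarrow> real) \<Rightarrow> bool" where
  "littlewood_paley \<psi> \<phi> \<longleftrightarrow>
     test_function \<psi> \<and> test_function \<phi> \<and>
     (\<forall>\<xi> \<eta>. norm \<xi> = norm \<eta> \<longrightarrow> \<psi> \<xi> = \<psi> \<eta>) \<and>
     (\<forall>\<xi> \<eta>. norm \<xi> = norm \<eta> \<longrightarrow> \<phi> \<xi> = \<phi> \<eta>) \<and>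
     (\<forall>\<xi>. \<psi> \<xi> \<ge> 0) \<and> (\<forall>\<xi>. \<phi> \<xi> \<ge> 0) \<and>
     supp \<psi> \<subseteq> {\<xi>. norm \<xi> \<le> 1} \<and>
     supp \<phi> \<subseteq> {\<xi>. 1/2 \<le> norm \<xi> \<and> norm \<xi> \<le> 2} \<and>
     (\<forall>\<xi>. (\<lambda>k. \<phi> (\<xi> /\<^sub>R 2 ^ k)) sums (1 - \<psi> \<xi>))"

definition LP_block ::
    "('a::euclidean_space \<Rightarrow> real) \<Rightarrow> real \<Rightarrow>
     (('a \<Rightarrow> complex) \<Rightarrow> complex) \<Rightarrow> ('a \<Rightarrow> complex) \<Rightarrow> complex" where
  "LP_block \<phi> \<delta> = fourier_multiplier (\<lambda>\<xi>. complex_of_real (\<phi> (\<xi> /\<^sub>R \<delta>)))"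

text \<open>
  The block acting on the variable \<open>v\<close> of \<open>(x, v)\<close>: the Fourier multiplier on the phase space whose
  symbol depends only on the frequency \<open>\<eta>\<close> dual to \<open>v\<close>. The transform in \<open>x\<close> cancels.
\<close>

definition LP_block_v ::
    "('a::euclidean_space \<Rightarrow> real) \<Rightarrow> real \<Rightarrow>
     (('a \<times> 'a \<Rightarrow> complex) \<Rightarrow> complex) \<Rightarrow> ('a \<times> 'a \<Rightarrow> complex) \<Rightarrow> complex" where
  "LP_block_v \<phi> \<delta> = fourier_multiplier (\<lambda>(\<xi>, \<eta>). complex_of_real (\<phi> (\<eta> /\<^sub>R \<delta>)))"

text \<open>Real powers of extended nonnegative reals; only used with exponents \<open>a > 0\<close>.\<close>

definition ennpowr :: "ennreal \<Rightarrow> real \<Rightarrow> ennreal" where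
  "ennpowr x a = (if x = \<infinity> then \<infinity> else ennreal (enn2real x powr a))"

text \<open>
  The function is \<^typ>\<open>ennreal\<close> valued so that the norm can be iterated; exponents range over
  \<open>[1, \<infinity>]\<close>.
\<close>

definition Lp_norm :: "ennreal \<Rightarrow> ('a::euclidean_space \<Rightarrow> ennreal) \<Rightarrow> ennreal" where
  "Lp_norm p h =
     (if p = \<infinity> then esssup lborel h
      else ennpowr (\<integral>\<^sup>+x. ennpowr (h x) (enn2real p) \<partial>lborel) (1 / enn2real p))"

definition lq_norm :: "ennreal \<Rightarrow> (int \<Rightarrow> ennreal) \<Rightarrow> ennreal" where
  "lq_norm q c =
     (if q = \<infinity> then (SUP k. c k)
      else ennpowr (\<Sum>\<^sub>\<infinity>k. ennpowr (c k) (enn2real q)) (1 / enn2real q))"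

text \<open>
  The representing function of a distribution is unique almost everywhere, so the infima below are
  the norm of that function, and they are \<open>\<infinity>\<close> if the distribution is not a function.
\<close>

definition dist_Lp_norm ::
    "ennreal \<Rightarrow> (('a::euclidean_space \<Rightarrow> complex) \<Rightarrow> complex) \<Rightarrow> ennreal" where
  "dist_Lp_norm p T = (INF F\<in>{F. represents T F}. Lp_norm p (\<lambda>x. ennreal (norm (F x))))"

definition dist_mixed_norm ::
    "ennreal \<Rightarrow> ennreal \<Rightarrow> (('a::euclidean_space \<times> 'a \<Rightarrow> complex) \<Rightarrow> complex) \<Rightarrow> ennreal" where
  "dist_mixed_norm r p T =
     (INF F\<in>{F. represents T F}. Lp_norm r (\<lambda>x. Lp_norm p (\<lambda>v. ennreal (norm (F (x, v))))))"

definition besov_seminorm ::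
    "('a::euclidean_space \<Rightarrow> real) \<Rightarrow> real \<Rightarrow> ennreal \<Rightarrow> ennreal \<Rightarrow>
     (('a \<Rightarrow> complex) \<Rightarrow> complex) \<Rightarrow> ennreal" where
  "besov_seminorm \<phi> s p q u =
     lq_norm q (\<lambda>k. ennreal (2 powr (of_int k * s)) * dist_Lp_norm p (LP_block \<phi> (2 powi k) u))"

definition besov_space ::
    "('a::euclidean_space \<Rightarrow> real) \<Rightarrow> real \<Rightarrow> ennreal \<Rightarrow> ennreal \<Rightarrow>
     (('a \<Rightarrow> complex) \<Rightarrow> complex) set" where
  "besov_space \<phi> s p q = {u. tempered_distribution u \<and> besov_seminorm \<phi> s p q u < \<infinity>}"

definition mixed_besov_seminorm ::
    "('a::euclidean_space \<Rightarrow> real) \<Rightarrow> ennreal \<Rightarrow> real \<Rightarrow> ennreal \<Rightarrow> ennreal \<Rightarrow>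
     (('a \<times> 'a \<Rightarrow> complex) \<Rightarrow> complex) \<Rightarrow> ennreal" where
  "mixed_besov_seminorm \<phi> r s p q f =
     lq_norm q (\<lambda>k. ennreal (2 powr (of_int k * s)) *
       dist_mixed_norm r p (LP_block_v \<phi> (2 powi k) f))"

definition mixed_besov_space ::
    "('a::euclidean_space \<Rightarrow> real) \<Rightarrow> ennreal \<Rightarrow> real \<Rightarrow> ennreal \<Rightarrow> ennreal \<Rightarrow>
     (('a \<times> 'a \<Rightarrow> complex) \<Rightarrow> complex) set" where
  "mixed_besov_space \<phi> r s p q =
     {f. tempered_distribution f \<and> mixed_besov_seminorm \<phi> r s p q f < \<infinity>}"

text \<open>
  \<open>v \<cdot> \<nabla>\<^sub>x f = g\<close> tested against compactly supported smooth functions; the coefficient \<open>v\<close> does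
  not depend on \<open>x\<close>, so the formal adjoint of \<open>v \<cdot> \<nabla>\<^sub>x\<close> is \<open>- v \<cdot> \<nabla>\<^sub>x\<close>.
\<close>

definition transport_equation ::
    "(('a::euclidean_space \<times> 'a \<Rightarrow> complex) \<Rightarrow> complex) \<Rightarrow>
     (('a \<times> 'a \<Rightarrow> complex) \<Rightarrow> complex) \<Rightarrow> bool" where
  "transport_equation f g \<longleftrightarrow>
     (\<forall>h. test_function h \<longrightarrow>
        - f (\<lambda>(x, v). \<Sum>b\<in>Basis. (v \<bullet> b) *\<^sub>R dir_deriv (b, 0) h (x, v)) = g h)"

text \<open>
  The formula
  \<open>\<Delta>\<^sup>x (\<integral> f dv) = \<integral> (\<Delta>\<^sup>v f)(x - t v, v) dv + \<integral>\<^sub>0\<^sup>t \<integral> (\<Delta>\<^sup>v g)(x - s v, v) dv ds\<close>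
  at frequencies \<open>2^k\<close>, \<open>t 2^k\<close> and \<open>s 2^k\<close>, for a candidate \<open>u\<close> for the velocity average.
  The blocks of \<open>f\<close> and \<open>g\<close> are functions \<open>F\<close> and \<open>G s\<close> only up to null sets, whence the joint
  measurability of \<open>G\<close>; two admissible choices of \<open>F\<close> and \<open>G\<close> give right-hand sides that agree
  for almost every \<open>x\<close>.
\<close>

definition velocity_block ::
    "('a::euclidean_space \<Rightarrow> real) \<Rightarrow> (('a \<times> 'a \<Rightarrow> complex) \<Rightarrow> complex) \<Rightarrow>
     (('a \<times> 'a \<Rightarrow> complex) \<Rightarrow> complex) \<Rightarrow> (('a \<Rightarrow> complex) \<Rightarrow> complex) \<Rightarrow> int \<Rightarrow> real \<Rightarrow> bool" where
  "velocity_block \<phi> f g u k t \<longleftrightarrow>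
     (\<exists>F G.
        represents (LP_block_v \<phi> (t * 2 powi k) f) F \<and>
        (\<lambda>(s, z). G s z) \<in> borel_measurable borel \<and>
        (\<forall>s\<in>{0<..<t}. represents (LP_block_v \<phi> (s * 2 powi k) g) (G s)) \<and>
        (AE x in lborel. integrable lborel (\<lambda>v. F (x - t *\<^sub>R v, v))) \<and>
        (AE x in lborel.
           set_integrable lborel ({0<..<t} \<times> UNIV) (\<lambda>(s, v). G s (x - s *\<^sub>R v, v))) \<and>
        represents (LP_block \<phi> (2 powi k) u)
          (\<lambda>x. (LINT v|lborel. F (x - t *\<^sub>R v, v)) +
               (LINT s:{0<..<t}|lborel. LINT v|lborel. G s (x - s *\<^sub>R v, v))))"

text \<open>
  \<open>u\<close> is a velocity average of \<open>f\<close>, where \<open>v \<cdot> \<nabla>\<^sub>x f = g\<close>: either the actual integral over \<open>v\<close>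
  of a globally integrable \<open>f\<close>, or a tempered distribution with the prescribed dyadic blocks. The
  blocks determine \<open>u\<close> only up to polynomials, which are invisible to homogeneous semi-norms.
\<close>

definition velocity_average ::
    "('a::euclidean_space \<Rightarrow> real) \<Rightarrow> (('a \<times> 'a \<Rightarrow> complex) \<Rightarrow> complex) \<Rightarrow>
     (('a \<times> 'a \<Rightarrow> complex) \<Rightarrow> complex) \<Rightarrow> (('a \<Rightarrow> complex) \<Rightarrow> complex) \<Rightarrow> bool" where
  "velocity_average \<phi> f g u \<longleftrightarrow>
     tempered_distribution u \<and>
     ((\<exists>F. integrable lborel F \<and> represents f F \<and>
           represents u (\<lambda>x. LINT v|lborel. F (x, v))) \<or>
      (\<forall>k. \<forall>t>0. velocity_block \<phi> f g u k t))"

end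

theory Submission
 imports Defs "HOL-Probability.Characteristic_Functions" "HOL-Probability.Sinc_Integral"
begin

text \<open>Average over \<open>v\<close> along the characteristics \<open>x - t v\<close>. Duhamel's formula for \<open>v \<cdot> \<nabla>\<^sub>x f = g\<close> expresses the velocity average by \<open>f\<close>
transported over an arbitrary time \<open>t\<close> and by \<open>g\<close> transported over the times \<open>0 < s < t\<close>. The theorem rests on two
facts about free transport.

\<^item> A function \<open>a (x + t v)\<close> has its frequencies on the plane \<open>\<eta> = t \<xi>\<close>. Hence the \<open>x\<close>-block of the average at frequency
\<open>2\<^sup>k\<close> involves only the \<open>v\<close>-block of \<open>f\<close> at frequency \<open>t 2\<^sup>k\<close> and those of \<open>g\<close> at the frequencies \<open>s 2\<^sup>k\<close>: regularity in \<open>v\<close>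
becomes regularity in \<open>x\<close> (\<open>Htest_frequency\<close>, \<open>Fd_pair\<close>).

\<^item> The velocity integral of a transported function obeys the dispersive estimate
\<open>\<parallel>\<integral> F (x - t v, v) dv\<parallel>\<^sub>p \<le> t powr (- d) * \<parallel>F\<parallel>\<close> with the norm of \<open>L\<^sup>1\<^sub>x L\<^sup>p\<^sub>v\<close> on the right (\<open>glp_tmass\<close>).

So the block at frequency \<open>2\<^sup>k\<close> is bounded by \<open>t powr (- d)\<close> times the size of \<open>f\<close> at frequency \<open>t 2\<^sup>k\<close>, plus the integral
over \<open>(0, t)\<close> of \<open>s powr (- d)\<close> times the size of \<open>g\<close> at frequency \<open>s 2\<^sup>k\<close> (\<open>block_estimate\<close>). The second term converges at \<open>s = 0\<close>
because \<open>\<beta> < 1 - d\<close>. For \<open>t = \<tau> 2 powr (k (1 / m - 1))\<close> with \<open>m = 1 + \<alpha> - \<beta>\<close> the weight \<open>2 powr (k s)\<close> removes all powers of \<open>2\<^sup>k\<close>: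
what remains is \<open>\<tau> powr (- (\<alpha> + d))\<close> times the \<open>f\<close>-norm sampled at the frequencies \<open>\<tau> 2 powr (k / m)\<close>, and \<open>\<tau> powr (1 - d - \<beta>)\<close>
times a similar average for \<open>g\<close>. Since a dyadic interval contains a bounded number of these frequencies (\<open>S7_lq\<close>), the
\<open>\<ell>\<^sup>q\<close> norms are those of the data, and optimizing in \<open>\<tau>\<close> gives the product of powers (\<open>optimize_scale\<close>, \<open>besov_estimate\<close>).

Since \<open>f\<close> and \<open>g\<close> need not be functions, Duhamel's formula is derived by duality. The equation is tested with the time integral
of \<open>a (x + s v)\<close>, cut off in \<open>v\<close> by a function with compactly supported transform; then only finitely many \<open>v\<close>-blocks
contribute, these are functions, and the cutoff can be removed (\<open>transport_increment\<close>). The right-hand side of the formula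
is therefore independent of \<open>t\<close> (\<open>Bt_indep\<close>), which has two consequences. A tempered distribution with the prescribed
blocks exists: the blocks, each evaluated at its own time, can be summed since \<open>- D < s < D / p\<close> (\<open>s_bounds\<close>,
\<open>uu_td\<close>, \<open>uu_block\<close>). And if \<open>f\<close> is integrable, letting \<open>t\<close> tend to \<open>0\<close> shows that its actual velocity integral satisfies the
formula for every \<open>t\<close> (\<open>integrable_average_block\<close>), so that one estimate covers both notions of average.\<close>

section \<open>Families closed under differentiation\<close>

abbreviation enorm :: "'a::real_normed_vector \<Rightarrow> ennreal" where "enorm x \<equiv> ennreal (norm x)"

abbreviation nn_lborel :: "('a::euclidean_space \<Rightarrow> ennreal) \<Rightarrow> ennreal" (binder "INN " 10) where
 "nn_lborel f \<equiv> nn_integral lborel f"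

abbreviation lint_lborel :: "('a::euclidean_space \<Rightarrow> 'b::{banach, second_countable_topology}) \<Rightarrow> 'b" (binder "LIN " 10) where
 "lint_lborel f \<equiv> integral\<^sup>L lborel f"

lemmas integrable_dominated = Bochner_Integration.integrable_bound

lemmas LINT_cong = Bochner_Integration.integral_cong[OF refl]

text \<open>\<open>dcl W n f\<close>: the family \<open>f\<close> and its partial derivatives up to order \<open>n\<close> belong to the class \<open>W\<close>. Classes
are classes of families, so that a bound in \<open>W\<close> is uniform in the index; a single function is a family
over \<^typ>\<open>unit\<close>. Products, sums and affine substitutions are treated once for all classes.\<close>

primrec dcl :: "(('i \<Rightarrow> 'a::euclidean_space \<Rightarrow> 'b::real_normed_vector) \<Rightarrow> bool) \<Rightarrow> nat \<Rightarrow> ('i \<Rightarrow> 'a \<Rightarrow> 'b) \<Rightarrow> bool"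
 where
 "dcl W 0 f \<longleftrightarrow> W f"
| "dcl W (Suc n) f \<longleftrightarrow> W f \<and> (\<forall>i x. f i differentiable (at x)) \<and> (\<forall>b\<in>Basis. dcl W n (\<lambda>i. dir_deriv b (f i)))"

lemma dir_deriv_eqI: "(f has_derivative D) (at x) \<Longrightarrow> dir_deriv b f x = D b"
 unfolding dir_deriv_def by (simp add: frechet_derivative_at[symmetric])

lemma has_dir_deriv:
 "f differentiable (at x) \<Longrightarrow> (f has_derivative (\<lambda>h. dir_deriv h f x)) (at x)"
 unfolding dir_deriv_def by (rule frechet_derivative_works[THEN iffD1])

lemma dir_deriv_sum_Basis:
 fixes f :: "'a::euclidean_space \<Rightarrow> 'b::real_normed_vector"
 assumes "f differentiable (at x)"
 shows "dir_deriv h f x = (\<Sum>b\<in>Basis. (h \<bullet> b) *\<^sub>R dir_deriv b f x)"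
proof -
 interpret bounded_linear "\<lambda>h. dir_deriv h f x"
  using has_dir_deriv[OF assms] has_derivative_bounded_linear by blast
 have "dir_deriv h f x = dir_deriv (\<Sum>b\<in>Basis. (h \<bullet> b) *\<^sub>R b) f x"
  by (simp add: euclidean_representation)
 also have "\<dots> = (\<Sum>b\<in>Basis. (h \<bullet> b) *\<^sub>R dir_deriv b f x)"
  by (simp add: sum scaleR)
 finally show ?thesis .
qed

lemma iter_deriv_snoc: "iter_deriv (bs @ [b]) f = iter_deriv bs (dir_deriv b f)"
 by (simp add: iter_deriv_def)

lemma iter_deriv_Nil [simp]: "iter_deriv [] f = f"
 by (simp add: iter_deriv_def)

lemma dcl_SucD: "dcl W (Suc n) f \<Longrightarrow> dcl W n f"
 by (induction n arbitrary: f) auto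

lemma dcl_iff:
 fixes f :: "'i \<Rightarrow> 'a::euclidean_space \<Rightarrow> 'b::real_normed_vector"
 shows "(\<forall>n. dcl W n f) \<longleftrightarrow> (\<forall>bs\<in>lists Basis. W (\<lambda>i. iter_deriv bs (f i)) \<and> (\<forall>i x. iter_deriv bs (f i) differentiable (at x)))"
 (is "?L \<longleftrightarrow> ?R")
proof
 have "W (\<lambda>i. iter_deriv bs (f i)) \<and> (\<forall>i x. iter_deriv bs (f i) differentiable (at x))"
  if "dcl W (Suc (length bs)) f" "bs \<in> lists Basis" for bs
  using that
 proof (induction bs arbitrary: f rule: rev_induct)
  case (snoc b bs)
  have "dcl W (Suc (length bs)) (\<lambda>i. dir_deriv b (f i))"
   using snoc.prems by simp
  from snoc.IH[OF this] show ?case using snoc.prems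
   unfolding iter_deriv_snoc by auto
 qed simp
 then show "?L \<Longrightarrow> ?R" by blast
 show ?L if ?R
 proof
  fix n show "dcl W n f" using that
  proof (induction n arbitrary: f)
   case (Suc n)
   have "dcl W n (\<lambda>i. dir_deriv b (f i))" if "b \<in> Basis" for b
   proof (rule Suc.IH, intro ballI)
    fix bs :: "'a list" assume "bs \<in> lists Basis"
    with Suc.prems that have "W (\<lambda>i. iter_deriv (bs @ [b]) (f i)) \<and> (\<forall>i x. iter_deriv (bs @ [b]) (f i) differentiable (at x))"
     by auto
    then show "W (\<lambda>i. iter_deriv bs (dir_deriv b (f i))) \<and> (\<forall>i x. iter_deriv bs (dir_deriv b (f i)) differentiable at x)"
     unfolding iter_deriv_snoc .
   qed
   moreover have "W f" "\<forall>i x. f i differentiable (at x)"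
    using Suc.prems[rule_format, of "[]"] by auto
   ultimately show ?case by simp
  next
  case 0
  have "W (\<lambda>i. iter_deriv [] (f i))" using 0 lists.Nil by blast
  then show ?case by simp
 qed
 qed
qed

lemma dcl_mono:
 assumes "\<And>f. W f \<Longrightarrow> W' f" shows "dcl W n f \<Longrightarrow> dcl W' n f"
 by (induction n arbitrary: f) (auto simp: assms)

lemma dcl_strengthen:
 assumes "\<And>f. W f \<Longrightarrow> (\<And>i x. f i differentiable (at x)) \<Longrightarrow> W' f"
 shows "dcl W (Suc n) f \<Longrightarrow> dcl W' n f"
 by (induction n arbitrary: f) (auto intro: assms)

lemma dcl_bounded_linear:
 assumes L: "bounded_linear L" and W: "\<And>f. W f \<Longrightarrow> W' (\<lambda>i x. L (f i x))"
 shows "dcl W n f \<Longrightarrow> dcl W' n (\<lambda>i x. L (f i x))"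
proof (induction n arbitrary: f)
 case (Suc n)
 have d: "((\<lambda>x. L (f i x)) has_derivative (\<lambda>h. L (dir_deriv h (f i) x))) (at x)" for i x
  using bounded_linear.has_derivative[OF L has_dir_deriv] Suc.prems by auto
 have "dir_deriv b (\<lambda>x. L (f i x)) = (\<lambda>x. L (dir_deriv b (f i) x))" for b i
  using dir_deriv_eqI[OF d] by auto
 with Suc d show ?case using differentiableI[OF d] by (auto simp: W)
qed (simp add: W)

lemma dcl_add:
 assumes W: "\<And>f g. W1 f \<Longrightarrow> W2 g \<Longrightarrow> W3 (\<lambda>i x. f i x + g i x)"
 shows "dcl W1 n f \<Longrightarrow> dcl W2 n g \<Longrightarrow> dcl W3 n (\<lambda>i x. f i x + g i x)"
proof (induction n arbitrary: f g)
 case (Suc n)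
 have d: "((\<lambda>x. f i x + g i x) has_derivative (\<lambda>h. dir_deriv h (f i) x + dir_deriv h (g i) x)) (at x)" for i x
  by (rule has_derivative_add[OF has_dir_deriv has_dir_deriv]) (use Suc.prems in auto)
 have "dir_deriv b (\<lambda>x. f i x + g i x) = (\<lambda>x. dir_deriv b (f i) x + dir_deriv b (g i) x)" for b i
  using dir_deriv_eqI[OF d] by auto
 with Suc d show ?case using differentiableI[OF d] by (auto simp: W)
qed (simp add: W)

lemma dcl_mult:
 fixes f g :: "'i \<Rightarrow> 'a::euclidean_space \<Rightarrow> 'b::real_normed_algebra"
 assumes W: "\<And>f g. W1 f \<Longrightarrow> W2 g \<Longrightarrow> W3 (\<lambda>i x. f i x * g i x)"
  and A: "\<And>f g. W3 f \<Longrightarrow> W3 g \<Longrightarrow> W3 (\<lambda>i x. f i x + g i x)"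
 shows "dcl W1 n f \<Longrightarrow> dcl W2 n g \<Longrightarrow> dcl W3 n (\<lambda>i x. f i x * g i x)"
proof (induction n arbitrary: f g)
 case (Suc n)
 have d: "((\<lambda>x. f i x * g i x) has_derivative (\<lambda>h. f i x * dir_deriv h (g i) x + dir_deriv h (f i) x * g i x)) (at x)" for i x
  by (rule has_derivative_mult[OF has_dir_deriv has_dir_deriv]) (use Suc.prems in auto)
 have e: "dir_deriv b (\<lambda>x. f i x * g i x) = (\<lambda>x. f i x * dir_deriv b (g i) x + dir_deriv b (f i) x * g i x)" for b i
  using dir_deriv_eqI[OF d] by auto
 have "dcl W3 n (\<lambda>i x. f i x * dir_deriv b (g i) x + dir_deriv b (f i) x * g i x)" if "b \<in> Basis" for b
 proof (rule dcl_add[of W3 W3 W3])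
  show "dcl W3 n (\<lambda>i x. f i x * dir_deriv b (g i) x)"
   by (rule Suc.IH[OF dcl_SucD[OF Suc.prems(1)]]) (use Suc.prems that in auto)
  show "dcl W3 n (\<lambda>i x. dir_deriv b (f i) x * g i x)"
   by (rule Suc.IH[OF _ dcl_SucD[OF Suc.prems(2)]]) (use Suc.prems that in auto)
 qed (rule A)
 with Suc d e show ?case using differentiableI[OF d] by (auto simp: W)
qed (simp add: W)

lemma dcl_sum:
 fixes f :: "'j \<Rightarrow> 'i \<Rightarrow> 'a::euclidean_space \<Rightarrow> 'b::real_normed_vector"
 assumes Z: "W (\<lambda>_ _. 0)" and A: "\<And>f g. W f \<Longrightarrow> W g \<Longrightarrow> W (\<lambda>i x. f i x + g i x)"
  and f: "\<And>j. j \<in> S \<Longrightarrow> dcl W n (f j)"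
 shows "dcl W n (\<lambda>i x. \<Sum>j\<in>S. f j i x)"
proof -
 have z: "dcl W n (\<lambda>_ _. 0)"
 proof (induction n)
  case (Suc n)
  have "dir_deriv b (\<lambda>_. 0) = (\<lambda>_. 0 :: 'b)" for b :: 'a
   by (rule ext, rule dir_deriv_eqI) simp
  with Suc Z show ?case by simp
 qed (simp add: Z)
 show ?thesis
 proof (cases "finite S")
  case True
  then show ?thesis using f
   by (induction S) (auto intro!: dcl_add[of W W W] z A)
 qed (simp add: z)
qed

lemma dcl_affine:
 fixes L :: "'c::euclidean_space \<Rightarrow> 'a::euclidean_space"
 assumes L: "bounded_linear L" and W: "\<And>f. W f \<Longrightarrow> W' (\<lambda>i x. f i (c + L x))"
  and Z: "W' (\<lambda>_ _. 0)" and A: "\<And>f g. W' f \<Longrightarrow> W' g \<Longrightarrow> W' (\<lambda>i x. f i x + g i x)"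
  and S: "\<And>f r. W' f \<Longrightarrow> W' (\<lambda>i x. r *\<^sub>R f i x)"
 shows "dcl W n f \<Longrightarrow> dcl W' n (\<lambda>i x. f i (c + L x))"
proof (induction n arbitrary: f)
 case (Suc n)
 have cL: "((\<lambda>x. c + L x) has_derivative L) (at x)" for x
  using bounded_linear_imp_has_derivative[OF L] by (auto intro!: derivative_eq_intros)
 have d: "((\<lambda>x. f i (c + L x)) has_derivative (\<lambda>h. dir_deriv (L h) (f i) (c + L x))) (at x)" for i x
  by (rule has_derivative_compose[OF cL has_dir_deriv]) (use Suc.prems in auto)
 have "dir_deriv b (\<lambda>x. f i (c + L x)) = (\<lambda>x. \<Sum>k\<in>Basis. (L b \<bullet> k) *\<^sub>R dir_deriv k (f i) (c + L x))" for b i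
  unfolding fun_eq_iff dir_deriv_eqI[OF d]
  by (intro allI dir_deriv_sum_Basis) (use Suc.prems in auto)
 moreover have "dcl W' n (\<lambda>i x. \<Sum>k\<in>Basis. (L b \<bullet> k) *\<^sub>R dir_deriv k (f i) (c + L x))" for b
 proof (rule dcl_sum[OF Z A])
  fix k :: 'a assume "k \<in> Basis"
  then have "dcl W' n (\<lambda>i x. dir_deriv k (f i) (c + L x))" using Suc by auto
  then show "dcl W' n (\<lambda>i x. (L b \<bullet> k) *\<^sub>R dir_deriv k (f i) (c + L x))"
   by (rule dcl_bounded_linear[where W=W' and W'=W', rotated 2]) (auto intro: bounded_linear_scaleR_right S)
 qed
 ultimately show ?case using d Suc.prems using differentiableI[OF d] by (auto simp: W)
qed (simp add: W)

section \<open>Rapidly decreasing and polynomially bounded families\<close>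

definition rapid :: "('i \<Rightarrow> 'a::real_normed_vector \<Rightarrow> 'b::real_normed_vector) \<Rightarrow> bool" where
 "rapid f \<longleftrightarrow> (\<forall>N. \<exists>C. \<forall>i x. (1 + norm x) ^ N * norm (f i x) \<le> C)"

definition polyb :: "('i \<Rightarrow> 'a::real_normed_vector \<Rightarrow> 'b::real_normed_vector) \<Rightarrow> bool" where
 "polyb f \<longleftrightarrow> (\<exists>N C. \<forall>i x. norm (f i x) \<le> C * (1 + norm x) ^ N)"

lemma rapidD: "rapid f \<Longrightarrow> \<exists>C. \<forall>i x. (1 + norm x) ^ N * norm (f i x) \<le> C"
 unfolding rapid_def by blast

lemma rapid_add: assumes "rapid f" "rapid g" shows "rapid (\<lambda>i x. f i x + g i x)"
 unfolding rapid_def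
proof
 fix N
 obtain C1 C2 where C: "\<And>i x. (1 + norm x) ^ N * norm (f i x) \<le> C1" "\<And>i x. (1 + norm x) ^ N * norm (g i x) \<le> C2"
  using rapidD[OF assms(1), of N] rapidD[OF assms(2), of N] by auto
 have "(1 + norm x) ^ N * norm (f i x + g i x) \<le> C1 + C2" for i x
  using mult_left_mono[OF norm_triangle_ineq[of "f i x" "g i x"], of "(1 + norm x) ^ N"] C[where i=i and x=x]
  by (simp add: algebra_simps)
 then show "\<exists>C. \<forall>i x. (1 + norm x) ^ N * norm (f i x + g i x) \<le> C" by blast
qed

lemma rapid_zero: "rapid (\<lambda>_ _. 0)"
 unfolding rapid_def by auto

lemma rapid_linear: assumes "bounded_linear L" "rapid f" shows "rapid (\<lambda>i x. L (f i x))"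
 unfolding rapid_def
proof
 fix N
 obtain C where C: "\<And>i x. (1 + norm x) ^ N * norm (f i x) \<le> C"
  using rapidD[OF assms(2), of N] by auto
 obtain K where K: "\<And>x. norm (L x) \<le> norm x * K" "K > 0"
  using bounded_linear.pos_bounded[OF assms(1)] by auto
 have "(1 + norm x) ^ N * norm (L (f i x)) \<le> C * K" for i x
 proof -
  have "(1 + norm x) ^ N * norm (L (f i x)) \<le> (1 + norm x) ^ N * (norm (f i x) * K)"
   by (intro mult_left_mono K) auto
  also have "\<dots> \<le> C * K" using mult_right_mono[OF C[where i=i and x=x], of K] K by (simp add: mult.assoc)
  finally show ?thesis .
 qed
 then show "\<exists>C. \<forall>i x. (1 + norm x) ^ N * norm (L (f i x)) \<le> C" by blast
qed

lemma polyb_D: assumes "polyb f" obtains N C where "C \<ge> 0" "\<And>i x. norm (f i x) \<le> C * (1 + norm x) ^ N"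
proof -
 obtain N C where C: "\<And>i x. norm (f i x) \<le> C * (1 + norm x) ^ N" using assms unfolding polyb_def by blast
 have "norm (f i x) \<le> \<bar>C\<bar> * (1 + norm x) ^ N" for i x
  by (rule order_trans[OF C]) (intro mult_right_mono, auto)
 then show ?thesis using that[of "\<bar>C\<bar>" N] by auto
qed

lemma polyb_add: assumes "polyb f" "polyb g" shows "polyb (\<lambda>i x. f i x + g i x)"
proof -
 obtain N1 C1 where 1: "C1 \<ge> 0" "\<And>i x. norm (f i x) \<le> C1 * (1 + norm x) ^ N1" using polyb_D[OF assms(1)] by metis
 obtain N2 C2 where 2: "C2 \<ge> 0" "\<And>i x. norm (g i x) \<le> C2 * (1 + norm x) ^ N2" using polyb_D[OF assms(2)] by metis
 have "norm (f i x + g i x) \<le> (C1 + C2) * (1 + norm x) ^ max N1 N2" for i x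
 proof -
  have "norm (f i x + g i x) \<le> C1 * (1 + norm x) ^ N1 + C2 * (1 + norm x) ^ N2"
   by (rule norm_triangle_le) (use 1 2 in \<open>auto intro!: add_mono\<close>)
  also have "\<dots> \<le> C1 * (1 + norm x) ^ max N1 N2 + C2 * (1 + norm x) ^ max N1 N2"
   by (intro add_mono mult_left_mono power_increasing) (use 1 2 in auto)
  finally show ?thesis by (simp add: algebra_simps)
 qed
 then show ?thesis unfolding polyb_def by blast
qed

lemma polyb_mult:
 fixes f g :: "'i \<Rightarrow> 'a::real_normed_vector \<Rightarrow> 'b::real_normed_algebra"
 assumes "polyb f" "polyb g" shows "polyb (\<lambda>i x. f i x * g i x)"
proof -
 obtain N1 C1 where 1: "C1 \<ge> 0" "\<And>i x. norm (f i x) \<le> C1 * (1 + norm x) ^ N1" using polyb_D[OF assms(1)] by metis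
 obtain N2 C2 where 2: "C2 \<ge> 0" "\<And>i x. norm (g i x) \<le> C2 * (1 + norm x) ^ N2" using polyb_D[OF assms(2)] by metis
 have "norm (f i x * g i x) \<le> (C1 * C2) * (1 + norm x) ^ (N1 + N2)" for i x
 proof -
  have "norm (f i x * g i x) \<le> (C1 * (1 + norm x) ^ N1) * (C2 * (1 + norm x) ^ N2)"
   by (rule order_trans[OF norm_mult_ineq]) (use 1 2 in \<open>auto intro!: mult_mono\<close>)
  then show ?thesis by (simp add: power_add algebra_simps)
 qed
 then show ?thesis unfolding polyb_def by blast
qed

lemma polyb_rapid_mult:
 fixes f g :: "'i \<Rightarrow> 'a::real_normed_vector \<Rightarrow> 'b::real_normed_algebra"
 assumes "polyb f" "rapid g" shows "rapid (\<lambda>i x. f i x * g i x)"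
 unfolding rapid_def
proof
 fix M
 obtain N C where 1: "C \<ge> 0" "\<And>i x. norm (f i x) \<le> C * (1 + norm x) ^ N" using polyb_D[OF assms(1)] by metis
 obtain C2 where 2: "\<And>i x. (1 + norm x) ^ (M + N) * norm (g i x) \<le> C2" using rapidD[OF assms(2)] by metis
 have "(1 + norm x) ^ M * norm (f i x * g i x) \<le> C * C2" for i x
 proof -
  have "norm (f i x * g i x) \<le> (C * (1 + norm x) ^ N) * norm (g i x)"
   by (rule order_trans[OF norm_mult_ineq]) (use 1 in \<open>auto intro!: mult_right_mono\<close>)
  then have "(1 + norm x) ^ M * norm (f i x * g i x) \<le> (1 + norm x) ^ M * ((C * (1 + norm x) ^ N) * norm (g i x))"
   by (intro mult_left_mono) auto
  also have "\<dots> = C * ((1 + norm x) ^ (M + N) * norm (g i x))" by (simp add: power_add algebra_simps)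
  also have "\<dots> \<le> C * C2" using 1 2 by (intro mult_left_mono) auto
  finally show ?thesis .
 qed
 then show "\<exists>C. \<forall>i x. (1 + norm x) ^ M * norm (f i x * g i x) \<le> C" by blast
qed

lemma polyb_bounded: "(\<And>i x. norm (f i x) \<le> C) \<Longrightarrow> polyb f"
 unfolding polyb_def by (rule exI[of _ 0]) auto

lemma one_plus_norm_le:
 assumes "0 \<le> K" "norm x \<le> K * (1 + norm y)" shows "1 + norm x \<le> (1 + K) * (1 + norm y)"
proof -
 have "norm x \<le> K * (1 + norm y)" "0 \<le> norm y" using assms by auto
 then have "1 + norm x \<le> (1 + norm y) + K * (1 + norm y)" by linarith
 then show ?thesis by (simp add: algebra_simps)
qed

lemma rapid_compose:
 assumes f: "rapid f" and K: "0 \<le> K" "\<And>x. norm x \<le> K * (1 + norm (T x))"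
 shows "rapid (\<lambda>i x. f i (T x))"
 unfolding rapid_def
proof
 fix N
 obtain C where C: "\<And>i x. (1 + norm x) ^ N * norm (f i x) \<le> C"
  using rapidD[OF f, of N] by auto
 have "(1 + norm x) ^ N * norm (f i (T x)) \<le> (1 + K) ^ N * C" for i x
 proof -
  have "(1 + norm x) ^ N \<le> ((1 + K) * (1 + norm (T x))) ^ N"
   by (intro power_mono one_plus_norm_le K) auto
  then have "(1 + norm x) ^ N * norm (f i (T x)) \<le> ((1 + K) * (1 + norm (T x))) ^ N * norm (f i (T x))"
   by (intro mult_right_mono) auto
  also have "\<dots> = (1 + K) ^ N * ((1 + norm (T x)) ^ N * norm (f i (T x)))"
   by (simp add: power_mult_distrib)
  also have "\<dots> \<le> (1 + K) ^ N * C" using C K(1) by (intro mult_left_mono) auto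
  finally show ?thesis .
 qed
 then show "\<exists>C. \<forall>i x. (1 + norm x) ^ N * norm (f i (T x)) \<le> C" by blast
qed

lemma polyb_compose:
 assumes f: "polyb f" and K: "0 \<le> K" "\<And>x. norm (T x) \<le> K * (1 + norm x)"
 shows "polyb (\<lambda>i x. f i (T x))"
proof -
 obtain N C where 1: "C \<ge> 0" "\<And>i x. norm (f i x) \<le> C * (1 + norm x) ^ N" using polyb_D[OF f] by metis
 have "norm (f i (T x)) \<le> (C * (1 + K)^N) * (1 + norm x) ^ N" for i x
 proof -
  have "(1 + norm (T x)) ^ N \<le> ((1 + K) * (1 + norm x)) ^ N"
   by (intro power_mono one_plus_norm_le K) auto
  then have "C * (1 + norm (T x)) ^ N \<le> C * ((1 + K) * (1 + norm x)) ^ N" using 1 by (intro mult_left_mono) auto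
  with 1(2)[of i "T x"] show ?thesis by (simp only: power_mult_distrib mult.assoc)
 qed
 then show ?thesis unfolding polyb_def by blast
qed

section \<open>Schwartz functions and slowly increasing multipliers\<close>

definition slow :: "('a::euclidean_space \<Rightarrow> complex) \<Rightarrow> bool" where
 "slow g \<longleftrightarrow> (\<forall>n. dcl polyb n (\<lambda>_::unit. g))"

lemma schwartz_iff: "schwartz h \<longleftrightarrow> (\<forall>n. dcl rapid n (\<lambda>_::unit. h))"
proof -
 have "(\<forall>N. bounded (range (\<lambda>x. (1 + norm x) ^ N *\<^sub>R k x))) \<longleftrightarrow> rapid (\<lambda>_::unit. k)" for k :: "'a \<Rightarrow> complex"
  unfolding rapid_def bounded_iff by (auto simp: abs_of_nonneg)
 then show ?thesis
  unfolding dcl_iff schwartz_def smooth_def by blast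
qed

lemma slowI: "(\<And>n. dcl polyb n (\<lambda>_::unit. g)) \<Longrightarrow> slow g"
 and slowD: "slow g \<Longrightarrow> dcl polyb n (\<lambda>_::unit. g)"
 unfolding slow_def by auto

lemma schwartzI: "(\<And>n. dcl rapid n (\<lambda>_::unit. h)) \<Longrightarrow> schwartz h"
 and schwartzD: "schwartz h \<Longrightarrow> dcl rapid n (\<lambda>_::unit. h)"
 unfolding schwartz_iff by auto

lemma schwartz_add: "schwartz f \<Longrightarrow> schwartz g \<Longrightarrow> schwartz (\<lambda>x. f x + g x)"
 by (rule schwartzI, rule dcl_add[of rapid rapid rapid]) (auto intro: schwartzD rapid_add)

lemma schwartz_slow_mult: "slow f \<Longrightarrow> schwartz g \<Longrightarrow> schwartz (\<lambda>x. f x * g x)"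
 by (rule schwartzI, rule dcl_mult[of polyb rapid rapid]) (auto intro: schwartzD slowD polyb_rapid_mult rapid_add)

lemma slow_mult: "slow f \<Longrightarrow> slow g \<Longrightarrow> slow (\<lambda>x. f x * g x)"
 by (rule slowI, rule dcl_mult[of polyb polyb polyb]) (auto intro: slowD polyb_mult polyb_add)

lemma schwartz_linear: "bounded_linear L \<Longrightarrow> schwartz g \<Longrightarrow> schwartz (\<lambda>x. L (g x))"
 by (rule schwartzI, rule dcl_bounded_linear[of L rapid rapid]) (auto intro: schwartzD rapid_linear)

lemma schwartz_cmult: "schwartz g \<Longrightarrow> schwartz (\<lambda>x. c * g x)"
 by (rule schwartz_linear[OF bounded_linear_mult_right])

lemma schwartz_zero: "schwartz (\<lambda>x. 0)"
proof -
 have *: "iter_deriv bs (\<lambda>x. 0) = (\<lambda>x. 0)" for bs :: "'a list"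
 proof (induction bs)
  case (Cons b bs)
  have "dir_deriv b (\<lambda>_. 0) = (\<lambda>_. 0)" by (rule ext, rule dir_deriv_eqI) simp
  with Cons show ?case by (simp add: iter_deriv_def)
 qed simp
 show ?thesis unfolding schwartz_def smooth_def * by auto
qed

lemma schwartz_sum: "(\<And>i. i \<in> S \<Longrightarrow> schwartz (f i)) \<Longrightarrow> schwartz (\<lambda>x. \<Sum>i\<in>S. f i x)"
 by (induction S rule: infinite_finite_induct) (auto intro: schwartz_add schwartz_zero)

lemma schwartz_diff: "schwartz f \<Longrightarrow> schwartz g \<Longrightarrow> schwartz (\<lambda>x. f x - g x)"
 using schwartz_add[of f "\<lambda>x. - 1 * g x"] schwartz_cmult[of g "-1"] by simp

lemma schwartz_dir_deriv: "schwartz f \<Longrightarrow> b \<in> Basis \<Longrightarrow> schwartz (dir_deriv b f)"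
 using schwartzD[of f "Suc _"] by (auto intro!: schwartzI)

lemma schwartz_differentiable: "schwartz f \<Longrightarrow> f differentiable (at x)"
 using schwartzD[of f 1] by auto

lemma schwartz_continuous: "schwartz f \<Longrightarrow> continuous_on A f"
 by (meson schwartz_differentiable continuous_at_imp_continuous_on differentiable_imp_continuous_within)

lemma schwartz_measurable [measurable_dest]: "schwartz f \<Longrightarrow> f \<in> borel_measurable borel"
 by (simp add: borel_measurable_continuous_onI schwartz_continuous)

lemma schwartz_decay:
 assumes "schwartz f" obtains C where "C > 0" "\<And>x. (1 + norm x) ^ N * norm (f x) \<le> C"
proof -
 have "rapid (\<lambda>_::unit. f)" using schwartzD[OF assms, of 0] by simp
 then obtain C where C: "\<And>x. (1 + norm x) ^ N * norm (f x) \<le> C" unfolding rapid_def by metis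
 have "(1 + norm x) ^ N * norm (f x) \<le> max C 1" for x using C[of x] by auto
 then show ?thesis using that[of "max C 1"] by auto
qed

lemma schwartz_bounded:
 assumes "schwartz f" obtains C where "C > 0" "\<And>x. norm (f x) \<le> C"
 using schwartz_decay[OF assms, of 0] by auto

lemma schwartz_affine:
 fixes L :: "'c::euclidean_space \<Rightarrow> 'a::euclidean_space"
 assumes L: "bounded_linear L" and K: "0 \<le> K" "\<And>x. norm x \<le> K * (1 + norm (c + L x))" and h: "schwartz h"
 shows "schwartz (\<lambda>x. h (c + L x))"
proof (rule schwartzI)
 fix n
 show "dcl rapid n (\<lambda>_::unit. \<lambda>x. h (c + L x))"
 proof (rule dcl_affine[of L rapid rapid, OF L _ rapid_zero])
  show "rapid (\<lambda>i x. f i (c + L x))" if "rapid f" for f :: "unit \<Rightarrow> 'a \<Rightarrow> complex"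
   using that by (rule rapid_compose[OF _ K])
 qed (simp_all add: rapid_add rapid_linear[OF bounded_linear_scaleR_right] schwartzD h)
qed

lemma schwartz_scale_shift:
 assumes "schwartz h" "r \<noteq> 0" shows "schwartz (\<lambda>x. h (c + r *\<^sub>R x))"
proof (rule schwartz_affine[OF bounded_linear_scaleR_right])
 show "0 \<le> (1 + norm c) / \<bar>r\<bar>" by simp
 fix x
 have "\<bar>r\<bar> * norm x \<le> norm (c + r *\<^sub>R x) + norm c"
  using norm_triangle_ineq4[of "c + r *\<^sub>R x" c] by simp
 also have "\<dots> \<le> (1 + norm c) * (1 + norm (c + r *\<^sub>R x))" by (simp add: algebra_simps)
 finally show "norm x \<le> (1 + norm c) / \<bar>r\<bar> * (1 + norm (c + r *\<^sub>R x))"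
  using assms by (simp add: field_simps)
qed fact

lemma slow_linear_compose:
 fixes L :: "'c::euclidean_space \<Rightarrow> 'a::euclidean_space"
 assumes L: "bounded_linear L" and h: "slow h"
 shows "slow (\<lambda>x. h (L x))"
proof (rule slowI)
 fix n
 obtain K where K: "\<And>x. norm (L x) \<le> norm x * K" "K > 0"
  using bounded_linear.pos_bounded[OF L] by auto
 have K': "norm (L x) \<le> K * (1 + norm x)" for x using K(1)[of x] K(2) by (simp add: algebra_simps)
 have "dcl polyb n (\<lambda>_::unit. \<lambda>x. h (0 + L x))"
 proof (rule dcl_affine[of L polyb polyb, OF L])
  show "polyb (\<lambda>i x. f i (0 + L x))" if "polyb f" for f :: "unit \<Rightarrow> 'a \<Rightarrow> complex"
   using that by (rule polyb_compose[where K=K]) (use K K' in auto)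
  show "polyb (\<lambda>i x. r *\<^sub>R f i x)" if "polyb f" for f :: "unit \<Rightarrow> 'c \<Rightarrow> complex" and r
   using polyb_mult[OF polyb_bounded[where C="\<bar>r\<bar>" and f="\<lambda>_ _. of_real r"] that]
   by (simp add: scaleR_conv_of_real)
 qed (auto intro: polyb_add slowD h polyb_bounded[where C=0])
 then show "dcl polyb n (\<lambda>_::unit. \<lambda>x. h (L x))" by simp
qed

lemma schwartz_slow: "schwartz h \<Longrightarrow> slow h"
proof (rule slowI, erule schwartzD[THEN dcl_mono[rotated]])
 fix f :: "unit \<Rightarrow> 'a \<Rightarrow> complex" assume "rapid f"
 then obtain C where "\<And>i x. (1 + norm x) ^ 0 * norm (f i x) \<le> C" unfolding rapid_def by metis
 then show "polyb f" by (intro polyb_bounded) auto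
qed

lemma slow_const: "slow (\<lambda>x. c)"
proof (rule slowI)
 show "dcl polyb n (\<lambda>_::unit. \<lambda>x::'a. c)" for n
 proof (induction n arbitrary: c)
  case (Suc n)
  have "dir_deriv b (\<lambda>_. c) = (\<lambda>_. 0)" for b :: 'a
   by (rule ext, rule dir_deriv_eqI) simp
  with Suc[of 0] show ?case by (auto intro!: polyb_bounded[where C="norm c"])
 qed (auto intro: polyb_bounded)
qed

lemma slow_inner: "slow (\<lambda>x. complex_of_real (x \<bullet> e))"
proof (rule slowI)
 fix n
 have *: "polyb (\<lambda>_::unit. \<lambda>x. complex_of_real (x \<bullet> e))"
  unfolding polyb_def
 proof (rule exI[of _ 1], rule exI[of _ "norm e"], safe)
  fix x show "norm (complex_of_real (x \<bullet> e)) \<le> norm e * (1 + norm x) ^ 1"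
   using Cauchy_Schwarz_ineq2[of x e] by (simp add: algebra_simps add_increasing)
 qed
 show "dcl polyb n (\<lambda>_::unit. \<lambda>x. complex_of_real (x \<bullet> e))"
 proof (cases n)
  case (Suc m)
  have d: "((\<lambda>x. complex_of_real (x \<bullet> e)) has_derivative (\<lambda>h. complex_of_real (h \<bullet> e))) (at x)" for x
   by (auto intro!: derivative_eq_intros)
  have "dir_deriv b (\<lambda>x. complex_of_real (x \<bullet> e)) = (\<lambda>x. complex_of_real (b \<bullet> e))" for b
   using dir_deriv_eqI[OF d] by auto
  with d slowD[OF slow_const, of m] * show ?thesis unfolding Suc by (auto simp: differentiable_def)
 qed (simp add: *)
qed

lemma slow_cis_inner: "slow (\<lambda>x. exp (\<i> * of_real (x \<bullet> e)))"
proof (rule slowI)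
 fix n
 have "dcl polyb n (\<lambda>_::unit. \<lambda>x. c * exp (\<i> * of_real (x \<bullet> e)))" for c
 proof (induction n arbitrary: c)
  case (Suc n)
  have l: "((\<lambda>x. \<i> * of_real (x \<bullet> e)) has_derivative (\<lambda>h. \<i> * of_real (h \<bullet> e))) (at x)" for x
   by (intro has_derivative_mult_right has_derivative_of_real has_derivative_inner_left has_derivative_ident)
  have d: "((\<lambda>x. c * exp (\<i> * of_real (x \<bullet> e))) has_derivative 
   (\<lambda>h. c * (exp (\<i> * of_real (x \<bullet> e)) * (\<i> * of_real (h \<bullet> e))))) (at x)" for x
   by (intro has_derivative_mult_right has_derivative_compose[OF l] has_field_derivative_imp_has_derivative DERIV_exp)
  have "dir_deriv b (\<lambda>x. c * exp (\<i> * of_real (x \<bullet> e))) = 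
   (\<lambda>x. (c * \<i> * of_real (b \<bullet> e)) * exp (\<i> * of_real (x \<bullet> e)))" for b
   using dir_deriv_eqI[OF d] by (auto simp: algebra_simps)
  with d Suc show ?case by (auto simp: differentiable_def norm_mult intro!: polyb_bounded[where C="norm c"])
 next
  case (0 c)
  then show ?case using polyb_bounded[where C="norm c" and f="\<lambda>_::unit. \<lambda>x. c * exp (\<i> * of_real (x \<bullet> e))"]
   by (simp add: norm_mult)
 qed
 from this[of 1] show "dcl polyb n (\<lambda>_::unit. \<lambda>x. exp (\<i> * of_real (x \<bullet> e)))" by simp
qed

lemma test_function_iff_vanish:
 fixes h :: "'a::euclidean_space \<Rightarrow> 'b::real_normed_vector"
 shows "test_function h \<longleftrightarrow> smooth h \<and> (\<exists>R. \<forall>x. norm x > R \<longrightarrow> h x = 0)"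
proof -
 have "compact (supp h) \<longleftrightarrow> (\<exists>R. \<forall>x. norm x > R \<longrightarrow> h x = 0)"
 proof
  assume "compact (supp h)"
  then obtain R where "\<And>x. x \<in> supp h \<Longrightarrow> norm x \<le> R"
   using compact_imp_bounded bounded_iff by metis
  then show "\<exists>R. \<forall>x. norm x > R \<longrightarrow> h x = 0"
   unfolding supp_def using closure_subset by (intro exI[of _ R]) (force simp: not_le[symmetric])
 next
  assume "\<exists>R. \<forall>x. norm x > R \<longrightarrow> h x = 0"
  then obtain R where R: "\<And>x. norm x > R \<Longrightarrow> h x = 0" by auto
  have "{x. h x \<noteq> 0} \<subseteq> cball 0 R" using R by force
  then have "bounded (supp h)" unfolding supp_def by (meson bounded_cball bounded_closure bounded_subset)
  then show "compact (supp h)" by (simp add: supp_def compact_eq_bounded_closed)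
 qed
 then show ?thesis unfolding test_function_def by blast
qed

lemma schwartz_smooth: "schwartz h \<Longrightarrow> smooth h"
 by (simp add: schwartz_def)

lemma test_function_schwartz:
 fixes h :: "'a::euclidean_space \<Rightarrow> complex"
 assumes "test_function h" shows "schwartz h"
proof -
 obtain R where R: "\<And>x. norm x > R \<Longrightarrow> h x = 0" and s: "smooth h"
  using assms unfolding test_function_iff_vanish by auto
 let ?W = "\<lambda>f :: unit \<Rightarrow> 'a \<Rightarrow> complex. \<forall>i x. norm x > R \<longrightarrow> f i x = 0"
 have d: "dcl (\<lambda>_. True) n (\<lambda>_::unit. h)" for n
  using s dcl_iff[of "\<lambda>_. True" "\<lambda>_::unit. h"] by (auto simp: smooth_def)
 have *: "dcl (\<lambda>_. True) n f \<Longrightarrow> ?W f \<Longrightarrow> dcl ?W n f" for n f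
 proof (induction n arbitrary: f)
  case (Suc n)
  have "?W (\<lambda>i. dir_deriv b (f i))" for b
  proof (safe)
   fix i and x :: 'a assume x: "norm x > R"
   have "((\<lambda>x. 0) has_derivative (\<lambda>_. 0)) (at x)" by simp
   then have "(f i has_derivative (\<lambda>_. 0)) (at x)"
   proof (rule has_derivative_transform_within_open[where s="{x. norm x > R}"])
    show "open {x::'a. norm x > R}" by (intro open_Collect_less continuous_intros)
   qed (use x Suc.prems in auto)
   then show "dir_deriv b (f i) x = 0" by (rule dir_deriv_eqI)
  qed
  with Suc show ?case by auto
 qed auto
 have "rapid f" if f: "?W f" "\<And>i x. f i differentiable (at x)" for f :: "unit \<Rightarrow> 'a \<Rightarrow> complex"
  unfolding rapid_def
 proof
  fix N
  have "continuous_on (cball 0 R) (\<lambda>x. (1 + norm x) ^ N * norm (f () x))"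
   by (intro continuous_intros continuous_at_imp_continuous_on ballI differentiable_imp_continuous_within f)
  then have "compact ((\<lambda>x. (1 + norm x) ^ N * norm (f () x)) ` cball 0 R)"
   by (intro compact_continuous_image) auto
  then obtain C where C: "\<And>x. x \<in> cball 0 R \<Longrightarrow> (1 + norm x) ^ N * norm (f () x) \<le> C"
   using compact_imp_bounded bounded_iff by (metis (no_types, lifting) image_eqI abs_le_D1 real_norm_def)
  have "(1 + norm x) ^ N * norm (f i x) \<le> max C 0" for i x
   using C[of x] f(1) by (cases "norm x > R") auto
  then show "\<exists>C. \<forall>i x. (1 + norm x) ^ N * norm (f i x) \<le> C" by blast
 qed
 then show ?thesis
  using dcl_strengthen[of ?W rapid] *[OF d] R by (intro schwartzI) blast
qed

lemma test_function_of_real: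
 fixes h :: "'a::euclidean_space \<Rightarrow> real"
 assumes "test_function h" shows "test_function (\<lambda>x. of_real (h x))"
proof -
 have d: "dcl (\<lambda>_. True) n (\<lambda>_::unit. h)" for n
  using assms dcl_iff[of "\<lambda>_. True" "\<lambda>_::unit. h"] by (auto simp: smooth_def test_function_def)
 have "dcl (\<lambda>_. True) n (\<lambda>_::unit. \<lambda>x. of_real (h x))" for n
  by (rule dcl_bounded_linear[of _ "\<lambda>_. True", OF bounded_linear_of_real _ d]) simp
 then have "smooth (\<lambda>x. of_real (h x))"
  using dcl_iff[of "\<lambda>_. True" "\<lambda>_::unit. \<lambda>x. of_real (h x)"] by (auto simp: smooth_def)
 then show ?thesis using assms unfolding test_function_iff_vanish by auto
qed

lemma norm_exp_minus_i [simp]: "norm (exp (- (\<i> * of_real r))) = 1"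
 by (simp add: norm_exp_eq_Re)

lemma norm_exp_i [simp]: "norm (exp (\<i> * of_real r)) = 1"
 by (simp add: norm_exp_eq_Re)

lemma affine_lborel:
 fixes f :: "'a::euclidean_space \<Rightarrow> 'b::{banach, second_countable_topology}"
 assumes r: "r \<noteq> 0"
 shows integrable_affine: "integrable lborel f \<Longrightarrow> integrable lborel (\<lambda>x. f (c + r *\<^sub>R x))"
  and integral_affine: "f \<in> borel_measurable borel \<Longrightarrow> \<bar>r\<bar> ^ DIM('a) *\<^sub>R (LIN x. f (c + r *\<^sub>R x)) = (LIN x. f x)"
proof -
 let ?d = "distr lborel borel (\<lambda>x. c + r *\<^sub>R x)"
 note A = lborel_affine[OF r, of c]
 have m: "(\<lambda>x::'a. c + r *\<^sub>R x) \<in> lborel \<rightarrow>\<^sub>M borel" by simp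
 { assume f: "integrable lborel f"
  have fm: "f \<in> borel_measurable borel" using f by auto
  from f have "integrable (density ?d (\<lambda>_. \<bar>r\<bar> ^ DIM('a))) f"
   using A by simp
  then have "integrable ?d (\<lambda>x. \<bar>r\<bar> ^ DIM('a) *\<^sub>R f x)"
   by (subst (asm) integrable_density) (use fm in auto)
  then have "integrable ?d (\<lambda>x. inverse (\<bar>r\<bar> ^ DIM('a)) *\<^sub>R (\<bar>r\<bar> ^ DIM('a) *\<^sub>R f x))"
   by (rule integrable_scaleR_right)
  then have "integrable ?d f" using r by simp
  then show "integrable lborel (\<lambda>x. f (c + r *\<^sub>R x))"
   by (subst (asm) integrable_distr_eq[OF m]) (use fm in auto) }
 { assume f: "f \<in> borel_measurable borel"
  have "(LIN x. f x) = (LINT x|density ?d (\<lambda>_. \<bar>r\<bar> ^ DIM('a)). f x)"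
   using A by simp
  also have "\<dots> = (LINT x|distr lborel borel (\<lambda>x. c + r *\<^sub>R x). \<bar>r\<bar> ^ DIM('a) *\<^sub>R f x)"
   by (subst integral_density) (use f in auto)
  also have "\<dots> = \<bar>r\<bar> ^ DIM('a) *\<^sub>R (LIN x. f (c + r *\<^sub>R x))"
   by (subst integral_distr[OF m]) (use f in auto)
  finally show "\<bar>r\<bar> ^ DIM('a) *\<^sub>R (LIN x. f (c + r *\<^sub>R x)) = (LIN x. f x)" by simp }
qed

lemma nn_integral_affine:
 fixes f :: "'a::euclidean_space \<Rightarrow> ennreal"
 assumes r: "r \<noteq> 0" and [measurable]: "f \<in> borel_measurable borel"
 shows "ennreal (\<bar>r\<bar> ^ DIM('a)) * (INN x. f (c + r *\<^sub>R x)) = (INN x. f x)"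
proof -
 have "(INN x. f x) = (\<integral>\<^sup>+x. f x \<partial>density (distr lborel borel (\<lambda>x. c + r *\<^sub>R x)) (\<lambda>_. \<bar>r\<bar> ^ DIM('a)))"
  using lborel_affine[OF r, of c] by simp
 also have "\<dots> = (INN x. ennreal (\<bar>r\<bar> ^ DIM('a)) * f (c + r *\<^sub>R x))"
  by (simp add: nn_integral_density nn_integral_distr)
 finally show ?thesis by (simp add: nn_integral_cmult)
qed

lemma AE_affine:
 fixes P :: "'a::euclidean_space \<Rightarrow> bool"
 assumes r: "r \<noteq> 0" and [measurable]: "Measurable.pred borel P" and "AE x in lborel. P x"
 shows "AE x in lborel. P (c + r *\<^sub>R x)"
proof -
 have "AE x in density (distr lborel borel (\<lambda>x. c + r *\<^sub>R x)) (\<lambda>_. \<bar>r\<bar> ^ DIM('a)). P x"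
  using assms(3) by (subst (asm) lborel_affine[OF r, of c])
 then have "AE x in distr lborel borel (\<lambda>x. c + r *\<^sub>R x). 0 < ennreal (\<bar>r\<bar> ^ DIM('a)) \<longrightarrow> P x"
  by (subst (asm) AE_density) auto
 then have "AE x in distr lborel borel (\<lambda>x. c + r *\<^sub>R x). P x" using r by simp
 then show ?thesis by (subst (asm) AE_distr_iff) auto
qed

lemma integral_shift:
 fixes f :: "'a::euclidean_space \<Rightarrow> 'b::{banach, second_countable_topology}"
 shows "f \<in> borel_measurable borel \<Longrightarrow> (LIN x. f (c + x)) = (LIN x. f x)"
 using integral_affine[of 1 f c] by simp

lemma integrable_shift:
 fixes f :: "'a::euclidean_space \<Rightarrow> 'b::{banach, second_countable_topology}"
 shows "integrable lborel f \<Longrightarrow> integrable lborel (\<lambda>x. f (c + x))"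
 using integrable_affine[of 1 f c] by simp

lemma integral_lborel_prod:
 fixes f :: "'a::euclidean_space \<Rightarrow> real \<Rightarrow> complex"
 assumes f: "\<And>b. b \<in> Basis \<Longrightarrow> integrable lborel (f b)"
 shows "(LIN x. (\<Prod>b\<in>Basis. f b (x \<bullet> b))) = (\<Prod>b\<in>Basis. LIN y. f b y)"
proof -
 interpret product_sigma_finite "\<lambda>_::'a. lborel :: real measure" by standard
 have [measurable]: "\<And>b. b \<in> Basis \<Longrightarrow> f b \<in> borel_measurable borel" using f by auto
 have "(LIN x. (\<Prod>b\<in>Basis. f b (x \<bullet> b))) =
  (LINT x|distr (\<Pi>\<^sub>M b\<in>Basis. lborel) borel (\<lambda>f. \<Sum>b\<in>Basis. f b *\<^sub>R b). (\<Prod>b\<in>Basis. f b (x \<bullet> b)))"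
  by (subst lborel_eq) simp
 also have "\<dots> = (LINT x|(\<Pi>\<^sub>M b\<in>(Basis :: 'a set). lborel). (\<Prod>b\<in>Basis. f b ((\<Sum>c\<in>Basis. x c *\<^sub>R c) \<bullet> b)))"
  by (rule integral_distr) auto
 also have "\<dots> = (LINT x|(\<Pi>\<^sub>M b\<in>(Basis :: 'a set). lborel). (\<Prod>b\<in>Basis. f b (x b)))"
  by (intro Bochner_Integration.integral_cong refl prod.cong) simp
 also have "\<dots> = (\<Prod>b\<in>Basis. LIN y. f b y)"
  by (rule product_integral_prod) (use f in auto)
 finally show ?thesis .
qed

lemma integrable_pair_mult:
 fixes f :: "'a \<Rightarrow> complex" and g :: "'b \<Rightarrow> complex"
 assumes "sigma_finite_measure M1" "sigma_finite_measure M2" "integrable M1 f" "integrable M2 g"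
 shows "integrable (M1 \<Otimes>\<^sub>M M2) (\<lambda>(x, y). f x * g y)"
proof -
 interpret pair_sigma_finite M1 M2 using assms by (simp add: pair_sigma_finite_def)
 have [measurable]: "f \<in> borel_measurable M1" "g \<in> borel_measurable M2" using assms by auto
 show ?thesis
  by (rule Fubini_integrable) (use assms in \<open>auto simp: norm_mult\<close>)
qed

section \<open>Integrability of Schwartz functions\<close>

text \<open>A product of one-dimensional functions, so integrable by Fubini, and the symbol \<open>1 / weight\<close> is a
polynomial, hence corresponds to a differential operator.\<close>

definition weight :: "'a::euclidean_space \<Rightarrow> real" where
 "weight x = (\<Prod>b\<in>Basis. 1 / (1 + (x \<bullet> b)\<^sup>2))"

lemma weight_measurable [measurable]: "weight \<in> borel_measurable borel"
 unfolding weight_def[abs_def] by measurable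

lemma weight_pos: "weight x > 0"
 unfolding weight_def by (intro prod_pos) (auto intro!: divide_pos_pos add_pos_nonneg)

lemma integrable_weight: "integrable lborel (weight :: 'a::euclidean_space \<Rightarrow> real)"
proof -
 have i: "integrable lborel (\<lambda>y::real. 1 / (1 + y\<^sup>2))"
  using integrable_inverse_1_plus_square by (simp add: set_integrable_def inverse_eq_divide)
 have "(INN x. ennreal (weight (x::'a))) = (INN x. (\<Prod>b\<in>Basis. ennreal (1 / (1 + ((x::'a) \<bullet> b)\<^sup>2))))"
  unfolding weight_def by (intro nn_integral_cong prod_ennreal[symmetric]) auto
 also have "\<dots> = (\<Prod>b\<in>(Basis :: 'a set). (INN y. ennreal (1 / (1 + y\<^sup>2))))"
  by (rule nn_integral_lborel_prod) auto
 also have "(INN y. ennreal (1 / (1 + y\<^sup>2))) = ennreal (LIN y. 1 / (1 + y\<^sup>2))"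
  by (rule nn_integral_eq_integral[OF i]) auto
 finally have "(INN x. ennreal (weight (x::'a))) < \<infinity>"
  by (simp add: power_less_top_ennreal)
 moreover have "norm (weight x) = weight x" for x :: 'a using weight_pos[of x] by simp
 ultimately show ?thesis by (intro integrableI_bounded) auto
qed

lemma inverse_le_weight: "1 \<le> (1 + norm x) ^ (2 * DIM('a)) * weight (x :: 'a::euclidean_space)"
proof -
 have "(\<Prod>b\<in>Basis. 1 + (x \<bullet> b)\<^sup>2) \<le> (\<Prod>b\<in>(Basis::'a set). (1 + norm x)\<^sup>2)"
 proof (intro prod_mono conjI)
  fix b :: 'a assume "b \<in> Basis"
  then have "\<bar>x \<bullet> b\<bar> \<le> norm x" by (rule Basis_le_norm)
  then have "(x \<bullet> b)\<^sup>2 \<le> (norm x)\<^sup>2" by (metis abs_norm_cancel abs_le_square_iff)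
  then show "1 + (x \<bullet> b)\<^sup>2 \<le> (1 + norm x)\<^sup>2" by (simp add: power2_sum add_increasing2)
 qed (auto intro: add_nonneg_nonneg)
 also have "\<dots> = (1 + norm x) ^ (2 * DIM('a))" by (simp add: power_mult)
 finally have *: "(\<Prod>b\<in>Basis. 1 + (x \<bullet> b)\<^sup>2) \<le> (1 + norm x) ^ (2 * DIM('a))" .
 have p: "(\<Prod>b\<in>Basis. 1 + (x \<bullet> b)\<^sup>2) > 0" by (intro prod_pos) (auto intro: add_pos_nonneg)
 have "weight x = 1 / (\<Prod>b\<in>Basis. 1 + (x \<bullet> b)\<^sup>2)"
  unfolding weight_def by (simp add: prod_dividef)
 with * p show ?thesis by (simp add: field_simps)
qed

lemma decay_le_weight:
 assumes "(1 + norm x) ^ (2 * DIM('a)) * y \<le> C" "0 \<le> y" shows "y \<le> C * weight (x :: 'a::euclidean_space)"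
proof -
 have "y \<le> y * ((1 + norm x) ^ (2 * DIM('a)) * weight x)"
  using mult_left_mono[OF inverse_le_weight[of x] assms(2)] by simp
 also have "\<dots> = ((1 + norm x) ^ (2 * DIM('a)) * y) * weight x" by (simp add: algebra_simps)
 also have "\<dots> \<le> C * weight x" using assms weight_pos[of x] by (intro mult_right_mono) auto
 finally show ?thesis .
qed

lemma schwartz_le_weight:
 assumes "schwartz f" obtains C where "C > 0" "\<And>x. norm (f x) \<le> C * weight x"
 using schwartz_decay[OF assms, of "2 * DIM('a)"] decay_le_weight by (metis norm_ge_zero)

lemma schwartz_integrable: assumes "schwartz f" shows "integrable lborel f"
proof -
 obtain C where "C > 0" and C: "\<And>x. norm (f x) \<le> C * weight x" using schwartz_le_weight[OF assms] by metis
 have [measurable]: "f \<in> borel_measurable borel" using assms by measurable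
 show ?thesis
 proof (rule integrable_dominated)
  show "integrable lborel (\<lambda>x. C * weight x)" using integrable_weight by auto
  show "AE x in lborel. norm (f x) \<le> norm (C * weight x)"
   using order_trans[OF C abs_ge_self] by auto
 qed measurable
qed

section \<open>Differentiation under the integral sign\<close>

text \<open>Differentiation under the integral sign: the difference quotients are dominated by means of the mean value
inequality, and the derivative is assembled from the partial ones by \<open>dir_deriv_sum_Basis\<close>.\<close>

lemma has_derivative_integral:
 fixes g :: "'a::euclidean_space \<Rightarrow> 'w \<Rightarrow> complex"
 assumes S: "open S" "convex S" "z0 \<in> S"
  and int: "\<And>z. z \<in> S \<Longrightarrow> integrable M (g z)"
  and d: "\<And>w z. w \<in> space M \<Longrightarrow> z \<in> S \<Longrightarrow> (\<lambda>z. g z w) differentiable (at z)"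
  and B: "\<And>w z b. w \<in> space M \<Longrightarrow> z \<in> S \<Longrightarrow> b \<in> Basis \<Longrightarrow> norm (dir_deriv b (\<lambda>z. g z w) z) \<le> B w"
  and iB: "integrable M B"
 shows "((\<lambda>z. LINT w|M. g z w) has_derivative (\<lambda>h. \<Sum>b\<in>Basis. (h \<bullet> b) *\<^sub>R (LINT w|M. dir_deriv b (\<lambda>z. g z w) z0))) (at z0)"
  and "b \<in> Basis \<Longrightarrow> dir_deriv b (\<lambda>z. LINT w|M. g z w) z0 = (LINT w|M. dir_deriv b (\<lambda>z. g z w) z0)"
proof -
 define d' where "d' b w = dir_deriv b (\<lambda>z. g z w) z0" for b w
 have hd: "((\<lambda>z. g z w) has_derivative (\<lambda>h. \<Sum>b\<in>Basis. (h \<bullet> b) *\<^sub>R dir_deriv b (\<lambda>z. g z w) z)) (at z)"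
  if "w \<in> space M" "z \<in> S" for w z
  by (rule has_derivative_eq_rhs[OF has_dir_deriv[OF d[OF that]]], rule ext)
   (rule dir_deriv_sum_Basis[OF d[OF that]])
 have le: "norm (\<Sum>b\<in>Basis. (h \<bullet> b) *\<^sub>R dir_deriv b (\<lambda>z. g z w) z) \<le> (DIM('a) * B w) * norm h"
  if "w \<in> space M" "z \<in> S" for w z h
 proof -
  have "norm (\<Sum>b\<in>Basis. (h \<bullet> b) *\<^sub>R dir_deriv b (\<lambda>z. g z w) z) \<le> (\<Sum>b\<in>(Basis::'a set). norm h * B w)"
  proof (rule sum_norm_le)
   fix b :: 'a assume b: "b \<in> Basis"
   show "norm ((h \<bullet> b) *\<^sub>R dir_deriv b (\<lambda>z. g z w) z) \<le> norm h * B w"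
    unfolding norm_scaleR by (intro mult_mono B[OF that b] Basis_le_norm[OF b]) auto
  qed
  then show ?thesis by (simp add: mult_ac)
 qed
 have lip: "norm (g x w - g y w) \<le> (DIM('a) * B w) * norm (x - y)" if "w \<in> space M" "x \<in> S" "y \<in> S" for w x y
 proof (rule differentiable_bound[OF S(2) _ _ that(2,3)])
  show "((\<lambda>z. g z w) has_derivative (\<lambda>h. \<Sum>b\<in>Basis. (h \<bullet> b) *\<^sub>R dir_deriv b (\<lambda>z. g z w) z)) (at z within S)" if "z \<in> S" for z
   using hd[OF \<open>w \<in> space M\<close> that] by (rule has_derivative_at_withinI)
  show "onorm (\<lambda>h. \<Sum>b\<in>Basis. (h \<bullet> b) *\<^sub>R dir_deriv b (\<lambda>z. g z w) z) \<le> DIM('a) * B w" if "z \<in> S" for z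
   by (rule onorm_le) (use le[OF \<open>w \<in> space M\<close> that] in auto)
 qed
 have gm: "z \<in> S \<Longrightarrow> g z \<in> borel_measurable M" for z using int by auto
 have d'm: "d' b \<in> borel_measurable M" if b: "b \<in> Basis" for b
 proof -
  obtain e where e: "e > 0" "ball z0 e \<subseteq> S" using S open_contains_ball by metis
  define r where "r n = e / (n + 2)" for n :: nat
  have r: "r n > 0" "r n < e" for n using e by (auto simp: r_def field_simps add_pos_nonneg)
  have r0: "r \<longlonglongrightarrow> 0" unfolding r_def by real_asymp
  have inS: "z0 + r n *\<^sub>R b \<in> S" for n using r[of n] e b by (auto simp: dist_norm)
  show ?thesis
  proof (rule borel_measurable_LIMSEQ_metric)
   fix w assume w: "w \<in> space M"
   have "((\<lambda>y. norm (g y w - g z0 w - dir_deriv (y - z0) (\<lambda>z. g z w) z0) / norm (y - z0)) \<longlongrightarrow> 0) (at z0 within UNIV)"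
    using has_dir_deriv[OF d[OF w S(3)]] unfolding has_derivative_iff_norm by auto
   then have "(\<lambda>n. norm (g (z0 + r n *\<^sub>R b) w - g z0 w - dir_deriv (r n *\<^sub>R b) (\<lambda>z. g z w) z0) / norm (r n *\<^sub>R b)) \<longlonglongrightarrow> 0"
    unfolding tendsto_at_iff_sequentially comp_def
    by (drule_tac x="\<lambda>n. z0 + r n *\<^sub>R b" in spec)
     (use r b in \<open>auto intro!: tendsto_eq_intros r0 simp: less_imp_neq[OF r(1), symmetric]\<close>)
   moreover have "dir_deriv (r n *\<^sub>R b) (\<lambda>z. g z w) z0 = r n *\<^sub>R d' b w" for n
    unfolding d'_def using has_derivative_linear[OF has_dir_deriv[OF d[OF w S(3)]]]
    by (rule linear_scale)
   moreover have "norm (g (z0 + r n *\<^sub>R b) w - g z0 w - r n *\<^sub>R d' b w) / norm (r n *\<^sub>R b)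
    = norm ((g (z0 + r n *\<^sub>R b) w - g z0 w) /\<^sub>R r n - d' b w)" for n
   proof -
    have "(g (z0 + r n *\<^sub>R b) w - g z0 w) /\<^sub>R r n - d' b w = (g (z0 + r n *\<^sub>R b) w - g z0 w - r n *\<^sub>R d' b w) /\<^sub>R r n"
     using r(1)[of n] by (simp add: scaleR_diff_right)
    then show ?thesis using r(1)[of n] b by (simp add: divide_inverse mult.commute)
   qed
   ultimately have "(\<lambda>n. norm ((g (z0 + r n *\<^sub>R b) w - g z0 w) /\<^sub>R r n - d' b w)) \<longlonglongrightarrow> 0" by simp
   then show "(\<lambda>n. (g (z0 + r n *\<^sub>R b) w - g z0 w) /\<^sub>R r n) \<longlonglongrightarrow> d' b w"
    by (simp add: tendsto_norm_zero_iff LIM_zero_iff)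
  next
   show "(\<lambda>w. (g (z0 + r n *\<^sub>R b) w - g z0 w) /\<^sub>R r n) \<in> borel_measurable M" for n
    using gm[OF inS[of n]] gm[OF S(3)] by measurable
  qed
 qed
 have d'i: "integrable M (d' b)" if b: "b \<in> Basis" for b
  by (rule integrable_dominated[OF iB d'm[OF b]])
   (use order_trans[OF B[OF _ S(3) b] abs_ge_self] in \<open>auto simp: d'_def\<close>)
 have "((\<lambda>z. LINT w|M. g z w) has_derivative (\<lambda>h. \<Sum>b\<in>Basis. (h \<bullet> b) *\<^sub>R (LINT w|M. d' b w))) (at z0 within S)"
  unfolding has_derivative_iff_norm
 proof
  show "bounded_linear (\<lambda>h. \<Sum>b\<in>Basis. (h \<bullet> b) *\<^sub>R (LINT w|M. d' b w))"
   by (intro bounded_linear_sum bounded_linear_scaleR_const bounded_linear_inner_left)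
  show "((\<lambda>y. norm ((LINT w|M. g y w) - (LINT w|M. g z0 w) - (\<Sum>b\<in>Basis. ((y - z0) \<bullet> b) *\<^sub>R (LINT w|M. d' b w))) / norm (y - z0)) \<longlongrightarrow> 0) (at z0 within S)"
   unfolding tendsto_at_iff_sequentially comp_def
  proof (intro allI impI)
   fix X assume X: "\<forall>i. X i \<in> S - {z0}" "X \<longlonglongrightarrow> z0"
   define q where "q i w = (g (X i) w - g z0 w - (\<Sum>b\<in>Basis. ((X i - z0) \<bullet> b) *\<^sub>R d' b w)) /\<^sub>R norm (X i - z0)" for i w
   have eq: "norm ((LINT w|M. g (X i) w) - (LINT w|M. g z0 w) - (\<Sum>b\<in>Basis. ((X i - z0) \<bullet> b) *\<^sub>R (LINT w|M. d' b w))) / norm (X i - z0)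
     = norm (LINT w|M. q i w)" for i
   proof -
    have "(LINT w|M. q i w) = ((LINT w|M. g (X i) w) - (LINT w|M. g z0 w) - (\<Sum>b\<in>Basis. ((X i - z0) \<bullet> b) *\<^sub>R (LINT w|M. d' b w))) /\<^sub>R norm (X i - z0)"
     unfolding q_def using int X S d'i by (simp add: Bochner_Integration.integral_sum)
    then show ?thesis by (simp add: divide_inverse)
   qed
   have "(\<lambda>i. LINT w|M. q i w) \<longlonglongrightarrow> (LINT w|M. 0)"
   proof (rule integral_dominated_convergence[where w="\<lambda>w. 2 * DIM('a) * B w"])
    show "q i \<in> borel_measurable M" for i
     unfolding q_def using gm X S d'm by (intro borel_measurable_scaleR borel_measurable_diff borel_measurable_sum) auto
    show "AE w in M. norm (q i w) \<le> 2 * DIM('a) * B w" for i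
    proof (rule AE_I2)
     fix w assume w: "w \<in> space M"
     have n0: "norm (X i - z0) > 0" using X by auto
     have "norm (g (X i) w - g z0 w - (\<Sum>b\<in>Basis. ((X i - z0) \<bullet> b) *\<^sub>R d' b w)) \<le> DIM('a) * B w * norm (X i - z0) + DIM('a) * B w * norm (X i - z0)"
      unfolding d'_def
      by (intro order_trans[OF norm_triangle_ineq4] add_mono lip le w S) (use X in auto)
     then have "inverse (norm (X i - z0)) * norm (g (X i) w - g z0 w - (\<Sum>b\<in>Basis. ((X i - z0) \<bullet> b) *\<^sub>R d' b w))
      \<le> inverse (norm (X i - z0)) * (DIM('a) * B w * norm (X i - z0) + DIM('a) * B w * norm (X i - z0))"
      using n0 by (intro mult_left_mono) auto
     also have "\<dots> = 2 * DIM('a) * B w" using n0 by (simp add: field_simps)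
     finally show "norm (q i w) \<le> 2 * DIM('a) * B w" by (simp add: q_def)
    qed
    show "AE w in M. (\<lambda>i. q i w) \<longlonglongrightarrow> 0"
    proof (rule AE_I2)
     fix w assume w: "w \<in> space M"
     have "((\<lambda>y. norm ((g y w) - (g z0 w) - (\<Sum>b\<in>Basis. ((y - z0) \<bullet> b) *\<^sub>R (d' b w))) / norm (y - z0)) \<longlongrightarrow> 0) (at z0 within S)"
      using has_derivative_at_withinI[OF hd[OF w S(3)], of S] unfolding has_derivative_iff_norm d'_def by auto
     then have "(\<lambda>i. norm (q i w)) \<longlonglongrightarrow> 0"
      using X unfolding tendsto_at_iff_sequentially comp_def q_def by (auto simp: divide_inverse mult.commute)
     then show "(\<lambda>i. q i w) \<longlonglongrightarrow> 0" by (rule tendsto_norm_zero_cancel)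
    qed
   qed (use iB in auto)
   then show "(\<lambda>i. norm ((LINT w|M. g (X i) w) - (LINT w|M. g z0 w) - (\<Sum>b\<in>Basis. ((X i - z0) \<bullet> b) *\<^sub>R (LINT w|M. d' b w))) / norm (X i - z0)) \<longlonglongrightarrow> 0"
    unfolding eq by (simp add: tendsto_norm_zero)
  qed
 qed
 then show *: "((\<lambda>z. LINT w|M. g z w) has_derivative (\<lambda>h. \<Sum>b\<in>Basis. (h \<bullet> b) *\<^sub>R (LINT w|M. dir_deriv b (\<lambda>z. g z w) z0))) (at z0)"
  using at_within_open[OF S(3,1)] by (simp only: d'_def)
 assume b: "b \<in> Basis"
 have "dir_deriv b (\<lambda>z. LINT w|M. g z w) z0 = (\<Sum>c\<in>Basis. (b \<bullet> c) *\<^sub>R (LINT w|M. dir_deriv c (\<lambda>z. g z w) z0))"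
  using dir_deriv_eqI[OF *] .
 also have "\<dots> = (\<Sum>c\<in>Basis. if c = b then (LINT w|M. dir_deriv c (\<lambda>z. g z w) z0) else 0)"
  by (intro sum.cong refl) (simp add: inner_Basis[OF b] eq_commute[of b])
 finally show "dir_deriv b (\<lambda>z. LINT w|M. g z w) z0 = (LINT w|M. dir_deriv b (\<lambda>z. g z w) z0)"
  using b by simp
qed

section \<open>The Fourier transform on Schwartz functions\<close>

lemma schwartz_phase:
 assumes "schwartz f" shows "schwartz (\<lambda>v. exp (- (\<i> * of_real (\<xi> \<bullet> v))) * f v)"
proof -
 have "slow (\<lambda>v. exp (- (\<i> * of_real (\<xi> \<bullet> v))))"
  using slow_cis_inner[of "- \<xi>"] by (simp add: inner_commute)
 then show ?thesis using assms by (rule schwartz_slow_mult)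
qed

lemma integrable_phase:
 fixes f :: "'a::euclidean_space \<Rightarrow> complex"
 assumes "integrable lborel f"
 shows "integrable lborel (\<lambda>v. exp (- (\<i> * of_real (\<xi> \<bullet> v))) * f v)"
  and "integrable lborel (\<lambda>v. exp (\<i> * of_real (\<xi> \<bullet> v)) * f v)"
proof -
 have [measurable]: "f \<in> borel_measurable borel" using assms by auto
 show "integrable lborel (\<lambda>v. exp (- (\<i> * of_real (\<xi> \<bullet> v))) * f v)"
  by (rule integrable_dominated[OF assms]) (measurable, auto simp: norm_mult)
 show "integrable lborel (\<lambda>v. exp (\<i> * of_real (\<xi> \<bullet> v)) * f v)"
  by (rule integrable_dominated[OF assms]) (measurable, auto simp: norm_mult)
qed

lemma norm_fourier_le: "norm (fourier f \<xi>) \<le> (LIN v. norm (f v))"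
 unfolding fourier_def by (rule order_trans[OF integral_norm_bound]) (simp add: norm_mult)

lemma inv_fourier_eq_fourier: "inv_fourier f v = of_real (1 / (2 * pi) ^ DIM('a)) * fourier f (- v :: 'a::euclidean_space)"
 unfolding inv_fourier_def fourier_def by (simp add: inner_commute)

text \<open>By translation invariance \<open>LIN x. F (x + z)\<close> does not depend on \<open>z\<close>; differentiate at \<open>z = 0\<close>.\<close>

lemma integral_dir_deriv_zero:
 assumes F: "schwartz F" and b: "b \<in> Basis" shows "(LIN x. dir_deriv b F x) = 0"
proof -
 have dF: "schwartz (dir_deriv c F)" if "c \<in> Basis" for c using F that by (rule schwartz_dir_deriv)
 have "\<exists>C>0. \<forall>x. (1 + norm x) ^ (2 * DIM('a)) * norm (dir_deriv c F x) \<le> C" if "c \<in> Basis" for c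
  using schwartz_decay[OF dF[OF that], of "2 * DIM('a)"] by metis
 then obtain C where C: "\<And>c. c \<in> Basis \<Longrightarrow> C c > 0" "\<And>c x. c \<in> Basis \<Longrightarrow> (1 + norm x) ^ (2 * DIM('a)) * norm (dir_deriv c F x) \<le> C c"
  by metis
 define K where "K = (\<Sum>c\<in>Basis. C c) * 2 ^ (2 * DIM('a))"
 have sh: "((\<lambda>z. F (x + z)) has_derivative (\<lambda>h. dir_deriv h F (x + z))) (at z)" for x z
  by (rule has_derivative_compose[of "\<lambda>z. x + z" "\<lambda>h. h" z UNIV F])
   (use has_dir_deriv[OF schwartz_differentiable[OF F]] in \<open>auto intro!: derivative_eq_intros\<close>)
 have dsh: "dir_deriv c (\<lambda>z. F (x + z)) z = dir_deriv c F (x + z)" for c x z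
  using dir_deriv_eqI[OF sh] .
 have "dir_deriv b (\<lambda>z. LIN x. F (x + z)) 0 = (LIN x. dir_deriv b (\<lambda>z. F (x + z)) 0)"
 proof (rule has_derivative_integral(2)[where S="ball 0 1" and B="\<lambda>x. K * weight x", OF _ _ _ _ _ _ _ b])
  show "integrable lborel (\<lambda>x. F (x + z))" for z
   using integrable_shift[OF schwartz_integrable[OF F], of z] by (simp add: add.commute)
  show "(\<lambda>z. F (x + z)) differentiable at z" for x z using differentiableI[OF sh] .
  show "norm (dir_deriv c (\<lambda>z. F (x + z)) z) \<le> K * weight x" if z: "z \<in> ball 0 1" and c: "c \<in> Basis" for x z c
   unfolding dsh
  proof (rule decay_le_weight)
   have "norm x \<le> norm (x + z) + norm z" using norm_triangle_ineq4[of "x + z" z] by simp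
   then have "1 + norm x \<le> 2 * (1 + norm (x + z))" using z norm_ge_zero[of "x + z"] unfolding mem_ball dist_0_norm by argo
   then have "(1 + norm x) ^ (2 * DIM('a)) \<le> (2 * (1 + norm (x + z))) ^ (2 * DIM('a))"
    by (intro power_mono) auto
   then have "(1 + norm x) ^ (2 * DIM('a)) * norm (dir_deriv c F (x + z))
     \<le> (2 * (1 + norm (x + z))) ^ (2 * DIM('a)) * norm (dir_deriv c F (x + z))"
    by (rule mult_right_mono) simp
   also have "\<dots> = 2 ^ (2 * DIM('a)) * ((1 + norm (x + z)) ^ (2 * DIM('a)) * norm (dir_deriv c F (x + z)))"
    by (simp only: power_mult_distrib mult.assoc)
   also have "\<dots> \<le> 2 ^ (2 * DIM('a)) * C c" by (intro mult_left_mono C c) simp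
   also have "\<dots> \<le> 2 ^ (2 * DIM('a)) * (\<Sum>c\<in>Basis. C c)"
    by (intro mult_left_mono member_le_sum) (use c C(1)[THEN less_imp_le] in auto)
   finally show "(1 + norm x) ^ (2 * DIM('a)) * norm (dir_deriv c F (x + z)) \<le> K" by (simp add: K_def mult.commute)
  qed simp
 qed (auto intro!: integrable_mult_right integrable_weight)
 moreover have "(LIN x. F (x + z)) = (LIN x. F x)" for z
  using integral_shift[OF schwartz_measurable[OF F], of z] by (simp add: add.commute)
 moreover have "dir_deriv b (\<lambda>z::'a. c) 0 = 0" for c :: complex by (rule dir_deriv_eqI) simp
 ultimately show ?thesis unfolding dsh by simp
qed

lemma fourier_dir_deriv:
 assumes f: "schwartz f" and b: "b \<in> Basis"
 shows "fourier (dir_deriv b f) \<xi> = \<i> * of_real (\<xi> \<bullet> b) * fourier f \<xi>"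
proof -
 let ?e = "\<lambda>v. exp (- (\<i> * of_real (\<xi> \<bullet> v)))"
 have l: "((\<lambda>v. - (\<i> * of_real (\<xi> \<bullet> v))) has_derivative (\<lambda>h. - (\<i> * of_real (\<xi> \<bullet> h)))) (at v)" for v
  by (intro has_derivative_minus has_derivative_mult_right has_derivative_of_real has_derivative_inner_right has_derivative_ident)
 have e: "(?e has_derivative (\<lambda>h. ?e v * (- (\<i> * of_real (\<xi> \<bullet> h))))) (at v)" for v
  by (intro has_derivative_compose[OF l] has_field_derivative_imp_has_derivative DERIV_exp)
 have "dir_deriv b (\<lambda>v. ?e v * f v) v = ?e v * dir_deriv b f v + (?e v * (- (\<i> * of_real (\<xi> \<bullet> b)))) * f v" for v
  using dir_deriv_eqI[OF has_derivative_mult[OF e has_dir_deriv[OF schwartz_differentiable[OF f]]]] .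
 then have "0 = (LIN v. ?e v * dir_deriv b f v + (?e v * (- (\<i> * of_real (\<xi> \<bullet> b)))) * f v)"
  using integral_dir_deriv_zero[OF schwartz_phase[OF f, of \<xi>] b] by simp
 also have "\<dots> = (LIN v. ?e v * dir_deriv b f v + (- (\<i> * of_real (\<xi> \<bullet> b))) * (?e v * f v))"
  by (simp add: algebra_simps)
 also have "\<dots> = fourier (dir_deriv b f) \<xi> + (- (\<i> * of_real (\<xi> \<bullet> b))) * fourier f \<xi>"
  unfolding fourier_def
  using integrable_phase(1)[OF schwartz_integrable[OF f]] integrable_phase(1)[OF schwartz_integrable[OF schwartz_dir_deriv[OF f b]]]
  by (subst Bochner_Integration.integral_add) auto
 finally show ?thesis by (simp add: algebra_simps)
qed

lemma fourier_has_derivative: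
 assumes f: "schwartz f"
 shows "fourier f differentiable (at \<xi>)"
  and "b \<in> Basis \<Longrightarrow> dir_deriv b (fourier f) \<xi> = fourier (\<lambda>v. - \<i> * of_real (v \<bullet> b) * f v) \<xi>"
proof -
 let ?g = "\<lambda>\<xi> v. exp (- (\<i> * of_real (\<xi> \<bullet> v))) * f v"
 have fe: "fourier f = (\<lambda>\<xi>. LIN v. ?g \<xi> v)" by (simp add: fourier_def fun_eq_iff)
 have l: "((\<lambda>\<xi>. - (\<i> * of_real (\<xi> \<bullet> v))) has_derivative (\<lambda>h. - (\<i> * of_real (h \<bullet> v)))) (at \<xi>)" for v \<xi>
  by (intro has_derivative_minus has_derivative_mult_right has_derivative_of_real has_derivative_inner_left has_derivative_ident)
 have d: "((\<lambda>\<xi>. ?g \<xi> v) has_derivative (\<lambda>h. (exp (- (\<i> * of_real (\<xi> \<bullet> v))) * (- (\<i> * of_real (h \<bullet> v)))) * f v)) (at \<xi>)" for v \<xi>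
  by (intro has_derivative_mult_left has_derivative_compose[OF l] has_field_derivative_imp_has_derivative DERIV_exp)
 have dd: "dir_deriv c (\<lambda>\<xi>. ?g \<xi> v) \<xi> = (exp (- (\<i> * of_real (\<xi> \<bullet> v))) * (- (\<i> * of_real (c \<bullet> v)))) * f v" for c v \<xi>
  using dir_deriv_eqI[OF d] .
 obtain C where C: "C > 0" "\<And>x. (1 + norm x) ^ (2 * DIM('a) + 1) * norm (f x) \<le> C"
  using schwartz_decay[OF f] by metis
 have bd: "norm (dir_deriv c (\<lambda>\<xi>. ?g \<xi> v) z) \<le> C * weight v" if "c \<in> Basis" for c v z
 proof (rule decay_le_weight)
  have "\<bar>c \<bullet> v\<bar> \<le> norm v" using Basis_le_norm[OF that, of v] by (simp add: inner_commute)
  then have "(1 + norm v) ^ (2 * DIM('a)) * norm (dir_deriv c (\<lambda>\<xi>. ?g \<xi> v) z) \<le> (1 + norm v) ^ (2 * DIM('a)) * ((1 + norm v) * norm (f v))"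
   unfolding dd norm_mult by (intro mult_left_mono) (auto intro!: mult_right_mono simp: norm_mult)
  also have "\<dots> = (1 + norm v) ^ (2 * DIM('a) + 1) * norm (f v)" by simp
  also have "\<dots> \<le> C" by (rule C)
  finally show "(1 + norm v) ^ (2 * DIM('a)) * norm (dir_deriv c (\<lambda>\<xi>. ?g \<xi> v) z) \<le> C" .
 qed simp
 note H = has_derivative_integral[where S=UNIV and M=lborel and g="?g" and B="\<lambda>v. C * weight v" and ?z0.0=\<xi>,
   OF open_UNIV convex_UNIV UNIV_I integrable_phase(1)[OF schwartz_integrable[OF f]] differentiableI[OF d] bd
    integrable_mult_right[OF integrable_weight]]
 show "fourier f differentiable (at \<xi>)" unfolding fe using differentiableI[OF H(1)] by simp
 show "dir_deriv b (fourier f) \<xi> = fourier (\<lambda>v. - \<i> * of_real (v \<bullet> b) * f v) \<xi>" if "b \<in> Basis"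
  unfolding fe using H(2)[OF _ that] unfolding dd by (simp add: fourier_def algebra_simps inner_commute)
qed

text \<open>Applying \<open>1 - \<partial>\<^sub>b\<^sup>2\<close> for every basis vector \<open>b\<close> multiplies the transform by \<open>1 / weight\<close>. Iterating
this gives the decay of the transform.\<close>

lemma fourier_weight_multiple:
 fixes f :: "'a::euclidean_space \<Rightarrow> complex"
 assumes f: "schwartz f"
 shows "\<exists>g. schwartz g \<and> (\<forall>\<xi>. fourier g \<xi> = fourier f \<xi> / complex_of_real (weight \<xi>))"
proof -
 have "\<exists>g. schwartz g \<and> (\<forall>\<xi>. fourier g \<xi> = (\<Prod>b\<in>S. complex_of_real (1 + (\<xi> \<bullet> b)\<^sup>2)) * fourier f \<xi>)"
  if "finite S" "S \<subseteq> Basis" for S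
  using that
 proof (induction S)
  case (insert b S)
  then obtain g where g: "schwartz g" "\<And>\<xi>. fourier g \<xi> = (\<Prod>b\<in>S. complex_of_real (1 + (\<xi> \<bullet> b)\<^sup>2)) * fourier f \<xi>" by auto
  have b: "b \<in> Basis" using insert by auto
  let ?h = "dir_deriv b (dir_deriv b g)"
  have h: "schwartz ?h" using g b by (intro schwartz_dir_deriv)
  have "fourier (\<lambda>x. g x - ?h x) \<xi> = (\<Prod>b\<in>insert b S. complex_of_real (1 + (\<xi> \<bullet> b)\<^sup>2)) * fourier f \<xi>" for \<xi>
  proof -
  have "fourier (\<lambda>x. g x - ?h x) \<xi> = fourier g \<xi> - fourier ?h \<xi>"
   unfolding fourier_def
   using integrable_phase(1)[OF schwartz_integrable[OF g(1)]] integrable_phase(1)[OF schwartz_integrable[OF h]]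
   by (simp add: right_diff_distrib)
  also have "fourier ?h \<xi> = - complex_of_real ((\<xi> \<bullet> b)\<^sup>2) * fourier g \<xi>"
  proof -
   have "fourier ?h \<xi> = \<i> * complex_of_real (\<xi> \<bullet> b) * (\<i> * complex_of_real (\<xi> \<bullet> b) * fourier g \<xi>)"
    by (simp only: fourier_dir_deriv[OF schwartz_dir_deriv[OF g(1) b] b] fourier_dir_deriv[OF g(1) b])
   also have "\<dots> = (\<i> * \<i>) * (complex_of_real (\<xi> \<bullet> b) * complex_of_real (\<xi> \<bullet> b)) * fourier g \<xi>"
    by (simp only: mult_ac)
   finally show ?thesis by (simp add: power2_eq_square)
  qed
  finally show ?thesis using insert by (simp add: g algebra_simps)
  qed
  then show ?case using schwartz_diff[OF g(1) h] by blast
 qed (use f in auto)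
 from this[of Basis] obtain g where g: "schwartz g" "\<And>\<xi>. fourier g \<xi> = (\<Prod>b\<in>Basis. complex_of_real (1 + (\<xi> \<bullet> b)\<^sup>2)) * fourier f \<xi>"
  by auto
 have "(\<Prod>b\<in>Basis. complex_of_real (1 + (\<xi> \<bullet> b)\<^sup>2)) = 1 / complex_of_real (weight \<xi>)" for \<xi> :: 'a
  unfolding weight_def by (simp add: prod_dividef)
 with g show ?thesis by auto
qed

lemma one_plus_norm_le_weight:
 "1 + norm (x :: 'a::euclidean_space) \<le> 2 ^ DIM('a) / weight x"
proof -
 have *: "1 + (\<Sum>b\<in>S. \<bar>x \<bullet> b\<bar>) \<le> (\<Prod>b\<in>S. 1 + \<bar>x \<bullet> b\<bar>)" if "finite S" for S :: "'a set"
  using that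
 proof (induction S)
  case (insert b S)
  have "1 \<le> (\<Prod>b\<in>S. 1 + \<bar>x \<bullet> b\<bar>)" by (rule prod_ge_1) auto
  then have "\<bar>x \<bullet> b\<bar> * 1 \<le> \<bar>x \<bullet> b\<bar> * (\<Prod>b\<in>S. 1 + \<bar>x \<bullet> b\<bar>)" by (intro mult_left_mono) auto
  with insert show ?case by (simp add: algebra_simps)
 qed simp
 have "1 + norm x \<le> 1 + (\<Sum>b\<in>Basis. \<bar>x \<bullet> b\<bar>)" using norm_le_l1[of x] by simp
 also have "\<dots> \<le> (\<Prod>b\<in>Basis. 1 + \<bar>x \<bullet> b\<bar>)" by (rule *) simp
 also have "\<dots> \<le> (\<Prod>b\<in>Basis. 2 * (1 + (x \<bullet> b)\<^sup>2))"
 proof (intro prod_mono conjI)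
  fix b :: 'a
  have "0 \<le> (\<bar>x \<bullet> b\<bar> - 1)\<^sup>2" by simp
  then have "2 * \<bar>x \<bullet> b\<bar> \<le> 1 + (x \<bullet> b)\<^sup>2" by (simp add: power2_diff)
  moreover have "2 * a \<le> 1 + c \<Longrightarrow> 0 \<le> c \<Longrightarrow> 1 + a \<le> 2 * (1 + c)" for a c :: real by simp
  ultimately show "1 + \<bar>x \<bullet> b\<bar> \<le> 2 * (1 + (x \<bullet> b)\<^sup>2)" using zero_le_power2 by blast
 qed auto
 also have "\<dots> = 2 ^ DIM('a) / weight x"
  unfolding weight_def prod.distrib by (simp add: prod_dividef)
 finally show ?thesis .
qed

lemma fourier_decay:
 fixes f :: "'a::euclidean_space \<Rightarrow> complex"
 assumes f: "schwartz f"
 shows "\<exists>C. \<forall>\<xi>. (1 + norm \<xi>) ^ N * norm (fourier f \<xi>) \<le> C"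
proof -
 have "\<exists>g. schwartz g \<and> (\<forall>\<xi>. fourier g \<xi> = fourier f \<xi> / of_real (weight \<xi>) ^ N)"
 proof (induction N)
  case (Suc N)
  then obtain g where g: "schwartz g" "\<And>\<xi>. fourier g \<xi> = fourier f \<xi> / of_real (weight \<xi>) ^ N" by auto
  from fourier_weight_multiple[OF g(1)] show ?case by (auto simp: g(2) field_simps)
 qed (use f in auto)
 then obtain g where g: "schwartz g" "\<And>\<xi>. fourier g \<xi> = fourier f \<xi> / of_real (weight \<xi>) ^ N" by auto
 have "(1 + norm \<xi>) ^ N * norm (fourier f \<xi>) \<le> (2 ^ DIM('a)) ^ N * (LIN v. norm (g v))" for \<xi>
 proof -
  have w: "weight \<xi> > 0" by (rule weight_pos)
  have "(1 + norm \<xi>) ^ N * norm (fourier f \<xi>) \<le> (2 ^ DIM('a) / weight \<xi>) ^ N * norm (fourier f \<xi>)"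
   by (intro mult_right_mono power_mono one_plus_norm_le_weight) auto
  also have "\<dots> = (2 ^ DIM('a)) ^ N * norm (fourier g \<xi>)"
   using w by (simp add: g(2) norm_divide norm_power power_divide)
  also have "\<dots> \<le> (2 ^ DIM('a)) ^ N * (LIN v. norm (g v))"
   by (intro mult_left_mono norm_fourier_le) auto
  finally show ?thesis .
 qed
 then show ?thesis by blast
qed

lemma schwartz_mult_inner: "schwartz f \<Longrightarrow> schwartz (\<lambda>v. c * of_real (v \<bullet> b) * f v)"
 using schwartz_cmult[OF schwartz_slow_mult[OF slow_inner], of f c b] by (simp add: mult.assoc)

lemma schwartz_fourier:
 assumes "schwartz f" shows "schwartz (fourier f)"
proof (rule schwartzI)
 fix n show "dcl rapid n (\<lambda>_::unit. fourier f)" using assms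
 proof (induction n arbitrary: f)
  case 0 then show ?case using fourier_decay[of f] unfolding dcl.simps rapid_def by blast
 next
  case (Suc n)
  have "dir_deriv b (fourier f) = fourier (\<lambda>v. - \<i> * of_real (v \<bullet> b) * f v)" if "b \<in> Basis" for b
   using fourier_has_derivative(2)[OF Suc.prems that] by (simp add: fun_eq_iff)
  moreover have "dcl rapid n (\<lambda>_::unit. fourier (\<lambda>v. - \<i> * of_real (v \<bullet> b) * f v))" for b
   by (rule Suc.IH[OF schwartz_mult_inner[OF Suc.prems]])
  ultimately show ?case
   using fourier_has_derivative(1)[OF Suc.prems] fourier_decay[OF Suc.prems] unfolding dcl.simps rapid_def by auto
 qed
qed

lemma schwartz_reflect: "schwartz f \<Longrightarrow> schwartz (\<lambda>v. f (- v))"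
 using schwartz_scale_shift[of f "-1" 0] by simp

lemma schwartz_inv_fourier: "schwartz f \<Longrightarrow> schwartz (inv_fourier f)"
 using schwartz_cmult[OF schwartz_reflect[OF schwartz_fourier], of f] inv_fourier_eq_fourier[of f]
 by (simp only: ext[of "inv_fourier f", OF inv_fourier_eq_fourier])

section \<open>Fourier inversion\<close>

definition gauss :: "'a::euclidean_space \<Rightarrow> real" where "gauss x = exp (- (norm x)\<^sup>2 / 2)"

lemma gauss_real_fourier:
 "integrable lborel (\<lambda>y::real. exp (- (\<i> * of_real (t * y))) * of_real (exp (- y\<^sup>2 / 2)))"
 "(LIN y. exp (- (\<i> * of_real (t * y))) * of_real (exp (- y\<^sup>2 / 2))) = of_real (sqrt (2 * pi) * exp (- t\<^sup>2 / 2))"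
proof -
 have sd: "exp (- y\<^sup>2 / 2) = sqrt (2 * pi) * std_normal_density y" for y :: real
  by (simp add: std_normal_density_def)
 have i: "integrable lborel (\<lambda>y. of_real (std_normal_density y))"
  using integrable_normal_density[of 1 0] by (simp add: integrable_of_real)
 have i2: "integrable lborel (\<lambda>y::real. exp (- (\<i> * of_real (t \<bullet> y))) * of_real (std_normal_density y))"
  by (rule integrable_phase(1)[OF i])
 have "char std_normal_distribution (- t) = (LIN y. exp (- (\<i> * of_real (t * y))) * of_real (std_normal_density y))"
  unfolding char_def by (subst integral_density) (auto simp: normal_density_nonneg scaleR_conv_of_real mult.commute)
 then have v: "(LIN y. exp (- (\<i> * of_real (t * y))) * of_real (std_normal_density y)) = of_real (exp (- t\<^sup>2 / 2))"
  by (simp add: char_std_normal_distribution)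
 show "integrable lborel (\<lambda>y::real. exp (- (\<i> * of_real (t * y))) * of_real (exp (- y\<^sup>2 / 2)))"
  using integrable_mult_right[OF i2, of "of_real (sqrt (2 * pi))"] unfolding sd by (simp add: mult_ac)
 show "(LIN y. exp (- (\<i> * of_real (t * y))) * of_real (exp (- y\<^sup>2 / 2))) = of_real (sqrt (2 * pi) * exp (- t\<^sup>2 / 2))"
 proof -
  have "(LIN y. exp (- (\<i> * of_real (t * y))) * of_real (exp (- y\<^sup>2 / 2)))
   = (LIN y. of_real (sqrt (2 * pi)) * (exp (- (\<i> * of_real (t * y))) * of_real (std_normal_density y)))"
   unfolding sd by (intro Bochner_Integration.integral_cong refl) (simp add: mult_ac)
  then show ?thesis using v by (simp only: integral_mult_right_zero) simp
 qed
qed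

lemma gauss_prod: "gauss x = (\<Prod>b\<in>Basis. exp (- (x \<bullet> b)\<^sup>2 / 2))"
proof -
 have "(norm x)\<^sup>2 = (\<Sum>b\<in>Basis. (x \<bullet> b)\<^sup>2)"
  unfolding power2_norm_eq_inner by (subst euclidean_inner) (simp add: power2_eq_square)
 then show ?thesis
  unfolding gauss_def by (simp add: exp_sum[symmetric] sum_negf sum_divide_distrib)
qed

lemma gauss_measurable [measurable]: "gauss \<in> borel_measurable borel"
 unfolding gauss_def[abs_def] by measurable

lemma fourier_gauss: "fourier (\<lambda>x. of_real (gauss x)) \<xi> = of_real (sqrt (2 * pi) ^ DIM('a) * gauss (\<xi> :: 'a::euclidean_space))"
proof -
 have "exp (- (\<i> * of_real (\<xi> \<bullet> v))) * of_real (gauss v)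
  = (\<Prod>b\<in>Basis. exp (- (\<i> * of_real ((\<xi> \<bullet> b) * (v \<bullet> b)))) * of_real (exp (- (v \<bullet> b)\<^sup>2 / 2)))" for v
 proof -
  have "- (\<i> * of_real (\<xi> \<bullet> v)) = (\<Sum>b\<in>Basis. - (\<i> * of_real ((\<xi> \<bullet> b) * (v \<bullet> b))))"
   by (subst euclidean_inner) (simp add: sum_distrib_left sum_negf)
  then show ?thesis unfolding gauss_prod prod.distrib by (simp add: exp_sum)
 qed
 then have "fourier (\<lambda>x. of_real (gauss x)) \<xi> =
  (\<Prod>b\<in>Basis. LIN y. exp (- (\<i> * of_real ((\<xi> \<bullet> b) * y))) * of_real (exp (- y\<^sup>2 / 2)))"
  unfolding fourier_def
  by (simp only:) (rule integral_lborel_prod[of "\<lambda>b y. exp (- (\<i> * of_real ((\<xi> \<bullet> b) * y))) * of_real (exp (- y\<^sup>2 / 2))"],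
   rule gauss_real_fourier(1))
 also have "\<dots> = of_real (sqrt (2 * pi) ^ DIM('a) * gauss \<xi>)"
  unfolding gauss_real_fourier(2) gauss_prod by (simp add: prod.distrib)
 finally show ?thesis .
qed

lemma gauss_le: "0 < gauss x" "gauss x \<le> 1"
 unfolding gauss_def by auto

lemma integrable_gauss: "integrable lborel (\<lambda>x. complex_of_real (gauss (x::'a::euclidean_space)))"
proof -
 have "fourier (\<lambda>x. complex_of_real (gauss x)) (0::'a) = complex_of_real (sqrt (2 * pi) ^ DIM('a))"
  unfolding fourier_gauss by (simp add: gauss_def)
 then have "(LIN x. complex_of_real (gauss (x::'a))) \<noteq> 0" by (simp add: fourier_def)
 then show ?thesis using not_integrable_integral_eq by blast
qed

lemma fourier_gauss_scale:
 assumes "e > 0"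
 shows "fourier (\<lambda>x. of_real (gauss (e *\<^sub>R x))) \<xi> = of_real (sqrt (2 * pi) ^ DIM('a) * gauss ((\<xi> :: 'a::euclidean_space) /\<^sub>R e) / e ^ DIM('a))"
proof -
 let ?F = "\<lambda>x. exp (- (\<i> * of_real ((\<xi> /\<^sub>R e) \<bullet> x))) * of_real (gauss x)"
 have "e ^ DIM('a) *\<^sub>R fourier (\<lambda>x. of_real (gauss (e *\<^sub>R x))) \<xi> = \<bar>e\<bar> ^ DIM('a) *\<^sub>R (LIN x. ?F (0 + e *\<^sub>R x))"
 proof -
  have "(\<xi> /\<^sub>R e) \<bullet> (0 + e *\<^sub>R x) = \<xi> \<bullet> x" for x using assms by simp
  then show ?thesis unfolding fourier_def using assms by (simp only:) simp
 qed
 also have "\<dots> = (LIN x. ?F x)"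
  by (rule integral_affine) (use assms in auto)
 also have "\<dots> = of_real (sqrt (2 * pi) ^ DIM('a) * gauss (\<xi> /\<^sub>R e))"
  using fourier_gauss[of "\<xi> /\<^sub>R e"] by (simp add: fourier_def)
 finally show ?thesis using assms by (simp add: scaleR_conv_of_real field_simps)
qed

lemma integral_gauss: "(LIN x. complex_of_real (gauss (x::'a::euclidean_space))) = complex_of_real (sqrt (2 * pi) ^ DIM('a))"
 using fourier_gauss[of "0::'a"] by (simp add: fourier_def gauss_def)

text \<open>The inner integral is regularized by a Gaussian of width tending to infinity. By Fubini it becomes the
average of \<open>f\<close> against a Gaussian concentrating at \<open>x\<close>, whose transform is known explicitly.\<close>

lemma inv_fourier_fourier:
 fixes f :: "'a::euclidean_space \<Rightarrow> complex"
 assumes f: "schwartz f" shows "inv_fourier (fourier f) x = f x"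
proof -
 note [measurable] = schwartz_measurable[OF f] schwartz_measurable[OF schwartz_fourier[OF f]]
 have fi: "integrable lborel f" and Fi: "integrable lborel (fourier f)"
  using f by (auto intro: schwartz_integrable schwartz_fourier)
 define e where "e n = 1 / real (Suc n)" for n
 have e: "e n > 0" "e n \<noteq> 0" for n by (auto simp: e_def)
 have e0: "e \<longlonglongrightarrow> 0" unfolding e_def using LIMSEQ_inverse_real_of_nat by (simp add: inverse_eq_divide)
 let ?c = "complex_of_real (sqrt (2 * pi) ^ DIM('a))"
 define L where "L n = (LIN \<xi>. exp (\<i> * complex_of_real (\<xi> \<bullet> x)) * fourier f \<xi> * complex_of_real (gauss (e n *\<^sub>R \<xi>)))" for n
 have gi: "integrable lborel (\<lambda>\<xi>. complex_of_real (gauss (e n *\<^sub>R (\<xi>::'a))))" for n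
  using integrable_affine[OF e(2), of "\<lambda>\<xi>. complex_of_real (gauss \<xi>)" 0] integrable_gauss by auto
 have L1: "L \<longlonglongrightarrow> (LIN \<xi>. exp (\<i> * complex_of_real (\<xi> \<bullet> x)) * fourier f \<xi>)"
  unfolding L_def
 proof (rule integral_dominated_convergence[where w="\<lambda>\<xi>. norm (fourier f \<xi>)"])
  show "AE \<xi> in lborel. norm (exp (\<i> * complex_of_real (\<xi> \<bullet> x)) * fourier f \<xi> * complex_of_real (gauss (e n *\<^sub>R \<xi>))) \<le> norm (fourier f \<xi>)" for n
  proof (rule AE_I2)
   fix \<xi>
   have "norm (fourier f \<xi>) * gauss (e n *\<^sub>R \<xi>) \<le> norm (fourier f \<xi>) * 1"
    by (intro mult_left_mono gauss_le) auto
   then show "norm (exp (\<i> * complex_of_real (\<xi> \<bullet> x)) * fourier f \<xi> * complex_of_real (gauss (e n *\<^sub>R \<xi>))) \<le> norm (fourier f \<xi>)"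
    using less_imp_le[OF gauss_le(1)[of "e n *\<^sub>R \<xi>"]] by (simp add: norm_mult abs_of_nonneg)
  qed
  show "AE \<xi> in lborel. (\<lambda>n. exp (\<i> * complex_of_real (\<xi> \<bullet> x)) * fourier f \<xi> * complex_of_real (gauss (e n *\<^sub>R \<xi>))) \<longlonglongrightarrow> exp (\<i> * complex_of_real (\<xi> \<bullet> x)) * fourier f \<xi>"
  proof (rule AE_I2)
   fix \<xi> :: 'a
   have "(\<lambda>n. complex_of_real (gauss (e n *\<^sub>R \<xi>))) \<longlonglongrightarrow> complex_of_real (exp (- (norm (0 *\<^sub>R \<xi>))\<^sup>2 / 2))"
    unfolding gauss_def by (intro tendsto_intros e0) auto
   from tendsto_mult[OF tendsto_const this, of "exp (\<i> * complex_of_real (\<xi> \<bullet> x)) * fourier f \<xi>"]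
   show "(\<lambda>n. exp (\<i> * complex_of_real (\<xi> \<bullet> x)) * fourier f \<xi> * complex_of_real (gauss (e n *\<^sub>R \<xi>))) \<longlonglongrightarrow> exp (\<i> * complex_of_real (\<xi> \<bullet> x)) * fourier f \<xi>"
    by simp
  qed
 qed (use Fi in auto)
 have L2: "L n = (LIN z. f (x + e n *\<^sub>R z) * (?c * complex_of_real (gauss z)))" for n
 proof -
  let ?G = "\<lambda>\<xi> y. exp (\<i> * complex_of_real (\<xi> \<bullet> (x - y))) * (complex_of_real (gauss (e n *\<^sub>R \<xi>)) * f y)"
  have pi: "integrable (lborel \<Otimes>\<^sub>M lborel) (\<lambda>(\<xi>::'a, y). complex_of_real (gauss (e n *\<^sub>R \<xi>)) * f y)"
   by (rule integrable_pair_mult[OF sigma_finite_lborel sigma_finite_lborel gi fi])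
  have ig: "integrable (lborel \<Otimes>\<^sub>M lborel) (case_prod ?G)"
   by (rule integrable_dominated[OF pi]) (measurable, auto simp: norm_mult)
  have "L n = (LIN \<xi>. LIN y. ?G \<xi> y)"
   unfolding L_def
  proof (rule LINT_cong)
   fix \<xi>
   have "exp (\<i> * complex_of_real (\<xi> \<bullet> x)) * fourier f \<xi> * complex_of_real (gauss (e n *\<^sub>R \<xi>))
    = (LIN y. (exp (\<i> * complex_of_real (\<xi> \<bullet> x)) * complex_of_real (gauss (e n *\<^sub>R \<xi>))) * (exp (- (\<i> * complex_of_real (\<xi> \<bullet> y))) * f y))"
    unfolding fourier_def by (subst integral_mult_right_zero) simp
   also have "\<dots> = (LIN y. ?G \<xi> y)"
    by (intro Bochner_Integration.integral_cong refl) (simp add: inner_diff_right exp_diff exp_minus field_simps)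
   finally show "exp (\<i> * complex_of_real (\<xi> \<bullet> x)) * fourier f \<xi> * complex_of_real (gauss (e n *\<^sub>R \<xi>)) = (LIN y. ?G \<xi> y)" .
  qed
  also have "\<dots> = (LIN y. LIN \<xi>. ?G \<xi> y)"
   using lborel_pair.Fubini_integral[OF ig] by simp
  also have "\<dots> = (LIN y. f y * (?c * complex_of_real (gauss ((y - x) /\<^sub>R e n)) / complex_of_real (e n ^ DIM('a))))"
  proof (rule LINT_cong)
   fix y
   have "(LIN \<xi>. ?G \<xi> y) = (LIN \<xi>. f y * (exp (- (\<i> * complex_of_real ((y - x) \<bullet> \<xi>))) * complex_of_real (gauss (e n *\<^sub>R \<xi>))))"
    by (intro Bochner_Integration.integral_cong refl) (simp add: inner_diff_right inner_diff_left inner_commute field_simps)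
   also have "\<dots> = f y * fourier (\<lambda>\<xi>. complex_of_real (gauss (e n *\<^sub>R \<xi>))) (y - x)"
    unfolding fourier_def by (subst integral_mult_right_zero) simp
   finally show "(LIN \<xi>. ?G \<xi> y) = f y * (?c * complex_of_real (gauss ((y - x) /\<^sub>R e n)) / complex_of_real (e n ^ DIM('a)))"
    by (simp add: fourier_gauss_scale[OF e(1)])
  qed
  also have "\<dots> = \<bar>e n\<bar> ^ DIM('a) *\<^sub>R (LIN z. f (x + e n *\<^sub>R z) * (?c * complex_of_real (gauss (((x + e n *\<^sub>R z) - x) /\<^sub>R e n)) / complex_of_real (e n ^ DIM('a))))"
   by (rule integral_affine[OF e(2), symmetric]) measurable
  also have "\<dots> = (LIN z. f (x + e n *\<^sub>R z) * (?c * complex_of_real (gauss z)))"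
   unfolding integral_scaleR_right[symmetric]
   by (intro Bochner_Integration.integral_cong refl) (use e(1)[of n] in \<open>simp add: scaleR_conv_of_real\<close>)
  finally show ?thesis .
 qed
 obtain C where C: "C > 0" "\<And>y. norm (f y) \<le> C" using schwartz_bounded[OF f] by metis
 have "(\<lambda>n. LIN z. f (x + e n *\<^sub>R z) * (?c * complex_of_real (gauss z))) \<longlonglongrightarrow> (LIN z. f x * (?c * complex_of_real (gauss (z::'a))))"
 proof (rule integral_dominated_convergence[where w="\<lambda>z. C * norm (?c * complex_of_real (gauss z))"])
  show "AE z in lborel. (\<lambda>n. f (x + e n *\<^sub>R z) * (?c * complex_of_real (gauss z))) \<longlonglongrightarrow> f x * (?c * complex_of_real (gauss z))"
  proof (rule AE_I2)
   fix z
   have "(\<lambda>n. x + e n *\<^sub>R z) \<longlonglongrightarrow> x" by (auto intro!: tendsto_eq_intros e0)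
   then have "(\<lambda>n. f (x + e n *\<^sub>R z)) \<longlonglongrightarrow> f x"
    by (rule isCont_tendsto_compose[rotated]) (use schwartz_continuous[OF f, of UNIV] in \<open>simp add: continuous_on_eq_continuous_at\<close>)
   then show "(\<lambda>n. f (x + e n *\<^sub>R z) * (?c * complex_of_real (gauss z))) \<longlonglongrightarrow> f x * (?c * complex_of_real (gauss z))"
    by (rule tendsto_mult_right)
  qed
  show "integrable lborel (\<lambda>z::'a. C * norm (?c * complex_of_real (gauss z)))"
   by (intro integrable_mult_right integrable_norm integrable_gauss)
 qed (use C(2) in \<open>auto simp: norm_mult intro!: mult_right_mono\<close>)
 also have "(LIN z. f x * (?c * complex_of_real (gauss (z::'a)))) = f x * (?c * ?c)"
  by (simp only: integral_mult_right_zero integral_gauss)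
 finally have "L \<longlonglongrightarrow> f x * (?c * ?c)" unfolding L2[abs_def] .
 with L1 have "(LIN \<xi>. exp (\<i> * complex_of_real (\<xi> \<bullet> x)) * fourier f \<xi>) = f x * (?c * ?c)"
  by (rule LIMSEQ_unique)
 moreover have "?c * ?c = complex_of_real ((2 * pi) ^ DIM('a))"
  unfolding of_real_mult[symmetric] power_mult_distrib[symmetric] by simp
 ultimately show ?thesis unfolding inv_fourier_def by simp
qed

lemma fourier_inv_fourier:
 fixes f :: "'a::euclidean_space \<Rightarrow> complex"
 assumes f: "schwartz f" shows "fourier (inv_fourier f) x = f x"
proof -
 have 1: "inv_fourier f \<xi> = of_real (1 / (2 * pi) ^ DIM('a)) * fourier (\<lambda>v. f (- v)) \<xi>" for \<xi>
 proof -
  have "fourier (\<lambda>v. f (- v)) \<xi> = (LIN v. exp (\<i> * of_real (\<xi> \<bullet> (0 + (-1) *\<^sub>R v))) * f (0 + (-1) *\<^sub>R v))"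
   by (simp add: fourier_def)
  also have "\<dots> = (LIN v. exp (\<i> * of_real (\<xi> \<bullet> v)) * f v)"
   using integral_affine[of "-1" "\<lambda>v. exp (\<i> * of_real (\<xi> \<bullet> v)) * f v" 0] schwartz_measurable[OF f] by simp
  finally show ?thesis by (simp add: inv_fourier_def inner_commute)
 qed
 have "fourier (inv_fourier f) x = of_real (1 / (2 * pi) ^ DIM('a)) * fourier (fourier (\<lambda>v. f (- v))) x"
  unfolding 1[abs_def] unfolding fourier_def[of _ x] by (subst integral_mult_right_zero[symmetric]) (simp add: mult_ac)
 also have "\<dots> = inv_fourier (fourier (\<lambda>v. f (- v))) (- x)"
  by (simp add: inv_fourier_eq_fourier)
 also have "\<dots> = f x" using inv_fourier_fourier[OF schwartz_reflect[OF f], of "- x"] by simp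
 finally show ?thesis .
qed

section \<open>Fourier multipliers on Schwartz functions\<close>

text \<open>Fourier multipliers act on distributions by duality; this is the action on test functions. Because of the
order of the two transforms its symbol is not reflected.\<close>

definition mop :: "('a::euclidean_space \<Rightarrow> complex) \<Rightarrow> ('a \<Rightarrow> complex) \<Rightarrow> 'a \<Rightarrow> complex" where
 "mop m h = fourier (\<lambda>\<zeta>. m \<zeta> * inv_fourier h \<zeta>)"

definition kern :: "('a::euclidean_space \<Rightarrow> complex) \<Rightarrow> 'a \<Rightarrow> complex" where
 "kern m w = of_real (1 / (2 * pi) ^ DIM('a)) * fourier m w"

lemma fourier_multiplier_eq: "fourier_multiplier m T h = T (mop m h)"
 by (simp add: fourier_multiplier_def inv_fourier_dist_def mult_dist_def fourier_dist_def mop_def)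

lemma schwartz_mop: "slow m \<Longrightarrow> schwartz h \<Longrightarrow> schwartz (mop m h)"
 unfolding mop_def by (intro schwartz_fourier schwartz_slow_mult schwartz_inv_fourier)

lemma inv_fourier_mop: "slow m \<Longrightarrow> schwartz h \<Longrightarrow> inv_fourier (mop m h) = (\<lambda>\<zeta>. m \<zeta> * inv_fourier h \<zeta>)"
 unfolding mop_def by (rule ext, rule inv_fourier_fourier) (intro schwartz_slow_mult schwartz_inv_fourier)

lemma mop_eq_self: "schwartz h \<Longrightarrow> (\<And>\<zeta>. inv_fourier h \<zeta> \<noteq> 0 \<Longrightarrow> m \<zeta> = 1) \<Longrightarrow> mop m h = h"
proof -
 assume h: "schwartz h" and m: "\<And>\<zeta>. inv_fourier h \<zeta> \<noteq> 0 \<Longrightarrow> m \<zeta> = 1"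
 have "(\<lambda>\<zeta>. m \<zeta> * inv_fourier h \<zeta>) = inv_fourier h" using m by force
 then show "mop m h = h" unfolding mop_def using fourier_inv_fourier[OF h] by auto
qed

lemma mop_cong: "(\<And>\<zeta>. inv_fourier h \<zeta> \<noteq> 0 \<Longrightarrow> m \<zeta> = m' \<zeta>) \<Longrightarrow> mop m h = mop m' h"
 unfolding mop_def by (rule arg_cong[where f=fourier]) force

lemma mop_sum:
 assumes "schwartz h" "\<And>i. i \<in> I \<Longrightarrow> slow (m i)"
 shows "mop (\<lambda>\<zeta>. \<Sum>i\<in>I. m i \<zeta>) h = (\<lambda>z. \<Sum>i\<in>I. mop (m i) h z)"
proof
 fix z
 have "integrable lborel (\<lambda>\<zeta>. exp (- (\<i> * of_real (z \<bullet> \<zeta>))) * (m i \<zeta> * inv_fourier h \<zeta>))" if "i \<in> I" for i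
  by (intro integrable_phase schwartz_integrable schwartz_slow_mult schwartz_inv_fourier assms that)
 then show "mop (\<lambda>\<zeta>. \<Sum>i\<in>I. m i \<zeta>) h z = (\<Sum>i\<in>I. mop (m i) h z)"
  unfolding mop_def fourier_def sum_distrib_right sum_distrib_left
  by (rule Bochner_Integration.integral_sum)
qed

lemma schwartz_kern: "schwartz m \<Longrightarrow> schwartz (kern m)"
 unfolding kern_def[abs_def] by (intro schwartz_cmult schwartz_fourier)

lemma kern_representation: fixes m :: "'a::euclidean_space \<Rightarrow> complex"
 shows "schwartz m \<Longrightarrow> m \<eta> = (LIN w. exp (\<i> * of_real (w \<bullet> \<eta>)) * kern m w)"
proof -
 assume m: "schwartz m"
 have "m \<eta> = of_real (1 / (2 * pi) ^ DIM('a)) * (LIN w. exp (\<i> * of_real (w \<bullet> \<eta>)) * fourier m w)"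
  using inv_fourier_fourier[OF m, of \<eta>] by (simp only: inv_fourier_def)
 also have "\<dots> = (LIN w. of_real (1 / (2 * pi) ^ DIM('a)) * (exp (\<i> * of_real (w \<bullet> \<eta>)) * fourier m w))"
  by (simp only: integral_mult_right_zero)
 also have "\<dots> = (LIN w. exp (\<i> * of_real (w \<bullet> \<eta>)) * kern m w)"
  unfolding kern_def by (intro Bochner_Integration.integral_cong refl) (simp only: mult_ac)
 finally show ?thesis .
qed

text \<open>The map \<open>\<pi>'\<close> and its adjoint \<open>\<iota>\<close> cover both the full variable and a symbol depending only on the frequency
of the second component, where the convolution acts in that component alone.\<close>

lemma mop_convolution:
 fixes m :: "'a::euclidean_space \<Rightarrow> complex" and \<pi>' :: "'e::euclidean_space \<Rightarrow> 'a" and \<iota> :: "'a \<Rightarrow> 'e"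
 assumes m: "schwartz m" and h: "schwartz h" and [measurable]: "\<pi>' \<in> borel_measurable borel"
  and adj: "\<And>\<zeta> w. \<zeta> \<bullet> \<iota> w = \<pi>' \<zeta> \<bullet> w"
 shows "mop (\<lambda>\<zeta>. m (\<pi>' \<zeta>)) h z = (LIN w. kern m w * h (z - \<iota> w))"
proof -
 note [measurable] = schwartz_measurable[OF schwartz_kern[OF m]] schwartz_measurable[OF schwartz_inv_fourier[OF h]]
 let ?H = "inv_fourier h"
 let ?G = "\<lambda>\<zeta> w. exp (- (\<i> * of_real (z \<bullet> \<zeta>))) * exp (\<i> * of_real (w \<bullet> \<pi>' \<zeta>)) * (?H \<zeta> * kern m w)"
 have pi: "integrable (lborel \<Otimes>\<^sub>M lborel) (\<lambda>(\<zeta>::'e, w::'a). ?H \<zeta> * kern m w)"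
  by (intro integrable_pair_mult sigma_finite_lborel schwartz_integrable schwartz_inv_fourier schwartz_kern m h)
 have ig: "integrable (lborel \<Otimes>\<^sub>M lborel) (case_prod ?G)"
  by (rule integrable_dominated[OF pi]) (measurable, auto simp: norm_mult)
 have "mop (\<lambda>\<zeta>. m (\<pi>' \<zeta>)) h z = (LIN \<zeta>. LIN w. ?G \<zeta> w)"
  unfolding mop_def fourier_def
 proof (rule LINT_cong)
  fix \<zeta> :: 'e
  have "(LIN w. ?G \<zeta> w) = (LIN w. (exp (- (\<i> * of_real (z \<bullet> \<zeta>))) * ?H \<zeta>) * (exp (\<i> * of_real (w \<bullet> \<pi>' \<zeta>)) * kern m w))"
   by (intro Bochner_Integration.integral_cong refl) (simp add: mult_ac)
  also have "\<dots> = (exp (- (\<i> * of_real (z \<bullet> \<zeta>))) * ?H \<zeta>) * m (\<pi>' \<zeta>)"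
   by (simp only: integral_mult_right_zero kern_representation[OF m, of "\<pi>' \<zeta>", symmetric])
  finally show "exp (- (\<i> * of_real (z \<bullet> \<zeta>))) * (m (\<pi>' \<zeta>) * ?H \<zeta>) = (LIN w. ?G \<zeta> w)" by (simp only: mult_ac)
 qed
 also have "\<dots> = (LIN w. LIN \<zeta>. ?G \<zeta> w)"
  using lborel_pair.Fubini_integral[OF ig] by simp
 also have "\<dots> = (LIN w. kern m w * h (z - \<iota> w))"
 proof (rule LINT_cong)
  fix w :: 'a
  have "(LIN \<zeta>. ?G \<zeta> w) = (LIN \<zeta>. kern m w * (exp (- (\<i> * of_real ((z - \<iota> w) \<bullet> \<zeta>))) * ?H \<zeta>))"
  proof (intro Bochner_Integration.integral_cong refl)
   fix \<zeta> :: 'e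
   have "(z - \<iota> w) \<bullet> \<zeta> = z \<bullet> \<zeta> - w \<bullet> \<pi>' \<zeta>"
    using adj[of \<zeta> w] by (simp only: inner_diff_left inner_commute[of "\<iota> w"] inner_commute[of w])
   then have "exp (- (\<i> * of_real ((z - \<iota> w) \<bullet> \<zeta>))) = exp (- (\<i> * of_real (z \<bullet> \<zeta>))) * exp (\<i> * of_real (w \<bullet> \<pi>' \<zeta>))"
    by (simp add: exp_add[symmetric] algebra_simps)
   then show "?G \<zeta> w = kern m w * (exp (- (\<i> * of_real ((z - \<iota> w) \<bullet> \<zeta>))) * ?H \<zeta>)" by simp
  qed
  also have "\<dots> = kern m w * fourier ?H (z - \<iota> w)" unfolding fourier_def by (rule integral_mult_right_zero)
  finally show "(LIN \<zeta>. ?G \<zeta> w) = kern m w * h (z - \<iota> w)" using fourier_inv_fourier[OF h] by simp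
 qed
 finally show ?thesis .
qed

lemma kern_scale:
 fixes m :: "'a::euclidean_space \<Rightarrow> complex"
 assumes "r > 0" and [measurable]: "m \<in> borel_measurable borel"
 shows "kern (\<lambda>\<xi>. m (\<xi> /\<^sub>R r)) w = of_real (r ^ DIM('a)) * kern m (r *\<^sub>R w)"
proof -
 let ?F = "\<lambda>\<xi>. exp (- (\<i> * of_real (w \<bullet> \<xi>))) * m (\<xi> /\<^sub>R r)"
 have "fourier (\<lambda>\<xi>. m (\<xi> /\<^sub>R r)) w = \<bar>r\<bar> ^ DIM('a) *\<^sub>R (LIN \<xi>. ?F (0 + r *\<^sub>R \<xi>))"
  unfolding fourier_def by (rule integral_affine[symmetric]) (use assms in auto)
 also have "(LIN \<xi>. ?F (0 + r *\<^sub>R \<xi>)) = fourier m (r *\<^sub>R w)"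
  unfolding fourier_def using assms by simp
 finally show ?thesis unfolding kern_def using assms by (simp add: scaleR_conv_of_real)
qed

section \<open>Tempered distributions\<close>

context
 fixes T :: "('a::euclidean_space \<Rightarrow> complex) \<Rightarrow> complex"
 assumes T: "tempered_distribution T"
begin

lemma td_add: "schwartz f \<Longrightarrow> schwartz g \<Longrightarrow> T (\<lambda>x. f x + g x) = T f + T g"
 using T unfolding tempered_distribution_def by blast

lemma td_cmult: "schwartz f \<Longrightarrow> T (\<lambda>x. c * f x) = c * T f"
 using T unfolding tempered_distribution_def by blast

lemma td_zero: "T (\<lambda>x. 0) = 0"
 using td_cmult[OF schwartz_zero, of 0] by simp

lemma td_diff: "schwartz f \<Longrightarrow> schwartz g \<Longrightarrow> T (\<lambda>x. f x - g x) = T f - T g"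
 using td_add[of f "\<lambda>x. - 1 * g x"] td_cmult[of g "-1"] schwartz_cmult[of g "-1"] by simp

lemma td_sum: "(\<And>i. i \<in> I \<Longrightarrow> schwartz (f i)) \<Longrightarrow> T (\<lambda>x. \<Sum>i\<in>I. f i x) = (\<Sum>i\<in>I. T (f i))"
 by (induction I rule: infinite_finite_induct) (auto simp: td_zero td_add schwartz_sum)

end

section \<open>Littlewood-Paley decompositions\<close>

definition lpsym :: "('a::euclidean_space \<Rightarrow> real) \<Rightarrow> real \<Rightarrow> 'a \<Rightarrow> complex" where
 "lpsym \<phi> \<delta> \<xi> = of_real (\<phi> (\<xi> /\<^sub>R \<delta>))"

lemma LP_block_eq: "LP_block \<phi> \<delta> T h = T (mop (lpsym \<phi> \<delta>) h)"
 unfolding LP_block_def fourier_multiplier_eq lpsym_def[abs_def] ..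

lemma LP_block_v_eq: "LP_block_v \<phi> \<delta> T h = T (mop (\<lambda>\<zeta>. lpsym \<phi> \<delta> (snd \<zeta>)) h)"
 unfolding LP_block_v_def fourier_multiplier_eq lpsym_def[abs_def] by (simp add: case_prod_unfold)

locale LP =
 fixes \<psi> \<phi> :: "'a::euclidean_space \<Rightarrow> real"
 assumes lp: "littlewood_paley \<psi> \<phi>"
begin

lemma lp_parts:
 "test_function \<psi>" "test_function \<phi>" "\<forall>\<xi>. \<psi> \<xi> \<ge> 0" "\<forall>\<xi>. \<phi> \<xi> \<ge> 0"
 "supp \<psi> \<subseteq> {\<xi>. norm \<xi> \<le> 1}" "supp \<phi> \<subseteq> {\<xi>. 1/2 \<le> norm \<xi> \<and> norm \<xi> \<le> 2}"
 "\<forall>\<xi>. (\<lambda>k. \<phi> (\<xi> /\<^sub>R 2 ^ k)) sums (1 - \<psi> \<xi>)"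
 using lp unfolding littlewood_paley_def by - ((elim conjE, assumption)+)

lemmas test_psi = lp_parts(1) and test_phi = lp_parts(2)

lemma phi_nonneg: "\<phi> x \<ge> 0" and psi_nonneg: "\<psi> x \<ge> 0"
 using lp_parts(3,4) by auto

lemma supp_subset: "supp f \<subseteq> A \<Longrightarrow> f x \<noteq> 0 \<Longrightarrow> x \<in> A"
 unfolding supp_def using closure_subset[of "{x. f x \<noteq> 0}"] by auto

lemma phi_supp: assumes "\<phi> \<xi> \<noteq> 0" shows "1/2 \<le> norm \<xi> \<and> norm \<xi> \<le> 2"
proof -
 have "supp \<phi> \<subseteq> {\<xi>. 1/2 \<le> norm \<xi> \<and> norm \<xi> \<le> 2}" by (rule lp_parts)
 then show ?thesis using assms supp_subset[of \<phi> _ \<xi>] by auto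
qed

lemma psi_supp: assumes "\<psi> \<xi> \<noteq> 0" shows "norm \<xi> \<le> 1"
proof -
 have "supp \<psi> \<subseteq> {\<xi>. norm \<xi> \<le> 1}" by (rule lp_parts)
 then show ?thesis using assms supp_subset[of \<psi> _ \<xi>] by auto
qed

lemma phi_sums: "(\<lambda>k. \<phi> (\<xi> /\<^sub>R 2 ^ k)) sums (1 - \<psi> \<xi>)"
 using lp_parts(7) by blast

lemma psi_eq_1: assumes "norm \<xi> < 1/2" shows "\<psi> \<xi> = 1"
proof -
 have "\<phi> (\<xi> /\<^sub>R 2 ^ k) = 0" for k
 proof (rule ccontr)
  assume "\<phi> (\<xi> /\<^sub>R 2 ^ k) \<noteq> 0"
  then have "1/2 \<le> norm \<xi> / 2 ^ k" using phi_supp[of "\<xi> /\<^sub>R 2 ^ k"]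
   by (simp add: field_simps)
  moreover have "norm \<xi> / 2 ^ k \<le> norm \<xi>" by (simp add: divide_le_eq mult_le_cancel_left1)
  ultimately show False using assms by linarith
 qed
 then have "(\<lambda>k. \<phi> (\<xi> /\<^sub>R 2 ^ k)) sums 0" by simp
 from sums_unique2[OF this phi_sums] show ?thesis by simp
qed

text \<open>The defining series at \<open>\<xi> / 2\<close> and at \<open>\<xi>\<close> differ by their first term, so every dyadic sum telescopes.\<close>

lemma phi_eq: "\<phi> \<xi> = \<psi> (\<xi> /\<^sub>R 2) - \<psi> \<xi>"
proof -
 have "(\<lambda>k. \<phi> (\<xi> /\<^sub>R 2 ^ Suc k)) sums (1 - \<psi> (\<xi> /\<^sub>R 2))"
  using phi_sums[of "\<xi> /\<^sub>R 2"] by (simp add: mult.commute)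
 then have "(\<lambda>k. \<phi> (\<xi> /\<^sub>R 2 ^ k)) sums (1 - \<psi> (\<xi> /\<^sub>R 2) + \<phi> (\<xi> /\<^sub>R 2 ^ 0))"
  by (rule sums_Suc)
 from sums_unique2[OF this phi_sums] show ?thesis by simp
qed

lemma sum_phi:
 assumes "i \<le> j" shows "(\<Sum>k\<in>{i..j}. \<phi> (\<xi> /\<^sub>R 2 powi k)) = \<psi> (\<xi> /\<^sub>R 2 powi (j + 1)) - \<psi> (\<xi> /\<^sub>R 2 powi i)"
 using assms
proof (induction j rule: int_ge_induct)
 case base
 show ?case using phi_eq[of "\<xi> /\<^sub>R 2 powi i"] by (simp add: power_int_add mult.commute)
next
 case (step j)
 have "{i..j + 1} = insert (j + 1) {i..j}" using step.hyps by auto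
 then have "(\<Sum>k\<in>{i..j + 1}. \<phi> (\<xi> /\<^sub>R 2 powi k)) = \<phi> (\<xi> /\<^sub>R 2 powi (j + 1)) + (\<Sum>k\<in>{i..j}. \<phi> (\<xi> /\<^sub>R 2 powi k))"
  by simp
 also have "\<dots> = \<psi> (\<xi> /\<^sub>R 2 powi (j + 1 + 1)) - \<psi> (\<xi> /\<^sub>R 2 powi i)"
  unfolding step.IH using phi_eq[of "\<xi> /\<^sub>R 2 powi (j + 1)"] by (simp add: power_int_add mult.commute)
 finally show ?case .
qed

lemma sum_phi_eq_1:
 assumes "2 powi i < norm \<xi>" "norm \<xi> < 2 powi j"
 shows "(\<Sum>k\<in>{i..j}. \<phi> (\<xi> /\<^sub>R 2 powi k)) = 1"
proof -
 have "(2::real) powi i < 2 powi j" using assms by linarith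
 then have ij: "i \<le> j" by (metis linorder_not_less less_imp_le power_int_increasing one_le_numeral not_less)
 have "\<psi> (\<xi> /\<^sub>R 2 powi i) = 0" 
 proof (rule ccontr)
  assume "\<psi> (\<xi> /\<^sub>R 2 powi i) \<noteq> 0"
  then have "norm \<xi> / 2 powi i \<le> 1" using psi_supp[of "\<xi> /\<^sub>R 2 powi i"] by (simp add: divide_inverse mult.commute)
  then show False using assms by (simp add: divide_le_eq)
 qed
 moreover have "\<psi> (\<xi> /\<^sub>R 2 powi (j + 1)) = 1"
  by (rule psi_eq_1) (use assms in \<open>simp add: power_int_add field_simps\<close>)
 ultimately show ?thesis using sum_phi[OF ij] by simp
qed

lemma schwartz_phi: "schwartz (\<lambda>\<xi>. of_real (\<phi> \<xi>))" and schwartz_psi: "schwartz (\<lambda>\<xi>. of_real (\<psi> \<xi>))"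
 by (intro test_function_schwartz test_function_of_real test_phi test_psi)+

lemma schwartz_lpsym: "\<delta> > 0 \<Longrightarrow> schwartz (lpsym \<phi> \<delta>)"
 unfolding lpsym_def[abs_def] using schwartz_scale_shift[OF schwartz_phi, of "inverse \<delta>" 0] by simp

lemma slow_lpsym: "\<delta> > 0 \<Longrightarrow> slow (lpsym \<phi> \<delta>)"
 by (intro schwartz_slow schwartz_lpsym)

lemma slow_lpsym_snd: "\<delta> > 0 \<Longrightarrow> slow (\<lambda>\<zeta>::'a \<times> 'a. lpsym \<phi> \<delta> (snd \<zeta>))"
 by (intro slow_linear_compose[OF bounded_linear_snd] slow_lpsym)

lemma lpsym_supp: "\<delta> > 0 \<Longrightarrow> lpsym \<phi> \<delta> \<xi> \<noteq> 0 \<Longrightarrow> \<delta> / 2 \<le> norm \<xi> \<and> norm \<xi> \<le> 2 * \<delta>"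
 using phi_supp[of "\<xi> /\<^sub>R \<delta>"] unfolding lpsym_def by (auto simp: field_simps)

lemma sum_lpsym_eq_1:
 assumes "2 powi i < norm \<xi>" "norm \<xi> < 2 powi j"
 shows "(\<Sum>k\<in>{i..j}. lpsym \<phi> (2 powi k) \<xi>) = 1"
 using sum_phi_eq_1[OF assms] unfolding lpsym_def by (simp flip: of_real_sum)

abbreviation Kphi :: "'a \<Rightarrow> complex" where "Kphi \<equiv> kern (\<lambda>\<xi>. of_real (\<phi> \<xi>))"

lemma kern_lpsym: "\<delta> > 0 \<Longrightarrow> kern (lpsym \<phi> \<delta>) w = of_real (\<delta> ^ DIM('a)) * Kphi (\<delta> *\<^sub>R w)"
 using kern_scale[of \<delta> "\<lambda>\<xi>. of_real (\<phi> \<xi>)" w] schwartz_measurable[OF schwartz_phi]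
 by (simp add: lpsym_def[abs_def])

lemma mop_lpsym: "\<delta> > 0 \<Longrightarrow> schwartz h \<Longrightarrow> mop (lpsym \<phi> \<delta>) h z = (LIN w. kern (lpsym \<phi> \<delta>) w * h (z - w))"
 by (rule mop_convolution[where \<pi>'="\<lambda>x. x" and \<iota>="\<lambda>x. x", simplified, OF schwartz_lpsym]) auto

lemma mop_lpsym_snd: "\<delta> > 0 \<Longrightarrow> schwartz h \<Longrightarrow>
 mop (\<lambda>\<zeta>. lpsym \<phi> \<delta> (snd \<zeta>)) h z = (LIN w. kern (lpsym \<phi> \<delta>) w * h (z - (0, w)))"
 by (rule mop_convolution[where \<pi>'="snd" and \<iota>="\<lambda>x. (0, x)", OF schwartz_lpsym]) 
  (auto simp: borel_measurable_continuous_onI continuous_on_snd inner_prod_def)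

text \<open>On test functions with \<open>v\<close>-frequencies in a dyadic shell the sum of finitely many symbols is \<open>1\<close>. This is the
only decomposition of distributions that is used: no series of blocks has to converge.\<close>

lemma td_v_blocks:
 fixes T :: "('a \<times> 'a \<Rightarrow> complex) \<Rightarrow> complex"
 assumes T: "tempered_distribution T" and H: "schwartz H"
  and s: "\<And>\<zeta>. inv_fourier H \<zeta> \<noteq> 0 \<Longrightarrow> 2 powi i < norm (snd \<zeta>) \<and> norm (snd \<zeta>) < 2 powi j"
 shows "T H = (\<Sum>k\<in>{i..j}. LP_block_v \<phi> (2 powi k) T H)"
proof -
 have p: "(2::real) powi k > 0" for k by simp
 have "T H = T (mop (\<lambda>\<zeta>. \<Sum>k\<in>{i..j}. lpsym \<phi> (2 powi k) (snd \<zeta>)) H)"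
  by (subst mop_eq_self[OF H]) (use sum_lpsym_eq_1 s in auto)
 also have "\<dots> = T (\<lambda>z. \<Sum>k\<in>{i..j}. mop (\<lambda>\<zeta>. lpsym \<phi> (2 powi k) (snd \<zeta>)) H z)"
  by (subst mop_sum[OF H slow_lpsym_snd[OF p]]) simp
 also have "\<dots> = (\<Sum>k\<in>{i..j}. T (mop (\<lambda>\<zeta>. lpsym \<phi> (2 powi k) (snd \<zeta>)) H))"
  by (rule td_sum[OF T schwartz_mop[OF slow_lpsym_snd[OF p] H]])
 finally show ?thesis by (simp only: LP_block_v_eq)
qed

end

section \<open>Real powers of extended nonnegative reals\<close>

lemma ennpowr_ennreal: "0 \<le> x \<Longrightarrow> ennpowr (ennreal x) a = ennreal (x powr a)"
 by (simp add: ennpowr_def)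

lemma ennpowr_top [simp]: "ennpowr \<infinity> a = \<infinity>" "ennpowr top a = top"
 by (simp_all add: ennpowr_def)

lemma ennpowr_zero [simp]: "ennpowr 0 a = 0"
 by (simp add: ennpowr_def)

lemma ennpowr_measurable [measurable]: "(\<lambda>x. ennpowr x a) \<in> borel_measurable borel"
 unfolding ennpowr_def by measurable

lemma ennpowr_mono: "x \<le> y \<Longrightarrow> 0 \<le> a \<Longrightarrow> ennpowr x a \<le> ennpowr y a"
 by (cases x; cases y) (auto simp: ennpowr_ennreal top_unique intro!: powr_mono2)

lemma ennpowr_mult: "0 < a \<Longrightarrow> ennpowr (x * y) a = ennpowr x a * ennpowr y a"
 by (cases x; cases y) (auto simp: ennpowr_ennreal ennreal_mult[symmetric] powr_mult ennreal_mult_top ennreal_top_mult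
   simp del: ennreal_mult infinity_ennreal_def)

lemma ennpowr_ennpowr: "ennpowr (ennpowr x a) b = ennpowr x (a * b)"
 by (cases x) (auto simp: ennpowr_ennreal powr_powr)

lemma ennpowr_1 [simp]: "ennpowr x 1 = x"
 by (cases x) (auto simp: ennpowr_ennreal)

lemma ennpowr_le_iff: assumes "0 < a" shows "ennpowr x a \<le> y \<longleftrightarrow> x \<le> ennpowr y (1 / a)"
proof
 assume "ennpowr x a \<le> y"
 then have "ennpowr (ennpowr x a) (1/a) \<le> ennpowr y (1/a)" using assms by (intro ennpowr_mono) auto
 then show "x \<le> ennpowr y (1 / a)" using assms by (simp add: ennpowr_ennpowr)
next
 assume "x \<le> ennpowr y (1 / a)"
 then have "ennpowr x a \<le> ennpowr (ennpowr y (1/a)) a" using assms by (intro ennpowr_mono) auto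
 then show "ennpowr x a \<le> y" using assms by (simp add: ennpowr_ennpowr)
qed

lemma young_powr:
 assumes "1 \<le> r" "0 \<le> y" "0 < (a::real)"
 shows "r * a powr (r - 1) * y \<le> y powr r + (r - 1) * a powr r"
proof (cases "r = 1")
 case True then show ?thesis using assms by simp
next
 case False
 then have r: "r > 1" using assms by simp
 define q where "q = r / (r - 1)"
 have q: "q > 1" "1 / r + 1 / q = 1" using r by (auto simp: q_def field_simps)
 have "y * a powr (r - 1) \<le> y powr r / r + (a powr (r - 1)) powr q / q"
  by (rule Youngs_inequality) (use assms r q in auto)
 also have "(a powr (r - 1)) powr q = a powr r" using r by (simp add: powr_powr q_def)
 finally have "r * (y * a powr (r - 1)) \<le> r * (y powr r / r + a powr r / q)" using r by (intro mult_left_mono) auto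
 also have "\<dots> = y powr r + (r - 1) * a powr r" using r by (simp add: q_def field_simps)
 finally show ?thesis by (simp add: mult_ac)
qed

lemma young_ennpowr:
 assumes "1 \<le> r" "0 < (a::real)"
 shows "ennreal (r * a powr (r - 1)) * y \<le> ennpowr y r + ennreal ((r - 1) * a powr r)"
proof (cases y)
 case (real x)
 then have "ennreal (r * a powr (r - 1)) * y = ennreal (r * a powr (r - 1) * x)"
  using assms by (simp add: ennreal_mult)
 also have "\<dots> \<le> ennreal (x powr r + (r - 1) * a powr r)"
  using young_powr[of r x a] assms real by (intro ennreal_leI) auto
 also have "\<dots> = ennpowr y r + ennreal ((r - 1) * a powr r)"
  using real assms by (simp add: ennpowr_ennreal)
 finally show ?thesis .
qed simp

text \<open>Jensen's inequality for the measure with density \<open>w\<close>, applied to \<open>h / w\<close>.\<close>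

lemma nn_integral_weighted_powr:
 fixes w :: "'b \<Rightarrow> real"
 assumes r: "1 \<le> r" and W: "0 < W" "(\<integral>\<^sup>+y. ennreal (w y) \<partial>N) \<le> ennreal W"
  and [measurable]: "w \<in> borel_measurable N" "h \<in> borel_measurable N"
  and w0: "\<And>y. 0 \<le> w y" "\<And>y. w y = 0 \<Longrightarrow> h y = 0"
 shows "ennpowr (\<integral>\<^sup>+y. h y \<partial>N) r \<le> ennreal (W powr (r - 1)) * (\<integral>\<^sup>+y. ennpowr (h y) r * ennreal (w y powr (1 - r)) \<partial>N)"
  (is "ennpowr ?I r \<le> _ * ?Q")
proof (cases "?Q = \<infinity>")
 case True
 then show ?thesis using W by (simp add: ennreal_mult_top)
next
 case False
 have pt: "ennreal (r * a powr (r - 1)) * h y \<le> ennpowr (h y) r * ennreal (w y powr (1 - r)) + ennreal ((r - 1) * a powr r) * ennreal (w y)"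
  if "a > 0" for a y
 proof (cases "w y = 0")
  case True
  then show ?thesis using w0(2) by simp
 next
  case False
  then have wp: "w y > 0" using w0(1)[of y] by simp
  have "ennreal (r * a powr (r - 1)) * h y = (ennreal (r * a powr (r - 1)) * (h y * ennreal (1 / w y))) * ennreal (w y)"
   using wp by (simp add: mult.assoc ennreal_mult[symmetric])
  also have "\<dots> \<le> (ennpowr (h y * ennreal (1 / w y)) r + ennreal ((r - 1) * a powr r)) * ennreal (w y)"
   by (intro mult_right_mono young_ennpowr r that) auto
  also have "\<dots> = ennpowr (h y) r * (ennreal ((1 / w y) powr r) * ennreal (w y)) + ennreal ((r - 1) * a powr r) * ennreal (w y)"
   using r wp by (simp add: ennpowr_mult ennpowr_ennreal distrib_right mult.assoc)
  also have "ennreal ((1 / w y) powr r) * ennreal (w y) = ennreal (w y powr (1 - r))"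
   using wp by (simp add: ennreal_mult[symmetric] powr_diff powr_divide)
  finally show ?thesis .
 qed
 have Y: "ennreal (r * a powr (r - 1)) * ?I \<le> ?Q + ennreal ((r - 1) * a powr r) * ennreal W" if a: "a > 0" for a
 proof -
  have "ennreal (r * a powr (r - 1)) * ?I = (\<integral>\<^sup>+y. ennreal (r * a powr (r - 1)) * h y \<partial>N)"
   by (simp add: nn_integral_cmult)
  also have "\<dots> \<le> (\<integral>\<^sup>+y. ennpowr (h y) r * ennreal (w y powr (1 - r)) + ennreal ((r - 1) * a powr r) * ennreal (w y) \<partial>N)"
   by (intro nn_integral_mono pt a)
  also have "\<dots> = ?Q + ennreal ((r - 1) * a powr r) * (\<integral>\<^sup>+y. ennreal (w y) \<partial>N)"
   by (subst nn_integral_add) (auto simp: nn_integral_cmult)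
  also have "\<dots> \<le> ?Q + ennreal ((r - 1) * a powr r) * ennreal W"
   by (intro add_left_mono mult_left_mono W) auto
  finally show ?thesis .
 qed
 from Y[of 1] False have "ennreal r * ?I < \<infinity>"
  by (simp add: less_top[symmetric] top_unique) (metis ennreal_add_eq_top ennreal_mult_eq_top_iff ennreal_neq_top infinity_ennreal_def le_iff_add less_top top_unique)
 then have "?I \<noteq> \<infinity>" using r by (auto simp: ennreal_mult_top)
 then obtain I where I: "?I = ennreal I" "I \<ge> 0" by (cases ?I) auto
 from False obtain Q where Q: "?Q = ennreal Q" "Q \<ge> 0" by (cases ?Q) auto
 show ?thesis
 proof (cases "I = 0")
  case False
  then have Ip: "I > 0" using I by simp
  define a where "a = I / W"
  have a: "a > 0" using Ip W by (simp add: a_def)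
  have "ennreal (r * a powr (r - 1) * I) \<le> ennreal (Q + (r - 1) * a powr r * W)"
   using Y[OF a] r I Q W by (simp add: ennreal_mult)
  then have "r * a powr (r - 1) * I \<le> Q + (r - 1) * a powr r * W"
   using Q r W by (subst (asm) ennreal_le_iff) auto
  moreover have "r * a powr (r - 1) * I = r * (a powr r * W)"
  proof -
   have "a powr (r - 1) * I = a powr r * W"
    using a W by (simp add: powr_diff) (simp add: a_def field_simps)
   then show ?thesis by (simp add: mult.assoc)
  qed
  moreover have "(r - 1) * a powr r * W = r * (a powr r * W) - a powr r * W" by (simp add: algebra_simps)
  ultimately have "a powr r * W \<le> Q" by linarith
  moreover have "a powr r * W = I powr r / W powr (r - 1)"
   using Ip W by (simp add: a_def powr_divide powr_diff)
  ultimately have "I powr r \<le> W powr (r - 1) * Q" using W by (simp add: pos_divide_le_eq mult.commute)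
  then show ?thesis using I Q by (simp add: ennpowr_ennreal ennreal_mult[symmetric] ennreal_leI)
 qed (simp add: I)
qed

section \<open>Lebesgue norms\<close>

definition glp :: "'a measure \<Rightarrow> ennreal \<Rightarrow> ('a \<Rightarrow> ennreal) \<Rightarrow> ennreal" where
 "glp M p h = (if p = \<infinity> then esssup M h
   else ennpowr (\<integral>\<^sup>+x. ennpowr (h x) (enn2real p) \<partial>M) (1 / enn2real p))"

lemma Lp_norm_glp: "Lp_norm p h = glp lborel p h"
 by (simp add: Lp_norm_def glp_def)

lemma nn_integral_count_space_infsum: "(\<integral>\<^sup>+k. f k \<partial>count_space UNIV) = (\<Sum>\<^sub>\<infinity>k. f (k :: int))"
proof -
 let ?S = "SUP F\<in>{F. finite F \<and> F \<subseteq> UNIV}. sum f F" and ?I = "\<integral>\<^sup>+k. f k \<partial>count_space UNIV"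
 have "?S \<le> ?I"
 proof (rule SUP_least, clarsimp)
  fix F :: "int set" assume F: "finite F"
  have "sum f F = (\<integral>\<^sup>+k. f k * indicator F k \<partial>count_space UNIV)"
   using F by (subst nn_integral_count_space'[of F]) auto
  also have "\<dots> \<le> ?I" by (intro nn_integral_mono) (auto simp: indicator_def)
  finally show "sum f F \<le> ?I" .
 qed
 moreover have "?I \<le> ?S"
 proof -
  have "?I = (\<integral>\<^sup>+n. f (int_decode n) \<partial>count_space UNIV)"
   by (rule nn_integral_bij_count_space[symmetric, OF bij_int_decode])
  also have "\<dots> = (SUP n. \<Sum>i<n. f (int_decode i))" by (simp add: nn_integral_count_space_nat suminf_eq_SUP)
  also have "\<dots> \<le> ?S"
  proof (rule SUP_least)
   fix n
   have "(\<Sum>i<n. f (int_decode i)) = sum f (int_decode ` {..<n})" by (simp add: sum.reindex inj_int_decode)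
   also have "\<dots> \<le> ?S" by (rule SUP_upper) simp
   finally show "(\<Sum>i<n. f (int_decode i)) \<le> ?S" .
  qed
  finally show ?thesis .
 qed
 ultimately show ?thesis using nonneg_infsum_complete[of UNIV f] by simp
qed

lemma lq_norm_glp: "lq_norm q c = glp (count_space UNIV) q c"
proof -
 have "esssup (count_space UNIV) c = (SUP k. c k)"
 proof (rule antisym)
  show "esssup (count_space UNIV) c \<le> (SUP k. c k)"
   by (rule esssup_I) (auto simp: AE_count_space intro: SUP_upper)
  show "(SUP k. c k) \<le> esssup (count_space UNIV) c"
   using esssup_AE[of c "count_space UNIV"] by (intro SUP_least) (auto simp: AE_count_space)
 qed
 then show ?thesis by (simp add: lq_norm_def glp_def nn_integral_count_space_infsum)
qed

lemma exponent_cases: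
 assumes "1 \<le> (p::ennreal)"
 obtains "p = \<infinity>" | r where "p = ennreal r" "1 \<le> r"
 using assms by (cases p) (auto simp: one_ennreal_def[symmetric] ennreal_le_iff simp flip: ennreal_1)

lemma glp_real: "1 \<le> r \<Longrightarrow> glp M (ennreal r) h = ennpowr (\<integral>\<^sup>+x. ennpowr (h x) r \<partial>M) (1 / r)"
 by (simp add: glp_def)

lemma glp_inf: "glp M \<infinity> h = esssup M h"
 by (simp add: glp_def)

lemma Lp_norm_1: "Lp_norm 1 h = (INN x. h x)"
 using glp_real[of 1 lborel h] by (simp add: Lp_norm_glp)

lemma glp_mono_AE:
 assumes p: "1 \<le> p" and "h \<in> borel_measurable M" "AE x in M. h x \<le> g x" shows "glp M p h \<le> glp M p g"
 using p
proof (cases p rule: exponent_cases)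
 case 1 show ?thesis unfolding 1 glp_inf using assms by (intro esssup_AE_mono)
next
 case (2 r)
 have "AE x in M. ennpowr (h x) r \<le> ennpowr (g x) r" using assms(3) by eventually_elim (use 2 in \<open>auto intro: ennpowr_mono\<close>)
 then show ?thesis unfolding 2(1) glp_real[OF 2(2)] using 2(2)
  by (intro ennpowr_mono nn_integral_mono_AE) auto
qed

lemma glp_cong_AE:
 assumes "1 \<le> p" "h \<in> borel_measurable M" "g \<in> borel_measurable M" "AE x in M. h x = g x" shows "glp M p h = glp M p g"
proof (rule antisym)
 show "glp M p h \<le> glp M p g" by (rule glp_mono_AE) (use assms in auto)
 have "AE x in M. g x = h x" using assms(4) by eventually_elim simp
 then show "glp M p g \<le> glp M p h" by (intro glp_mono_AE) (use assms in auto)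
qed

lemma glp_cmult_le:
 assumes p: "1 \<le> p" and [measurable]: "h \<in> borel_measurable M"
 shows "glp M p (\<lambda>x. c * h x) \<le> c * glp M p h"
 using p
proof (cases p rule: exponent_cases)
 case 1
 have "AE x in M. c * h x \<le> c * esssup M h" using esssup_AE[of h M] by eventually_elim (auto intro: mult_left_mono)
 then show ?thesis unfolding 1 glp_inf by (intro esssup_I) auto
next
 case (2 r)
 have "(\<integral>\<^sup>+x. ennpowr (c * h x) r \<partial>M) = ennpowr c r * (\<integral>\<^sup>+x. ennpowr (h x) r \<partial>M)"
  using 2 by (simp add: ennpowr_mult nn_integral_cmult)
 then show ?thesis unfolding 2(1) glp_real[OF 2(2)] using 2(2)
  by (simp add: ennpowr_mult ennpowr_ennpowr)
qed

lemma measurable_glp: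
 assumes p: "1 \<le> p" and M: "sigma_finite_measure M" and f: "(\<lambda>(y, x). f y x) \<in> borel_measurable (N \<Otimes>\<^sub>M M)"
 shows "(\<lambda>y. glp M p (f y)) \<in> borel_measurable N"
proof -
 interpret sigma_finite_measure M by fact
 note [measurable] = f
 show ?thesis using p
 proof (cases p rule: exponent_cases)
  case 1
  have "(\<lambda>y. esssup M (f y)) \<in> borel_measurable N"
  proof (rule borel_measurableI_le)
   fix c
   have fy: "f y \<in> borel_measurable M" if "y \<in> space N" for y
    using measurable_compose[OF measurable_Pair1'[OF that] f] by simp
   have "esssup M (f y) \<le> c \<longleftrightarrow> emeasure M {x \<in> space M. c < f y x} = 0" if "y \<in> space N" for y
   proof -
    have [measurable]: "f y \<in> borel_measurable M" by (rule fy[OF that])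
    have "esssup M (f y) \<le> c \<longleftrightarrow> (AE x in M. f y x \<le> c)"
    proof
     assume c: "esssup M (f y) \<le> c"
     show "AE x in M. f y x \<le> c" using esssup_AE[of "f y" M] by eventually_elim (use c in auto)
    qed (auto intro: esssup_I)
    also have "\<dots> \<longleftrightarrow> emeasure M {x \<in> space M. \<not> f y x \<le> c} = 0" by (rule AE_iff_measurable[OF _ refl]) measurable
    finally show ?thesis by (simp add: not_le)
   qed
   then have "{y \<in> space N. esssup M (f y) \<le> c} = {y \<in> space N. emeasure M {x \<in> space M. c < f y x} = 0}" by auto
   also have "\<dots> \<in> sets N"
   proof -
    have Q: "{z \<in> space (N \<Otimes>\<^sub>M M). c < (\<lambda>(y, x). f y x) z} \<in> sets (N \<Otimes>\<^sub>M M)" by measurable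
    have "Pair y -` {z \<in> space (N \<Otimes>\<^sub>M M). c < (\<lambda>(y, x). f y x) z} = {x \<in> space M. c < f y x}" if "y \<in> space N" for y
     using that by (auto simp: space_pair_measure)
    then have "(\<lambda>y. emeasure M {x \<in> space M. c < f y x}) \<in> borel_measurable N"
     using measurable_emeasure_Pair[OF Q] by (simp cong: measurable_cong)
    then show ?thesis by measurable
   qed
   finally show "{y \<in> space N. esssup M (f y) \<le> c} \<in> sets N" .
  qed
  then show ?thesis unfolding 1 glp_inf .
 next
  case (2 r)
  show ?thesis unfolding 2(1) glp_real[OF 2(2)] by measurable
 qed
qed

text \<open>For finite exponents, Jensen's inequality with the density \<open>w y\<close> proportional to the norm of the slice \<open>f (_, y)\<close>
makes the right-hand side linear in the slices, and Tonelli's theorem finishes the proof.\<close>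

lemma minkowski_integral:
 assumes p: "1 \<le> p" and M: "sigma_finite_measure M" and N: "sigma_finite_measure N"
  and f: "(\<lambda>(x, y). f x y) \<in> borel_measurable (M \<Otimes>\<^sub>M N)"
 shows "glp M p (\<lambda>x. \<integral>\<^sup>+y. f x y \<partial>N) \<le> (\<integral>\<^sup>+y. glp M p (\<lambda>x. f x y) \<partial>N)" (is "_ \<le> (\<integral>\<^sup>+y. ?m y \<partial>N)")
proof -
 interpret M: sigma_finite_measure M by fact
 interpret N: sigma_finite_measure N by fact
 interpret P: pair_sigma_finite M N ..
 note [measurable] = f
 have f2 [measurable]: "(\<lambda>(y, x). f x y) \<in> borel_measurable (N \<Otimes>\<^sub>M M)"
  using measurable_compose[OF measurable_pair_swap' f] by (simp add: case_prod_unfold)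
 have [measurable]: "?m \<in> borel_measurable N"
  by (rule measurable_glp[OF p M f2])
 show ?thesis
 proof (cases "(\<integral>\<^sup>+y. ?m y \<partial>N) = \<infinity>")
  case False
  show ?thesis using p
  proof (cases p rule: exponent_cases)
   case 1
   have "AE y in N. AE x in M. f x y \<le> ?m y" unfolding 1 glp_inf by (intro AE_I2 esssup_AE)
   then have "AE x in M. AE y in N. f x y \<le> ?m y" by (subst P.AE_commute) measurable
   then have "AE x in M. (\<integral>\<^sup>+y. f x y \<partial>N) \<le> (\<integral>\<^sup>+y. ?m y \<partial>N)"
    by eventually_elim (rule nn_integral_mono_AE)
   then show ?thesis unfolding 1 glp_inf by (intro esssup_I) auto
  next
   case (2 r)
   have fin: "AE y in N. ?m y \<noteq> \<infinity>" by (rule nn_integral_PInf_AE) (use False in auto)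
   obtain S where S: "(\<integral>\<^sup>+y. ?m y \<partial>N) = ennreal S" "S \<ge> 0" using False by (cases "\<integral>\<^sup>+y. ?m y \<partial>N") auto
   obtain g :: "'b \<Rightarrow> real" where g: "g \<in> borel_measurable N" "\<And>x. g x > 0" "integrable N g"
    using N.obtain_positive_integrable_function by metis
   note [measurable] = g(1)
   have main: "glp M p (\<lambda>x. \<integral>\<^sup>+y. f x y \<partial>N) \<le> ennreal (S + e)" if e: "e > 0" for e :: real
   proof -
    define c where "c = e / (1 + integral\<^sup>L N g)"
    have Ig: "0 \<le> integral\<^sup>L N g" using g by (intro integral_nonneg_AE) (auto intro: less_imp_le)
    have c: "c > 0" "c * integral\<^sup>L N g \<le> e" using e Ig by (auto simp: c_def field_simps add_pos_nonneg)
    (* the summand c * g keeps the density positive where the slice vanishes *)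
    define w where "w y = enn2real (?m y) + c * g y" for y
    have wp: "w y > 0" for y unfolding w_def using c g by (intro add_nonneg_pos) auto
    have [measurable]: "w \<in> borel_measurable N" unfolding w_def by measurable
    have mw: "AE y in N. ?m y \<le> ennreal (w y)"
     using fin
    proof eventually_elim
     fix y assume "?m y \<noteq> \<infinity>"
     then have "?m y = ennreal (enn2real (?m y))" by (simp add: less_top)
     also have "\<dots> \<le> ennreal (w y)" unfolding w_def using c g(2)[of y] by (intro ennreal_leI) auto
     finally show "?m y \<le> ennreal (w y)" .
    qed
    have W: "(\<integral>\<^sup>+y. ennreal (w y) \<partial>N) \<le> ennreal (S + e)"
    proof -
     have "(\<integral>\<^sup>+y. ennreal (w y) \<partial>N) = (\<integral>\<^sup>+y. ennreal (enn2real (?m y)) \<partial>N) + (\<integral>\<^sup>+y. ennreal (c * g y) \<partial>N)"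
      unfolding w_def using c g(2) by (subst nn_integral_add[symmetric]) (auto intro!: nn_integral_cong ennreal_plus mult_nonneg_nonneg simp: less_imp_le)
     also have "(\<integral>\<^sup>+y. ennreal (enn2real (?m y)) \<partial>N) = ennreal S"
      unfolding S(1)[symmetric] using fin by (intro nn_integral_cong_AE) (auto simp: less_top elim!: eventually_mono)
     also have "(\<integral>\<^sup>+y. ennreal (c * g y) \<partial>N) = ennreal (c * integral\<^sup>L N g)"
      using c g(2,3) by (subst nn_integral_eq_integral) (auto intro!: AE_I2 mult_nonneg_nonneg less_imp_le)
     finally show ?thesis using c S Ig e by (simp add: ennreal_plus[symmetric] ennreal_leI del: ennreal_plus)
    qed
    have Sp: "S + e > 0" using S e by simp
    have "(\<integral>\<^sup>+x. ennpowr (\<integral>\<^sup>+y. f x y \<partial>N) r \<partial>M)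
     \<le> (\<integral>\<^sup>+x. ennreal ((S + e) powr (r - 1)) * (\<integral>\<^sup>+y. ennpowr (f x y) r * ennreal (w y powr (1 - r)) \<partial>N) \<partial>M)"
     by (intro nn_integral_mono nn_integral_weighted_powr 2 Sp W) (use wp less_imp_neq[OF wp] in \<open>auto intro: less_imp_le\<close>)
    also have "\<dots> = ennreal ((S + e) powr (r - 1)) * (\<integral>\<^sup>+x. \<integral>\<^sup>+y. ennpowr (f x y) r * ennreal (w y powr (1 - r)) \<partial>N \<partial>M)"
     by (rule nn_integral_cmult) measurable
    also have "(\<integral>\<^sup>+x. \<integral>\<^sup>+y. ennpowr (f x y) r * ennreal (w y powr (1 - r)) \<partial>N \<partial>M)
     = (\<integral>\<^sup>+y. \<integral>\<^sup>+x. ennpowr (f x y) r * ennreal (w y powr (1 - r)) \<partial>M \<partial>N)"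
     by (rule P.Fubini'[symmetric]) measurable
    also have "\<dots> = (\<integral>\<^sup>+y. (\<integral>\<^sup>+x. ennpowr (f x y) r \<partial>M) * ennreal (w y powr (1 - r)) \<partial>N)"
     by (intro nn_integral_cong nn_integral_multc) measurable
    also have "\<dots> \<le> (\<integral>\<^sup>+y. ennreal (w y) \<partial>N)"
    proof (rule nn_integral_mono_AE)
     show "AE y in N. (\<integral>\<^sup>+x. ennpowr (f x y) r \<partial>M) * ennreal (w y powr (1 - r)) \<le> ennreal (w y)"
      using mw
     proof eventually_elim
      fix y assume "?m y \<le> ennreal (w y)"
      then have "(\<integral>\<^sup>+x. ennpowr (f x y) r \<partial>M) \<le> ennpowr (ennreal (w y)) r"
       unfolding 2(1) glp_real[OF 2(2)] using 2(2) by (subst (asm) ennpowr_le_iff) auto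
      also have "\<dots> = ennreal (w y powr r)" using wp[of y] by (simp add: ennpowr_ennreal)
      finally have "(\<integral>\<^sup>+x. ennpowr (f x y) r \<partial>M) * ennreal (w y powr (1 - r)) \<le> ennreal (w y powr r) * ennreal (w y powr (1 - r))"
       by (rule mult_right_mono) simp
      also have "\<dots> = ennreal (w y)" using wp[of y] by (simp add: ennreal_mult[symmetric] powr_add[symmetric])
      finally show "(\<integral>\<^sup>+x. ennpowr (f x y) r \<partial>M) * ennreal (w y powr (1 - r)) \<le> ennreal (w y)" .
     qed
    qed
    also note W
    finally have "(\<integral>\<^sup>+x. ennpowr (\<integral>\<^sup>+y. f x y \<partial>N) r \<partial>M) \<le> ennreal ((S + e) powr (r - 1)) * ennreal (S + e)"
     by (simp add: mult_left_mono)
    also have "\<dots> = ennpowr (ennreal (S + e)) r"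
     using Sp by (simp add: ennreal_mult[symmetric] powr_diff ennpowr_ennreal)
    finally show ?thesis unfolding 2(1) glp_real[OF 2(2)] using 2(2) by (subst ennpowr_le_iff) auto
   qed
   show ?thesis
   proof (rule ennreal_le_epsilon)
    fix e :: real assume "0 < e"
    then show "glp M p (\<lambda>x. \<integral>\<^sup>+y. f x y \<partial>N) \<le> (\<integral>\<^sup>+y. ?m y \<partial>N) + ennreal e"
     using main[of e] S by (simp add: ennreal_plus)
   qed
  qed
 qed simp
qed

lemma glp_triangle:
 assumes p: "1 \<le> p" and M: "sigma_finite_measure M" and [measurable]: "f \<in> borel_measurable M" "g \<in> borel_measurable M"
 shows "glp M p (\<lambda>x. f x + g x) \<le> glp M p f + glp M p g"
proof -
 have N: "sigma_finite_measure (count_space (UNIV :: bool set))"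
  by (rule sigma_finite_measure_count_space)
 have "glp M p (\<lambda>x. \<integral>\<^sup>+b. (if b then f x else g x) \<partial>count_space UNIV) \<le> (\<integral>\<^sup>+b. glp M p (\<lambda>x. if b then f x else g x) \<partial>count_space UNIV)"
 proof (rule minkowski_integral[OF p M N])
  show "(\<lambda>(x, b). if b then f x else g x) \<in> borel_measurable (M \<Otimes>\<^sub>M count_space UNIV)"
   by measurable
 qed
 then show ?thesis by (simp add: nn_integral_count_space_finite UNIV_bool add.commute)
qed

lemma glp_sum:
 assumes p: "1 \<le> p" and M: "sigma_finite_measure M" and m: "\<And>i. i \<in> I \<Longrightarrow> f i \<in> borel_measurable M" and I: "finite I" "I \<noteq> {}"
 shows "glp M p (\<lambda>x. \<Sum>i\<in>I. f i x) \<le> (\<Sum>i\<in>I. glp M p (f i))"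
 using I m
proof (induction I rule: finite_ne_induct)
 case (insert i I)
 have "glp M p (\<lambda>x. f i x + (\<Sum>i\<in>I. f i x)) \<le> glp M p (f i) + glp M p (\<lambda>x. \<Sum>i\<in>I. f i x)"
  by (rule glp_triangle[OF p M]) (use insert in auto)
 also have "\<dots> \<le> glp M p (f i) + (\<Sum>i\<in>I. glp M p (f i))"
  by (intro add_left_mono insert.IH) (use insert in auto)
 finally show ?case using insert by simp
qed simp

text \<open>Interpolating the dual norm of \<open>w\<close> between its supremum and its integral is enough below, and it avoids the
conjugate exponent.\<close>

lemma glp_hoelder:
 fixes w :: "'a \<Rightarrow> real"
 assumes p: "1 \<le> p" and [measurable]: "h \<in> borel_measurable M" "w \<in> borel_measurable M"
  and w: "\<And>x. 0 \<le> w x" "\<And>x. w x \<le> c" "(\<integral>\<^sup>+x. ennreal (w x) \<partial>M) \<le> ennreal e" "0 < c" "0 < e"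
 shows "(\<integral>\<^sup>+x. h x * ennreal (w x) \<partial>M) \<le> ennreal (e powr (1 - enn2real (inverse p)) * c powr (enn2real (inverse p))) * glp M p h"
 using p
proof (cases p rule: exponent_cases)
 case 1
 have "AE x in M. h x * ennreal (w x) \<le> esssup M h * ennreal (w x)"
  using esssup_AE[of h M] by eventually_elim (auto intro: mult_right_mono)
 then have "(\<integral>\<^sup>+x. h x * ennreal (w x) \<partial>M) \<le> (\<integral>\<^sup>+x. esssup M h * ennreal (w x) \<partial>M)" by (rule nn_integral_mono_AE)
 also have "\<dots> = esssup M h * (\<integral>\<^sup>+x. ennreal (w x) \<partial>M)" by (rule nn_integral_cmult) measurable
 also have "\<dots> \<le> esssup M h * ennreal e" by (intro mult_left_mono w) auto
 finally show ?thesis unfolding 1 glp_inf using w by (simp add: mult.commute)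
next
 case (2 r)
 have "ennpowr (\<integral>\<^sup>+x. h x * ennreal (w x) \<partial>M) r \<le> ennreal (e powr (r - 1)) * (\<integral>\<^sup>+x. ennpowr (h x * ennreal (w x)) r * ennreal (w x powr (1 - r)) \<partial>M)"
  by (rule nn_integral_weighted_powr[OF 2(2) w(5,3)]) (use w in auto)
 also have "\<dots> \<le> ennreal (e powr (r - 1)) * (\<integral>\<^sup>+x. ennreal c * ennpowr (h x) r \<partial>M)"
 proof (intro mult_left_mono nn_integral_mono)
  fix x
  show "ennpowr (h x * ennreal (w x)) r * ennreal (w x powr (1 - r)) \<le> ennreal c * ennpowr (h x) r"
  proof (cases "w x = 0")
   case False
   then have wx: "w x > 0" using w(1)[of x] by simp
   have "ennpowr (h x * ennreal (w x)) r * ennreal (w x powr (1 - r)) = ennpowr (h x) r * (ennreal (w x powr r) * ennreal (w x powr (1 - r)))"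
    using 2 wx by (simp add: ennpowr_mult ennpowr_ennreal mult.assoc)
   also have "ennreal (w x powr r) * ennreal (w x powr (1 - r)) = ennreal (w x)"
    using wx by (simp add: ennreal_mult[symmetric] powr_add[symmetric])
   also have "ennpowr (h x) r * ennreal (w x) \<le> ennpowr (h x) r * ennreal c" by (intro mult_left_mono ennreal_leI w) auto
   finally show ?thesis by (simp add: mult.commute)
  qed simp
 qed auto
 also have "\<dots> = ennreal (e powr (r - 1) * c) * (\<integral>\<^sup>+x. ennpowr (h x) r \<partial>M)"
  using w by (simp add: nn_integral_cmult ennreal_mult mult.assoc)
 finally have "(\<integral>\<^sup>+x. h x * ennreal (w x) \<partial>M) \<le> ennpowr (ennreal (e powr (r - 1) * c) * (\<integral>\<^sup>+x. ennpowr (h x) r \<partial>M)) (1 / r)"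
  using 2 by (subst (asm) ennpowr_le_iff) auto
 also have "\<dots> = ennreal ((e powr (r - 1) * c) powr (1 / r)) * glp M p h"
  unfolding 2(1) glp_real[OF 2(2)] using 2 w by (simp add: ennpowr_mult ennpowr_ennreal)
 also have "(e powr (r - 1) * c) powr (1 / r) = e powr (1 - enn2real (inverse p)) * c powr (enn2real (inverse p))"
 proof -
  have "inverse p = ennreal (1 / r)" using 2 by (simp add: inverse_ennreal inverse_eq_divide)
  then have ip: "enn2real (inverse p) = 1 / r" using 2 by simp
  have "(r - 1) * (1 / r) = 1 - 1 / r" using 2 by (simp add: field_simps)
  then show ?thesis unfolding ip using w by (simp add: powr_mult powr_powr)
 qed
 finally show ?thesis .
qed

lemma Lp_affine:
 fixes h :: "'a::euclidean_space \<Rightarrow> ennreal"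
 assumes p: "1 \<le> p" and r: "t \<noteq> 0" and [measurable]: "h \<in> borel_measurable borel"
 shows "glp lborel p (\<lambda>x. h (c + t *\<^sub>R x)) \<le> ennreal (\<bar>t\<bar> powr (- DIM('a) * enn2real (inverse p))) * glp lborel p h"
 using p
proof (cases p rule: exponent_cases)
 case 1
 have "AE x in lborel. h x \<le> esssup lborel h" by (rule esssup_AE)
 then have "AE x in lborel. h (c + t *\<^sub>R x) \<le> esssup lborel h" by (intro AE_affine[OF r]) measurable
 then have "esssup lborel (\<lambda>x. h (c + t *\<^sub>R x)) \<le> esssup lborel h" by (intro esssup_I) measurable
 then show ?thesis unfolding 1 glp_inf using r by simp
next
 case (2 q)
 have "inverse p = ennreal (1 / q)" using 2 by (simp add: inverse_ennreal inverse_eq_divide)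
 then have ip: "enn2real (inverse p) = 1 / q" using 2 by simp
 have "(INN x. ennpowr (h x) q) = ennreal (\<bar>t\<bar> ^ DIM('a)) * (INN x. ennpowr (h (c + t *\<^sub>R x)) q)"
  by (rule nn_integral_affine[OF r, symmetric]) measurable
 then have "ennreal (\<bar>t\<bar> powr (- DIM('a))) * (INN x. ennpowr (h x) q)
  = (ennreal (\<bar>t\<bar> powr (- DIM('a))) * ennreal (\<bar>t\<bar> ^ DIM('a))) * (INN x. ennpowr (h (c + t *\<^sub>R x)) q)"
  by (simp add: mult.assoc)
 also have "ennreal (\<bar>t\<bar> powr (- DIM('a))) * ennreal (\<bar>t\<bar> ^ DIM('a)) = 1"
  using r by (simp add: ennreal_mult[symmetric] powr_realpow[symmetric] powr_add[symmetric])
 finally have e: "(INN x. ennpowr (h (c + t *\<^sub>R x)) q) = ennreal (\<bar>t\<bar> powr (- DIM('a))) * (INN x. ennpowr (h x) q)" by simp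
 show ?thesis unfolding ip unfolding 2(1) glp_real[OF 2(2)] e using 2 r
  by (simp add: ennpowr_mult ennpowr_ennreal powr_powr)
qed

section \<open>Uniqueness of the representing function\<close>

text \<open>Boxes form a generator of the Borel sets that is stable under intersection.\<close>

lemma AE_zero_if_boxes_zero:
 fixes f :: "'a::euclidean_space \<Rightarrow> complex"
 assumes f: "integrable lborel f" and U: "(LIN x. f x) = 0"
  and b: "\<And>a b. (LINT x:box a b|lborel. f x) = 0"
 shows "AE x in lborel. f x = 0"
proof (rule sigma_finite_measure.density_zero[OF sigma_finite_lborel f])
 have si: "set_integrable lborel A f" if "A \<in> sets borel" for A
  using that f unfolding set_integrable_def by (intro integrable_mult_indicator) auto
 fix A :: "'a set" assume "A \<in> sets lborel"
 then have A: "A \<in> sigma_sets UNIV (range (\<lambda>(a, b). box a b))"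
  using arg_cong[OF borel_eq_box, of sets] by auto
 have "Int_stable (range (\<lambda>(a, b). box a b :: 'a set))"
  by (auto simp: Int_stable_def box_Int_box)
 moreover have "range (\<lambda>(a, b). box a b :: 'a set) \<subseteq> Pow UNIV" by simp
 ultimately show "set_lebesgue_integral lborel A f = 0" using A
 proof (induction rule: sigma_sets_induct_disjoint)
  case (basic A) then show ?case using b by auto
 next
  case empty then show ?case by (simp add: set_lebesgue_integral_def)
 next
  case (compl A)
  then have A: "A \<in> sets borel" using arg_cong[OF borel_eq_box, of sets] by auto
  have "(LINT x:(UNIV - A) \<union> A|lborel. f x) = (LINT x:UNIV - A|lborel. f x) + (LINT x:A|lborel. f x)"
   using A by (intro set_integral_Un si) auto
  moreover have "(UNIV - A) \<union> A = UNIV" by auto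
  ultimately show ?case using compl U by (simp add: set_lebesgue_integral_def)
 next
  case (union A)
  then have A: "A i \<in> sets borel" for i using arg_cong[OF borel_eq_box, of sets] by auto
  have "(LINT x:(\<Union>i. A i)|lborel. f x) = (\<Sum>i. (LINT x:(A i)|lborel. f x))"
   by (rule lebesgue_integral_countable_add) (use A union(1) in \<open>auto intro!: si simp: disjoint_family_on_def\<close>)
  then show ?case using union by simp
 qed
qed

definition bump :: "('e::euclidean_space \<Rightarrow> real) \<Rightarrow> real \<Rightarrow> bool" where
 "bump \<rho> R \<longleftrightarrow> R > 0 \<and> schwartz (\<lambda>z. of_real (\<rho> z)) \<and> (\<forall>z. 0 \<le> \<rho> z) \<and>
  (\<forall>z. norm z > R \<longrightarrow> \<rho> z = 0) \<and> (\<forall>z. norm z < 1/2 \<longrightarrow> \<rho> z = 1)"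

lemma bump_integral_pos:
 fixes \<rho> :: "'e::euclidean_space \<Rightarrow> real"
 assumes bump: "bump \<rho> R" shows "integral\<^sup>L lborel \<rho> > 0"
proof -
 have S: "schwartz (\<lambda>z. of_real (\<rho> z))" and p0: "\<And>z. 0 \<le> \<rho> z"
  and p1: "\<And>z. norm z < 1/2 \<Longrightarrow> \<rho> z = 1"
  using bump unfolding bump_def by auto
 have ipr: "integrable lborel \<rho>" using integrable_norm[OF schwartz_integrable[OF S]] p0 by (simp add: abs_of_nonneg)
 define c where "c = integral\<^sup>L lborel \<rho>"
 have "c > 0"
 proof -
  have "c \<ge> 0" unfolding c_def using p0 by simp
  moreover have "c \<noteq> 0"
  proof
   assume "c = 0"
   then have "AE x in lborel. \<rho> x = 0" unfolding c_def using ipr p0 by (subst (asm) integral_nonneg_eq_0_iff_AE) auto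
   then have "AE x in lborel. x \<notin> ball (0::'e) (1/2)" by eventually_elim (use p1 in auto)
   then have "ball (0::'e) (1/2) \<in> null_sets lborel" by (subst AE_iff_null_sets) auto
   then have "negligible (ball (0::'e) (1/2))" unfolding negligible_iff_null_sets by (rule null_sets_completionI)
   then show False using open_not_negligible[of "ball (0::'e) (1/2)"] by simp
  qed
  ultimately show ?thesis by simp
 qed
 then show ?thesis by (simp add: c_def)
qed

text \<open>The indicator of a box is the limit almost everywhere of its mollifications, and by Fubini \<open>F\<close> annihilates
these because it annihilates every translate of the mollifier.\<close>

lemma AE_zero_if_annihilates:
 fixes \<rho> :: "'e::euclidean_space \<Rightarrow> real" and F :: "'e \<Rightarrow> complex"
 assumes bump: "bump \<rho> R" and Fm [measurable]: "F \<in> borel_measurable borel"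
  and ann: "\<And>h. schwartz h \<Longrightarrow> integrable lborel (\<lambda>x. F x * h x)" "\<And>h. schwartz h \<Longrightarrow> (LIN x. F x * h x) = 0"
 shows "AE x in lborel. F x = 0"
proof -
 have R: "R > 0" and S: "schwartz (\<lambda>z. complex_of_real (\<rho> z))" and p0: "\<And>z. 0 \<le> \<rho> z"
  and pR: "\<And>z. norm z > R \<Longrightarrow> \<rho> z = 0" and p1: "\<And>z. norm z < 1/2 \<Longrightarrow> \<rho> z = 1"
  using bump unfolding bump_def by auto
 have "(\<lambda>z. Re (complex_of_real (\<rho> z))) \<in> borel_measurable borel" using schwartz_measurable[OF S] by measurable
 then have pm [measurable]: "\<rho> \<in> borel_measurable borel" by simp
 obtain C where C: "C > 0" "\<And>z. \<rho> z \<le> C" using schwartz_bounded[OF S] p0 by (metis norm_of_real abs_of_nonneg)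
 have ip: "integrable lborel (\<lambda>z. complex_of_real (\<rho> z))" by (rule schwartz_integrable[OF S])
 have ipr: "integrable lborel \<rho>" using integrable_norm[OF ip] p0 by (simp add: abs_of_nonneg)
 define c where "c = integral\<^sup>L lborel \<rho>"
 have c: "c > 0" unfolding c_def by (rule bump_integral_pos[OF bump])
 have loc: "integrable lborel (\<lambda>x. indicator (ball 0 r) x *\<^sub>R F x)" if r: "r > 0" for r
 proof (rule integrable_dominated)
  show "integrable lborel (\<lambda>x. F x * complex_of_real (\<rho> (0 + (1/(2*r)) *\<^sub>R x)))"
   by (rule ann(1)[OF schwartz_scale_shift[OF S]]) (use r in auto)
  show "AE x in lborel. norm (indicator (ball 0 r) x *\<^sub>R F x) \<le> norm (F x * complex_of_real (\<rho> (0 + (1/(2*r)) *\<^sub>R x)))"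
  proof (rule AE_I2)
   fix x
   have "\<rho> ((1/(2*r)) *\<^sub>R x) = 1" if "x \<in> ball 0 r" by (rule p1) (use that r in \<open>simp add: field_simps\<close>)
   then show "norm (indicator (ball 0 r) x *\<^sub>R F x) \<le> norm (F x * complex_of_real (\<rho> (0 + (1/(2*r)) *\<^sub>R x)))"
    by (auto simp: indicator_def norm_mult)
  qed
 qed (use Fm in \<open>auto intro!: borel_measurable_scaleR borel_measurable_indicator\<close>)
 have bx: "(LINT x:box a b|lborel. F x) = 0" for a b
 proof -
  let ?B = "box a b"
  obtain r0 where r0: "r0 > 0" "?B \<subseteq> ball 0 r0"
   using bounded_box[of a b] bounded_subset_ballD by blast
  define r1 where "r1 = r0 + R + 1"
  have r1: "r1 > 0" using r0 R by (simp add: r1_def)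
  define N where "N n = real (Suc n)" for n
  have N: "N n \<ge> 1" "N n > 0" for n by (auto simp: N_def)
  define g where "g n x = (LIN y. indicator ?B y * \<rho> (N n *\<^sub>R (x - y)))" for n x
  have gm [measurable]: "g n \<in> borel_measurable borel" for n unfolding g_def by measurable
  have near: "norm x < r1" if "y \<in> ?B" "\<rho> (N n *\<^sub>R (x - y)) \<noteq> 0" for x y n
  proof -
   have "N n * norm (x - y) \<le> R" using pR[of "N n *\<^sub>R (x - y)"] that(2) N[of n] by (force simp: not_less[symmetric])
   moreover have "norm (x - y) \<le> N n * norm (x - y)" using N[of n] by (simp add: mult_le_cancel_right1)
   moreover have "norm y < r0" using that(1) r0 by auto
   moreover have "norm x \<le> norm (x - y) + norm y" using norm_triangle_ineq[of "x - y" y] by simp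
   ultimately show ?thesis unfolding r1_def by simp
  qed
  have gN: "N n ^ DIM('e) * g n x = (LIN z. indicator ?B (x - z /\<^sub>R N n) * \<rho> z)" for n x
  proof -
   have "\<bar>- (1 / N n)\<bar> ^ DIM('e) *\<^sub>R (LIN z. indicator ?B (x + (- (1 / N n)) *\<^sub>R z) * \<rho> (N n *\<^sub>R (x - (x + (- (1 / N n)) *\<^sub>R z)))) = g n x"
    unfolding g_def by (rule integral_affine) (use N[of n] in auto)
   moreover have "N n *\<^sub>R (x - (x + (- (1 / N n)) *\<^sub>R z)) = z" for z using N(2)[of n] by simp
   ultimately show ?thesis using N(2)[of n] by (simp add: field_simps power_one_over inverse_eq_divide)
  qed
  have gb: "norm (N n ^ DIM('e) * g n x) \<le> c" for n x
   unfolding gN c_def by (rule order_trans[OF integral_norm_bound], rule integral_mono')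
    (use ipr p0 in \<open>auto simp: indicator_def abs_mult\<close>)
  have g0: "g n x = 0" if "norm x \<ge> r1" for n x
  proof -
   have "indicator ?B y * \<rho> (N n *\<^sub>R (x - y)) = 0" for y using near[of y n x] that by (auto simp: indicator_def)
   then have "g n x = (LINT y|(lborel::'e measure). 0)" unfolding g_def by presburger
   then show ?thesis by simp
  qed
  have iB: "integrable lborel (\<lambda>y. complex_of_real (indicator ?B y))"
   by (intro integrable_of_real integrable_real_indicator) (auto simp: emeasure_lborel_box_eq)
  have zero: "(LIN x. F x * complex_of_real (g n x)) = 0" for n
  proof -
   let ?G = "\<lambda>x y. F x * complex_of_real (indicator ?B y * \<rho> (N n *\<^sub>R (x - y)))"
   have pi: "integrable (lborel \<Otimes>\<^sub>M lborel) (\<lambda>(x::'e, y::'e). (complex_of_real C * (indicator (ball 0 r1) x *\<^sub>R F x)) * complex_of_real (indicator ?B y))"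
    by (intro integrable_pair_mult sigma_finite_lborel iB integrable_mult_right loc r1)
   have ig: "integrable (lborel \<Otimes>\<^sub>M lborel) (case_prod ?G)"
   proof (rule integrable_dominated[OF pi])
    have "norm (?G x y) \<le> norm ((complex_of_real C * (indicator (ball 0 r1) x *\<^sub>R F x)) * complex_of_real (indicator ?B y))" for x y
    proof (cases "y \<in> ?B \<and> \<rho> (N n *\<^sub>R (x - y)) \<noteq> 0")
     case True
     then have "x \<in> ball 0 r1" using near by auto
     then show ?thesis using True p0 C(1) mult_right_mono[OF C(2)[of "N n *\<^sub>R (x - y)"] norm_ge_zero[of "F x"]]
      by (simp add: norm_mult abs_of_nonneg mult.commute)
    qed auto
    then show "AE z in lborel \<Otimes>\<^sub>M lborel. norm (case z of (x, y) \<Rightarrow> ?G x y) \<le> norm (case z of (x, y) \<Rightarrow> (complex_of_real C * (indicator (ball 0 r1) x *\<^sub>R F x)) * complex_of_real (indicator ?B y))"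
     by (intro AE_I2) auto
   qed measurable
   have "(LIN x. F x * complex_of_real (g n x)) = (LIN x. LIN y. ?G x y)"
    unfolding g_def by (simp flip: integral_complex_of_real)
   also have "\<dots> = (LIN y. LIN x. ?G x y)" using lborel_pair.Fubini_integral[OF ig] by simp
   also have "\<dots> = (LIN y. complex_of_real (indicator ?B y) * (LIN x. F x * complex_of_real (\<rho> (- (N n *\<^sub>R y) + N n *\<^sub>R x))))"
    by (intro Bochner_Integration.integral_cong refl, subst integral_mult_right_zero[symmetric])
     (simp add: algebra_simps)
   also have "\<dots> = (LIN y. complex_of_real (indicator ?B (y::'e)) * 0)"
   proof -
    have "N n \<noteq> 0" using N(2)[of n] by simp
    then have "(LIN x. F x * complex_of_real (\<rho> (- (N n *\<^sub>R y) + N n *\<^sub>R x))) = 0" for y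
     using ann(2)[OF schwartz_scale_shift[OF S]] by blast
    then show ?thesis by (simp only:)
   qed
   finally show ?thesis by simp
  qed
  have "(\<lambda>n. LIN x. F x * complex_of_real (N n ^ DIM('e) * g n x)) \<longlonglongrightarrow> (LIN x. F x * complex_of_real (c * indicator ?B x))"
  proof (rule integral_dominated_convergence[where w="\<lambda>x. c * norm (indicator (ball 0 r1) x *\<^sub>R F x)"])
   show "integrable lborel (\<lambda>x. c * norm (indicator (ball 0 r1) x *\<^sub>R F x))"
    by (intro integrable_mult_right integrable_norm loc r1)
   show "AE x in lborel. norm (F x * complex_of_real (N n ^ DIM('e) * g n x)) \<le> c * norm (indicator (ball 0 r1) x *\<^sub>R F x)" for n
   proof (rule AE_I2)
    fix x
    show "norm (F x * complex_of_real (N n ^ DIM('e) * g n x)) \<le> c * norm (indicator (ball 0 r1) x *\<^sub>R F x)"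
    proof (cases "norm x < r1")
     case True
     then show ?thesis using mult_left_mono[OF gb[of n x] norm_ge_zero[of "F x"]] unfolding norm_mult[of "F x"] norm_of_real
      by (simp add: mult.commute)
    qed (simp add: g0)
   qed
   have "AE x in lborel. x \<notin> cbox a b - ?B"
    using null_sets_cbox_Diff_box AE_not_in by blast
   then show "AE x in lborel. (\<lambda>n. F x * complex_of_real (N n ^ DIM('e) * g n x)) \<longlonglongrightarrow> F x * complex_of_real (c * indicator ?B x)"
   proof eventually_elim
    fix x assume x: "x \<notin> cbox a b - ?B"
    have "(\<lambda>n. N n ^ DIM('e) * g n x) \<longlonglongrightarrow> (LIN z. indicator ?B x * \<rho> z)"
     unfolding gN
    proof (rule integral_dominated_convergence[where w=\<rho>])
     show "AE z in lborel. (\<lambda>n. indicator ?B (x - z /\<^sub>R N n) * \<rho> z) \<longlonglongrightarrow> indicator ?B x * \<rho> z"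
     proof (rule AE_I2)
      fix z
      have "(\<lambda>n. 1 / N n) \<longlonglongrightarrow> 0" unfolding N_def using LIMSEQ_inverse_real_of_nat by (simp add: inverse_eq_divide)
      then have l: "(\<lambda>n. x - z /\<^sub>R N n) \<longlonglongrightarrow> x"
       using tendsto_diff[OF tendsto_const tendsto_scaleR[OF _ tendsto_const], of "\<lambda>n. 1 / N n" 0 sequentially x z]
       by (simp add: inverse_eq_divide)
      have "eventually (\<lambda>n. indicator ?B (x - z /\<^sub>R N n) = (indicator ?B x :: real)) sequentially"
      proof (cases "x \<in> ?B")
       case True
       have "eventually (\<lambda>n. x - z /\<^sub>R N n \<in> ?B) sequentially"
        using l True open_box topological_tendstoD by blast
       then show ?thesis by eventually_elim (use True in auto)
      next
       case False
       then have "x \<in> - cbox a b" using x by auto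
       then have "eventually (\<lambda>n. x - z /\<^sub>R N n \<in> - cbox a b) sequentially"
        using l topological_tendstoD by (metis open_Compl closed_cbox)
       then show ?thesis by eventually_elim (use False box_subset_cbox[of a b] in \<open>auto simp: indicator_def\<close>)
      qed
      then have "eventually (\<lambda>n. indicator ?B x * \<rho> z = indicator ?B (x - z /\<^sub>R N n) * \<rho> z) sequentially"
       by eventually_elim simp
      then show "(\<lambda>n. indicator ?B (x - z /\<^sub>R N n) * \<rho> z) \<longlonglongrightarrow> indicator ?B x * \<rho> z"
       by (rule Lim_transform_eventually[OF tendsto_const])
     qed
    qed (use ipr p0 in \<open>auto simp: indicator_def\<close>)
    then have "(\<lambda>n. complex_of_real (N n ^ DIM('e) * g n x)) \<longlonglongrightarrow> complex_of_real (c * indicator ?B x)"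
     by (intro tendsto_of_real) (simp add: c_def mult.commute)
    then show "(\<lambda>n. F x * complex_of_real (N n ^ DIM('e) * g n x)) \<longlonglongrightarrow> F x * complex_of_real (c * indicator ?B x)"
     by (rule tendsto_mult_left)
   qed
  qed measurable
  moreover have "(LIN x. F x * complex_of_real (N n ^ DIM('e) * g n x)) = 0" for n
  proof -
   have "(LIN x. F x * complex_of_real (N n ^ DIM('e) * g n x)) = (LIN x. complex_of_real (N n ^ DIM('e)) * (F x * complex_of_real (g n x)))"
    by (intro Bochner_Integration.integral_cong refl) simp
   then show ?thesis by (simp only: integral_mult_right_zero zero mult_zero_right)
  qed
  ultimately have "(\<lambda>n::nat. 0) \<longlonglongrightarrow> (LIN x. F x * complex_of_real (c * indicator ?B x))"
   by (simp only:)
  from LIMSEQ_unique[OF tendsto_const this]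
  have "0 = (LIN x. F x * complex_of_real (c * indicator ?B x))" .
  also have "\<dots> = (LIN x. complex_of_real c * (indicator ?B x *\<^sub>R F x))"
   by (intro Bochner_Integration.integral_cong refl) (simp add: scaleR_conv_of_real)
  also have "\<dots> = complex_of_real c * (LINT x:?B|lborel. F x)"
   unfolding set_lebesgue_integral_def by (rule integral_mult_right_zero)
  finally show ?thesis using c by simp
 qed
 have "AE x in lborel. \<forall>k. indicator (box (- real k *\<^sub>R One) (real k *\<^sub>R One)) x *\<^sub>R F x = 0"
 proof (subst AE_all_countable, rule allI)
  fix k
  let ?K = "box (- real k *\<^sub>R One) (real k *\<^sub>R One) :: 'e set"
  show "AE x in lborel. indicator ?K x *\<^sub>R F x = 0"
  proof (rule AE_zero_if_boxes_zero)
   obtain r where r: "r > 0" "?K \<subseteq> ball 0 r" using bounded_box bounded_subset_ballD by blast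
   show "integrable lborel (\<lambda>x. indicator ?K x *\<^sub>R F x)"
   proof (rule integrable_dominated[OF loc[OF r(1)]])
    show "AE x in lborel. norm (indicator ?K x *\<^sub>R F x) \<le> norm (indicator (ball 0 r) x *\<^sub>R F x)"
     using r(2) by (intro AE_I2) (auto simp: indicator_def subset_iff)
   qed (use Fm in \<open>auto intro!: borel_measurable_scaleR borel_measurable_indicator\<close>)
   show "(LIN x. indicator ?K x *\<^sub>R F x) = 0" using bx by (simp add: set_lebesgue_integral_def)
   fix a b
   have "(LINT x:box a b|lborel. indicator ?K x *\<^sub>R F x) = (LINT x:box a b \<inter> ?K|lborel. F x)"
    unfolding set_lebesgue_integral_def by (intro Bochner_Integration.integral_cong) (auto simp: indicator_def)
   also have "\<dots> = 0" unfolding box_Int_box by (rule bx)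
   finally show "(LINT x:box a b|lborel. indicator ?K x *\<^sub>R F x) = 0" .
  qed
 qed
 then show ?thesis
 proof eventually_elim
  fix x assume *: "\<forall>k. indicator (box (- real k *\<^sub>R One) (real k *\<^sub>R One)) x *\<^sub>R F x = 0"
  obtain k where k: "norm x < real k" using reals_Archimedean2 by blast
  have "x \<in> box (- real k *\<^sub>R One) (real k *\<^sub>R One)"
  proof (unfold mem_box, safe)
   fix i :: 'e assume i: "i \<in> Basis"
   have "\<bar>x \<bullet> i\<bar> < real k" using Basis_le_norm[OF i, of x] k by simp
   then show "(- real k *\<^sub>R One) \<bullet> i < x \<bullet> i" "x \<bullet> i < (real k *\<^sub>R One) \<bullet> i" using i by auto
  qed
  then show "F x = 0" using *[rule_format, of k] by simp
 qed
qed

lemma represents_unique: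
 fixes \<rho> :: "'e::euclidean_space \<Rightarrow> real" and F F' :: "'e \<Rightarrow> complex"
 assumes "bump \<rho> R" and F: "represents T F" and F': "represents T F'"
 shows "AE x in lborel. F x = F' x"
proof -
 have "AE x in lborel. F x - F' x = 0"
 proof (rule AE_zero_if_annihilates[OF assms(1)])
  show "(\<lambda>x. F x - F' x) \<in> borel_measurable borel" using F F' unfolding represents_def by (intro borel_measurable_diff) auto
  fix h :: "'e \<Rightarrow> complex" assume h: "schwartz h"
  then have i: "integrable lborel (\<lambda>x. F x * h x)" "integrable lborel (\<lambda>x. F' x * h x)"
   "(LIN x. F x * h x) = (LIN x. F' x * h x)"
   using F F' unfolding represents_def by auto
  show "integrable lborel (\<lambda>x. (F x - F' x) * h x)" "(LIN x. (F x - F' x) * h x) = 0"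
   using i by (simp_all add: left_diff_distrib)
 qed
 then show ?thesis by eventually_elim simp
qed

lemma slow_smooth: "slow f \<Longrightarrow> smooth f"
 using dcl_iff[of polyb "\<lambda>_::unit. f"] unfolding slow_def smooth_def by auto

lemma smooth_imp_smooth_of_real: "test_function \<rho> \<Longrightarrow> slow (\<lambda>x. of_real (\<rho> x))"
 by (intro schwartz_slow test_function_schwartz test_function_of_real)

context LP begin

definition Psi :: "'a \<times> 'a \<Rightarrow> real" where "Psi z = \<psi> (fst z) * \<psi> (snd z)"

lemma psi_nonzero: "norm \<xi> > 1 \<Longrightarrow> \<psi> \<xi> = 0"
 using psi_supp[of \<xi>] by linarith

lemma test_Psi: "test_function (\<lambda>z. complex_of_real (Psi z))"
 unfolding test_function_iff_vanish
proof
 have "slow (\<lambda>z. complex_of_real (\<psi> (fst z)) * complex_of_real (\<psi> (snd z)))"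
  by (intro slow_mult slow_linear_compose[OF bounded_linear_fst] slow_linear_compose[OF bounded_linear_snd]
    smooth_imp_smooth_of_real test_psi)
 then show "smooth (\<lambda>z. complex_of_real (Psi z))" unfolding Psi_def of_real_mult by (rule slow_smooth)
 show "\<exists>R. \<forall>z. norm z > R \<longrightarrow> complex_of_real (Psi z) = 0"
 proof (rule exI[of _ 2], safe)
  fix x v :: 'a assume "norm (x, v) > 2"
  then have "norm x + norm v > 2" using norm_Pair_le[of x v] by linarith
  then have "norm x > 1 \<or> norm v > 1" by linarith
  then show "complex_of_real (Psi (x, v)) = 0" by (auto simp: Psi_def psi_nonzero)
 qed
qed

lemma bump_psi: "bump \<psi> 1"
 unfolding bump_def using schwartz_psi psi_nonneg psi_nonzero psi_eq_1 by auto

lemma bump_Psi: "bump Psi 2"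
 unfolding bump_def
proof (intro conjI allI impI)
 show "schwartz (\<lambda>z. of_real (Psi z))" by (rule test_function_schwartz[OF test_Psi])
 fix z :: "'a \<times> 'a"
 show "0 \<le> Psi z" by (simp add: Psi_def psi_nonneg)
 obtain x v where z: "z = (x, v)" by (cases z)
 show "Psi z = 0" if "norm z > 2"
 proof -
  have "norm x + norm v > 2" using norm_Pair_le[of x v] that z by simp
  then have "norm x > 1 \<or> norm v > 1" by linarith
  then show ?thesis by (auto simp: Psi_def psi_nonzero z)
 qed
 show "Psi z = 1" if "norm z < 1 / 2"
  using that norm_fst_le[of x v] norm_snd_le[of v x] by (simp add: Psi_def psi_eq_1 z)
qed simp

end

section \<open>Mixed norms and free transport\<close>

text \<open>The norm of \<open>L\<^sup>1\<^sub>x L\<^sup>p\<^sub>v\<close>.\<close>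

definition mixp :: "ennreal \<Rightarrow> ('a::euclidean_space \<times> 'a \<Rightarrow> complex) \<Rightarrow> ennreal" where
 "mixp p F = (INN x. glp lborel p (\<lambda>v. enorm (F (x, v))))"

lemma mixed_norm_eq: "Lp_norm 1 (\<lambda>x. Lp_norm p (\<lambda>v. enorm (F (x, v)))) = mixp p F"
 by (simp only: Lp_norm_1 mixp_def) (simp only: Lp_norm_glp)

lemma borel_fst [measurable (raw)]:
 fixes f :: "'m \<Rightarrow> 'a::euclidean_space \<times> 'b::euclidean_space"
 assumes "f \<in> M \<rightarrow>\<^sub>M borel" shows "(\<lambda>x. fst (f x)) \<in> M \<rightarrow>\<^sub>M borel"
 by (rule measurable_compose[OF assms borel_measurable_continuous_onI]) (intro continuous_intros)

lemma borel_snd [measurable (raw)]: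
 fixes f :: "'m \<Rightarrow> 'a::euclidean_space \<times> 'b::euclidean_space"
 assumes "f \<in> M \<rightarrow>\<^sub>M borel" shows "(\<lambda>x. snd (f x)) \<in> M \<rightarrow>\<^sub>M borel"
 by (rule measurable_compose[OF assms borel_measurable_continuous_onI]) (intro continuous_intros)

lemma borel_pair: "borel_measurable (lborel \<Otimes>\<^sub>M lborel) = borel_measurable (borel :: ('a::euclidean_space \<times> 'b::euclidean_space) measure)"
 by (simp add: lborel_prod)

lemma mixp_cong_AE:
 fixes F F' :: "'a::euclidean_space \<times> 'a \<Rightarrow> complex"
 assumes p: "1 \<le> p" and [measurable]: "F \<in> borel_measurable borel" "F' \<in> borel_measurable borel"
  and AE: "AE z in lborel. F z = F' z"
 shows "mixp p F = mixp p F'"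
proof -
 have "AE z in lborel \<Otimes>\<^sub>M lborel. F z = F' z" using AE by (simp only: lborel_prod)
 then have "AE x in lborel. AE v in lborel. F (x, v) = F' (x, v)" by (rule lborel_pair.AE_pair)
 then have "AE x in lborel. glp lborel p (\<lambda>v. enorm (F (x, v))) = glp lborel p (\<lambda>v. enorm (F' (x, v)))"
 proof eventually_elim
  fix x assume *: "AE v in lborel. F (x, v) = F' (x, v)"
  show "glp lborel p (\<lambda>v. enorm (F (x, v))) = glp lborel p (\<lambda>v. enorm (F' (x, v)))"
   by (rule glp_cong_AE[OF p]) (measurable, use * in \<open>auto elim: eventually_mono\<close>)
 qed
 then show ?thesis unfolding mixp_def by (rule nn_integral_cong_AE)
qed

lemma measurable_glp_snd:
 fixes F :: "'a::euclidean_space \<times> 'a \<Rightarrow> complex"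
 assumes p: "1 \<le> p" and [measurable]: "F \<in> borel_measurable borel"
 shows "(\<lambda>x. glp lborel p (\<lambda>v. enorm (F (x, v)))) \<in> borel_measurable borel"
 by (rule measurable_glp[OF p sigma_finite_lborel]) measurable

text \<open>Free transport preserves the measure of the phase space.\<close>

lemma shear_lborel:
 "distr lborel borel (\<lambda>z. (fst z + t *\<^sub>R snd z, snd z)) = (lborel :: ('a::euclidean_space \<times> 'a) measure)"
proof (rule measure_eqI)
 fix A :: "('a \<times> 'a) set" assume "A \<in> sets (distr lborel borel (\<lambda>z. (fst z + t *\<^sub>R snd z, snd z)))"
 then have [measurable]: "A \<in> sets borel" by simp
 have "emeasure (distr lborel borel (\<lambda>z. (fst z + t *\<^sub>R snd z, snd z))) A = (\<integral>\<^sup>+z. indicator A z \<partial>distr lborel borel (\<lambda>z. (fst z + t *\<^sub>R snd z, snd z)))"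
  by simp
 also have "\<dots> = (\<integral>\<^sup>+z. indicator A (fst z + t *\<^sub>R snd z, snd z) \<partial>(lborel \<Otimes>\<^sub>M lborel))"
  by (subst nn_integral_distr) (simp_all add: lborel_prod)
 also have "\<dots> = (INN v. INN x. indicator A (x + t *\<^sub>R v, v))"
  by (subst lborel_pair.nn_integral_snd[symmetric]) (simp_all, measurable)
 also have "\<dots> = (INN v. INN x. indicator A (x, v))"
 proof (rule nn_integral_cong)
  fix v :: 'a
  show "(INN x. indicator A (x + t *\<^sub>R v, v)) = (INN x. indicator A (x, v))"
   using nn_integral_affine[of 1 "\<lambda>x. indicator A (x, v)" "t *\<^sub>R v"] by (simp add: add.commute)
 qed
 also have "\<dots> = (\<integral>\<^sup>+z. indicator A z \<partial>(lborel \<Otimes>\<^sub>M lborel))"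
  by (subst lborel_pair.nn_integral_snd[symmetric]) (simp_all add: lborel_prod)
 also have "\<dots> = emeasure lborel A" by (simp add: lborel_prod)
 finally show "emeasure (distr lborel borel (\<lambda>z. (fst z + t *\<^sub>R snd z, snd z))) A = emeasure lborel A" .
qed simp

text \<open>The velocity integral of the modulus after free transport over the time \<open>t\<close>.\<close>

definition tmass :: "real \<Rightarrow> ('a::euclidean_space \<times> 'a \<Rightarrow> complex) \<Rightarrow> 'a \<Rightarrow> ennreal" where
 "tmass t F x = (INN v. enorm (F (x - t *\<^sub>R v, v)))"

lemma tmass_eq:
 fixes F :: "'a::euclidean_space \<times> 'a \<Rightarrow> complex"
 assumes t: "t > 0" and [measurable]: "F \<in> borel_measurable borel"
 shows "tmass t F x = (INN y. ennreal (t powr (- DIM('a))) * enorm (F (y, (- (1/t)) *\<^sub>R y + (1/t) *\<^sub>R x)))"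
proof -
 let ?f = "\<lambda>y. enorm (F (y, (- (1/t)) *\<^sub>R y + (1/t) *\<^sub>R x))"
 have "ennreal (\<bar>- t\<bar> ^ DIM('a)) * (INN v. ?f (x + (- t) *\<^sub>R v)) = (INN y. ?f y)"
  by (rule nn_integral_affine) (use t in auto)
 moreover have "(- (1/t)) *\<^sub>R (x + (- t) *\<^sub>R v) + (1/t) *\<^sub>R x = v" for v
  using t by (simp add: algebra_simps)
 ultimately have "ennreal (t ^ DIM('a)) * tmass t F x = (INN y. ?f y)"
  using t by (simp add: tmass_def)
 then have "ennreal (t powr (- DIM('a))) * (INN y. ?f y) = (ennreal (t powr (- DIM('a))) * ennreal (t ^ DIM('a))) * tmass t F x"
  by (simp add: mult.assoc)
 also have "ennreal (t powr (- DIM('a))) * ennreal (t ^ DIM('a)) = 1"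
  using t by (simp add: ennreal_mult[symmetric] powr_realpow[symmetric] powr_add[symmetric])
 finally show ?thesis by (simp add: nn_integral_cmult)
qed

lemma measurable_tmass:
 fixes F :: "'a::euclidean_space \<times> 'a \<Rightarrow> complex"
 assumes [measurable]: "F \<in> borel_measurable borel"
 shows "tmass t F \<in> borel_measurable borel"
 unfolding tmass_def[abs_def] by measurable

definition cexp :: "'a::euclidean_space itself \<Rightarrow> ennreal \<Rightarrow> real" where
 "cexp _ p = DIM('a) * (1 - enn2real (inverse p))"

text \<open>The dispersive estimate for free transport. With \<open>y = x - t v\<close> the velocity integral becomes \<open>t\<^sup>-\<^sup>D\<close> times an
integral over the initial position \<open>y\<close>. By Minkowski's inequality only the \<open>L\<^sup>p\<close> norm in \<open>x\<close> of
\<open>F (y, (x - y) / t)\<close> matters, and scaling gives the factor \<open>t\<^sup>D\<^sup>/\<^sup>p\<close>.\<close>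

lemma glp_tmass:
 fixes F :: "'a::euclidean_space \<times> 'a \<Rightarrow> complex"
 assumes p: "1 \<le> p" and t: "t > 0" and [measurable]: "F \<in> borel_measurable borel"
 shows "glp lborel p (tmass t F) \<le> ennreal (t powr (- cexp TYPE('a) p)) * mixp p F"
proof -
 let ?f = "\<lambda>x y. ennreal (t powr (- DIM('a))) * enorm (F (y, (- (1/t)) *\<^sub>R y + (1/t) *\<^sub>R x))"
 have [measurable]: "(\<lambda>x. glp lborel p (\<lambda>v. enorm (F (x, v)))) \<in> borel_measurable borel"
  by (rule measurable_glp_snd[OF p]) measurable
 have "glp lborel p (tmass t F) = glp lborel p (\<lambda>x. INN y. ?f x y)"
  using tmass_eq[OF t assms(3)] by presburger
 also have "\<dots> \<le> (INN y. glp lborel p (\<lambda>x. ?f x y))"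
  by (rule minkowski_integral[OF p sigma_finite_lborel sigma_finite_lborel]) measurable
 also have "\<dots> \<le> (INN y. ennreal (t powr (- cexp TYPE('a) p)) * glp lborel p (\<lambda>v. enorm (F (y, v))))"
 proof (rule nn_integral_mono)
  fix y :: 'a
  have "glp lborel p (\<lambda>x. ?f x y) \<le> ennreal (t powr (- DIM('a))) * glp lborel p (\<lambda>x. enorm (F (y, (- (1/t)) *\<^sub>R y + (1/t) *\<^sub>R x)))"
   by (rule glp_cmult_le[OF p]) measurable
  also have "\<dots> \<le> ennreal (t powr (- DIM('a))) * (ennreal (\<bar>1/t\<bar> powr (- DIM('a) * enn2real (inverse p))) * glp lborel p (\<lambda>v. enorm (F (y, v))))"
   by (intro mult_left_mono Lp_affine[OF p, of "1/t" "\<lambda>v. enorm (F (y, v))"]) (use t in auto)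
  also have "\<dots> = (ennreal (t powr (- DIM('a))) * ennreal (\<bar>1/t\<bar> powr (- DIM('a) * enn2real (inverse p)))) * glp lborel p (\<lambda>v. enorm (F (y, v)))"
   by (simp add: mult.assoc)
  also have "ennreal (t powr (- DIM('a))) * ennreal (\<bar>1/t\<bar> powr (- DIM('a) * enn2real (inverse p))) = ennreal (t powr (- cexp TYPE('a) p))"
  proof -
   have "\<bar>1/t\<bar> powr (- DIM('a) * enn2real (inverse p)) = t powr (DIM('a) * enn2real (inverse p))"
    using t by (simp add: powr_minus powr_divide)
   then show ?thesis by (simp add: ennreal_mult[symmetric] powr_add[symmetric] cexp_def algebra_simps)
  qed
  finally show "glp lborel p (\<lambda>x. ?f x y) \<le> ennreal (t powr (- cexp TYPE('a) p)) * glp lborel p (\<lambda>v. enorm (F (y, v)))" .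
 qed
 also have "\<dots> = ennreal (t powr (- cexp TYPE('a) p)) * mixp p F"
  unfolding mixp_def by (rule nn_integral_cmult) measurable
 finally show ?thesis .
qed

lemma shear_nn_integral:
 fixes f :: "'a::euclidean_space \<times> 'a \<Rightarrow> ennreal"
 assumes [measurable]: "f \<in> borel_measurable borel"
 shows "(INN z. f z) = (INN x. INN v. f (x - t *\<^sub>R v, v))"
proof -
 have "(INN z. f z) = (\<integral>\<^sup>+z. f z \<partial>distr lborel borel (\<lambda>z. (fst z + (- t) *\<^sub>R snd z, snd z)))"
  by (simp only: shear_lborel)
 also have "\<dots> = (\<integral>\<^sup>+z. f (case z of (x, v) \<Rightarrow> (x - t *\<^sub>R v, v)) \<partial>(lborel \<Otimes>\<^sub>M lborel))"
  by (subst nn_integral_distr) (auto simp: lborel_prod case_prod_unfold)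
 also have "\<dots> = (INN x. INN v. f (x - t *\<^sub>R v, v))"
  by (subst lborel.nn_integral_fst[symmetric]) (simp_all, measurable)
 finally show ?thesis .
qed

lemma shear_integral:
 fixes f :: "'a::euclidean_space \<times> 'a \<Rightarrow> complex"
 assumes f: "integrable lborel f"
 shows "(LIN z. f z) = (LIN x. LIN v. f (x - t *\<^sub>R v, v))"
  and "AE x in lborel. integrable lborel (\<lambda>v. f (x - t *\<^sub>R v, v))"
  and "integrable lborel (\<lambda>x. LIN v. f (x - t *\<^sub>R v, v))"
proof -
 have fm [measurable]: "f \<in> borel_measurable borel" using f by auto
 have m: "(\<lambda>z. (fst z + (- t) *\<^sub>R snd z, snd z)) \<in> lborel \<rightarrow>\<^sub>M (borel :: ('a \<times> 'a) measure)" by measurable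
 have "integrable (distr lborel borel (\<lambda>z. (fst z + (- t) *\<^sub>R snd z, snd z))) f"
  using f by (simp only: shear_lborel)
 then have i: "integrable (lborel \<Otimes>\<^sub>M lborel) (\<lambda>(x, v). f (x - t *\<^sub>R v, v))"
  by (subst (asm) integrable_distr_eq[OF m]) (auto simp: lborel_prod case_prod_unfold)
 have "(LIN z. f z) = (LINT z|distr lborel borel (\<lambda>z. (fst z + (- t) *\<^sub>R snd z, snd z)). f z)"
  by (simp only: shear_lborel)
 also have "\<dots> = (LINT z|(lborel \<Otimes>\<^sub>M lborel). (case z of (x, v) \<Rightarrow> f (x - t *\<^sub>R v, v)))"
  by (subst integral_distr[OF m]) (auto simp: lborel_prod case_prod_unfold)
 also have "\<dots> = (LIN x. LIN v. f (x - t *\<^sub>R v, v))"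
  using lborel_pair.integral_fst'[OF i] by simp
 finally show "(LIN z. f z) = (LIN x. LIN v. f (x - t *\<^sub>R v, v))" .
 show "AE x in lborel. integrable lborel (\<lambda>v. f (x - t *\<^sub>R v, v))"
  using lborel_pair.AE_integrable_fst'[OF i] by simp
 show "integrable lborel (\<lambda>x. LIN v. f (x - t *\<^sub>R v, v))"
  using lborel_pair.integrable_fst'[OF i] by simp
qed

definition wnorm :: "ennreal \<Rightarrow> real \<Rightarrow> real \<Rightarrow> real" where
 "wnorm p e c = e powr (1 - enn2real (inverse p)) * c powr (enn2real (inverse p))"

text \<open>The dispersive estimate dualized. The constant sees only the supremum and the integral of \<open>a\<close>, which makes
it summable over the blocks of a Schwartz function later on.\<close>

lemma transported_pairing_le:
 fixes F :: "'a::euclidean_space \<times> 'a \<Rightarrow> complex"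
 assumes p: "1 \<le> p" and t: "t > 0" and [measurable]: "F \<in> borel_measurable borel" "a \<in> borel_measurable borel"
  and a: "\<And>x. norm (a x :: complex) \<le> c" "(INN x. enorm (a x)) \<le> ennreal e" "0 < c" "0 < e"
 shows "(INN z. enorm (F z) * enorm (a (fst z + t *\<^sub>R snd z)))
  \<le> ennreal (wnorm p e c) * (ennreal (t powr (- cexp TYPE('a) p)) * mixp p F)"
proof -
 have [measurable]: "tmass t F \<in> borel_measurable borel" by (rule measurable_tmass) measurable
 have "(INN z. enorm (F z) * enorm (a (fst z + t *\<^sub>R snd z)))
  = (INN x. INN v. enorm (F (x - t *\<^sub>R v, v)) * enorm (a x))"
  using shear_nn_integral[of "\<lambda>z. enorm (F z) * enorm (a (fst z + t *\<^sub>R snd z))" t] by simp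
 also have "\<dots> = (INN x. tmass t F x * enorm (a x))"
  unfolding tmass_def by (intro nn_integral_cong nn_integral_multc) measurable
 also have "\<dots> \<le> ennreal (wnorm p e c) * glp lborel p (tmass t F)"
  unfolding wnorm_def by (rule glp_hoelder[OF p]) (use a in auto)
 also have "\<dots> \<le> ennreal (wnorm p e c) * (ennreal (t powr (- cexp TYPE('a) p)) * mixp p F)"
  by (intro mult_left_mono glp_tmass[OF p t]) auto
 finally show ?thesis .
qed

lemma schwartz_wnorm:
 assumes "schwartz (a :: 'a::euclidean_space \<Rightarrow> complex)"
 obtains c e where "c > 0" "e > 0" "\<And>x. norm (a x) \<le> c" "(INN x. enorm (a x)) \<le> ennreal e"
proof -
 obtain c where c: "c > 0" "\<And>x. norm (a x) \<le> c" using schwartz_bounded[OF assms] by metis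
 have i: "integrable lborel a" by (rule schwartz_integrable[OF assms])
 have "(INN x. enorm (a x)) = ennreal (LIN x. norm (a x))"
  using integrable_norm[OF i] by (intro nn_integral_eq_integral) auto
 also have "\<dots> \<le> ennreal (1 + (LIN x. norm (a x)))" by (intro ennreal_leI) simp
 finally show ?thesis using that[OF c(1) _ c(2), of "1 + (LIN x. norm (a x))"]
  by (simp only: add_pos_nonneg zero_less_one integral_nonneg_AE[OF AE_I2[OF norm_ge_zero]])
qed

text \<open>Hence a function with finite mixed norm defines a distribution.\<close>

lemma mixp_pairing_le:
 assumes p: "1 \<le> p" and H: "schwartz (H :: 'a::euclidean_space \<times> 'a \<Rightarrow> complex)"
 shows "\<exists>C. \<forall>F\<in>borel_measurable borel. (INN z. enorm (F z :: complex) * enorm (H z)) \<le> ennreal C * mixp p F"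
proof -
 note [measurable] = schwartz_measurable[OF H]
 obtain c where c: "c > 0" "\<And>z. norm (H z) \<le> c" using schwartz_bounded[OF H] by metis
 obtain C where C: "C > 0" "\<And>z. (1 + norm z) ^ (2 * DIM('a)) * norm (H z) \<le> C" using schwartz_decay[OF H] by metis
 define e where "e = 1 + C * integral\<^sup>L lborel (weight :: 'a \<Rightarrow> real)"
 have w0: "integral\<^sup>L lborel (weight :: 'a \<Rightarrow> real) \<ge> 0" using weight_pos less_imp_le by (intro integral_nonneg_AE) blast
 have e: "e > 0" unfolding e_def using C w0 by (intro add_pos_nonneg) auto
 have He: "(INN v. enorm (H (x, v))) \<le> ennreal e" for x
 proof -
  have "norm (H (x, v)) \<le> C * weight v" for v
  proof (rule decay_le_weight)
   have "(1 + norm v) ^ (2 * DIM('a)) * norm (H (x, v)) \<le> (1 + norm (x, v)) ^ (2 * DIM('a)) * norm (H (x, v))"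
    by (intro mult_right_mono power_mono) (auto simp: norm_snd_le)
   also have "\<dots> \<le> C" by (rule C)
   finally show "(1 + norm v) ^ (2 * DIM('a)) * norm (H (x, v)) \<le> C" .
  qed simp
  then have "(INN v. enorm (H (x, v))) \<le> (INN v. ennreal (C * weight (v::'a)))"
   by (intro nn_integral_mono ennreal_leI)
  also have "\<dots> = ennreal (LIN v. C * weight (v::'a))"
   by (intro nn_integral_eq_integral integrable_mult_right integrable_weight AE_I2 mult_nonneg_nonneg)
    (use C weight_pos less_imp_le in \<open>auto intro: less_imp_le\<close>)
  also have "\<dots> \<le> ennreal e" unfolding e_def by (intro ennreal_leI) simp
  finally show ?thesis .
 qed
 have "(INN z. enorm (F z) * enorm (H z)) \<le> ennreal (wnorm p e c) * mixp p F"
  if [measurable]: "F \<in> borel_measurable borel" for F :: "'a \<times> 'a \<Rightarrow> complex"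
 proof -
  have [measurable]: "(\<lambda>x. glp lborel p (\<lambda>v. enorm (F (x, v)))) \<in> borel_measurable borel"
   by (rule measurable_glp_snd[OF p]) measurable
  have "(INN z. enorm (F z) * enorm (H z))
   = (INN x. INN v. enorm (F (x, v)) * enorm (H (x, v)))"
   using shear_nn_integral[of "\<lambda>z. enorm (F z) * enorm (H z)" 0] by simp
  also have "\<dots> \<le> (INN x. ennreal (wnorm p e c) * glp lborel p (\<lambda>v. enorm (F (x, v))))"
   unfolding wnorm_def by (intro nn_integral_mono glp_hoelder[OF p]) (use c e He in auto)
  also have "\<dots> = ennreal (wnorm p e c) * mixp p F"
   unfolding mixp_def by (rule nn_integral_cmult) measurable
  finally show ?thesis .
 qed
 then show ?thesis by blast
qed

lemma mixp_integrable_gen: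
 fixes F H :: "'a::euclidean_space \<times> 'a \<Rightarrow> complex"
 assumes [measurable]: "F \<in> borel_measurable borel" "H \<in> borel_measurable borel" and fin: "mixp p F < \<infinity>"
  and H: "(INN z. enorm (F z) * enorm (H z)) \<le> ennreal C * mixp p F"
 shows "integrable lborel (\<lambda>z. F z * H z)"
proof (rule integrableI_bounded)
 show "(\<lambda>z. F z * H z) \<in> borel_measurable lborel" by measurable
 have "(INN z. enorm (F z * H z)) \<le> ennreal C * mixp p F"
  using H by (simp add: norm_mult ennreal_mult)
 also have "\<dots> < \<infinity>" using fin by (simp add: ennreal_mult_less_top)
 finally show "(INN z. enorm (F z * H z)) < \<infinity>" .
qed

lemma mixp_integrable:
 fixes F :: "'a::euclidean_space \<times> 'a \<Rightarrow> complex"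
 assumes p: "1 \<le> p" and [measurable]: "F \<in> borel_measurable borel" and fin: "mixp p F < \<infinity>"
  and H: "schwartz H"
 shows "integrable lborel (\<lambda>z. F z * H z)"
 using mixp_pairing_le[OF p H] mixp_integrable_gen[OF _ schwartz_measurable[OF H] fin] by (metis assms(2))

text \<open>Convolution with the reflected kernel in the second variable, the adjoint of the action on test functions.\<close>

definition vconv :: "('a \<times> 'a \<Rightarrow> complex) \<Rightarrow> ('a::euclidean_space \<Rightarrow> complex) \<Rightarrow> 'a \<times> 'a \<Rightarrow> complex" where
 "vconv F K z = (LIN w. F (fst z, snd z + w) * K w)"

lemma measurable_vconv:
 assumes [measurable]: "F \<in> borel_measurable borel" "K \<in> borel_measurable borel"
 shows "vconv F K \<in> borel_measurable borel"
 unfolding vconv_def[abs_def] by measurable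

lemma mixp_vconv:
 fixes F :: "'a::euclidean_space \<times> 'a \<Rightarrow> complex"
 assumes p: "1 \<le> p" and [measurable]: "F \<in> borel_measurable borel" and K: "K \<in> borel_measurable borel"
 shows "mixp p (vconv F K) \<le> (INN w. enorm (K w)) * mixp p F"
proof -
 note [measurable] = K measurable_vconv[OF assms(2) K]
 have m [measurable]: "(\<lambda>x. glp lborel p (\<lambda>v. enorm (F (x, v)))) \<in> borel_measurable borel"
  by (rule measurable_glp_snd[OF p]) measurable
 have "glp lborel p (\<lambda>v. enorm (vconv F K (x, v))) \<le> (INN w. enorm (K w)) * glp lborel p (\<lambda>v. enorm (F (x, v)))" for x
 proof -
  have le: "enorm (vconv F K (x, v)) \<le> (INN w. enorm (K w) * enorm (F (x, v + w)))" for v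
  proof (cases "integrable lborel (\<lambda>w. F (x, v + w) * K w)")
   case True
   then show ?thesis unfolding vconv_def fst_conv snd_conv
    by (rule order_trans[OF integral_norm_bound_ennreal]) (simp add: norm_mult ennreal_mult mult.commute)
  qed (simp add: vconv_def not_integrable_integral_eq)
  have "glp lborel p (\<lambda>v. enorm (vconv F K (x, v))) \<le> glp lborel p (\<lambda>v. INN w. enorm (K w) * enorm (F (x, v + w)))"
   by (intro glp_mono_AE[OF p] AE_I2 le) measurable
  also have "\<dots> \<le> (INN w. glp lborel p (\<lambda>v. enorm (K w) * enorm (F (x, v + w))))"
   by (rule minkowski_integral[OF p sigma_finite_lborel sigma_finite_lborel]) measurable
  also have "\<dots> \<le> (INN w. enorm (K w) * glp lborel p (\<lambda>v. enorm (F (x, v))))"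
  proof (rule nn_integral_mono)
   fix w :: 'a
   have "glp lborel p (\<lambda>v. enorm (K w) * enorm (F (x, v + w))) \<le> enorm (K w) * glp lborel p (\<lambda>v. enorm (F (x, v + w)))"
    by (rule glp_cmult_le[OF p]) measurable
   also have "glp lborel p (\<lambda>v. enorm (F (x, v + w))) \<le> glp lborel p (\<lambda>v. enorm (F (x, v)))"
    using Lp_affine[OF p, of 1 "\<lambda>v. enorm (F (x, v))" w] by (simp add: add.commute)
   finally show "glp lborel p (\<lambda>v. enorm (K w) * enorm (F (x, v + w))) \<le> enorm (K w) * glp lborel p (\<lambda>v. enorm (F (x, v)))"
    by (simp add: mult_left_mono)
  qed
  also have "\<dots> = (INN w. enorm (K w)) * glp lborel p (\<lambda>v. enorm (F (x, v)))"
   by (rule nn_integral_multc) measurable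
  finally show ?thesis .
 qed
 then have "mixp p (vconv F K) \<le> (INN x. (INN w. enorm (K w)) * glp lborel p (\<lambda>v. enorm (F (x, v))))"
  unfolding mixp_def by (rule nn_integral_mono)
 also have "\<dots> = (INN w. enorm (K w)) * mixp p F"
  unfolding mixp_def by (rule nn_integral_cmult) measurable
 finally show ?thesis .
qed

lemma mixp_sum:
 fixes F :: "'i \<Rightarrow> 'a::euclidean_space \<times> 'a \<Rightarrow> complex"
 assumes p: "1 \<le> p" and F: "\<And>i. i \<in> I \<Longrightarrow> F i \<in> borel_measurable borel" and I: "finite I" "I \<noteq> {}"
 shows "mixp p (\<lambda>z. \<Sum>i\<in>I. F i z) \<le> (\<Sum>i\<in>I. mixp p (F i))"
proof -
 have m: "(\<lambda>v. F i (x, v)) \<in> borel_measurable borel" if "i \<in> I" for i x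
 proof -
  note [measurable] = F[OF that]
  show ?thesis by measurable
 qed
 have "glp lborel p (\<lambda>v. enorm (\<Sum>i\<in>I. F i (x, v))) \<le> (\<Sum>i\<in>I. glp lborel p (\<lambda>v. enorm (F i (x, v))))" for x
 proof -
  have "glp lborel p (\<lambda>v. enorm (\<Sum>i\<in>I. F i (x, v))) \<le> glp lborel p (\<lambda>v. \<Sum>i\<in>I. enorm (F i (x, v)))"
   by (intro glp_mono_AE[OF p] AE_I2) (use m in \<open>auto intro!: ennreal_leI norm_sum\<close>)
  also have "\<dots> \<le> (\<Sum>i\<in>I. glp lborel p (\<lambda>v. enorm (F i (x, v))))"
   by (rule glp_sum[OF p sigma_finite_lborel]) (use m I in auto)
  finally show ?thesis .
 qed
 then have "mixp p (\<lambda>z. \<Sum>i\<in>I. F i z) \<le> (INN x. (\<Sum>i\<in>I. glp lborel p (\<lambda>v. enorm (F i (x, v)))))"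
  unfolding mixp_def by (rule nn_integral_mono)
 also have "\<dots> = (\<Sum>i\<in>I. mixp p (F i))"
  unfolding mixp_def by (rule nn_integral_sum) (use measurable_glp_snd[OF p F] in auto)
 finally show ?thesis .
qed

section \<open>Test functions along characteristics\<close>

text \<open>Integrals of a Schwartz function along the lines \<open>x + s v\<close> decay rapidly in \<open>x\<close> only up to polynomial losses in
\<open>v\<close>. A factor that decays in \<open>v\<close> turns them into Schwartz functions.\<close>

definition semirapid :: "('i \<Rightarrow> 'a::real_normed_vector \<times> 'a \<Rightarrow> complex) \<Rightarrow> bool" where
 "semirapid f \<longleftrightarrow> (\<forall>N. \<exists>M C. \<forall>i z. (1 + norm (fst z)) ^ N * norm (f i z) \<le> C * (1 + norm (snd z)) ^ M)"

definition vrapid :: "('i \<Rightarrow> 'a::real_normed_vector \<times> 'a \<Rightarrow> complex) \<Rightarrow> bool" where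
 "vrapid f \<longleftrightarrow> (\<forall>N. \<exists>C. \<forall>i z. (1 + norm (snd z)) ^ N * norm (f i z) \<le> C)"

lemma semirapid_D:
 assumes "semirapid f"
 obtains M C where "C \<ge> 0" "\<And>i z. (1 + norm (fst z)) ^ N * norm (f i z) \<le> C * (1 + norm (snd z)) ^ M"
proof -
 obtain M C where C: "\<And>i z. (1 + norm (fst z)) ^ N * norm (f i z) \<le> C * (1 + norm (snd z)) ^ M"
  using assms unfolding semirapid_def by blast
 have "(1 + norm (fst z)) ^ N * norm (f i z) \<le> \<bar>C\<bar> * (1 + norm (snd z)) ^ M" for i z
  by (rule order_trans[OF C]) (intro mult_right_mono, auto)
 then show ?thesis using that[of "\<bar>C\<bar>" M] by auto
qed

lemma semirapid_zero: "semirapid (\<lambda>_ _. 0)"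
 unfolding semirapid_def by (auto intro!: exI[of _ 0])

lemma semirapid_add: assumes "semirapid f" "semirapid g" shows "semirapid (\<lambda>i x. f i x + g i x)"
 unfolding semirapid_def
proof
 fix N
 obtain M1 C1 where 1: "C1 \<ge> 0" "\<And>i z. (1 + norm (fst z)) ^ N * norm (f i z) \<le> C1 * (1 + norm (snd z)) ^ M1" using semirapid_D[OF assms(1)] by metis
 obtain M2 C2 where 2: "C2 \<ge> 0" "\<And>i z. (1 + norm (fst z)) ^ N * norm (g i z) \<le> C2 * (1 + norm (snd z)) ^ M2" using semirapid_D[OF assms(2)] by metis
 have "(1 + norm (fst z)) ^ N * norm (f i z + g i z) \<le> (C1 + C2) * (1 + norm (snd z)) ^ max M1 M2" for i z
 proof -
  have "(1 + norm (fst z)) ^ N * norm (f i z + g i z) \<le> (1 + norm (fst z)) ^ N * norm (f i z) + (1 + norm (fst z)) ^ N * norm (g i z)"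
   unfolding distrib_left[symmetric] by (intro mult_left_mono norm_triangle_ineq) auto
  also have "\<dots> \<le> C1 * (1 + norm (snd z)) ^ M1 + C2 * (1 + norm (snd z)) ^ M2" by (intro add_mono 1 2)
  also have "\<dots> \<le> C1 * (1 + norm (snd z)) ^ max M1 M2 + C2 * (1 + norm (snd z)) ^ max M1 M2"
   by (intro add_mono mult_left_mono power_increasing 1 2) auto
  finally show ?thesis by (simp add: algebra_simps)
 qed
 then show "\<exists>M C. \<forall>i z. (1 + norm (fst z)) ^ N * norm (f i z + g i z) \<le> C * (1 + norm (snd z)) ^ M" by blast
qed

lemma norm_pair_weight: "1 + norm (z :: 'a::real_normed_vector \<times> 'a) \<le> (1 + norm (fst z)) * (1 + norm (snd z))"
proof -
 have "norm z \<le> norm (fst z) + norm (snd z)" using norm_Pair_le[of "fst z" "snd z"] by simp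
 moreover have "0 \<le> norm (fst z) * norm (snd z)" by simp
 ultimately have "1 + norm z \<le> 1 + norm (fst z) + norm (snd z) + norm (fst z) * norm (snd z)" by linarith
 then show ?thesis by (simp add: algebra_simps)
qed

lemma semirapid_vrapid_mult:
 assumes "semirapid f" "vrapid g" shows "rapid (\<lambda>i z. f i z * g i z)"
 unfolding rapid_def
proof
 fix N
 obtain M C where 1: "C \<ge> 0" "\<And>i z. (1 + norm (fst z)) ^ N * norm (f i z) \<le> C * (1 + norm (snd z)) ^ M" using semirapid_D[OF assms(1)] by metis
 obtain C2 where 2: "\<And>i z. (1 + norm (snd z)) ^ (M + N) * norm (g i z) \<le> C2" using assms(2) unfolding vrapid_def by metis
 have "(1 + norm z) ^ N * norm (f i z * g i z) \<le> C * C2" for i z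
 proof -
  have "(1 + norm z) ^ N * norm (f i z * g i z) \<le> ((1 + norm (fst z)) * (1 + norm (snd z))) ^ N * norm (f i z * g i z)"
   by (intro mult_right_mono power_mono norm_pair_weight) auto
  also have "\<dots> = ((1 + norm (fst z)) ^ N * norm (f i z)) * ((1 + norm (snd z)) ^ N * norm (g i z))"
   by (simp only: power_mult_distrib norm_mult mult_ac)
  also have "\<dots> \<le> (C * (1 + norm (snd z)) ^ M) * ((1 + norm (snd z)) ^ N * norm (g i z))"
   by (intro mult_right_mono 1) auto
  also have "\<dots> = C * ((1 + norm (snd z)) ^ (M + N) * norm (g i z))" by (simp only: power_add mult_ac)
  also have "\<dots> \<le> C * C2" by (intro mult_left_mono 1 2)
  finally show ?thesis .
 qed
 then show "\<exists>C. \<forall>i z. (1 + norm z) ^ N * norm (f i z * g i z) \<le> C" by blast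
qed

lemma transport_weight:
 fixes x v :: "'a::real_normed_vector"
 shows "1 + norm x \<le> (1 + \<bar>s\<bar>) * (1 + norm (x + s *\<^sub>R v)) * (1 + norm v)"
proof -
 have "norm x \<le> norm (x + s *\<^sub>R v) + \<bar>s\<bar> * norm v"
  using norm_triangle_ineq4[of "x + s *\<^sub>R v" "s *\<^sub>R v"] by simp
 then have "1 + norm x \<le> (1 + norm (x + s *\<^sub>R v)) + \<bar>s\<bar> * norm v" by simp
 also have "\<dots> \<le> (1 + norm (x + s *\<^sub>R v)) + (1 + norm (x + s *\<^sub>R v)) * (\<bar>s\<bar> * norm v)"
  by (intro add_left_mono) (simp add: mult_le_cancel_right1 algebra_simps)
 also have "\<dots> = (1 + norm (x + s *\<^sub>R v)) * (1 + \<bar>s\<bar> * norm v)" by (simp add: algebra_simps)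
 also have "\<dots> \<le> (1 + norm (x + s *\<^sub>R v)) * ((1 + \<bar>s\<bar>) * (1 + norm v))"
  by (intro mult_left_mono) (auto simp: algebra_simps)
 finally show ?thesis by (simp add: mult_ac)
qed

lemma rapid_transport_bound:
 assumes "rapid (f :: 'i \<Rightarrow> 'a::real_normed_vector \<Rightarrow> complex)"
 shows "\<exists>C. \<forall>i s z. \<bar>s\<bar> \<le> S \<longrightarrow> (1 + norm (fst z)) ^ N * norm (f i (fst z + s *\<^sub>R snd z)) \<le> C * (1 + norm (snd z)) ^ N"
proof -
 obtain C where C: "\<And>i x. (1 + norm x) ^ N * norm (f i x) \<le> C" using rapidD[OF assms] by metis
 have "(1 + norm x) ^ N * norm (f i (x + s *\<^sub>R v)) \<le> (1 + \<bar>S\<bar>) ^ N * C * (1 + norm v) ^ N" if "\<bar>s\<bar> \<le> S" for i s x v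
 proof -
  have "1 + norm x \<le> (1 + \<bar>s\<bar>) * (1 + norm (x + s *\<^sub>R v)) * (1 + norm v)" by (rule transport_weight)
  also have "\<dots> \<le> (1 + \<bar>S\<bar>) * (1 + norm (x + s *\<^sub>R v)) * (1 + norm v)" using that by (intro mult_right_mono) auto
  finally have "(1 + norm x) ^ N * norm (f i (x + s *\<^sub>R v)) \<le> ((1 + \<bar>S\<bar>) * (1 + norm (x + s *\<^sub>R v)) * (1 + norm v)) ^ N * norm (f i (x + s *\<^sub>R v))"
   by (intro mult_right_mono power_mono) auto
  also have "\<dots> = (1 + \<bar>S\<bar>) ^ N * ((1 + norm (x + s *\<^sub>R v)) ^ N * norm (f i (x + s *\<^sub>R v))) * (1 + norm v) ^ N"
   by (simp only: power_mult_distrib mult_ac)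
  also have "\<dots> \<le> (1 + \<bar>S\<bar>) ^ N * C * (1 + norm v) ^ N" by (intro mult_right_mono mult_left_mono C) auto
  finally show ?thesis .
 qed
 then show ?thesis by (metis prod.collapse)
qed

text \<open>The test function transported along characteristics, with a cutoff in velocity at scale \<open>r\<close>; \<open>Jtest\<close> is its
integral in time. In \<open>Aint\<close> the power \<open>s\<^sup>m\<close> is there because each derivative in \<open>v\<close> produces a factor \<open>s\<close>.\<close>

definition Htest :: "('a::euclidean_space \<Rightarrow> complex) \<Rightarrow> real \<Rightarrow> real \<Rightarrow> ('a \<Rightarrow> complex) \<Rightarrow> 'a \<times> 'a \<Rightarrow> complex" where
 "Htest \<kappa> t r a z = a (fst z + t *\<^sub>R snd z) * \<kappa> (snd z /\<^sub>R r)"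

definition Aint :: "real \<Rightarrow> real \<Rightarrow> nat \<Rightarrow> ('a::euclidean_space \<Rightarrow> complex) \<Rightarrow> 'a \<times> 'a \<Rightarrow> complex" where
 "Aint t1 t2 m a z = (LIN s. indicator {t1..t2} s *\<^sub>R (s ^ m *\<^sub>R a (fst z + s *\<^sub>R snd z)))"

definition Jtest :: "('a::euclidean_space \<Rightarrow> complex) \<Rightarrow> real \<Rightarrow> real \<Rightarrow> real \<Rightarrow> ('a \<Rightarrow> complex) \<Rightarrow> 'a \<times> 'a \<Rightarrow> complex" where
 "Jtest \<kappa> t1 t2 r a z = Aint t1 t2 0 a z * \<kappa> (snd z /\<^sub>R r)"

lemma dcl_chi:
 fixes \<kappa> :: "'a::euclidean_space \<Rightarrow> complex"
 assumes \<kappa>: "schwartz \<kappa>" and r: "r > 0"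
 shows "dcl vrapid n (\<lambda>_::unit. \<lambda>z :: 'a \<times> 'a. \<kappa> (snd z /\<^sub>R r))"
proof -
 have s: "schwartz (\<lambda>v. \<kappa> (v /\<^sub>R r))" using schwartz_scale_shift[OF \<kappa>, of "inverse r" 0] r by simp
 have "dcl vrapid n (\<lambda>_::unit. \<lambda>z :: 'a \<times> 'a. (\<lambda>v. \<kappa> (v /\<^sub>R r)) (0 + snd z))"
 proof (rule dcl_affine[of snd rapid vrapid, OF bounded_linear_snd _ _ _ _ schwartzD[OF s]])
  show "vrapid (\<lambda>i x. f i (0 + snd x))" if "rapid f" for f :: "unit \<Rightarrow> 'a \<Rightarrow> complex"
   using that unfolding rapid_def vrapid_def by simp
  show "vrapid (\<lambda>(_::unit) (_::'a \<times> 'a). 0)" unfolding vrapid_def by auto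
  show "vrapid (\<lambda>i x. f i x + g i x)" if "vrapid f" "vrapid g" for f g :: "unit \<Rightarrow> 'a \<times> 'a \<Rightarrow> complex"
   unfolding vrapid_def
  proof
   fix N
   obtain C1 C2 where C: "\<And>i z. (1 + norm (snd z)) ^ N * norm (f i z) \<le> C1" "\<And>i z. (1 + norm (snd z)) ^ N * norm (g i z) \<le> C2"
    using \<open>vrapid f\<close> \<open>vrapid g\<close> unfolding vrapid_def by metis
   have "(1 + norm (snd z)) ^ N * norm (f i z + g i z) \<le> C1 + C2" for i z
   proof -
    have "(1 + norm (snd z)) ^ N * norm (f i z + g i z) \<le> (1 + norm (snd z)) ^ N * norm (f i z) + (1 + norm (snd z)) ^ N * norm (g i z)"
     unfolding distrib_left[symmetric] by (intro mult_left_mono norm_triangle_ineq) auto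
    also have "\<dots> \<le> C1 + C2" by (intro add_mono C)
    finally show ?thesis .
   qed
   then show "\<exists>C. \<forall>i z. (1 + norm (snd z)) ^ N * norm (f i z + g i z) \<le> C" by blast
  qed
  show "vrapid (\<lambda>i x. c *\<^sub>R f i x)" if "vrapid f" for f :: "unit \<Rightarrow> 'a \<times> 'a \<Rightarrow> complex" and c
   unfolding vrapid_def
  proof
   fix N
   obtain C where C: "\<And>i z. (1 + norm (snd z)) ^ N * norm (f i z) \<le> C" using \<open>vrapid f\<close> unfolding vrapid_def by metis
   have "(1 + norm (snd z)) ^ N * norm (c *\<^sub>R f i z) \<le> \<bar>c\<bar> * C" for i z
    using mult_left_mono[OF C[of z i], of "\<bar>c\<bar>"] by (simp add: mult_ac)
   then show "\<exists>C. \<forall>i z. (1 + norm (snd z)) ^ N * norm (c *\<^sub>R f i z) \<le> C" by blast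
  qed
 qed
 then show ?thesis by simp
qed

lemma semirapid_scaleR:
 assumes "semirapid f" shows "semirapid (\<lambda>i x. (c::real) *\<^sub>R f i x)"
 unfolding semirapid_def
proof
 fix N
 obtain M C where 1: "C \<ge> 0" "\<And>i z. (1 + norm (fst z)) ^ N * norm (f i z) \<le> C * (1 + norm (snd z)) ^ M" using semirapid_D[OF assms] by metis
 have "(1 + norm (fst z)) ^ N * norm (c *\<^sub>R f i z) \<le> (\<bar>c\<bar> * C) * (1 + norm (snd z)) ^ M" for i z
  using mult_left_mono[OF 1(2)[of z i], of "\<bar>c\<bar>"] by (simp add: mult_ac)
 then show "\<exists>M C. \<forall>i z. (1 + norm (fst z)) ^ N * norm (c *\<^sub>R f i z) \<le> C * (1 + norm (snd z)) ^ M" by blast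
qed

lemma dcl_transport:
 fixes a :: "'a::euclidean_space \<Rightarrow> complex"
 assumes a: "schwartz a" shows "dcl semirapid n (\<lambda>_::unit. \<lambda>z. a (fst z + t *\<^sub>R snd z))"
proof -
 have L: "bounded_linear (\<lambda>z :: 'a \<times> 'a. fst z + t *\<^sub>R snd z)"
  by (intro bounded_linear_intros)
 have "dcl semirapid n (\<lambda>_::unit. \<lambda>z. a (0 + (fst z + t *\<^sub>R snd z)))"
 proof (rule dcl_affine[of _ rapid semirapid, OF L _ semirapid_zero semirapid_add semirapid_scaleR schwartzD[OF a]])
  show "semirapid (\<lambda>i x. f i (0 + (fst x + t *\<^sub>R snd x)))" if f: "rapid f" for f :: "unit \<Rightarrow> 'a \<Rightarrow> complex"
   unfolding semirapid_def
  proof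
   fix N
   obtain C where "\<forall>i s z. \<bar>s\<bar> \<le> \<bar>t\<bar> \<longrightarrow> (1 + norm (fst z)) ^ N * norm (f i (fst z + s *\<^sub>R snd z)) \<le> C * (1 + norm (snd z)) ^ N"
    using rapid_transport_bound[OF f, of "\<bar>t\<bar>" N] by blast
   then show "\<exists>M C. \<forall>i z. (1 + norm (fst z)) ^ N * norm (f i (0 + (fst z + t *\<^sub>R snd z))) \<le> C * (1 + norm (snd z)) ^ M"
    by (intro exI[of _ N] exI[of _ C]) auto
  qed
 qed auto
 then show ?thesis by simp
qed

lemma schwartz_Htest:
 assumes "schwartz \<kappa>" "r > 0" "schwartz a" shows "schwartz (Htest \<kappa> t r a)"
 unfolding Htest_def[abs_def]
 by (rule schwartzI, rule dcl_mult[of semirapid vrapid rapid])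
  (use assms in \<open>auto intro: semirapid_vrapid_mult rapid_add dcl_transport dcl_chi\<close>)

lemma Aint_props:
 fixes a :: "'a::euclidean_space \<Rightarrow> complex"
 assumes a: "schwartz a"
 shows Aint_integrable: "integrable lborel (\<lambda>s. indicator {t1..t2} s *\<^sub>R (s ^ m *\<^sub>R a (fst z + s *\<^sub>R snd z)))"
  and Aint_differentiable: "Aint t1 t2 m a differentiable (at z)"
  and Aint_dir_deriv_fst: "b \<in> Basis \<Longrightarrow> dir_deriv (b, 0) (Aint t1 t2 m a) z = Aint t1 t2 m (dir_deriv b a) z"
  and Aint_dir_deriv_snd: "b \<in> Basis \<Longrightarrow> dir_deriv (0, b) (Aint t1 t2 m a) z = Aint t1 t2 (Suc m) (dir_deriv b a) z"
  and Aint_semirapid: "semirapid (\<lambda>_::unit. Aint t1 t2 m a)"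
proof -
 define S where "S = max \<bar>t1\<bar> \<bar>t2\<bar>"
 have S: "S \<ge> 0" "\<And>s. s \<in> {t1..t2} \<Longrightarrow> \<bar>s\<bar> \<le> S" by (auto simp: S_def)
 have int_const: "integrable lborel (\<lambda>s. indicator {t1..t2} s * (K::real))" for K
  by (intro integrable_mult_left integrable_real_indicator) (auto simp: emeasure_lborel_Icc_eq)
 have gen: "integrable lborel (\<lambda>s. indicator {t1..t2} s *\<^sub>R (s ^ m *\<^sub>R a (fst z + s *\<^sub>R snd z)))"
  if a: "schwartz a" for a :: "'a \<Rightarrow> complex" and m and z
 proof -
  obtain C where C: "C > 0" "\<And>x. norm (a x) \<le> C" using schwartz_bounded[OF a] by metis
  note [measurable] = schwartz_measurable[OF a]
  show ?thesis
  proof (rule integrable_dominated[OF int_const[of "S ^ m * C"]])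
   show "AE s in lborel. norm (indicator {t1..t2} s *\<^sub>R (s ^ m *\<^sub>R a (fst z + s *\<^sub>R snd z))) \<le> norm (indicator {t1..t2} s * (S ^ m * C))"
   proof (rule AE_I2)
    fix s
    have "\<bar>s\<bar> ^ m * norm (a (fst z + s *\<^sub>R snd z)) \<le> S ^ m * C" if "s \<in> {t1..t2}"
     by (intro mult_mono power_mono S that C) (use S in auto)
    then show "norm (indicator {t1..t2} s *\<^sub>R (s ^ m *\<^sub>R a (fst z + s *\<^sub>R snd z))) \<le> norm (indicator {t1..t2} s * (S ^ m * C))"
     using order_trans[OF _ abs_ge_self[of "S ^ m * C"]] by (simp add: indicator_def power_abs)
   qed
  qed measurable
 qed
 show "integrable lborel (\<lambda>s. indicator {t1..t2} s *\<^sub>R (s ^ m *\<^sub>R a (fst z + s *\<^sub>R snd z)))" by (rule gen[OF a])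
 let ?g = "\<lambda>z s. indicator {t1..t2} s *\<^sub>R (s ^ m *\<^sub>R a (fst z + s *\<^sub>R snd z))"
 have hd: "((\<lambda>z. ?g z s) has_derivative (\<lambda>h. indicator {t1..t2} s *\<^sub>R (s ^ m *\<^sub>R dir_deriv (fst h + s *\<^sub>R snd h) a (fst z + s *\<^sub>R snd z)))) (at z)" for z s
 proof (intro has_derivative_scaleR_right)
  have l: "((\<lambda>z :: 'a \<times> 'a. fst z + s *\<^sub>R snd z) has_derivative (\<lambda>h. fst h + s *\<^sub>R snd h)) (at z)"
   by (intro derivative_intros)
  show "((\<lambda>z. a (fst z + s *\<^sub>R snd z)) has_derivative (\<lambda>h. dir_deriv (fst h + s *\<^sub>R snd h) a (fst z + s *\<^sub>R snd z))) (at z)"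
   by (rule has_derivative_compose[OF l has_dir_deriv[OF schwartz_differentiable[OF a]]])
 qed
 have lin: "linear (\<lambda>h. dir_deriv h a x)" for x
  by (rule has_derivative_linear[OF has_dir_deriv[OF schwartz_differentiable[OF a]]])
 have d1: "dir_deriv (b, 0) (\<lambda>z. ?g z s) z = indicator {t1..t2} s *\<^sub>R (s ^ m *\<^sub>R dir_deriv b a (fst z + s *\<^sub>R snd z))" for b s z
  using dir_deriv_eqI[OF hd, of "(b, 0)"] by simp
 have d2: "dir_deriv (0, b) (\<lambda>z. ?g z s) z = indicator {t1..t2} s *\<^sub>R (s ^ Suc m *\<^sub>R dir_deriv b a (fst z + s *\<^sub>R snd z))" for b s z
  using dir_deriv_eqI[OF hd, of "(0, b)"] linear_scale[OF lin] by (simp add: mult.commute)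
 have "\<exists>C>0. \<forall>x. norm (dir_deriv b a x) \<le> C" if "b \<in> Basis" for b
  using schwartz_bounded[OF schwartz_dir_deriv[OF a that]] by metis
 then obtain C where C: "\<And>b. b \<in> Basis \<Longrightarrow> C b > 0" "\<And>b x. b \<in> Basis \<Longrightarrow> norm (dir_deriv b a x) \<le> C b" by metis
 define K where "K = (S ^ m + S ^ Suc m) * (\<Sum>b\<in>Basis. C b)"
 have Cs: "norm (dir_deriv b a x) \<le> (\<Sum>b\<in>Basis. C b)" if "b \<in> Basis" for b x
  by (rule order_trans[OF C(2)[OF that]]) (rule member_le_sum, use that C(1)[THEN less_imp_le] in auto)
 have Bd: "norm (dir_deriv c (\<lambda>z. ?g z s) z) \<le> indicator {t1..t2} s * K" if c: "c \<in> Basis" for c s z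
 proof -
  have nn: "0 \<le> (\<Sum>b\<in>Basis. C b)" using C(1)[THEN less_imp_le] by (intro sum_nonneg)
  consider b where "c = (b, 0)" "b \<in> Basis" | b where "c = (0, b)" "b \<in> Basis" using c by (auto simp: Basis_prod_def)
  then show ?thesis
  proof cases
   case 1
   have "\<bar>s\<bar> ^ m * norm (dir_deriv b a (fst z + s *\<^sub>R snd z)) \<le> K" if "s \<in> {t1..t2}"
    unfolding K_def by (intro mult_mono Cs 1 order_trans[OF power_mono[OF S(2)[OF that]]]) (use S nn in auto)
   then show ?thesis unfolding 1 d1 by (auto simp: indicator_def power_abs)
  next
   case 2
   have "\<bar>s\<bar> ^ Suc m * norm (dir_deriv b a (fst z + s *\<^sub>R snd z)) \<le> K" if "s \<in> {t1..t2}"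
    unfolding K_def by (intro mult_mono Cs 2 order_trans[OF power_mono[OF S(2)[OF that]]]) (use S nn in auto)
   then show ?thesis unfolding 2 d2 by (auto simp: indicator_def power_abs abs_mult)
  qed
 qed
 note H = has_derivative_integral[where S=UNIV and M=lborel and g="?g" and B="\<lambda>s. indicator {t1..t2} s * K" and ?z0.0=z,
   OF open_UNIV convex_UNIV UNIV_I gen[OF a] differentiableI[OF hd] Bd int_const]
 have Ae: "Aint t1 t2 m a = (\<lambda>z. LIN s. ?g z s)" by (simp add: Aint_def fun_eq_iff)
 show "Aint t1 t2 m a differentiable (at z)" unfolding Ae using differentiableI[OF H(1)] by simp
 show "dir_deriv (b, 0) (Aint t1 t2 m a) z = Aint t1 t2 m (dir_deriv b a) z" if "b \<in> Basis"
  unfolding Ae using H(2)[of "(b, 0)"] that unfolding d1 by (simp add: Aint_def Basis_prod_def)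
 show "dir_deriv (0, b) (Aint t1 t2 m a) z = Aint t1 t2 (Suc m) (dir_deriv b a) z" if "b \<in> Basis"
  unfolding Ae using H(2)[of "(0, b)"] that unfolding d2 by (simp add: Aint_def Basis_prod_def)
 show "semirapid (\<lambda>_::unit. Aint t1 t2 m a)"
  unfolding semirapid_def
 proof
  fix N
  have "rapid (\<lambda>_::unit. a)" using schwartzD[OF a, of 0] by simp
  then obtain C where C: "\<And>s z. \<bar>s\<bar> \<le> S \<Longrightarrow> (1 + norm (fst z)) ^ N * norm (a (fst z + s *\<^sub>R snd z)) \<le> C * (1 + norm (snd z)) ^ N"
   using rapid_transport_bound[of "\<lambda>_::unit. a" S N] by auto
  define D where "D = (LIN s. indicator {t1..t2} s * (1::real)) * (S ^ m * \<bar>C\<bar>)"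
  have "(1 + norm (fst z)) ^ N * norm (Aint t1 t2 m a z) \<le> D * (1 + norm (snd z)) ^ N" for z
  proof -
   have le: "norm (?g z s) \<le> indicator {t1..t2} s * (S ^ m * \<bar>C\<bar> * (1 + norm (snd z)) ^ N / (1 + norm (fst z)) ^ N)" for s
   proof (cases "s \<in> {t1..t2}")
    case True
    have p: "(1 + norm (fst z)) ^ N > 0" by (simp add: add_pos_nonneg)
    have "(1 + norm (fst z)) ^ N * norm (a (fst z + s *\<^sub>R snd z)) \<le> C * (1 + norm (snd z)) ^ N" by (rule C[OF S(2)[OF True]])
    also have "\<dots> \<le> \<bar>C\<bar> * (1 + norm (snd z)) ^ N" by (intro mult_right_mono) auto
    finally have "norm (a (fst z + s *\<^sub>R snd z)) \<le> \<bar>C\<bar> * (1 + norm (snd z)) ^ N / (1 + norm (fst z)) ^ N"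
     using p by (simp add: pos_le_divide_eq mult.commute)
    then have "\<bar>s\<bar> ^ m * norm (a (fst z + s *\<^sub>R snd z)) \<le> S ^ m * (\<bar>C\<bar> * (1 + norm (snd z)) ^ N / (1 + norm (fst z)) ^ N)"
     by (intro mult_mono power_mono S(2)[OF True]) (use S in auto)
    then show ?thesis using True by (simp add: power_abs mult.assoc)
   qed simp
   have "norm (Aint t1 t2 m a z) \<le> (LIN s. indicator {t1..t2} s * (S ^ m * \<bar>C\<bar> * (1 + norm (snd z)) ^ N / (1 + norm (fst z)) ^ N))"
    unfolding Aint_def by (intro order_trans[OF integral_norm_bound] integral_mono integrable_norm gen[OF a] int_const le)
   also have "\<dots> = D * (1 + norm (snd z)) ^ N / (1 + norm (fst z)) ^ N"
    unfolding D_def by simp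
   finally show ?thesis by (simp add: pos_le_divide_eq add_pos_nonneg mult.commute)
  qed
  then show "\<exists>M C. \<forall>(i::unit) z. (1 + norm (fst z)) ^ N * norm (Aint t1 t2 m a z) \<le> C * (1 + norm (snd z)) ^ M" by blast
 qed
qed

lemma dcl_Aint:
 fixes a :: "'a::euclidean_space \<Rightarrow> complex"
 assumes "schwartz a" shows "dcl semirapid n (\<lambda>_::unit. Aint t1 t2 m a)"
 using assms
proof (induction n arbitrary: a m)
 case 0 then show ?case by (simp add: Aint_semirapid)
next
 case (Suc n)
 have "dcl semirapid n (\<lambda>i::unit. dir_deriv c (Aint t1 t2 m a))" if c: "c \<in> Basis" for c
 proof -
  consider b where "c = (b, 0)" "b \<in> Basis" | b where "c = (0, b)" "b \<in> Basis" using c by (auto simp: Basis_prod_def)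
  then show ?thesis
  proof cases
   case 1
   then have "dir_deriv c (Aint t1 t2 m a) = Aint t1 t2 m (dir_deriv b a)" using Aint_dir_deriv_fst[OF Suc.prems] by (simp add: fun_eq_iff)
   then show ?thesis using Suc.IH[OF schwartz_dir_deriv[OF Suc.prems 1(2)]] by simp
  next
   case 2
   then have "dir_deriv c (Aint t1 t2 m a) = Aint t1 t2 (Suc m) (dir_deriv b a)" using Aint_dir_deriv_snd[OF Suc.prems] by (simp add: fun_eq_iff)
   then show ?thesis using Suc.IH[OF schwartz_dir_deriv[OF Suc.prems 2(2)]] by simp
  qed
 qed
 then show ?case using Aint_semirapid[OF Suc.prems] Aint_differentiable[OF Suc.prems] by simp
qed

lemma schwartz_Jtest:
 assumes "schwartz \<kappa>" "r > 0" "schwartz a" shows "schwartz (Jtest \<kappa> t1 t2 r a)"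
 unfolding Jtest_def[abs_def]
 by (rule schwartzI, rule dcl_mult[of semirapid vrapid rapid])
  (use assms in \<open>auto intro: semirapid_vrapid_mult rapid_add dcl_Aint dcl_chi\<close>)

definition xgrad :: "('a::euclidean_space \<times> 'a \<Rightarrow> complex) \<Rightarrow> 'a \<times> 'a \<Rightarrow> complex" where
 "xgrad h z = (\<Sum>b\<in>Basis. (snd z \<bullet> b) *\<^sub>R dir_deriv (b, 0) h z)"

text \<open>Along characteristics \<open>v \<cdot> \<nabla>\<^sub>x\<close> is the derivative in time, so the fundamental theorem of calculus applies. Testing the
equation with \<open>Jtest\<close> therefore yields Duhamel's formula.\<close>

lemma xgrad_Jtest:
 fixes \<kappa> a :: "'a::euclidean_space \<Rightarrow> complex"
 assumes \<kappa>: "schwartz \<kappa>" and r: "r > 0" and a: "schwartz a" and t: "t1 \<le> t2"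
 shows "xgrad (Jtest \<kappa> t1 t2 r a) z = Htest \<kappa> t2 r a z - Htest \<kappa> t1 r a z"
proof -
 let ?T = "\<lambda>b s. indicator {t1..t2} s *\<^sub>R (s ^ 0 *\<^sub>R dir_deriv b a (fst z + s *\<^sub>R snd z))"
 have dX: "((\<lambda>z :: 'a \<times> 'a. \<kappa> (snd z /\<^sub>R r)) has_derivative (\<lambda>h. dir_deriv (snd h /\<^sub>R r) \<kappa> (snd z /\<^sub>R r))) (at z)" for z
  by (rule has_derivative_compose[OF _ has_dir_deriv[OF schwartz_differentiable[OF \<kappa>]]])
   (intro derivative_intros)
 have z0: "dir_deriv 0 \<kappa> x = 0" for x
  using linear_0[OF has_derivative_linear[OF has_dir_deriv[OF schwartz_differentiable[OF \<kappa>]]]] .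
 have "dir_deriv (b, 0) (Jtest \<kappa> t1 t2 r a) z = Aint t1 t2 0 (dir_deriv b a) z * \<kappa> (snd z /\<^sub>R r)" if "b \<in> Basis" for b
  unfolding Jtest_def
  by (subst dir_deriv_eqI[OF has_derivative_mult[OF has_dir_deriv[OF Aint_differentiable[OF a]] dX]])
   (simp add: z0 Aint_dir_deriv_fst[OF a that])
 then have "xgrad (Jtest \<kappa> t1 t2 r a) z = (\<Sum>b\<in>Basis. (snd z \<bullet> b) *\<^sub>R Aint t1 t2 0 (dir_deriv b a) z) * \<kappa> (snd z /\<^sub>R r)"
  unfolding xgrad_def sum_distrib_right by (intro sum.cong) auto
 also have "(\<Sum>b\<in>Basis. (snd z \<bullet> b) *\<^sub>R Aint t1 t2 0 (dir_deriv b a) z) = 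
  (LIN s. (\<Sum>b\<in>Basis. (snd z \<bullet> b) *\<^sub>R (?T b s)))"
 proof -
  have i: "integrable lborel (\<lambda>s. (snd z \<bullet> b) *\<^sub>R (?T b s))" if "b \<in> Basis" for b
   by (intro integrable_scaleR_right Aint_integrable schwartz_dir_deriv a that)
  have "(\<Sum>b\<in>Basis. (snd z \<bullet> b) *\<^sub>R Aint t1 t2 0 (dir_deriv b a) z) = 
   (\<Sum>b\<in>Basis. LIN s. (snd z \<bullet> b) *\<^sub>R (?T b s))"
   unfolding Aint_def by (intro sum.cong refl integral_scaleR_right[symmetric] Aint_integrable schwartz_dir_deriv a)
  also have "\<dots> = (LIN s. (\<Sum>b\<in>Basis. (snd z \<bullet> b) *\<^sub>R (?T b s)))"
   by (rule Bochner_Integration.integral_sum[symmetric]) (rule i)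
  finally show ?thesis .
 qed
 also have "\<dots> = (LIN s. indicator {t1..t2} s *\<^sub>R dir_deriv (snd z) a (fst z + s *\<^sub>R snd z))"
 proof (intro Bochner_Integration.integral_cong refl)
  fix s
  show "(\<Sum>b\<in>Basis. (snd z \<bullet> b) *\<^sub>R (?T b s)) = indicator {t1..t2} s *\<^sub>R dir_deriv (snd z) a (fst z + s *\<^sub>R snd z)"
   unfolding dir_deriv_sum_Basis[OF schwartz_differentiable[OF a], of "snd z"] scaleR_sum_right by (simp add: mult.commute)
 qed
 also have "\<dots> = a (fst z + t2 *\<^sub>R snd z) - a (fst z + t1 *\<^sub>R snd z)"
 proof (rule integral_FTC_Icc[OF t])
  fix s
  have l: "((\<lambda>s. fst z + s *\<^sub>R snd z) has_derivative (\<lambda>h. h *\<^sub>R snd z)) (at s within {t1..t2})"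
   by (auto intro!: derivative_eq_intros)
  have "((\<lambda>s. a (fst z + s *\<^sub>R snd z)) has_derivative (\<lambda>h. dir_deriv (h *\<^sub>R snd z) a (fst z + s *\<^sub>R snd z))) (at s within {t1..t2})"
   by (rule has_derivative_compose[OF l has_dir_deriv[OF schwartz_differentiable[OF a]]])
  then show "((\<lambda>s. a (fst z + s *\<^sub>R snd z)) has_vector_derivative dir_deriv (snd z) a (fst z + s *\<^sub>R snd z)) (at s within {t1..t2})"
   unfolding has_vector_derivative_def
   using linear_scale[OF has_derivative_linear[OF has_dir_deriv[OF schwartz_differentiable[OF a]]]] by simp
 next
  show "continuous_on {t1..t2} (\<lambda>s. dir_deriv (snd z) a (fst z + s *\<^sub>R snd z))"
   unfolding dir_deriv_sum_Basis[OF schwartz_differentiable[OF a], of "snd z"]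
   by (intro continuous_intros continuous_on_compose2[OF schwartz_continuous[OF schwartz_dir_deriv[OF a], of _ UNIV]]) auto
 qed
 finally show ?thesis by (simp add: Htest_def left_diff_distrib)
qed

section \<open>The transport equation against Schwartz functions\<close>

text \<open>Bounded families vanishing on balls of radius \<open>\<rho> i\<close>: the error \<open>Psi (z / R) - 1\<close> of a cutoff at radius \<open>R\<close>.\<close>

definition cutb :: "('i \<Rightarrow> 'e::real_normed_vector \<Rightarrow> complex) \<Rightarrow> ('i \<Rightarrow> real) \<Rightarrow> bool" where
 "cutb f \<rho> \<longleftrightarrow> (\<exists>C. \<forall>i z. norm (f i z) \<le> C) \<and> (\<forall>i z. norm z < \<rho> i \<longrightarrow> f i z = 0)"

text \<open>Sequences tending to zero in the Schwartz space, quantified by the rate of the cutoff error below.\<close>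

definition null_rapid :: "(nat \<Rightarrow> 'e::real_normed_vector \<Rightarrow> complex) \<Rightarrow> bool" where
 "null_rapid h \<longleftrightarrow> (\<forall>N. \<exists>C. \<forall>i z. (1 + norm z) ^ N * norm (h i z) \<le> C / real (Suc i))"

lemma null_rapid_add: assumes "null_rapid f" "null_rapid g" shows "null_rapid (\<lambda>i x. f i x + g i x)"
 unfolding null_rapid_def
proof
 fix N
 obtain C1 C2 where C: "\<And>i x. (1 + norm x) ^ N * norm (f i x) \<le> C1 / real (Suc i)" "\<And>i x. (1 + norm x) ^ N * norm (g i x) \<le> C2 / real (Suc i)"
  using assms unfolding null_rapid_def by metis
 have "(1 + norm x) ^ N * norm (f i x + g i x) \<le> (C1 + C2) / real (Suc i)" for i x
 proof -
  have "(1 + norm x) ^ N * norm (f i x + g i x) \<le> (1 + norm x) ^ N * norm (f i x) + (1 + norm x) ^ N * norm (g i x)"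
   unfolding distrib_left[symmetric] by (intro mult_left_mono norm_triangle_ineq) auto
  also have "\<dots> \<le> C1 / real (Suc i) + C2 / real (Suc i)" by (intro add_mono C)
  finally show ?thesis by (simp only: add_divide_distrib)
 qed
 then show "\<exists>C. \<forall>i z. (1 + norm z) ^ N * norm (f i z + g i z) \<le> C / real (Suc i)" by blast
qed

lemma null_rapid_zero: "null_rapid (\<lambda>_ _. 0)"
 unfolding null_rapid_def by (auto intro!: exI[of _ 0])

lemma polyb_null_rapid_mult: assumes "polyb f" "null_rapid g" shows "null_rapid (\<lambda>i x. f i x * g i x)"
 unfolding null_rapid_def
proof
 fix M
 obtain N C where 1: "C \<ge> 0" "\<And>i x. norm (f i x) \<le> C * (1 + norm x) ^ N" using polyb_D[OF assms(1)] by metis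
 obtain C2 where 2: "\<And>i x. (1 + norm x) ^ (M + N) * norm (g i x) \<le> C2 / real (Suc i)" using assms(2) unfolding null_rapid_def by metis
 have "(1 + norm x) ^ M * norm (f i x * g i x) \<le> (C * C2) / real (Suc i)" for i x
 proof -
  have "(1 + norm x) ^ M * norm (f i x * g i x) \<le> (1 + norm x) ^ M * ((C * (1 + norm x) ^ N) * norm (g i x))"
   unfolding norm_mult by (intro mult_left_mono mult_right_mono 1) auto
  also have "\<dots> = C * ((1 + norm x) ^ (M + N) * norm (g i x))" by (simp only: power_add mult_ac)
  also have "\<dots> \<le> C * (C2 / real (Suc i))" by (intro mult_left_mono 1 2)
  finally show ?thesis by simp
 qed
 then show "\<exists>C. \<forall>i z. (1 + norm z) ^ M * norm (f i z * g i z) \<le> C / real (Suc i)" by blast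
qed

lemma cutb_rapid_mult:
 assumes "cutb f (\<lambda>i. real (Suc i) / 2)" "rapid g" shows "null_rapid (\<lambda>i x. f i x * g i x)"
 unfolding null_rapid_def
proof
 fix N
 obtain C where 1: "\<And>i z. norm (f i z) \<le> C" and z: "\<And>i z. norm z < real (Suc i) / 2 \<Longrightarrow> f i z = 0"
  using assms(1) unfolding cutb_def by blast
 have C0: "0 \<le> C" using 1[of 0 undefined] norm_ge_zero order_trans by blast
 obtain C2 where 2: "\<And>i x. (1 + norm x) ^ Suc N * norm (g i x) \<le> C2" using rapidD[OF assms(2)] by metis
 have "(1 + norm x) ^ N * norm (f i x * g i x) \<le> (2 * C * C2) / real (Suc i)" for i x
 proof (cases "norm x < real (Suc i) / 2")
  case True
  have "0 \<le> C2" using order_trans[OF norm_ge_zero 2[of 0 i, simplified]] .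
  then show ?thesis using z[OF True] C0 by simp
 next
  case False
  then have i: "real (Suc i) \<le> 2 * (1 + norm x)" by simp
  have "real (Suc i) * ((1 + norm x) ^ N * norm (f i x * g i x)) \<le> 2 * (1 + norm x) * ((1 + norm x) ^ N * (C * norm (g i x)))"
   unfolding norm_mult by (intro mult_mono i mult_left_mono mult_right_mono 1) (use C0 in auto)
  also have "\<dots> = 2 * C * ((1 + norm x) ^ Suc N * norm (g i x))" by simp
  also have "\<dots> \<le> 2 * C * C2" by (intro mult_left_mono 2) (use C0 in auto)
  finally show ?thesis by (simp add: pos_le_divide_eq mult.commute)
 qed
 then show "\<exists>C. \<forall>i z. (1 + norm z) ^ N * norm (f i z * g i z) \<le> C / real (Suc i)" by blast
qed

lemma dcl_reindex:
 assumes W: "\<And>f. W f \<Longrightarrow> W' (\<lambda>i. f (r i))" shows "dcl W n f \<Longrightarrow> dcl W' n (\<lambda>i. f (r i))"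
proof (induction n arbitrary: f)
 case (Suc n)
 then show ?case using W by auto (use Suc.IH[of "\<lambda>i. dir_deriv _ (f i)"] in blast)
qed (simp add: W)

lemma dcl_vanish:
 fixes f :: "'i \<Rightarrow> 'e::euclidean_space \<Rightarrow> complex"
 assumes "dcl W n f" "\<And>i z. norm z < \<rho> i \<Longrightarrow> f i z = 0"
 shows "dcl (\<lambda>f. W f \<and> (\<forall>i z. norm z < \<rho> i \<longrightarrow> f i z = 0)) n f"
 using assms
proof (induction n arbitrary: f)
 case (Suc n)
 have "dir_deriv b (f i) x = 0" if x: "norm x < \<rho> i" for b i x
 proof -
  have "((\<lambda>x. 0) has_derivative (\<lambda>_. 0)) (at x)" by simp
  then have "(f i has_derivative (\<lambda>_. 0)) (at x)"
  proof (rule has_derivative_transform_within_open[where s="{x. norm x < \<rho> i}"])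
   show "open {x::'e. norm x < \<rho> i}" by (intro open_Collect_less continuous_intros)
  qed (use x Suc.prems in auto)
  then show ?thesis by (rule dir_deriv_eqI)
 qed
 with Suc show ?case by auto
qed auto

lemma cutb_dilate:
 assumes "cutb (\<lambda>_::unit. \<Theta>) (\<lambda>_. 1/2)" "\<And>i. \<bar>c i\<bar> \<le> 1"
 shows "cutb (\<lambda>i z. c i *\<^sub>R \<Theta> (z /\<^sub>R real (Suc i))) (\<lambda>i. real (Suc i) / 2)"
proof -
 obtain C where C: "\<And>z. norm (\<Theta> z) \<le> C" and z: "\<And>z. norm z < 1/2 \<Longrightarrow> \<Theta> z = 0" using assms(1) unfolding cutb_def by auto
 have C0: "0 \<le> C" using C[of 0] norm_ge_zero order_trans by blast
 have "norm (c i *\<^sub>R \<Theta> x) \<le> C" for i x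
  using mult_mono[OF assms(2)[of i] C[of x]] C0 by simp
 moreover have "\<Theta> (x /\<^sub>R real (Suc i)) = 0" if "norm x < real (Suc i) / 2" for x i
  by (rule z) (use that in \<open>simp add: field_simps\<close>)
 ultimately show ?thesis unfolding cutb_def by auto
qed

lemma dcl_dilate:
 fixes \<Theta> :: "'e::euclidean_space \<Rightarrow> complex"
 assumes "dcl cutb' n (\<lambda>_::unit. \<Theta>)" and "\<And>i. \<bar>c i\<bar> \<le> 1"
  and cutb': "cutb' = (\<lambda>f :: unit \<Rightarrow> 'e \<Rightarrow> complex. cutb f (\<lambda>_. 1/2))"
 shows "dcl (\<lambda>f :: nat \<Rightarrow> 'e \<Rightarrow> complex. cutb f (\<lambda>i. real (Suc i) / 2)) n (\<lambda>i z. c i *\<^sub>R \<Theta> (z /\<^sub>R real (Suc i)))"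
 using assms(1,2)
proof (induction n arbitrary: \<Theta> c)
 case (0 \<Theta> c)
 then show ?case unfolding cutb' dcl.simps by (rule cutb_dilate)
next
 case (Suc n \<Theta> c)
 have base: "cutb (\<lambda>i z. c i *\<^sub>R \<Theta> (z /\<^sub>R real (Suc i))) (\<lambda>i. real (Suc i) / 2)"
  using Suc.prems by (intro cutb_dilate) (auto simp: cutb')
 have dT: "\<Theta> differentiable (at x)" for x using Suc.prems(1) by auto
 have hd: "((\<lambda>z. c i *\<^sub>R \<Theta> (z /\<^sub>R real (Suc i))) has_derivative (\<lambda>h. c i *\<^sub>R dir_deriv (h /\<^sub>R real (Suc i)) \<Theta> (z /\<^sub>R real (Suc i)))) (at z)" for i z
  by (intro has_derivative_scaleR_right has_derivative_compose[OF _ has_dir_deriv[OF dT]]) (intro derivative_intros)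
 have dd: "dir_deriv b (\<lambda>z. c i *\<^sub>R \<Theta> (z /\<^sub>R real (Suc i))) = (\<lambda>z. (c i / real (Suc i)) *\<^sub>R dir_deriv b \<Theta> (z /\<^sub>R real (Suc i)))" for b i
 proof
  fix z
  have "dir_deriv (b /\<^sub>R real (Suc i)) \<Theta> (z /\<^sub>R real (Suc i)) = dir_deriv b \<Theta> (z /\<^sub>R real (Suc i)) /\<^sub>R real (Suc i)"
   by (rule linear_scale[OF has_derivative_linear[OF has_dir_deriv[OF dT]]])
  then show "dir_deriv b (\<lambda>z. c i *\<^sub>R \<Theta> (z /\<^sub>R real (Suc i))) z = (c i / real (Suc i)) *\<^sub>R dir_deriv b \<Theta> (z /\<^sub>R real (Suc i))"
   unfolding dir_deriv_eqI[OF hd] by (simp only: scaleR_scaleR divide_inverse)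
 qed
 have "\<bar>c i / real (Suc i)\<bar> \<le> 1" for i
 proof -
  have "\<bar>c i\<bar> / real (Suc i) \<le> 1 / 1" by (intro frac_le Suc.prems) auto
  then show ?thesis by simp
 qed
 then have "dcl (\<lambda>f :: nat \<Rightarrow> 'e \<Rightarrow> complex. cutb f (\<lambda>i. real (Suc i) / 2)) n (\<lambda>i. dir_deriv b (\<lambda>z. c i *\<^sub>R \<Theta> (z /\<^sub>R real (Suc i))))" if "b \<in> Basis" for b
  unfolding dd using that Suc.prems(1) by (intro Suc.IH) auto
 with base hd show ?case unfolding dcl.simps by (auto intro: differentiableI)
qed

lemma schwartz_norm_le:
 fixes h :: "'e::euclidean_space \<Rightarrow> complex"
 assumes "\<And>bs x. bs \<in> lists Basis \<Longrightarrow> length bs \<le> N \<Longrightarrow> (1 + norm x) ^ N * norm (iter_deriv bs h x) \<le> C bs"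
 shows "schwartz_norm N h \<le> (\<Sum>bs | bs \<in> lists (Basis :: 'e set) \<and> length bs \<le> N. C bs)"
 unfolding schwartz_norm_def by (intro sum_mono cSUP_least) (use assms in auto)

lemma finite_multi_indices: "finite {bs. bs \<in> lists (Basis :: 'e::euclidean_space set) \<and> length bs \<le> N}"
 by (rule finite_subset[OF _ finite_lists_length_le[OF finite_Basis, of N]]) (auto simp: in_lists_conv_set)

lemma td_tendsto_zero:
 fixes h :: "nat \<Rightarrow> 'e::euclidean_space \<Rightarrow> complex"
 assumes T: "tempered_distribution T" and h: "\<And>n. dcl null_rapid n h" and s: "\<And>i. schwartz (h i)"
 shows "(\<lambda>i. T (h i)) \<longlonglongrightarrow> 0"
proof -
 obtain N C where NC: "\<And>h. schwartz h \<Longrightarrow> norm (T h) \<le> C * schwartz_norm N h"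
  using T unfolding tempered_distribution_def by blast
 have "\<exists>K. \<forall>i x. (1 + norm x) ^ N * norm (iter_deriv bs (h i) x) \<le> K / real (Suc i)" if that: "bs \<in> lists Basis" for bs
 proof -
  have "\<forall>n. dcl null_rapid n h" using h by blast
  from bspec[OF iffD1[OF dcl_iff this] that] have "null_rapid (\<lambda>i. iter_deriv bs (h i))" by (rule conjunct1)
  then show ?thesis unfolding null_rapid_def by (rule spec)
 qed
 then have "\<forall>bs\<in>lists Basis. \<exists>K. \<forall>i x. (1 + norm x) ^ N * norm (iter_deriv bs (h i) x) \<le> K / real (Suc i)" by (intro ballI)
 from bchoice[OF this] obtain K where "\<forall>bs\<in>lists Basis. \<forall>i x. (1 + norm x) ^ N * norm (iter_deriv bs (h i) x) \<le> K bs / real (Suc i)" ..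
 note K = this[rule_format]
 define D where "D = (\<Sum>bs | bs \<in> lists (Basis :: 'e set) \<and> length bs \<le> N. K bs)"
 have sn: "schwartz_norm N (h i) \<le> D / real (Suc i)" for i
  using schwartz_norm_le[of N "h i" "\<lambda>bs. K bs / real (Suc i)"] K unfolding D_def by (simp add: sum_divide_distrib)
 have sn0: "0 \<le> schwartz_norm N (h i)" for i
  unfolding schwartz_norm_def
 proof (intro sum_nonneg)
  fix bs assume "bs \<in> {bs. bs \<in> lists (Basis :: 'e set) \<and> length bs \<le> N}"
  then have "bdd_above (range (\<lambda>x. (1 + norm x) ^ N * norm (iter_deriv bs (h i) x)))" using K by (intro bdd_aboveI[of _ "K bs / real (Suc i)"]) auto
  then show "0 \<le> (SUP x. (1 + norm x) ^ N * norm (iter_deriv bs (h i) x))"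
   by (rule cSUP_upper2[of _ _ 0]) auto
 qed
 have le: "norm (T (h i)) \<le> \<bar>C\<bar> * D * (1 / real (Suc i))" for i
 proof -
  have "norm (T (h i)) \<le> C * schwartz_norm N (h i)" by (rule NC[OF s])
  also have "\<dots> \<le> \<bar>C\<bar> * schwartz_norm N (h i)" by (intro mult_right_mono sn0) auto
  also have "\<dots> \<le> \<bar>C\<bar> * (D / real (Suc i))" by (intro mult_left_mono sn) auto
  finally show ?thesis by simp
 qed
 have "(\<lambda>i. 1 / real (Suc i)) \<longlonglongrightarrow> 0"
  using LIMSEQ_inverse_real_of_nat by (simp only: inverse_eq_divide)
 from tendsto_mult_left[OF this, of "\<bar>C\<bar> * D"]
 have lim: "(\<lambda>i. \<bar>C\<bar> * D * (1 / real (Suc i))) \<longlonglongrightarrow> 0" by (simp only: mult_zero_right)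
 show ?thesis by (rule Lim_null_comparison[OF always_eventually[OF allI[OF le]] lim])
qed

lemma dcl_xgrad:
 fixes h :: "nat \<Rightarrow> 'a::euclidean_space \<times> 'a \<Rightarrow> complex"
 assumes "dcl null_rapid (Suc n) h" shows "dcl null_rapid n (\<lambda>i. xgrad (h i))"
proof -
 have "dcl null_rapid n (\<lambda>i z. \<Sum>b\<in>Basis. complex_of_real (snd z \<bullet> b) * dir_deriv (b, 0) (h i) z)"
 proof (intro dcl_sum null_rapid_zero null_rapid_add dcl_mult[of polyb null_rapid null_rapid])
  fix b :: 'a assume b: "b \<in> Basis"
  have "dcl polyb n (\<lambda>_::unit. \<lambda>z::'a \<times> 'a. complex_of_real (snd z \<bullet> b))"
   by (rule slowD[OF slow_linear_compose[OF bounded_linear_snd slow_inner]])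
  then show "dcl polyb n (\<lambda>_::nat. \<lambda>z::'a \<times> 'a. complex_of_real (snd z \<bullet> b))"
   by (rule dcl_reindex[where r="\<lambda>_. ()", rotated]) (auto simp: polyb_def)
  show "dcl null_rapid n (\<lambda>i. dir_deriv (b, 0) (h i))"
   using assms b by (auto simp: Basis_prod_def)
 qed (auto intro: polyb_null_rapid_mult)
 then show ?thesis unfolding xgrad_def[abs_def] scaleR_conv_of_real .
qed

lemma schwartz_xgrad: assumes "schwartz h" shows "schwartz (xgrad h)"
proof -
 have "schwartz (\<lambda>z. \<Sum>b\<in>Basis. of_real (snd z \<bullet> b) * dir_deriv (b, 0) h z)"
  by (intro schwartz_sum schwartz_slow_mult slow_linear_compose[OF bounded_linear_snd slow_inner] schwartz_dir_deriv assms)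
   (auto simp: Basis_prod_def)
 then show ?thesis unfolding xgrad_def[abs_def] scaleR_conv_of_real .
qed

context LP begin

text \<open>The equation is known for compactly supported test functions only. Truncating at radius \<open>R\<close> changes a Schwartz
function by an error of size \<open>1 / R\<close> in every seminorm.\<close>

lemma transport_schwartz:
 fixes J :: "'a \<times> 'a \<Rightarrow> complex"
 assumes f: "tempered_distribution f" and g: "tempered_distribution g" and tr: "transport_equation f g" and J: "schwartz J"
 shows "- f (xgrad J) = g J"
proof -
 define E where "E i z = (complex_of_real (Psi (z /\<^sub>R real (Suc i))) - 1) * J z" for i and z :: "'a \<times> 'a"
 define \<Theta> where "\<Theta> z = complex_of_real (Psi z) - 1" for z
 have PsiS: "schwartz (\<lambda>z. complex_of_real (Psi z))" by (rule test_function_schwartz[OF test_Psi])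
 have cT: "dcl (\<lambda>f. cutb f (\<lambda>_. 1/2)) n (\<lambda>_::unit. \<Theta>)" for n
 proof -
  let ?B = "\<lambda>f :: unit \<Rightarrow> 'a \<times> 'a \<Rightarrow> complex. \<exists>C. \<forall>i z. norm (f i z) \<le> C"
  have b1: "dcl ?B n (\<lambda>_::unit. \<lambda>z. complex_of_real (Psi z))"
   by (rule dcl_mono[OF _ schwartzD[OF PsiS]]) (drule rapidD[where N=0], simp)
  have c0: "dcl ?B n (\<lambda>_::unit. \<lambda>z. c)" for c
  proof (induction n arbitrary: c)
   case (Suc n)
   have "dir_deriv b (\<lambda>_. c) = (\<lambda>_. 0)" for b :: "'a \<times> 'a" by (rule ext, rule dir_deriv_eqI) simp
   with Suc[of 0] show ?case by auto
  qed auto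
  have "dcl ?B n (\<lambda>_::unit. \<lambda>z. complex_of_real (Psi z) + (- 1))"
  proof (rule dcl_add[of ?B ?B ?B, OF _ b1 c0])
   fix f g :: "unit \<Rightarrow> 'a \<times> 'a \<Rightarrow> complex" assume "?B f" "?B g"
   then obtain C1 C2 where "\<And>i z. norm (f i z) \<le> C1" "\<And>i z. norm (g i z) \<le> C2" by metis
   then have "norm (f i z + g i z) \<le> C1 + C2" for i z by (intro norm_triangle_le add_mono)
   then show "?B (\<lambda>i x. f i x + g i x)" by blast
  qed
  then have "dcl ?B n (\<lambda>_::unit. \<Theta>)" by (simp add: \<Theta>_def[abs_def])
  moreover have "\<Theta> z = 0" if "norm z < 1/2" for z
  proof -
   have "Psi z = 1" using bump_Psi that unfolding bump_def by blast
   then show ?thesis by (simp add: \<Theta>_def)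
  qed
  ultimately show ?thesis unfolding cutb_def by (rule dcl_vanish)
 qed
 have hs: "schwartz (\<lambda>z. complex_of_real (Psi (z /\<^sub>R real (Suc i))))" for i
  using schwartz_scale_shift[OF PsiS, of "inverse (real (Suc i))" 0] by simp
 have hi: "test_function (\<lambda>z. J z + E i z)" for i
  unfolding test_function_iff_vanish
 proof
  have e: "(\<lambda>z. J z + E i z) = (\<lambda>z. complex_of_real (Psi (z /\<^sub>R real (Suc i))) * J z)"
   by (simp add: E_def fun_eq_iff algebra_simps)
  show "smooth (\<lambda>z. J z + E i z)"
   unfolding e by (intro schwartz_smooth schwartz_slow_mult schwartz_slow hs J)
  show "\<exists>R. \<forall>x. norm x > R \<longrightarrow> J x + E i x = 0"
  proof (rule exI[of _ "2 * real (Suc i)"], safe)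
   fix x :: "'a \<times> 'a" assume "2 * real (Suc i) < norm x"
   then have "norm (x /\<^sub>R real (Suc i)) > 2" by (simp add: field_simps)
   then have "Psi (x /\<^sub>R real (Suc i)) = 0" using bump_Psi unfolding bump_def by blast
   then show "J x + E i x = 0" using fun_cong[OF e, of x] by simp
  qed
 qed
 have ES: "schwartz (E i)" for i
  using schwartz_diff[OF test_function_schwartz[OF hi] J] by (simp add: fun_eq_iff)
 have En: "dcl null_rapid n E" for n
 proof -
  have "dcl (\<lambda>f :: nat \<Rightarrow> 'a \<times> 'a \<Rightarrow> complex. cutb f (\<lambda>i. real (Suc i) / 2)) n (\<lambda>i z. 1 *\<^sub>R \<Theta> (z /\<^sub>R real (Suc i)))"
   by (rule dcl_dilate[OF cT]) auto
  moreover have "dcl rapid n (\<lambda>_::nat. J)"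
   by (rule dcl_reindex[where r="\<lambda>_. ()", OF _ schwartzD[OF J]]) (auto simp: rapid_def)
  ultimately have "dcl null_rapid n (\<lambda>i z. 1 *\<^sub>R \<Theta> (z /\<^sub>R real (Suc i)) * J z)"
   by (rule dcl_mult[rotated 2, where ?W1.0="\<lambda>f. cutb f (\<lambda>i. real (Suc i) / 2)" and ?W2.0=rapid])
    (auto intro: cutb_rapid_mult null_rapid_add)
  then show ?thesis by (simp add: E_def[abs_def] \<Theta>_def)
 qed
 have xg: "xgrad (\<lambda>z. J z + E i z) = (\<lambda>z. xgrad J z + xgrad (E i) z)" for i
 proof
  fix z
  have "dir_deriv c (\<lambda>z. J z + E i z) z = dir_deriv c J z + dir_deriv c (E i) z" for c
   using dir_deriv_eqI[OF has_derivative_add[OF has_dir_deriv[OF schwartz_differentiable[OF J]] has_dir_deriv[OF schwartz_differentiable[OF ES]]]] .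
  then show "xgrad (\<lambda>z. J z + E i z) z = xgrad J z + xgrad (E i) z"
   by (simp add: xgrad_def scaleR_add_right sum.distrib)
 qed
 have eq: "- (f (xgrad J) + f (xgrad (E i))) = g J + g (E i)" for i
 proof -
  have "- f (xgrad (\<lambda>z. J z + E i z)) = g (\<lambda>z. J z + E i z)"
   using tr hi[of i] unfolding transport_equation_def xgrad_def[abs_def] by (simp add: case_prod_unfold)
  then show ?thesis unfolding xg by (simp add: td_add[OF f] td_add[OF g] schwartz_xgrad J ES)
 qed
 have "(\<lambda>i. - (f (xgrad J) + f (xgrad (E i)))) \<longlonglongrightarrow> - (f (xgrad J) + 0)"
  by (intro tendsto_intros td_tendsto_zero[OF f dcl_xgrad[OF En] schwartz_xgrad[OF ES]])
 moreover have "(\<lambda>i. g J + g (E i)) \<longlonglongrightarrow> g J + 0"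
  by (intro tendsto_intros td_tendsto_zero[OF g En ES])
 ultimately show ?thesis unfolding eq using LIMSEQ_unique by fastforce
qed

section \<open>Frequency localization along characteristics\<close>

text \<open>A velocity cutoff with band-limited rather than compact support, equal to \<open>1\<close> at the origin: multiplying
by it spreads the \<open>v\<close>-frequencies by at most \<open>1 / r\<close>.\<close>

definition vcut :: "'a \<Rightarrow> complex" where
 "vcut v = of_real (1 / integral\<^sup>L lborel \<psi>) * fourier (\<lambda>\<xi>. of_real (\<psi> \<xi>)) v"

lemma schwartz_vcut: "schwartz vcut"
 unfolding vcut_def[abs_def] by (intro schwartz_cmult schwartz_fourier schwartz_psi)

lemma vcut_0: "vcut 0 = 1"
 using bump_integral_pos[OF bump_psi] by (simp add: vcut_def fourier_def)

text \<open>The inverse transform without its normalizing constant, which depends on the dimension.\<close>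

definition expint :: "('e::euclidean_space \<Rightarrow> complex) \<Rightarrow> 'e \<Rightarrow> complex" where
 "expint f \<zeta> = (LIN z. exp (\<i> * of_real (z \<bullet> \<zeta>)) * f z)"

lemma inv_fourier_expint: "inv_fourier f \<zeta> = of_real (1 / (2 * pi) ^ DIM('e)) * expint f (\<zeta> :: 'e::euclidean_space)"
 by (simp add: inv_fourier_def expint_def)

lemma expint_zero_iff: "inv_fourier f (\<zeta> :: 'e::euclidean_space) = 0 \<longleftrightarrow> expint f \<zeta> = 0"
 by (simp add: inv_fourier_expint)

lemma inv_fourier_cmult: "inv_fourier (\<lambda>x. c * f x) (v :: 'e::euclidean_space) = c * inv_fourier f v"
proof -
 have "(LIN \<xi>. exp (\<i> * of_real (\<xi> \<bullet> v)) * (c * f \<xi>)) = (LIN \<xi>. c * (exp (\<i> * of_real (\<xi> \<bullet> v)) * f \<xi>))"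
  by (simp only: mult.left_commute)
 then show ?thesis unfolding inv_fourier_def by (simp only: integral_mult_right_zero mult.left_commute)
qed

lemma expint_cut: assumes "norm \<zeta> > 1" shows "expint vcut \<zeta> = 0"
proof -
 have "inv_fourier vcut \<zeta> = of_real (1 / integral\<^sup>L lborel \<psi>) * inv_fourier (fourier (\<lambda>\<xi>. of_real (\<psi> \<xi>))) \<zeta>"
  unfolding vcut_def[abs_def] by (rule inv_fourier_cmult)
 also have "\<dots> = 0" by (simp add: inv_fourier_fourier[OF schwartz_psi] psi_nonzero[OF assms])
 finally show ?thesis by (simp only: expint_zero_iff)
qed

lemma expint_Htest:
 assumes a: "schwartz a" and r: "r > 0"
 shows "expint (Htest vcut t r a) (\<xi>, \<eta>) = expint a \<xi> * (of_real (r ^ DIM('a)) * expint vcut (r *\<^sub>R (\<eta> - t *\<^sub>R \<xi>)))"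
proof -
 let ?f = "\<lambda>z. exp (\<i> * of_real (z \<bullet> (\<xi>, \<eta>))) * Htest vcut t r a z"
 have i: "integrable lborel ?f"
  using integrable_phase(2)[OF schwartz_integrable[OF schwartz_Htest[OF schwartz_vcut r a]], of "(\<xi>, \<eta>)"]
  by (simp add: inner_commute)
 have inner: "(LIN v. exp (\<i> * of_real (v \<bullet> (\<eta> - t *\<^sub>R \<xi>))) * vcut (v /\<^sub>R r)) = of_real (r ^ DIM('a)) * expint vcut (r *\<^sub>R (\<eta> - t *\<^sub>R \<xi>))"
 proof -
  note [measurable] = schwartz_measurable[OF schwartz_vcut]
  let ?g = "\<lambda>v. exp (\<i> * of_real (v \<bullet> (\<eta> - t *\<^sub>R \<xi>))) * vcut (v /\<^sub>R r)"
  have "(LIN v. ?g v) = \<bar>r\<bar> ^ DIM('a) *\<^sub>R (LIN v. ?g (0 + r *\<^sub>R v))"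
   by (rule integral_affine[symmetric]) (use r in auto)
  also have "(LIN v. ?g (0 + r *\<^sub>R v)) = expint vcut (r *\<^sub>R (\<eta> - t *\<^sub>R \<xi>))"
   unfolding expint_def using r by simp
  finally show ?thesis using r by (simp add: scaleR_conv_of_real)
 qed
 have "expint (Htest vcut t r a) (\<xi>, \<eta>) = (LIN x. LIN v. ?f (x - t *\<^sub>R v, v))"
  unfolding expint_def by (rule shear_integral(1)[OF i])
 also have "\<dots> = (LIN x. LIN v. (exp (\<i> * of_real (x \<bullet> \<xi>)) * a x) * (exp (\<i> * of_real (v \<bullet> (\<eta> - t *\<^sub>R \<xi>))) * vcut (v /\<^sub>R r)))"
  by (intro Bochner_Integration.integral_cong refl)
   (simp add: Htest_def inner_diff_left inner_diff_right algebra_simps exp_add exp_diff)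
 also have "\<dots> = (LIN x. (exp (\<i> * of_real (x \<bullet> \<xi>)) * a x) * (of_real (r ^ DIM('a)) * expint vcut (r *\<^sub>R (\<eta> - t *\<^sub>R \<xi>))))"
  by (simp only: integral_mult_right_zero inner)
 also have "\<dots> = expint a \<xi> * (of_real (r ^ DIM('a)) * expint vcut (r *\<^sub>R (\<eta> - t *\<^sub>R \<xi>)))"
  unfolding expint_def[of a] by (rule integral_mult_left_zero)
 finally show ?thesis .
qed

text \<open>The heart of the frequency localization: \<open>a (x + t v)\<close> has its frequencies on the plane \<open>\<eta> = t \<xi>\<close>. If \<open>a\<close> lives at
\<open>\<bar>\<xi>\<bar> ~ 2\<^sup>k\<close>, only the \<open>v\<close>-blocks at frequencies near \<open>t 2\<^sup>k\<close> are seen.\<close>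

lemma Htest_frequency:
 assumes "schwartz a" "r > 0" "expint (Htest vcut t r a) (\<xi>, \<eta>) \<noteq> 0"
 shows "inv_fourier a \<xi> \<noteq> 0 \<and> norm (\<eta> - t *\<^sub>R \<xi>) \<le> 1 / r"
proof -
 have "expint a \<xi> \<noteq> 0" "expint vcut (r *\<^sub>R (\<eta> - t *\<^sub>R \<xi>)) \<noteq> 0" using assms expint_Htest by auto
 moreover from this(2) have "norm (r *\<^sub>R (\<eta> - t *\<^sub>R \<xi>)) \<le> 1" using expint_cut by (meson not_le)
 then have "norm (\<eta> - t *\<^sub>R \<xi>) \<le> 1 / r" unfolding norm_scaleR using assms(2) by (simp add: field_simps)
 ultimately show ?thesis by (simp add: expint_zero_iff)
qed

lemma Htest_uniform_weight:
 assumes a: "schwartz a" and r: "r > 0"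
 shows "\<exists>C. \<forall>s\<in>{t1..t2}. \<forall>z. norm (Htest vcut s r a z) \<le> C * weight z"
proof -
 define N where "N = 2 * DIM('a \<times> 'a)"
 define S where "S = max \<bar>t1\<bar> \<bar>t2\<bar>"
 have S: "\<bar>s\<bar> \<le> S" if "s \<in> {t1..t2}" for s using that by (auto simp: S_def)
 have "rapid (\<lambda>_::unit. a)" using schwartzD[OF a, of 0] by simp
 then obtain C1 where C1: "\<And>s z. \<bar>s\<bar> \<le> S \<Longrightarrow> (1 + norm (fst z)) ^ N * norm (a (fst z + s *\<^sub>R snd z)) \<le> C1 * (1 + norm (snd z)) ^ N"
  using rapid_transport_bound[of "\<lambda>_::unit. a" S N] by auto
 have "vrapid (\<lambda>_::unit. \<lambda>z::'a \<times> 'a. vcut (snd z /\<^sub>R r))" using dcl_chi[OF schwartz_vcut r, of 0] by simp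
 then obtain C2 where C2: "\<And>z::'a \<times> 'a. (1 + norm (snd z)) ^ (N + N) * norm (vcut (snd z /\<^sub>R r)) \<le> C2" unfolding vrapid_def by metis
 have "norm (Htest vcut s r a z) \<le> (\<bar>C1\<bar> * C2) * weight z" if s: "s \<in> {t1..t2}" for s z
 proof (rule decay_le_weight)
  have "(1 + norm z) ^ (2 * DIM('a \<times> 'a)) * norm (Htest vcut s r a z) \<le> ((1 + norm (fst z)) * (1 + norm (snd z))) ^ N * norm (Htest vcut s r a z)"
   unfolding N_def by (intro mult_right_mono power_mono norm_pair_weight) auto
  also have "\<dots> = ((1 + norm (fst z)) ^ N * norm (a (fst z + s *\<^sub>R snd z))) * ((1 + norm (snd z)) ^ N * norm (vcut (snd z /\<^sub>R r)))"
   by (simp only: power_mult_distrib norm_mult Htest_def mult_ac)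
  also have "\<dots> \<le> (\<bar>C1\<bar> * (1 + norm (snd z)) ^ N) * ((1 + norm (snd z)) ^ N * norm (vcut (snd z /\<^sub>R r)))"
   by (intro mult_right_mono order_trans[OF C1[OF S[OF s]]]) auto
  also have "\<dots> = \<bar>C1\<bar> * ((1 + norm (snd z)) ^ (N + N) * norm (vcut (snd z /\<^sub>R r)))" by (simp only: power_add mult_ac)
  also have "\<dots> \<le> \<bar>C1\<bar> * C2" by (intro mult_left_mono C2) auto
  finally show "(1 + norm z) ^ (2 * DIM('a \<times> 'a)) * norm (Htest vcut s r a z) \<le> \<bar>C1\<bar> * C2" .
 qed simp
 then show ?thesis by blast
qed

lemma Jtest_frequency:
 assumes a: "schwartz a" and r: "r > 0" and J: "expint (Jtest vcut t1 t2 r a) \<zeta> \<noteq> 0"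
 shows "\<exists>s\<in>{t1..t2}. expint (Htest vcut s r a) \<zeta> \<noteq> 0"
proof (rule ccontr)
 assume "\<not> ?thesis"
 then have z: "expint (Htest vcut s r a) \<zeta> = 0" if "s \<in> {t1..t2}" for s using that by auto
 note [measurable] = schwartz_measurable[OF schwartz_vcut] schwartz_measurable[OF a]
 let ?G = "\<lambda>(s::real) z. exp (\<i> * complex_of_real (z \<bullet> \<zeta>)) * (indicator {t1..t2} s *\<^sub>R Htest vcut s r a z)"
 obtain C where C: "\<And>s z. s \<in> {t1..t2} \<Longrightarrow> norm (Htest vcut s r a z) \<le> C * weight z"
  using Htest_uniform_weight[OF a r] by blast
 have pi: "integrable (lborel \<Otimes>\<^sub>M lborel) (\<lambda>(s::real, z::'a \<times> 'a). complex_of_real (indicator {t1..t2} s) * complex_of_real (C * weight z))"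
  by (intro integrable_pair_mult sigma_finite_lborel integrable_of_real integrable_real_indicator integrable_mult_right integrable_weight)
   (auto simp: emeasure_lborel_Icc_eq)
 have ig: "integrable (lborel \<Otimes>\<^sub>M lborel) (case_prod ?G)"
 proof (rule integrable_dominated[OF pi])
  show "case_prod ?G \<in> borel_measurable (lborel \<Otimes>\<^sub>M lborel)" unfolding Htest_def by measurable
  have "norm (?G s z) \<le> norm (complex_of_real (indicator {t1..t2} s) * complex_of_real (C * weight z))" for s z
   using order_trans[OF C abs_ge_self, of s z] by (auto simp: indicator_def norm_mult abs_mult)
  then show "AE x in lborel \<Otimes>\<^sub>M lborel. norm (case_prod ?G x) \<le> norm (case x of (s, z) \<Rightarrow> complex_of_real (indicator {t1..t2} s) * complex_of_real (C * weight z))"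
   by (intro AE_I2) auto
 qed
 have "expint (Jtest vcut t1 t2 r a) \<zeta> = (LIN z. LIN s. ?G s z)"
  unfolding expint_def
 proof (intro Bochner_Integration.integral_cong refl)
  fix z
  have "(LIN s. ?G s z) = (LIN s. (exp (\<i> * complex_of_real (z \<bullet> \<zeta>)) * vcut (snd z /\<^sub>R r)) * (indicator {t1..t2} s *\<^sub>R (s ^ 0 *\<^sub>R a (fst z + s *\<^sub>R snd z))))"
   by (intro Bochner_Integration.integral_cong refl) (simp add: Htest_def)
  also have "\<dots> = (exp (\<i> * complex_of_real (z \<bullet> \<zeta>)) * vcut (snd z /\<^sub>R r)) * Aint t1 t2 0 a z"
   unfolding Aint_def by (rule integral_mult_right_zero)
  finally show "exp (\<i> * complex_of_real (z \<bullet> \<zeta>)) * Jtest vcut t1 t2 r a z = (LIN s. ?G s z)"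
   by (simp add: Jtest_def)
 qed
 also have "\<dots> = (LIN s. LIN z. ?G s z)"
  using lborel_pair.Fubini_integral[OF ig] by simp
 also have "\<dots> = (LIN s. indicator {t1..t2} s *\<^sub>R expint (Htest vcut s r a) \<zeta>)"
 proof (intro Bochner_Integration.integral_cong refl)
  fix s :: real
  show "(LIN z. ?G s z) = indicator {t1..t2} s *\<^sub>R expint (Htest vcut s r a) \<zeta>"
   by (cases "s \<in> {t1..t2}") (simp_all add: expint_def)
 qed
 also have "\<dots> = (LINT s|(lborel :: real measure). 0)"
  by (intro Bochner_Integration.integral_cong refl) (auto simp: indicator_def z)
 finally show False using J by simp
qed

end

section \<open>Dyadic scales\<close>

definition dyad :: "real \<Rightarrow> int" where "dyad x = \<lfloor>log 2 x\<rfloor>"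

lemma dyad_bounds: assumes "x > 0" shows "2 powi dyad x \<le> x" "x < 2 powi (dyad x + 1)"
proof -
 have e: "(2::real) powi j = 2 powr (of_int j)" for j by (simp add: powr_real_of_int')
 have "2 powr of_int (dyad x) \<le> 2 powr log 2 x" unfolding dyad_def by (intro powr_mono) auto
 then show "2 powi dyad x \<le> x" unfolding e using assms by simp
 have "2 powr log 2 x < 2 powr of_int (dyad x + 1)" unfolding dyad_def by (intro powr_less_mono) linarith+
 then show "x < 2 powi (dyad x + 1)" unfolding e using assms by simp
qed

lemma dyad_powi_shift:
 assumes "x > 0"
 shows "2 powi (dyad x - 3) < x / 4" "4 * x < 2 powi (dyad x + 3)"
proof -
 have "(2::real) powi (dyad x - 3) = 2 powi dyad x / 8" by (simp add: power_int_diff)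
 then show "2 powi (dyad x - 3) < x / 4" using dyad_bounds[OF assms] assms by simp
 have "(2::real) powi (dyad x + 3) = 2 powi (dyad x + 1) * 4" by (simp add: power_int_add)
 then show "4 * x < 2 powi (dyad x + 3)" using dyad_bounds[OF assms] by simp
qed

lemma enn2real_inverse_bounds: assumes "1 \<le> (p::ennreal)" shows "0 \<le> enn2real (inverse p)" "enn2real (inverse p) \<le> 1"
proof -
 have "0 \<le> enn2real (inverse p) \<and> enn2real (inverse p) \<le> 1"
  using assms
 proof (cases p rule: exponent_cases)
  case (2 r)
  then have "inverse p = ennreal (1 / r)" by (simp add: inverse_ennreal inverse_eq_divide)
  then show ?thesis using 2 by auto
 qed auto
 then show "0 \<le> enn2real (inverse p)" "enn2real (inverse p) \<le> 1" by auto
qed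

lemma cexp_nonneg: "1 \<le> p \<Longrightarrow> 0 \<le> cexp TYPE('a::euclidean_space) p"
 using enn2real_inverse_bounds[of p] by (simp add: cexp_def)

lemma mixp_shift:
 fixes F :: "'a::euclidean_space \<times> 'a \<Rightarrow> complex"
 assumes p: "1 \<le> p" and [measurable]: "F \<in> borel_measurable borel"
 shows "mixp p (\<lambda>z. F (fst z, snd z + w)) \<le> mixp p F"
 unfolding mixp_def fst_conv snd_conv
proof (rule nn_integral_mono)
 fix x
 show "glp lborel p (\<lambda>v. enorm (F (x, v + w))) \<le> glp lborel p (\<lambda>v. enorm (F (x, v)))"
  using Lp_affine[OF p, of 1 "\<lambda>v. enorm (F (x, v))" w] by (simp add: add.commute)
qed

text \<open>Stated for a domination hypothesis instead of a Schwartz function, since transported test functions do not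
decay in the phase space.\<close>

lemma vconv_adjoint:
 fixes F H :: "'a::euclidean_space \<times> 'a \<Rightarrow> complex"
 assumes p: "1 \<le> p" and F [measurable]: "F \<in> borel_measurable borel" and fin: "mixp p F < \<infinity>"
  and H [measurable]: "H \<in> borel_measurable borel"
  and dom: "\<forall>F\<in>borel_measurable borel. (INN z. enorm (F z :: complex) * enorm (H z)) \<le> ennreal C * mixp p F"
  and K: "integrable lborel K"
 shows "(LIN z. vconv F K z * H z) = (LIN z. F z * (LIN w. K w * H (z - (0, w))))"
  and "integrable lborel (\<lambda>z. vconv F K z * H z)"
proof -
 have [measurable]: "K \<in> borel_measurable borel" using K by auto
 let ?G1 = "\<lambda>w z. F (fst z, snd z + w) * K w * H z" and ?G2 = "\<lambda>w z. F z * K w * H (z - (0, w))"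
 have sh: "?G1 w z = (\<lambda>z. ?G2 w z) ((0, w) + z)" for w z by (cases z) (simp add: add.commute)
 have nn1: "(INN w. INN z. enorm (?G1 w z)) < \<infinity>"
 proof -
  have "(INN w. INN z. enorm (?G1 w z)) \<le> (INN w. enorm (K w) * (ennreal C * mixp p F))"
  proof (rule nn_integral_mono)
   fix w :: 'a
   have "(INN z. enorm (?G1 w z)) = (INN z. enorm (K w) * (enorm (F (fst z, snd z + w)) * enorm (H z)))"
    by (intro nn_integral_cong) (simp add: norm_mult ennreal_mult mult_ac)
   also have "\<dots> = enorm (K w) * (INN z. enorm (F (fst z, snd z + w)) * enorm (H z))"
    by (rule nn_integral_cmult) measurable
   also have "\<dots> \<le> enorm (K w) * (ennreal C * mixp p (\<lambda>z. F (fst z, snd z + w)))"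
    by (intro mult_left_mono dom[rule_format]) auto
   also have "\<dots> \<le> enorm (K w) * (ennreal C * mixp p F)"
    by (intro mult_left_mono mixp_shift[OF p F]) auto
   finally show "(INN z. enorm (?G1 w z)) \<le> enorm (K w) * (ennreal C * mixp p F)" .
  qed
  also have "\<dots> = (INN w. enorm (K w)) * (ennreal C * mixp p F)" by (rule nn_integral_multc) measurable
  also have "\<dots> < \<infinity>" using K fin by (simp add: ennreal_mult_less_top integrable_iff_bounded)
  finally show ?thesis .
 qed
 have nn2: "(INN w. INN z. enorm (?G2 w z)) < \<infinity>"
 proof -
  have "(INN z. enorm (?G2 w z)) = (INN z. enorm (?G1 w z))" for w
   using nn_integral_affine[of 1 "\<lambda>z. enorm (?G2 w z)" "(0, w)"] unfolding sh by simp
  then show ?thesis using nn1 by simp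
 qed
 have i1: "integrable (lborel \<Otimes>\<^sub>M lborel) (case_prod ?G1)"
 proof (rule integrableI_bounded)
  show "(\<integral>\<^sup>+x. enorm (case_prod ?G1 x) \<partial>(lborel \<Otimes>\<^sub>M lborel)) < \<infinity>"
   using nn1 by (subst lborel.nn_integral_fst[symmetric]) (simp_all, measurable)
 qed measurable
 have i2: "integrable (lborel \<Otimes>\<^sub>M lborel) (case_prod ?G2)"
 proof (rule integrableI_bounded)
  show "(\<integral>\<^sup>+x. enorm (case_prod ?G2 x) \<partial>(lborel \<Otimes>\<^sub>M lborel)) < \<infinity>"
   using nn2 by (subst lborel.nn_integral_fst[symmetric]) (simp_all, measurable)
 qed measurable
 have v: "vconv F K z * H z = (LIN w. ?G1 w z)" for z
  unfolding vconv_def by (rule integral_mult_left_zero[symmetric])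
 show "integrable lborel (\<lambda>z. vconv F K z * H z)"
  unfolding v using lborel_pair.integrable_snd[OF i1] .
 have "(LIN z. vconv F K z * H z) = (LIN w. LIN z. ?G1 w z)"
  unfolding v using lborel_pair.Fubini_integral[OF i1] by simp
 also have "\<dots> = (LIN w. LIN z. ?G2 w z)"
 proof (rule LINT_cong)
  fix w :: 'a
  show "(LIN z. ?G1 w z) = (LIN z. ?G2 w z)"
   unfolding sh by (rule integral_shift) measurable
 qed
 also have "\<dots> = (LIN z. LIN w. ?G2 w z)"
  using lborel_pair.Fubini_integral[OF i2] by simp
 also have "\<dots> = (LIN z. F z * (LIN w. K w * H (z - (0, w))))"
  by (intro Bochner_Integration.integral_cong refl) (simp only: mult.assoc integral_mult_right_zero)
 finally show "(LIN z. vconv F K z * H z) = (LIN z. F z * (LIN w. K w * H (z - (0, w))))" .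
qed

text \<open>The pairing of \<open>\<integral> F (x - t v, v) dv\<close> with \<open>a\<close>, in the variables of the phase space.\<close>

definition pair :: "real \<Rightarrow> ('a::euclidean_space \<times> 'a \<Rightarrow> complex) \<Rightarrow> ('a \<Rightarrow> complex) \<Rightarrow> complex" where
 "pair t F a = (LIN z. F z * a (fst z + t *\<^sub>R snd z))"

lemma transported_dom:
 fixes a :: "'a::euclidean_space \<Rightarrow> complex"
 assumes p: "1 \<le> p" and a: "schwartz a"
 shows "\<exists>C>0. \<forall>t>0. \<forall>F\<in>borel_measurable borel. (INN z. enorm (F z :: complex) * enorm (a (fst z + t *\<^sub>R snd z))) \<le> ennreal (C * t powr (- cexp TYPE('a) p)) * mixp p F"
proof -
 obtain c e where ce: "c > 0" "e > 0" "\<And>x. norm (a x) \<le> c" "(INN x. enorm (a x)) \<le> ennreal e"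
  using schwartz_wnorm[OF a] by metis
 have w: "wnorm p e c > 0" using ce by (simp add: wnorm_def)
 have "(INN z. enorm (F z :: complex) * enorm (a (fst z + t *\<^sub>R snd z))) \<le> ennreal (wnorm p e c * t powr (- cexp TYPE('a) p)) * mixp p F"
  if t: "t > 0" and F: "F \<in> borel_measurable borel" for t F
  using transported_pairing_le[OF p t F schwartz_measurable[OF a] ce(3,4,1,2)] w
  by (simp add: ennreal_mult mult.assoc)
 then show ?thesis using w by blast
qed

locale LPp = LP \<psi> \<phi> for \<psi> \<phi> :: "'a::euclidean_space \<Rightarrow> real" +
 fixes p :: ennreal
 assumes p1: "1 \<le> p"
begin

lemma pair_integrable:
 assumes F [measurable]: "F \<in> borel_measurable borel" and "mixp p F < \<infinity>" and a: "schwartz (a :: 'a \<Rightarrow> complex)" and t: "t > 0"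
 shows "integrable lborel (\<lambda>z. F z * a (fst z + t *\<^sub>R snd z))"
proof -
 note [measurable] = schwartz_measurable[OF a]
 obtain C where C: "C > 0" "\<forall>t>0. \<forall>F\<in>borel_measurable borel. (INN z. enorm (F z :: complex) * enorm (a (fst z + t *\<^sub>R snd z))) \<le> ennreal (C * t powr (- cexp TYPE('a) p)) * mixp p F"
  using transported_dom[OF p1 a] by blast
 from C(2)[rule_format, OF t F] show ?thesis by (intro mixp_integrable_gen[OF F _ assms(2)]) measurable
qed

lemma norm_pair_le:
 assumes F [measurable]: "F \<in> borel_measurable borel" and t: "t > 0" and [measurable]: "a \<in> borel_measurable borel"
  and a: "\<And>x. norm (a x :: complex) \<le> c" "(INN x. enorm (a (x::'a))) \<le> ennreal e" "0 < c" "0 < e"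
 shows "enorm (pair t F a) \<le> ennreal (wnorm p e c) * (ennreal (t powr (- cexp TYPE('a) p)) * mixp p F)"
proof (cases "integrable lborel (\<lambda>z. F z * a (fst z + t *\<^sub>R snd z))")
 case True
 have "enorm (pair t F a) \<le> (INN z. enorm (F z * a (fst z + t *\<^sub>R snd z)))"
  unfolding pair_def by (rule integral_norm_bound_ennreal[OF True])
 also have "\<dots> = (INN z. enorm (F z) * enorm (a (fst z + t *\<^sub>R snd z)))"
  by (simp add: norm_mult ennreal_mult)
 also have "\<dots> \<le> ennreal (wnorm p e c) * (ennreal (t powr (- cexp TYPE('a) p)) * mixp p F)"
  by (rule transported_pairing_le[OF p1 t]) (use a in auto)
 finally show ?thesis .
qed (simp add: pair_def not_integrable_integral_eq)

lemma pair_eq_iterated: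
 assumes F [measurable]: "F \<in> borel_measurable borel" and "mixp p F < \<infinity>" and a: "schwartz (a :: 'a \<Rightarrow> complex)" and t: "t > 0"
 shows "pair t F a = (LIN x. (LIN v. F (x - t *\<^sub>R v, v)) * a x)"
  and "integrable lborel (\<lambda>x. (LIN v. F (x - t *\<^sub>R v, v)) * a x)"
 using shear_integral(1,3)[OF pair_integrable[OF assms], of t] unfolding pair_def by simp_all

text \<open>The family \<open>F\<close> consists of functions representing the dyadic \<open>v\<close>-blocks of \<open>T\<close>, with finite mixed norms.\<close>

definition blocks :: "(('a \<times> 'a \<Rightarrow> complex) \<Rightarrow> complex) \<Rightarrow> (int \<Rightarrow> 'a \<times> 'a \<Rightarrow> complex) \<Rightarrow> bool" where
 "blocks T F \<longleftrightarrow> tempered_distribution T \<and> (\<forall>k. represents (LP_block_v \<phi> (2 powi k) T) (F k) \<and> mixp p (F k) < \<infinity>)"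

text \<open>Schwartz functions with spectrum in an annulus; these are the test functions for one dyadic block.\<close>

definition ann :: "real \<Rightarrow> real \<Rightarrow> ('a \<Rightarrow> complex) \<Rightarrow> bool" where
 "ann c1 c2 a \<longleftrightarrow> schwartz a \<and> (\<forall>\<xi>. inv_fourier a \<xi> \<noteq> 0 \<longrightarrow> c1 \<le> norm \<xi> \<and> norm \<xi> \<le> c2)"

lemma blocksD:
 assumes "blocks T F"
 shows "tempered_distribution T" "represents (LP_block_v \<phi> (2 powi k) T) (F k)" "mixp p (F k) < \<infinity>" "F k \<in> borel_measurable borel"
 using assms unfolding blocks_def represents_def by auto

lemma block_apply: "blocks T F \<Longrightarrow> schwartz H \<Longrightarrow> LP_block_v \<phi> (2 powi k) T H = (LIN z. F k z * H z)"
 using blocksD(2) unfolding represents_def by blast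

lemma Htest_localized:
 assumes a: "ann c1 c2 a" and c: "0 < c1" and t: "0 < t1" "t1 \<le> s" "s \<le> t2"
  and i: "2 powi i < t1 * c1 / 2" and j: "2 * t2 * c2 < 2 powi j" and r: "r > 0" "1 / r \<le> t1 * c1 / 2"
  and nz: "expint (Htest vcut s r a) \<zeta> \<noteq> 0"
 shows "2 powi i < norm (snd \<zeta>) \<and> norm (snd \<zeta>) < 2 powi j"
proof -
 obtain \<xi> \<eta> where z: "\<zeta> = (\<xi>, \<eta>)" by (cases \<zeta>)
 have sa: "schwartz a" using a by (simp add: ann_def)
 have *: "inv_fourier a \<xi> \<noteq> 0" "norm (\<eta> - s *\<^sub>R \<xi>) \<le> 1 / r" using Htest_frequency[OF sa r(1)] nz z by auto
 then have \<xi>: "c1 \<le> norm \<xi>" "norm \<xi> \<le> c2" using a by (auto simp: ann_def)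
 have "norm (s *\<^sub>R \<xi>) = s * norm \<xi>" using t by simp
 moreover have "norm (s *\<^sub>R \<xi>) \<le> norm (\<eta> - s *\<^sub>R \<xi>) + norm \<eta>" using norm_triangle_ineq4[of "\<eta>" "\<eta> - s *\<^sub>R \<xi>"] by simp
 moreover have "norm \<eta> \<le> norm (\<eta> - s *\<^sub>R \<xi>) + norm (s *\<^sub>R \<xi>)" using norm_triangle_ineq[of "\<eta> - s *\<^sub>R \<xi>" "s *\<^sub>R \<xi>"] by simp
 moreover have "t1 * c1 \<le> s * norm \<xi>" using t c \<xi> by (intro mult_mono) auto
 moreover have "s * norm \<xi> \<le> t2 * c2" using t c \<xi> by (intro mult_mono) auto
 moreover have "t1 * c1 > 0" using t c by simp
 ultimately have "t1 * c1 / 2 \<le> norm \<eta>" "norm \<eta> \<le> 2 * (t2 * c2)" using *(2) r(2) by linarith+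
 then show ?thesis using i j z by simp
qed

lemma localized_test:
 assumes T: "blocks T F" and a: "ann c1 c2 a" and c: "0 < c1" and t: "0 < t1" "t1 \<le> s" "s \<le> t2"
  and i: "2 powi i < t1 * c1 / 2" and j: "2 * t2 * c2 < 2 powi j" and r: "r > 0" "1 / r \<le> t1 * c1 / 2"
 shows "T (Htest vcut s r a) = (\<Sum>k\<in>{i..j}. LIN z. F k z * Htest vcut s r a z)"
  and "T (Jtest vcut t1 t2 r a) = (\<Sum>k\<in>{i..j}. LIN z. F k z * Jtest vcut t1 t2 r a z)"
proof -
 have sa: "schwartz a" using a by (simp add: ann_def)
 have H: "schwartz (Htest vcut s r a)" for s by (rule schwartz_Htest[OF schwartz_vcut r(1) sa])
 have J: "schwartz (Jtest vcut t1 t2 r a)" by (rule schwartz_Jtest[OF schwartz_vcut r(1) sa])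
 show "T (Htest vcut s r a) = (\<Sum>k\<in>{i..j}. LIN z. F k z * Htest vcut s r a z)"
  by (subst td_v_blocks[OF blocksD(1)[OF T] H, of s i j])
   (use Htest_localized[OF a c t i j r] block_apply[OF T H] in \<open>auto simp: expint_zero_iff\<close>)
 show "T (Jtest vcut t1 t2 r a) = (\<Sum>k\<in>{i..j}. LIN z. F k z * Jtest vcut t1 t2 r a z)"
 proof (subst td_v_blocks[OF blocksD(1)[OF T] J, of i j])
  fix \<zeta> assume "inv_fourier (Jtest vcut t1 t2 r a) \<zeta> \<noteq> 0"
  then have "expint (Jtest vcut t1 t2 r a) \<zeta> \<noteq> 0" by (simp add: expint_zero_iff)
  then obtain s where "s \<in> {t1..t2}" "expint (Htest vcut s r a) \<zeta> \<noteq> 0" using Jtest_frequency[OF sa r(1)] by blast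
  then show "2 powi i < norm (snd \<zeta>) \<and> norm (snd \<zeta>) < 2 powi j"
   using Htest_localized[OF a c t(1) _ _ i j r, of s \<zeta>] by simp
 qed (simp add: block_apply[OF T J])
qed

section \<open>Removing the velocity cutoff\<close>

definition rad :: "nat \<Rightarrow> real" where "rad n = real (Suc n)"

lemma rad: "rad n > 0" "(\<lambda>n. 1 / rad n) \<longlonglongrightarrow> 0"
 unfolding rad_def using LIMSEQ_inverse_real_of_nat by (auto simp: inverse_eq_divide)

lemma rad_small: assumes "x > 0" shows "eventually (\<lambda>n. 1 / rad n \<le> x) sequentially"
 using order_tendstoD(2)[OF rad(2) assms] by eventually_elim simp

lemma vcut_lim: "(\<lambda>n. vcut (v /\<^sub>R rad n)) \<longlonglongrightarrow> 1"
proof -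
 have "(\<lambda>n. (1 / rad n) *\<^sub>R v) \<longlonglongrightarrow> 0 *\<^sub>R v" by (intro tendsto_scaleR rad tendsto_const)
 then have "(\<lambda>n. v /\<^sub>R rad n) \<longlonglongrightarrow> 0" by (simp add: inverse_eq_divide)
 then have "(\<lambda>n. vcut (v /\<^sub>R rad n)) \<longlonglongrightarrow> vcut 0"
  by (rule isCont_tendsto_compose[rotated]) (use schwartz_continuous[OF schwartz_vcut, of UNIV] in \<open>simp add: continuous_on_eq_continuous_at\<close>)
 then show ?thesis by (simp add: vcut_0)
qed

lemma cutoff_limit:
 assumes i: "integrable lborel (\<lambda>z. F z * A z)" and [measurable]: "F \<in> borel_measurable borel" "A \<in> borel_measurable borel"
 shows "(\<lambda>n. LIN z. F z * (A z * vcut (snd z /\<^sub>R rad n))) \<longlonglongrightarrow> (LIN z. F z * A z)"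
proof -
 obtain M where M: "M > 0" "\<And>v. norm (vcut v) \<le> M" using schwartz_bounded[OF schwartz_vcut] by metis
 note [measurable] = schwartz_measurable[OF schwartz_vcut]
 show ?thesis
 proof (rule integral_dominated_convergence[where w="\<lambda>z. M * norm (F z * A z)"])
  show "integrable lborel (\<lambda>z. M * norm (F z * A z))" using i by (intro integrable_mult_right integrable_norm)
  show "AE z in lborel. (\<lambda>n. F z * (A z * vcut (snd z /\<^sub>R rad n))) \<longlonglongrightarrow> F z * A z"
  proof (rule AE_I2)
   fix z
   have "(\<lambda>n. (F z * A z) * vcut (snd z /\<^sub>R rad n)) \<longlonglongrightarrow> (F z * A z) * 1" by (intro tendsto_intros vcut_lim)
   then show "(\<lambda>n. F z * (A z * vcut (snd z /\<^sub>R rad n))) \<longlonglongrightarrow> F z * A z" by (simp add: mult.assoc)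
  qed
  show "AE z in lborel. norm (F z * (A z * vcut (snd z /\<^sub>R rad n))) \<le> M * norm (F z * A z)" for n
  proof (rule AE_I2)
   fix z
   have "norm (F z * A z) * norm (vcut (snd z /\<^sub>R rad n)) \<le> norm (F z * A z) * M" by (intro mult_left_mono M) auto
   then show "norm (F z * (A z * vcut (snd z /\<^sub>R rad n))) \<le> M * norm (F z * A z)"
    by (simp add: norm_mult mult_ac)
  qed
 qed measurable
qed

text \<open>The pairing of \<open>T\<close> with \<open>a (x + t v)\<close>, which is not a test function, obtained by removing the velocity cutoff. It exists
for spectrally localized \<open>a\<close> because only finitely many blocks of \<open>T\<close> contribute, all of them functions.\<close>

definition Ilim :: "(('a \<times> 'a \<Rightarrow> complex) \<Rightarrow> complex) \<Rightarrow> real \<Rightarrow> ('a \<Rightarrow> complex) \<Rightarrow> complex" where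
 "Ilim T t a = lim (\<lambda>n. T (Htest vcut t (rad n) a))"

lemma Ilim_tendsto:
 assumes T: "blocks T F" and a: "ann c1 c2 a" and c: "0 < c1" and t: "0 < t"
  and i: "2 powi i < t * c1 / 2" and j: "2 * t * c2 < 2 powi j"
 shows "(\<lambda>n. T (Htest vcut t (rad n) a)) \<longlonglongrightarrow> (\<Sum>k\<in>{i..j}. pair t (F k) a)"
proof -
 have sa: "schwartz a" using a by (simp add: ann_def)
 note [measurable] = schwartz_measurable[OF sa] blocksD(4)[OF T]
 have "(\<lambda>n. \<Sum>k\<in>{i..j}. LIN z. F k z * Htest vcut t (rad n) a z) \<longlonglongrightarrow> (\<Sum>k\<in>{i..j}. pair t (F k) a)"
  unfolding Htest_def pair_def
  by (intro tendsto_sum cutoff_limit pair_integrable blocksD[OF T] sa t) measurable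
 moreover have "eventually (\<lambda>n. (\<Sum>k\<in>{i..j}. LIN z. F k z * Htest vcut t (rad n) a z) = T (Htest vcut t (rad n) a)) sequentially"
 proof -
  have "t * c1 / 2 > 0" using t c by simp
  from rad_small[OF this] show ?thesis
   by eventually_elim (rule localized_test(1)[OF T a c t order_refl order_refl i j rad(1), symmetric])
 qed
 ultimately show ?thesis by (rule Lim_transform_eventually)
qed

lemma Ilim_eq:
 assumes "blocks T F" "ann c1 c2 a" "0 < c1" "0 < t" "2 powi i < t * c1 / 2" "2 * t * c2 < 2 powi j"
 shows "Ilim T t a = (\<Sum>k\<in>{i..j}. pair t (F k) a)"
 unfolding Ilim_def by (rule limI[OF Ilim_tendsto[OF assms]])

lemma powi_below: assumes "x > 0" obtains i :: int where "2 powi i < (x::real)"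
proof -
 have "2 powi (dyad x - 3) < x / 4" by (rule dyad_powi_shift(1)[OF assms])
 then have "2 powi (dyad x - 3) < x" using assms by simp
 then show ?thesis using that by blast
qed

lemma powi_above: obtains j :: int where "(x::real) < 2 powi j"
proof -
 have "max x 1 < 2 powi (dyad (max x 1) + 1)" by (rule dyad_bounds) simp
 then show ?thesis using that[of "dyad (max x 1) + 1"] by simp
qed

lemma pair_time_integrable:
 assumes F [measurable]: "F \<in> borel_measurable borel" and fin: "mixp p F < \<infinity>" and a: "schwartz (a :: 'a \<Rightarrow> complex)" and t: "0 < t1"
 shows "integrable (lborel \<Otimes>\<^sub>M lborel) (\<lambda>(s, z). indicator {t1..t2} s *\<^sub>R (F z * a (fst z + s *\<^sub>R snd z)))"
proof (rule integrableI_bounded)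
 note [measurable] = schwartz_measurable[OF a]
 obtain C where C: "C > 0" "\<forall>t>0. \<forall>F\<in>borel_measurable borel. (INN z. enorm (F z :: complex) * enorm (a (fst z + t *\<^sub>R snd z))) \<le> ennreal (C * t powr (- cexp TYPE('a) p)) * mixp p F"
  using transported_dom[OF p1 a] by blast
 show "(\<lambda>(s, z). indicator {t1..t2} s *\<^sub>R (F z * a (fst z + s *\<^sub>R snd z))) \<in> borel_measurable (lborel \<Otimes>\<^sub>M lborel)"
  by measurable
 have "(\<integral>\<^sup>+x. enorm (case x of (s, z) \<Rightarrow> indicator {t1..t2} s *\<^sub>R (F z * a (fst z + s *\<^sub>R snd z))) \<partial>(lborel \<Otimes>\<^sub>M lborel))
  = (INN s. INN z. enorm (indicator {t1..t2} s *\<^sub>R (F z * a (fst z + s *\<^sub>R snd z))))"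
  by (subst lborel.nn_integral_fst[symmetric]) (simp_all, measurable)
 also have "\<dots> \<le> (INN s. (ennreal (C * t1 powr (- cexp TYPE('a) p)) * mixp p F) * indicator {t1..t2} s)"
 proof (rule nn_integral_mono)
  fix s :: real
  show "(INN z. enorm (indicator {t1..t2} s *\<^sub>R (F z * a (fst z + s *\<^sub>R snd z)))) \<le> (ennreal (C * t1 powr (- cexp TYPE('a) p)) * mixp p F) * indicator {t1..t2} s"
  proof (cases "s \<in> {t1..t2}")
   case True
   then have s: "s > 0" using t by simp
   have "(INN z. enorm (indicator {t1..t2} s *\<^sub>R (F z * a (fst z + s *\<^sub>R snd z))))
    = (INN z. enorm (F z) * enorm (a (fst z + s *\<^sub>R snd z)))"
    using True by (simp add: norm_mult ennreal_mult)
   also have "\<dots> \<le> ennreal (C * s powr (- cexp TYPE('a) p)) * mixp p F" by (rule C(2)[rule_format, OF s F])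
   also have "\<dots> \<le> ennreal (C * t1 powr (- cexp TYPE('a) p)) * mixp p F"
    by (intro mult_right_mono ennreal_leI mult_left_mono powr_mono2') (use C t True cexp_nonneg[OF p1] in auto)
   finally show ?thesis using True by simp
  qed simp
 qed
 also have "\<dots> = (ennreal (C * t1 powr (- cexp TYPE('a) p)) * mixp p F) * emeasure lborel {t1..t2}"
  by (rule nn_integral_cmult_indicator) simp
 also have "\<dots> < \<infinity>" using fin by (simp add: ennreal_mult_less_top emeasure_lborel_Icc_eq)
 finally show "(\<integral>\<^sup>+x. enorm (case x of (s, z) \<Rightarrow> indicator {t1..t2} s *\<^sub>R (F z * a (fst z + s *\<^sub>R snd z))) \<partial>(lborel \<Otimes>\<^sub>M lborel)) < \<infinity>" .
qed

lemma pair_Aint: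
 assumes F: "F \<in> borel_measurable borel" "mixp p F < \<infinity>" and a: "schwartz (a :: 'a \<Rightarrow> complex)" and t: "0 < t1"
 shows "(LIN z. F z * Aint t1 t2 0 a z) = (LIN s. indicator {t1..t2} s *\<^sub>R pair s F a)"
  and "integrable lborel (\<lambda>z. F z * Aint t1 t2 0 a z)"
  and "integrable lborel (\<lambda>s. indicator {t1..t2} s *\<^sub>R pair s F a)"
proof -
 let ?G = "\<lambda>s z. indicator {t1..t2} s *\<^sub>R (F z * a (fst z + s *\<^sub>R snd z))"
 have i: "integrable (lborel \<Otimes>\<^sub>M lborel) (case_prod ?G)" by (rule pair_time_integrable[OF F a t])
 have v: "F z * Aint t1 t2 0 a z = (LIN s. ?G s z)" for z
  unfolding Aint_def by (subst integral_mult_right_zero[symmetric]) simp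
 have w: "(LIN z. ?G s z) = indicator {t1..t2} s *\<^sub>R pair s F a" for s
  unfolding pair_def by (cases "s \<in> {t1..t2}") auto
 show "integrable lborel (\<lambda>z. F z * Aint t1 t2 0 a z)"
  unfolding v using lborel_pair.integrable_snd[OF i] .
 show "integrable lborel (\<lambda>s. indicator {t1..t2} s *\<^sub>R pair s F a)"
  using lborel_pair.integrable_fst[OF i] unfolding w .
 show "(LIN z. F z * Aint t1 t2 0 a z) = (LIN s. indicator {t1..t2} s *\<^sub>R pair s F a)"
  unfolding v using lborel_pair.Fubini_integral[OF i] unfolding w .
qed

text \<open>The equation integrated along characteristics: both sides of the identity for \<open>Jtest\<close> involve finitely many
blocks, the same for all large cutoff radii, so that it can be removed.\<close>

theorem transport_increment:
 assumes f: "blocks f F" and g: "blocks g G" and tr: "transport_equation f g"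
  and a: "ann c1 c2 a" and c: "0 < c1" and t: "0 < t1" "t1 \<le> t2"
 shows "Ilim f t2 a - Ilim f t1 a = - (LIN s. indicator {t1..t2} s *\<^sub>R Ilim g s a)"
  and "integrable lborel (\<lambda>s. indicator {t1..t2} s *\<^sub>R Ilim g s a)"
proof -
 have sa: "schwartz a" using a by (simp add: ann_def)
 have tc: "t1 * c1 / 2 > 0" using t c by simp
 obtain i where i: "2 powi i < t1 * c1 / 2" using powi_below[OF tc] by metis
 obtain j where j: "2 * t2 * max c2 0 < 2 powi j" using powi_above by metis
 have ij: "2 powi i < s * c1 / 2" "2 * s * c2 < 2 powi j" if s: "t1 \<le> s" "s \<le> t2" for s
 proof -
  have "t1 * c1 \<le> s * c1" using s c by (intro mult_right_mono) auto
  then show "2 powi i < s * c1 / 2" using i by linarith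
  have "s * c2 \<le> s * max c2 0" using s t by (intro mult_left_mono) auto
  also have "\<dots> \<le> t2 * max c2 0" using s t by (intro mult_right_mono) auto
  finally show "2 * s * c2 < 2 powi j" using j by linarith
 qed
 have I: "indicator {t1..t2} s *\<^sub>R Ilim g s a = (\<Sum>k\<in>{i..j}. indicator {t1..t2} s *\<^sub>R pair s (G k) a)" for s
 proof (cases "s \<in> {t1..t2}")
  case True
  then have s: "0 < s" "t1 \<le> s" "s \<le> t2" using t by auto
  show ?thesis unfolding Ilim_eq[OF g a c s(1) ij(1)[OF s(2,3)] ij(2)[OF s(2,3)]] by (rule scaleR_sum_right)
 qed simp
 have ik: "integrable lborel (\<lambda>s. indicator {t1..t2} s *\<^sub>R pair s (G k) a)" for k
  by (rule pair_Aint(3)[OF blocksD(4,3)[OF g] sa t(1)])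
 show "integrable lborel (\<lambda>s. indicator {t1..t2} s *\<^sub>R Ilim g s a)"
  unfolding I by (intro Bochner_Integration.integrable_sum ik)
 have eq: "f (Htest vcut t2 (rad n) a) - f (Htest vcut t1 (rad n) a) = - g (Jtest vcut t1 t2 (rad n) a)" for n
 proof -
  have H: "schwartz (Htest vcut s (rad n) a)" for s by (rule schwartz_Htest[OF schwartz_vcut rad(1) sa])
  have J: "schwartz (Jtest vcut t1 t2 (rad n) a)" by (rule schwartz_Jtest[OF schwartz_vcut rad(1) sa])
  have "xgrad (Jtest vcut t1 t2 (rad n) a) = (\<lambda>z. Htest vcut t2 (rad n) a z - Htest vcut t1 (rad n) a z)"
   using xgrad_Jtest[OF schwartz_vcut rad(1) sa t(2)] by (simp add: fun_eq_iff)
  then have "- f (\<lambda>z. Htest vcut t2 (rad n) a z - Htest vcut t1 (rad n) a z) = g (Jtest vcut t1 t2 (rad n) a)"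
   using transport_schwartz[OF blocksD(1)[OF f] blocksD(1)[OF g] tr J] by simp
  then show ?thesis by (simp add: td_diff[OF blocksD(1)[OF f] H H] algebra_simps)
 qed
 have l1: "(\<lambda>n. f (Htest vcut t (rad n) a)) \<longlonglongrightarrow> Ilim f t a" if "t1 \<le> t" "t \<le> t2" for t
 proof -
  have t0: "0 < t" using \<open>0 < t1\<close> that by simp
  show ?thesis using Ilim_tendsto[OF f a c t0 ij(1)[OF that] ij(2)[OF that]] Ilim_eq[OF f a c t0 ij(1)[OF that] ij(2)[OF that]] by simp
 qed
 have "(\<lambda>n. g (Jtest vcut t1 t2 (rad n) a)) \<longlonglongrightarrow> (\<Sum>k\<in>{i..j}. LIN z. G k z * Aint t1 t2 0 a z)"
 proof -
  have Am: "Aint t1 t2 0 a \<in> borel_measurable borel"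
   using Aint_differentiable[OF sa] by (intro borel_measurable_continuous_onI continuous_at_imp_continuous_on ballI differentiable_imp_continuous_within)
  have "(\<lambda>n. \<Sum>k\<in>{i..j}. LIN z. G k z * Jtest vcut t1 t2 (rad n) a z) \<longlonglongrightarrow> (\<Sum>k\<in>{i..j}. LIN z. G k z * Aint t1 t2 0 a z)"
   unfolding Jtest_def
   by (intro tendsto_sum cutoff_limit pair_Aint(2)[OF blocksD(4,3)[OF g] sa t(1)] blocksD(4)[OF g] Am)
  moreover have "eventually (\<lambda>n. (\<Sum>k\<in>{i..j}. LIN z. G k z * Jtest vcut t1 t2 (rad n) a z) = g (Jtest vcut t1 t2 (rad n) a)) sequentially"
   using rad_small[OF tc]
   by eventually_elim (rule localized_test(2)[OF g a c t(1) order_refl t(2) i ij(2)[OF t(2) order_refl] rad(1), symmetric])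
  ultimately show ?thesis by (rule Lim_transform_eventually)
 qed
 also have "(\<Sum>k\<in>{i..j}. LIN z. G k z * Aint t1 t2 0 a z) = (LIN s. indicator {t1..t2} s *\<^sub>R Ilim g s a)"
  unfolding I pair_Aint(1)[OF blocksD(4,3)[OF g] sa t(1)]
  by (rule Bochner_Integration.integral_sum[symmetric]) (rule ik)
 finally have l2: "(\<lambda>n. - g (Jtest vcut t1 t2 (rad n) a)) \<longlonglongrightarrow> - (LIN s. indicator {t1..t2} s *\<^sub>R Ilim g s a)"
  by (rule tendsto_minus)
 have "(\<lambda>n. f (Htest vcut t2 (rad n) a) - f (Htest vcut t1 (rad n) a)) \<longlonglongrightarrow> Ilim f t2 a - Ilim f t1 a"
  using t by (intro tendsto_diff l1) auto
 then show "Ilim f t2 a - Ilim f t1 a = - (LIN s. indicator {t1..t2} s *\<^sub>R Ilim g s a)"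
  unfolding eq using l2 LIMSEQ_unique by blast
qed

section \<open>Blocks at arbitrary frequencies\<close>

text \<open>The block at an arbitrary frequency \<open>\<delta>\<close>, rebuilt from the dyadic blocks near \<open>\<delta>\<close>.\<close>

definition Fd :: "(int \<Rightarrow> 'a \<times> 'a \<Rightarrow> complex) \<Rightarrow> real \<Rightarrow> 'a \<times> 'a \<Rightarrow> complex" where
 "Fd F \<delta> z = (\<Sum>k\<in>{dyad \<delta> - 3..dyad \<delta> + 3}. vconv (F k) (kern (lpsym \<phi> \<delta>)) z)"

lemma integrable_kern: "\<delta> > 0 \<Longrightarrow> integrable lborel (kern (lpsym \<phi> \<delta>))"
 by (intro schwartz_integrable schwartz_kern schwartz_lpsym)

lemma kern_measurable: "\<delta> > 0 \<Longrightarrow> kern (lpsym \<phi> \<delta>) \<in> borel_measurable borel"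
 by (intro schwartz_measurable schwartz_kern schwartz_lpsym)

lemma measurable_Fd: "blocks T F \<Longrightarrow> \<delta> > 0 \<Longrightarrow> Fd F \<delta> \<in> borel_measurable borel"
 unfolding Fd_def[abs_def] by (intro borel_measurable_sum measurable_vconv blocksD(4) kern_measurable)

text \<open>A bound for the \<open>L\<^sup>1\<close> norm of every block kernel, by scaling; the summand \<open>1\<close> makes it positive.\<close>

definition KK :: real where "KK = 1 + (LIN w. norm (Kphi w))"

lemma KK_pos: "KK > 0"
 unfolding KK_def by (intro add_pos_nonneg) auto

lemma kern_L1: assumes "\<delta> > 0" shows "(INN w. enorm (kern (lpsym \<phi> \<delta>) w)) \<le> ennreal KK"
proof -
 have K: "schwartz Kphi" by (rule schwartz_kern[OF schwartz_phi])
 note [measurable] = schwartz_measurable[OF K]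
 have "(INN w. enorm (kern (lpsym \<phi> \<delta>) w)) = (INN w. ennreal (\<bar>\<delta>\<bar> ^ DIM('a)) * enorm (Kphi (0 + \<delta> *\<^sub>R w)))"
  using assms by (intro nn_integral_cong) (simp add: kern_lpsym norm_mult norm_power ennreal_mult)
 also have "\<dots> = ennreal (\<bar>\<delta>\<bar> ^ DIM('a)) * (INN w. enorm (Kphi (0 + \<delta> *\<^sub>R w)))"
  by (rule nn_integral_cmult) measurable
 also have "\<dots> = (INN w. enorm (Kphi w))" by (rule nn_integral_affine) (use assms in auto)
 also have "\<dots> = ennreal (LIN w. norm (Kphi w))"
  using schwartz_integrable[OF K] by (intro nn_integral_eq_integral) auto
 also have "\<dots> \<le> ennreal KK" unfolding KK_def by (intro ennreal_leI) simp
 finally show ?thesis .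
qed

lemma mixp_Fd:
 assumes "blocks T F" "\<delta> > 0"
 shows "mixp p (Fd F \<delta>) \<le> ennreal KK * (\<Sum>k\<in>{dyad \<delta> - 3..dyad \<delta> + 3}. mixp p (F k))"
proof -
 have "mixp p (Fd F \<delta>) \<le> (\<Sum>k\<in>{dyad \<delta> - 3..dyad \<delta> + 3}. mixp p (vconv (F k) (kern (lpsym \<phi> \<delta>))))"
  unfolding Fd_def[abs_def] by (rule mixp_sum[OF p1]) (use assms in \<open>auto intro: measurable_vconv blocksD(4) kern_measurable\<close>)
 also have "\<dots> \<le> (\<Sum>k\<in>{dyad \<delta> - 3..dyad \<delta> + 3}. ennreal KK * mixp p (F k))"
 proof (rule sum_mono)
  fix k
  have "mixp p (vconv (F k) (kern (lpsym \<phi> \<delta>))) \<le> (INN w. enorm (kern (lpsym \<phi> \<delta>) w)) * mixp p (F k)"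
   by (rule mixp_vconv[OF p1 blocksD(4)[OF assms(1)] kern_measurable[OF assms(2)]])
  also have "\<dots> \<le> ennreal KK * mixp p (F k)" by (intro mult_right_mono kern_L1 assms) auto
  finally show "mixp p (vconv (F k) (kern (lpsym \<phi> \<delta>))) \<le> ennreal KK * mixp p (F k)" .
 qed
 finally show ?thesis by (simp only: sum_distrib_left)
qed

lemma mixp_Fd_finite: assumes "blocks T F" "\<delta> > 0" shows "mixp p (Fd F \<delta>) < \<infinity>"
 by (rule le_less_trans[OF mixp_Fd[OF assms]])
  (use blocksD(3)[OF assms(1)] in \<open>auto simp: ennreal_mult_less_top\<close>)

lemma Fd_represents:
 assumes T: "blocks T F" and d: "\<delta> > 0"
 shows "represents (LP_block_v \<phi> \<delta> T) (Fd F \<delta>)"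
 unfolding represents_def
proof (intro conjI allI impI)
 show "Fd F \<delta> \<in> borel_measurable borel" by (rule measurable_Fd[OF T d])
 fix H :: "'a \<times> 'a \<Rightarrow> complex" assume H: "schwartz H"
 let ?P = "mop (\<lambda>\<zeta>. lpsym \<phi> \<delta> (snd \<zeta>)) H" and ?K = "kern (lpsym \<phi> \<delta>)"
 have P: "schwartz ?P" by (rule schwartz_mop[OF slow_lpsym_snd[OF d] H])
 obtain C where C: "\<forall>F\<in>borel_measurable borel. (INN z. enorm (F z :: complex) * enorm (H z)) \<le> ennreal C * mixp p F"
  using mixp_pairing_le[OF p1 H] by blast
 note adj = vconv_adjoint[OF p1 blocksD(4)[OF T] blocksD(3)[OF T] schwartz_measurable[OF H] C integrable_kern[OF d]]
 show "integrable lborel (\<lambda>z. Fd F \<delta> z * H z)" by (rule mixp_integrable[OF p1 measurable_Fd[OF T d] mixp_Fd_finite[OF T d] H])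
 have "LP_block_v \<phi> \<delta> T H = T ?P" by (rule LP_block_v_eq)
 also have "\<dots> = (\<Sum>k\<in>{dyad \<delta> - 3..dyad \<delta> + 3}. LP_block_v \<phi> (2 powi k) T ?P)"
 proof (rule td_v_blocks[OF blocksD(1)[OF T] P])
  fix \<zeta> assume "inv_fourier ?P \<zeta> \<noteq> 0"
  then have "lpsym \<phi> \<delta> (snd \<zeta>) \<noteq> 0" by (simp add: inv_fourier_mop[OF slow_lpsym_snd[OF d] H])
  from lpsym_supp[OF d this] show "2 powi (dyad \<delta> - 3) < norm (snd \<zeta>) \<and> norm (snd \<zeta>) < 2 powi (dyad \<delta> + 3)"
   using dyad_powi_shift[OF d] d by linarith
 qed
 also have "\<dots> = (\<Sum>k\<in>{dyad \<delta> - 3..dyad \<delta> + 3}. LIN z. vconv (F k) ?K z * H z)"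
  unfolding block_apply[OF T P] adj(1) mop_lpsym_snd[OF d H] ..
 also have "\<dots> = (LIN z. Fd F \<delta> z * H z)"
  unfolding Fd_def sum_distrib_right by (rule Bochner_Integration.integral_sum[symmetric]) (rule adj(2))
 finally show "LP_block_v \<phi> \<delta> T H = (LIN z. Fd F \<delta> z * H z)" .
qed

text \<open>Dilation of the kernel by \<open>t\<close> turns the \<open>v\<close>-block at frequency \<open>t 2\<^sup>k\<close> into the \<open>x\<close>-block at \<open>2\<^sup>k\<close> of the test function.\<close>

lemma Fd_pair:
 assumes T: "blocks T F" and t: "t > 0" and h: "schwartz (h :: 'a \<Rightarrow> complex)"
 shows "pair t (Fd F (t * 2 powi k)) h = Ilim T t (mop (lpsym \<phi> (2 powi k)) h)"
proof -
 define \<delta> where "\<delta> = t * 2 powi k"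
 have d: "\<delta> > 0" using t by (simp add: \<delta>_def)
 have q: "(2::real) powi k > 0" by simp
 let ?K = "kern (lpsym \<phi> \<delta>)" and ?P = "mop (lpsym \<phi> (2 powi k)) h" and ?H = "\<lambda>z. h (fst z + t *\<^sub>R snd z)"
 note [measurable] = schwartz_measurable[OF h] schwartz_measurable[OF schwartz_kern[OF schwartz_lpsym[OF q]]]
 have Pann: "ann (2 powi k / 2) (2 * 2 powi k) ?P"
  unfolding ann_def using schwartz_mop[OF slow_lpsym[OF q] h] lpsym_supp[OF q] inv_fourier_mop[OF slow_lpsym[OF q] h] by auto
 obtain C where C0: "C > 0" "\<forall>t>0. \<forall>F\<in>borel_measurable borel. (INN z. enorm (F z :: complex) * enorm (h (fst z + t *\<^sub>R snd z))) \<le> ennreal (C * t powr (- cexp TYPE('a) p)) * mixp p F"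
  using transported_dom[OF p1 h] by blast
 have C: "\<forall>F\<in>borel_measurable borel. (INN z. enorm (F z :: complex) * enorm (?H z)) \<le> ennreal (C * t powr (- cexp TYPE('a) p)) * mixp p F"
  using C0(2) t by blast
 have Hm: "?H \<in> borel_measurable borel" by measurable
 note adj = vconv_adjoint[OF p1 blocksD(4)[OF T] blocksD(3)[OF T] Hm C integrable_kern[OF d]]
 have kk: "(LIN w. ?K w * ?H (z - (0, w))) = ?P (fst z + t *\<^sub>R snd z)" for z
 proof -
  let ?g = "\<lambda>w. kern (lpsym \<phi> (2 powi k)) w * h ((fst z + t *\<^sub>R snd z) - w)"
  have "?K w * ?H (z - (0, w)) = of_real (t ^ DIM('a)) * ?g (0 + t *\<^sub>R w)" for w
   unfolding kern_lpsym[OF d] kern_lpsym[OF q] by (simp add: \<delta>_def power_mult_distrib scaleR_diff_right add_diff_eq mult.commute)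
  then have "(LIN w. ?K w * ?H (z - (0, w))) = (LIN w. of_real (t ^ DIM('a)) * ?g (0 + t *\<^sub>R w))" by simp
  also have "\<dots> = of_real (t ^ DIM('a)) * (LIN w. ?g (0 + t *\<^sub>R w))" by (rule integral_mult_right_zero)
  also have "\<dots> = \<bar>t\<bar> ^ DIM('a) *\<^sub>R (LIN w. ?g (0 + t *\<^sub>R w))" using t by (simp add: scaleR_conv_of_real)
  also have "\<dots> = (LIN w. ?g w)" by (rule integral_affine) (use t in auto)
  also have "\<dots> = ?P (fst z + t *\<^sub>R snd z)" by (rule mop_lpsym[OF q h, symmetric])
  finally show ?thesis .
 qed
 have "pair t (Fd F \<delta>) h = (\<Sum>k\<in>{dyad \<delta> - 3..dyad \<delta> + 3}. LIN z. vconv (F k) ?K z * ?H z)"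
  unfolding pair_def Fd_def sum_distrib_right by (rule Bochner_Integration.integral_sum) (rule adj(2))
 also have "\<dots> = (\<Sum>k\<in>{dyad \<delta> - 3..dyad \<delta> + 3}. pair t (F k) ?P)"
  unfolding adj(1) kk pair_def ..
 also have "\<dots> = Ilim T t ?P"
  by (rule Ilim_eq[OF T Pann _ t, symmetric]) (use dyad_powi_shift[OF d] in \<open>auto simp: \<delta>_def\<close>)
 finally show ?thesis unfolding \<delta>_def .
qed

end

section \<open>Sequence norms\<close>

abbreviation CZ :: "int measure" where "CZ \<equiv> count_space UNIV"

lemma sigma_finite_CZ: "sigma_finite_measure CZ"
 by (rule sigma_finite_measure_count_space)

lemma glp_CZ_ge: assumes q: "1 \<le> q" shows "c k \<le> glp CZ q c"
 using q
proof (cases q rule: exponent_cases)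
 case 1
 then show ?thesis using esssup_AE[of c CZ] by (simp add: glp_inf AE_count_space del: infinity_ennreal_def)
next
 case (2 r)
 have "ennpowr (c k) r = (\<integral>\<^sup>+j. ennpowr (c j) r * indicator {k} j \<partial>CZ)"
  by (subst nn_integral_count_space'[of "{k}"]) auto
 also have "\<dots> \<le> (\<integral>\<^sup>+j. ennpowr (c j) r \<partial>CZ)" by (intro nn_integral_mono) (auto simp: indicator_def)
 finally show ?thesis unfolding 2(1) glp_real[OF 2(2)] using 2(2) by (subst ennpowr_le_iff[symmetric]) auto
qed

text \<open>Exchanging the two sums counts every \<open>x j\<close> at most \<open>M\<close> times.\<close>

lemma glp_reindex:
 fixes J :: "int \<Rightarrow> int"
 assumes q: "1 \<le> q" and M: "1 \<le> M" "\<And>j. finite {k. J k = j}" "\<And>j. card {k. J k = j} \<le> M"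
 shows "glp CZ q (\<lambda>k. x (J k)) \<le> ennreal (real M) * glp CZ q x"
 using q
proof (cases q rule: exponent_cases)
 case 1
 have "esssup CZ (\<lambda>k. x (J k)) \<le> esssup CZ x"
  by (intro esssup_I) (auto simp: AE_count_space intro: glp_CZ_ge[of \<infinity> x, unfolded glp_inf])
 also have "\<dots> = ennreal 1 * esssup CZ x" by simp
 also have "\<dots> \<le> ennreal (real M) * esssup CZ x" using M(1) by (intro mult_right_mono ennreal_leI) auto
 finally show ?thesis unfolding 1 glp_inf .
next
 case (2 r)
 interpret P: pair_sigma_finite CZ CZ using sigma_finite_CZ by (simp add: pair_sigma_finite_def)
 let ?y = "\<lambda>j. ennpowr (x j) r"
 have "(\<integral>\<^sup>+k. ?y (J k) \<partial>CZ) = (\<integral>\<^sup>+k. \<integral>\<^sup>+j. ?y j * indicator {J k} j \<partial>CZ \<partial>CZ)"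
 proof (rule nn_integral_cong)
  show "?y (J k) = (\<integral>\<^sup>+j. ?y j * indicator {J k} j \<partial>CZ)" for k
   by (subst nn_integral_count_space'[of "{J k}"]) (auto simp: indicator_def)
 qed
 also have "\<dots> = (\<integral>\<^sup>+j. \<integral>\<^sup>+k. ?y j * indicator {J k} j \<partial>CZ \<partial>CZ)"
  by (rule P.Fubini'[symmetric]) (simp add: pair_measure_countable)
 also have "\<dots> \<le> (\<integral>\<^sup>+j. ennreal (real M) * ?y j \<partial>CZ)"
 proof (rule nn_integral_mono)
  fix j
  have "(\<integral>\<^sup>+k. ?y j * indicator {J k} j \<partial>CZ) = (\<Sum>k\<in>{k. J k = j}. ?y j)"
   by (subst nn_integral_count_space'[of "{k. J k = j}"]) (auto simp: M(2) indicator_def)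
  also have "\<dots> = ennreal (real (card {k. J k = j})) * ?y j" by (simp add: ennreal_of_nat_eq_real_of_nat)
  also have "\<dots> \<le> ennreal (real M) * ?y j" using M(3)[of j] by (intro mult_right_mono ennreal_leI) auto
  finally show "(\<integral>\<^sup>+k. ?y j * indicator {J k} j \<partial>CZ) \<le> ennreal (real M) * ?y j" .
 qed
 also have "\<dots> = ennreal (real M) * (\<integral>\<^sup>+j. ?y j \<partial>CZ)" by (rule nn_integral_cmult) simp
 finally have "ennpowr (\<integral>\<^sup>+k. ?y (J k) \<partial>CZ) (1 / r) \<le> ennpowr (ennreal (real M) * (\<integral>\<^sup>+j. ?y j \<partial>CZ)) (1 / r)"
  using 2(2) by (intro ennpowr_mono) auto
 also have "\<dots> = ennreal (real M powr (1 / r)) * ennpowr (\<integral>\<^sup>+j. ?y j \<partial>CZ) (1 / r)"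
  using 2(2) by (simp add: ennpowr_mult ennpowr_ennreal)
 also have "\<dots> \<le> ennreal (real M) * ennpowr (\<integral>\<^sup>+j. ?y j \<partial>CZ) (1 / r)"
 proof (intro mult_right_mono ennreal_leI)
  have "real M powr (1 / r) \<le> real M powr 1" using 2(2) M(1) by (intro powr_mono) auto
  then show "real M powr (1 / r) \<le> real M" using M(1) by simp
 qed auto
 finally show ?thesis unfolding 2(1) glp_real[OF 2(2)] .
qed

text \<open>A block at frequency \<open>\<delta>\<close> meets at most the seven dyadic blocks around \<open>dyad \<delta>\<close>.\<close>

definition S7 :: "(int \<Rightarrow> ennreal) \<Rightarrow> int \<Rightarrow> ennreal" where "S7 x j = (\<Sum>k\<in>{j - 3..j + 3}. x k)"

lemma S7_shift: "S7 x j = (\<Sum>r\<in>{-3..3}. x (j + r))"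
 unfolding S7_def by (rule sum.reindex_bij_witness[of _ "\<lambda>r. j + r" "\<lambda>k. k - j"]) auto

text \<open>At most \<open>\<lceil>1 / \<mu>\<rceil>\<close> of the frequencies \<open>c 2\<^sup>k\<^sup>\<mu>\<close> lie in the same dyadic interval, with a bound independent of \<open>c\<close>.\<close>

lemma S7_lq:
 assumes q: "1 \<le> q" and c: "c > 0" and \<mu>: "\<mu> > 0"
 shows "glp CZ q (\<lambda>k. S7 x (dyad (c * 2 powr (of_int k * \<mu>)))) \<le> ennreal (7 * real (nat \<lceil>1 / \<mu>\<rceil>)) * glp CZ q x"
proof -
 define M where "M = nat \<lceil>1 / \<mu>\<rceil>"
 define J where "J r k = dyad (c * 2 powr (of_int k * \<mu>)) + r" for r k :: int
 have "\<lceil>1 / \<mu>\<rceil> \<ge> 1" using \<mu> by simp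
 then have M: "1 \<le> M" unfolding M_def by linarith
 have J: "finite {k. J r k = j} \<and> card {k. J r k = j} \<le> M" for r j
 proof -
  define k0 where "k0 = \<lceil>(of_int (j - r) - log 2 c) / \<mu>\<rceil>"
  have "{k. J r k = j} \<subseteq> {k0..<k0 + \<lceil>1 / \<mu>\<rceil>}"
  proof
   fix k assume "k \<in> {k. J r k = j}"
   then have "\<lfloor>log 2 (c * 2 powr (of_int k * \<mu>))\<rfloor> = j - r" by (simp add: J_def dyad_def)
   moreover have "log 2 (c * 2 powr (of_int k * \<mu>)) = log 2 c + of_int k * \<mu>" using c by (simp add: log_mult)
   ultimately have "\<lfloor>log 2 c + of_int k * \<mu>\<rfloor> = j - r" by simp
   then have b: "of_int (j - r) \<le> log 2 c + of_int k * \<mu>" "log 2 c + of_int k * \<mu> < of_int (j - r) + 1" by linarith+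
   then have "(of_int (j - r) - log 2 c) / \<mu> \<le> of_int k" using \<mu> by (simp add: pos_divide_le_eq)
   then have k0: "k0 \<le> k" unfolding k0_def by (simp add: ceiling_le_iff)
   have "of_int k < (of_int (j - r) - log 2 c) / \<mu> + 1 / \<mu>"
    unfolding add_divide_distrib[symmetric] using b(2) \<mu> by (simp add: pos_less_divide_eq algebra_simps)
   also have "\<dots> \<le> of_int k0 + of_int \<lceil>1 / \<mu>\<rceil>" unfolding k0_def by (intro add_mono le_of_int_ceiling)
   finally have "k < k0 + \<lceil>1 / \<mu>\<rceil>" by linarith
   with k0 show "k \<in> {k0..<k0 + \<lceil>1 / \<mu>\<rceil>}" by simp
  qed
  from finite_subset[OF this] card_mono[OF _ this] show ?thesis by (simp add: M_def)
 qed
 have "glp CZ q (\<lambda>k. S7 x (dyad (c * 2 powr (of_int k * \<mu>)))) = glp CZ q (\<lambda>k. \<Sum>r\<in>{-3..3}. x (J r k))"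
  unfolding S7_shift J_def ..
 also have "\<dots> \<le> (\<Sum>r\<in>{-3..3}. glp CZ q (\<lambda>k. x (J r k)))"
  by (rule glp_sum[OF q sigma_finite_CZ]) auto
 also have "\<dots> \<le> (\<Sum>r\<in>{-3..3::int}. ennreal (real M) * glp CZ q x)"
  by (intro sum_mono glp_reindex[OF q M]) (use J in auto)
 also have "\<dots> = ennreal (7 * real M) * glp CZ q x" by (simp add: ennreal_mult mult.assoc)
 finally show ?thesis unfolding M_def .
qed

lemma nn_integral_powr_01:
 assumes "a > -1"
 shows "(INN x. ennreal (x powr a) * indicator {0<..<1} x) = ennreal (1 / (a + 1))"
proof -
 have "((\<lambda>x. x powr a) has_integral (1 powr (a + 1) / (a + 1))) {0..1}"
  by (rule has_integral_powr_from_0) (use assms in auto)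
 then have "((\<lambda>x. x powr a) has_integral (1 / (a + 1))) {0<..<1}"
  by (subst (asm) has_integral_Icc_iff_Ioo) simp
 then have "((\<lambda>x. if x \<in> {0<..<1} then x powr a else 0) has_integral (1 / (a + 1))) UNIV"
  by (simp only: has_integral_restrict_UNIV)
 then have "(INN x. ennreal (if x \<in> {0<..<1} then x powr a else 0)) = ennreal (1 / (a + 1))"
  by (intro nn_integral_has_integral_lborel) (use assms in auto)
 also have "(INN x. ennreal (if x \<in> {0<..<1} then x powr a else 0)) = (INN x. ennreal (x powr a) * indicator {0<..<1} x)"
  by (intro nn_integral_cong) (auto simp: indicator_def)
 finally show ?thesis .
qed

text \<open>Balancing the two terms gives \<open>\<tau> = (A / B) powr (1 / (a + b))\<close>. If \<open>A\<close> or \<open>B\<close> vanishes, let \<open>\<tau>\<close> tend to \<open>0\<close> or to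
infinity instead.\<close>

lemma optimize_scale:
 fixes A B E :: ennreal and a b C1 C2 :: real
 assumes a: "a > 0" and b: "b > 0" and C: "C1 \<ge> 0" "C2 \<ge> 0" and fin: "A < \<infinity>" "B < \<infinity>"
  and E: "\<And>\<tau>::real. \<tau> > 0 \<Longrightarrow> E \<le> ennreal (C1 * \<tau> powr (- a)) * A + ennreal (C2 * \<tau> powr b) * B"
 shows "E \<le> ennreal (C1 + C2) * ennpowr A (b / (a + b)) * ennpowr B (a / (a + b))"
proof -
 obtain A' B' where AB: "A = ennreal A'" "B = ennreal B'" "A' \<ge> 0" "B' \<ge> 0" using fin by (cases A; cases B) auto
 have E': "E \<le> ennreal (C1 * \<tau> powr (- a) * A' + C2 * \<tau> powr b * B')" if "\<tau> > 0" for \<tau>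
  using E[OF that] AB C by (simp add: ennreal_mult)
 consider "A' = 0" | "B' = 0" | "A' > 0" "B' > 0" using AB by fastforce
 then show ?thesis
 proof cases
  case 1
  have "(\<lambda>n. ennreal (C2 * (1 / real (Suc n)) powr b * B')) \<longlonglongrightarrow> ennreal (C2 * 0 powr b * B')"
   using b LIMSEQ_inverse_real_of_nat
   by (intro tendsto_ennrealI tendsto_intros tendsto_powr') (auto simp: inverse_eq_divide)
  moreover have "E \<le> ennreal (C2 * (1 / real (Suc n)) powr b * B')" for n
   using E'[of "1 / real (Suc n)"] 1 by simp
  ultimately have "E \<le> ennreal (C2 * 0 powr b * B')" by (intro LIMSEQ_le_const) auto
  then show ?thesis by simp
 next
  case 2
  have "(\<lambda>n. ennreal (C1 * (1 / real (Suc n)) powr a * A')) \<longlonglongrightarrow> ennreal (C1 * 0 powr a * A')"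
   using a LIMSEQ_inverse_real_of_nat
   by (intro tendsto_ennrealI tendsto_intros tendsto_powr') (auto simp: inverse_eq_divide)
  moreover have "E \<le> ennreal (C1 * (1 / real (Suc n)) powr a * A')" for n
  proof -
   have "real (Suc n) powr (- a) = (1 / real (Suc n)) powr a" by (simp add: powr_minus inverse_powr divide_inverse)
   then show ?thesis using E'[of "real (Suc n)"] 2 by simp
  qed
  ultimately have "E \<le> ennreal (C1 * 0 powr a * A')" by (intro LIMSEQ_le_const) auto
  then show ?thesis by simp
 next
  case 3
  define \<tau> where "\<tau> = (A' / B') powr (1 / (a + b))"
  have t: "\<tau> > 0" using 3 by (simp add: \<tau>_def)
  have ab: "a + b > 0" using a b by simp
  have e1: "\<tau> powr (- a) * A' = A' powr (b / (a + b)) * B' powr (a / (a + b))"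
  proof -
   have "\<tau> powr (- a) * A' = (A' powr (- (a / (a + b))) / B' powr (- (a / (a + b)))) * A' powr 1"
    using 3 by (simp add: \<tau>_def powr_powr powr_divide)
   also have "\<dots> = A' powr (1 - a / (a + b)) * B' powr (a / (a + b))"
    using 3 by (simp add: powr_minus powr_diff divide_inverse mult_ac)
   also have "1 - a / (a + b) = b / (a + b)" using ab by (simp add: field_simps)
   finally show ?thesis .
  qed
  have e2: "\<tau> powr b * B' = A' powr (b / (a + b)) * B' powr (a / (a + b))"
  proof -
   have "\<tau> powr b * B' = (A' powr (b / (a + b)) / B' powr (b / (a + b))) * B' powr 1"
    using 3 by (simp add: \<tau>_def powr_powr powr_divide)
   also have "\<dots> = A' powr (b / (a + b)) * B' powr (1 - b / (a + b))"
    using 3 by (simp add: powr_diff)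
   also have "1 - b / (a + b) = a / (a + b)" using ab by (simp add: field_simps)
   finally show ?thesis .
  qed
  have "C1 * \<tau> powr (- a) * A' + C2 * \<tau> powr b * B' = (C1 + C2) * A' powr (b / (a + b)) * B' powr (a / (a + b))"
  proof -
   have "C1 * \<tau> powr (- a) * A' + C2 * \<tau> powr b * B' = C1 * (\<tau> powr (- a) * A') + C2 * (\<tau> powr b * B')" by simp
   also have "\<dots> = (C1 + C2) * A' powr (b / (a + b)) * B' powr (a / (a + b))" unfolding e1 e2 by (simp add: algebra_simps)
   finally show ?thesis .
  qed
  then have "E \<le> ennreal ((C1 + C2) * A' powr (b / (a + b)) * B' powr (a / (a + b)))" using E'[OF t] by simp
  then show ?thesis using AB C by (simp add: ennpowr_ennreal ennreal_mult)
 qed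
qed

section \<open>Choice of the time scale\<close>

locale Avg = LPp \<psi> \<phi> p for \<psi> \<phi> :: "'a::euclidean_space \<Rightarrow> real" and p :: ennreal +
 fixes q :: ennreal and \<alpha> \<beta> d s :: real
 assumes q1: "1 \<le> q" and d: "d = real DIM('a) * (1 - enn2real (inverse p))"
  and \<alpha>: "\<alpha> > - d" and \<beta>: "\<beta> < 1 - d" and s: "s = (\<alpha> + d) / (1 + \<alpha> - \<beta>) - d"
begin

lemma cexp_d: "cexp TYPE('a) p = d" by (simp add: cexp_def d)

definition m :: real where "m = 1 + \<alpha> - \<beta>"

lemma m_pos: "m > 0" using \<alpha> \<beta> by (simp add: m_def)

lemma s_eq: "s = (\<alpha> + d) / m - d" using s by (simp add: m_def)

text \<open>The time at which the formula is used for the frequency \<open>2\<^sup>k\<close>. The exponent is chosen such that the weight \<open>2\<^sup>k\<^sup>s\<close>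
compensates the \<open>k\<close>-dependence of both terms simultaneously; this determines \<open>s\<close>.\<close>

definition tk :: "real \<Rightarrow> int \<Rightarrow> real" where "tk \<tau> k = \<tau> * 2 powr (of_int k * (1 / m - 1))"

lemma tk_pos: "\<tau> > 0 \<Longrightarrow> tk \<tau> k > 0" by (simp add: tk_def)

lemma powi_powr: "(2::real) powi k = 2 powr of_int k" by (simp add: powr_real_of_int')

lemma tk_freq: "tk \<tau> k * 2 powi k = \<tau> * 2 powr (of_int k * (1 / m))"
 unfolding tk_def powi_powr by (simp add: mult.assoc powr_add[symmetric] algebra_simps)

lemma tk_weight_f:
 assumes "\<tau> > 0"
 shows "2 powr (of_int k * s) * (tk \<tau> k powr (- d) * (tk \<tau> k * 2 powi k) powr (- \<alpha>)) = \<tau> powr (- (\<alpha> + d))"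
proof -
 have e: "of_int k * s + (of_int k * (1 / m - 1)) * (- d) + (of_int k * (1 / m)) * (- \<alpha>) = 0"
  using m_pos by (simp add: s_eq field_simps)
 have "2 powr (of_int k * s) * (tk \<tau> k powr (- d) * (tk \<tau> k * 2 powi k) powr (- \<alpha>))
  = (\<tau> powr (- d) * \<tau> powr (- \<alpha>)) * (2 powr (of_int k * s) * 2 powr ((of_int k * (1 / m - 1)) * (- d)) * 2 powr ((of_int k * (1 / m)) * (- \<alpha>)))"
  unfolding tk_freq using assms by (simp only: tk_def powr_mult powr_powr mult_ac)
 also have "\<dots> = \<tau> powr (- d + - \<alpha>) * 2 powr (of_int k * s + (of_int k * (1 / m - 1)) * (- d) + (of_int k * (1 / m)) * (- \<alpha>))"
  by (simp only: powr_add)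
 finally show ?thesis unfolding e by (simp add: algebra_simps)
qed

lemma tk_weight_g:
 assumes "\<tau> > 0"
 shows "2 powr (of_int k * s) * (tk \<tau> k * (tk \<tau> k powr (- d) * (tk \<tau> k * 2 powi k) powr (- \<beta>))) = \<tau> powr (1 - d - \<beta>)"
proof -
 have e: "of_int k * s + (of_int k * (1 / m - 1)) + (of_int k * (1 / m - 1)) * (- d) + (of_int k * (1 / m)) * (- \<beta>) = 0"
 proof -
  have "of_int k * s + (of_int k * (1 / m - 1)) + (of_int k * (1 / m - 1)) * (- d) + (of_int k * (1 / m)) * (- \<beta>)
   = of_int k * ((1 + \<alpha> - \<beta>) / m - 1)"
   by (simp only: s_eq ring_distribs divide_inverse) (simp add: algebra_simps)
  then show ?thesis using m_pos by (simp add: m_def)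
 qed
 have "2 powr (of_int k * s) * (tk \<tau> k * (tk \<tau> k powr (- d) * (tk \<tau> k * 2 powi k) powr (- \<beta>)))
  = (\<tau> * \<tau> powr (- d) * \<tau> powr (- \<beta>)) * (2 powr (of_int k * s) * 2 powr (of_int k * (1 / m - 1)) * 2 powr ((of_int k * (1 / m - 1)) * (- d)) * 2 powr ((of_int k * (1 / m)) * (- \<beta>)))"
  unfolding tk_freq using assms by (simp only: tk_def powr_mult powr_powr mult_ac)
 also have "\<tau> * \<tau> powr (- d) * \<tau> powr (- \<beta>) = \<tau> powr (1 + - d + - \<beta>)"
  using assms by (simp only: powr_add powr_one)
 also have "2 powr (of_int k * s) * 2 powr (of_int k * (1 / m - 1)) * 2 powr ((of_int k * (1 / m - 1)) * (- d)) * 2 powr ((of_int k * (1 / m)) * (- \<beta>))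
  = 2 powr (of_int k * s + (of_int k * (1 / m - 1)) + (of_int k * (1 / m - 1)) * (- d) + (of_int k * (1 / m)) * (- \<beta>))"
  by (simp only: powr_add)
 finally show ?thesis unfolding e by (simp add: algebra_simps)
qed

definition xs :: "real \<Rightarrow> (int \<Rightarrow> 'a \<times> 'a \<Rightarrow> complex) \<Rightarrow> int \<Rightarrow> ennreal" where
 "xs a F k = ennreal (2 powr (of_int k * a)) * mixp p (F k)"

lemma sum_mixp_le:
 assumes \<delta>: "\<delta> > 0"
 shows "(\<Sum>k\<in>{dyad \<delta> - 3..dyad \<delta> + 3}. mixp p (F k)) \<le> ennreal (2 powr (4 * \<bar>a\<bar>) * \<delta> powr (- a)) * S7 (xs a F) (dyad \<delta>)"
 unfolding S7_def sum_distrib_left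
proof (rule sum_mono)
 fix k assume k: "k \<in> {dyad \<delta> - 3..dyad \<delta> + 3}"
 define l where "l = log 2 \<delta>"
 have dl: "\<delta> = 2 powr l" using \<delta> by (simp add: l_def)
 have "\<bar>l - of_int k\<bar> \<le> 4" using k unfolding dyad_def l_def[symmetric] by (simp, linarith)
 then have "\<bar>l - of_int k\<bar> * \<bar>a\<bar> \<le> 4 * \<bar>a\<bar>" by (rule mult_right_mono) simp
 then have "(l - of_int k) * a \<le> 4 * \<bar>a\<bar>" by (metis abs_mult abs_le_D1)
 then have "2 powr (- (of_int k * a)) \<le> 2 powr (4 * \<bar>a\<bar> + l * (- a))" by (intro powr_mono) (auto simp: algebra_simps)
 also have "\<dots> = 2 powr (4 * \<bar>a\<bar>) * \<delta> powr (- a)" unfolding dl by (simp only: powr_add powr_powr)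
 finally have le: "2 powr (- (of_int k * a)) \<le> 2 powr (4 * \<bar>a\<bar>) * \<delta> powr (- a)" .
 have "mixp p (F k) = (ennreal (2 powr (- (of_int k * a))) * ennreal (2 powr (of_int k * a))) * mixp p (F k)"
  by (simp add: ennreal_mult[symmetric] powr_add[symmetric])
 also have "\<dots> = ennreal (2 powr (- (of_int k * a))) * xs a F k" by (simp add: xs_def mult.assoc)
 also have "\<dots> \<le> ennreal (2 powr (4 * \<bar>a\<bar>) * \<delta> powr (- a)) * xs a F k" by (intro mult_right_mono ennreal_leI le) auto
 finally show "mixp p (F k) \<le> ennreal (2 powr (4 * \<bar>a\<bar>) * \<delta> powr (- a)) * xs a F k" .
qed

text \<open>The contribution of \<open>f\<close>: the dispersive factor at time \<open>tk \<tau> k\<close> and the regularity at frequency \<open>tk \<tau> k 2\<^sup>k\<close>.\<close>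

lemma f_term_le:
 assumes "\<tau> > 0"
 shows "ennreal (2 powr (of_int k * s)) * (ennreal (tk \<tau> k powr (- d)) * (\<Sum>j\<in>{dyad (tk \<tau> k * 2 powi k) - 3..dyad (tk \<tau> k * 2 powi k) + 3}. mixp p (F j)))
  \<le> ennreal (2 powr (4 * \<bar>\<alpha>\<bar>) * \<tau> powr (- (\<alpha> + d))) * S7 (xs \<alpha> F) (dyad (\<tau> * 2 powr (of_int k * (1 / m))))"
proof -
 let ?\<delta> = "tk \<tau> k * 2 powi k"
 have \<delta>: "?\<delta> > 0" using tk_pos[OF assms] by simp
 have "ennreal (2 powr (of_int k * s)) * (ennreal (tk \<tau> k powr (- d)) * (\<Sum>j\<in>{dyad ?\<delta> - 3..dyad ?\<delta> + 3}. mixp p (F j)))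
  \<le> ennreal (2 powr (of_int k * s)) * (ennreal (tk \<tau> k powr (- d)) * (ennreal (2 powr (4 * \<bar>\<alpha>\<bar>) * ?\<delta> powr (- \<alpha>)) * S7 (xs \<alpha> F) (dyad ?\<delta>)))"
  by (intro mult_left_mono sum_mixp_le \<delta>) auto
 also have "\<dots> = ennreal (2 powr (4 * \<bar>\<alpha>\<bar>) * (2 powr (of_int k * s) * (tk \<tau> k powr (- d) * ?\<delta> powr (- \<alpha>)))) * S7 (xs \<alpha> F) (dyad ?\<delta>)"
  by (simp add: ennreal_mult mult_ac)
 finally show ?thesis unfolding tk_weight_f[OF assms] unfolding tk_freq .
qed

text \<open>The contribution of \<open>g\<close>, with the time rescaled to \<open>(0, 1)\<close>, so that the weight \<open>\<sigma> powr (- d - \<beta>)\<close> is the same for all \<open>k\<close>.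
It is integrable because \<open>\<beta> < 1 - d\<close>.\<close>

lemma g_term_le:
 assumes "\<tau> > 0"
 shows "ennreal (2 powr (of_int k * s)) * (INN t. indicator {0<..<tk \<tau> k} t * (ennreal (t powr (- d)) * (\<Sum>j\<in>{dyad (t * 2 powi k) - 3..dyad (t * 2 powi k) + 3}. mixp p (G j))))
  \<le> (INN \<sigma>. indicator {0<..<1} \<sigma> * (ennreal (2 powr (4 * \<bar>\<beta>\<bar>) * \<tau> powr (1 - d - \<beta>) * \<sigma> powr (- d - \<beta>)) * S7 (xs \<beta> G) (dyad (\<sigma> * \<tau> * 2 powr (of_int k * (1 / m))))))"
proof -
 define t0 where "t0 = tk \<tau> k"
 have t0: "t0 > 0" unfolding t0_def by (rule tk_pos[OF assms])
 have dm [measurable]: "dyad \<in> borel \<rightarrow>\<^sub>M count_space UNIV" unfolding dyad_def[abs_def] by measurable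
 let ?h = "\<lambda>t. indicator {0<..<t0} t * (ennreal (t powr (- d)) * (\<Sum>j\<in>{dyad (t * 2 powi k) - 3..dyad (t * 2 powi k) + 3}. mixp p (G j))) :: ennreal"
 have hm: "?h \<in> borel_measurable borel"
 proof -
  have "(\<lambda>t. (\<lambda>i. \<Sum>j\<in>{i - 3..i + 3}. mixp p (G j)) (dyad (t * 2 powi k))) \<in> borel_measurable borel"
   by (rule measurable_compose[of _ _ "count_space UNIV"]) measurable
  then show ?thesis by measurable
 qed
 have "(INN t. ?h t) = ennreal \<bar>t0\<bar> * (INN \<sigma>. ?h (0 + t0 * \<sigma>))"
  by (rule nn_integral_real_affine[OF hm]) (use t0 in auto)
 also have "\<dots> = (INN \<sigma>. ennreal t0 * ?h (t0 * \<sigma>))"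
  using hm t0 by (subst nn_integral_cmult) auto
 finally have "ennreal (2 powr (of_int k * s)) * (INN t. ?h t) = (INN \<sigma>. ennreal (2 powr (of_int k * s)) * (ennreal t0 * ?h (t0 * \<sigma>)))"
  using hm by (subst nn_integral_cmult) auto
 also have "\<dots> \<le> (INN \<sigma>. indicator {0<..<1} \<sigma> * (ennreal (2 powr (4 * \<bar>\<beta>\<bar>) * \<tau> powr (1 - d - \<beta>) * \<sigma> powr (- d - \<beta>)) * S7 (xs \<beta> G) (dyad (\<sigma> * \<tau> * 2 powr (of_int k * (1 / m))))))"
 proof (rule nn_integral_mono)
  fix \<sigma> :: real
  show "ennreal (2 powr (of_int k * s)) * (ennreal t0 * ?h (t0 * \<sigma>))
   \<le> indicator {0<..<1} \<sigma> * (ennreal (2 powr (4 * \<bar>\<beta>\<bar>) * \<tau> powr (1 - d - \<beta>) * \<sigma> powr (- d - \<beta>)) * S7 (xs \<beta> G) (dyad (\<sigma> * \<tau> * 2 powr (of_int k * (1 / m)))))"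
  proof (cases "\<sigma> \<in> {0<..<1}")
   case False
   then have "t0 * \<sigma> \<notin> {0<..<t0}" using t0 by (auto simp: zero_less_mult_iff)
   then show ?thesis by simp
  next
   case True
   let ?\<delta> = "t0 * \<sigma> * 2 powi k"
   have \<delta>: "?\<delta> > 0" using t0 True by simp
   have "ennreal (2 powr (of_int k * s)) * (ennreal t0 * ?h (t0 * \<sigma>))
    \<le> ennreal (2 powr (of_int k * s)) * (ennreal t0 * (ennreal ((t0 * \<sigma>) powr (- d)) * (\<Sum>j\<in>{dyad ?\<delta> - 3..dyad ?\<delta> + 3}. mixp p (G j))))"
    by (intro mult_left_mono) (auto simp: indicator_def)
   also have "\<dots> \<le> ennreal (2 powr (of_int k * s)) * (ennreal t0 * (ennreal ((t0 * \<sigma>) powr (- d)) * (ennreal (2 powr (4 * \<bar>\<beta>\<bar>) * ?\<delta> powr (- \<beta>)) * S7 (xs \<beta> G) (dyad ?\<delta>))))"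
    by (intro mult_left_mono sum_mixp_le \<delta>) auto
   also have "\<dots> = ennreal (2 powr (4 * \<bar>\<beta>\<bar>) * (2 powr (of_int k * s) * (t0 * (t0 powr (- d) * (t0 * 2 powi k) powr (- \<beta>)))) * \<sigma> powr (- d - \<beta>)) * S7 (xs \<beta> G) (dyad ?\<delta>)"
   proof -
    have "?\<delta> powr (- \<beta>) = (t0 * 2 powi k) powr (- \<beta>) * \<sigma> powr (- \<beta>)"
     using t0 True by (simp add: powr_mult[symmetric] mult_ac)
    moreover have "(t0 * \<sigma>) powr (- d) = t0 powr (- d) * \<sigma> powr (- d)" using t0 True by (simp add: powr_mult)
    moreover have "\<sigma> powr (- d - \<beta>) = \<sigma> powr (- d) * \<sigma> powr (- \<beta>)" by (simp add: powr_add[symmetric])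
    ultimately show ?thesis using t0 by (simp add: ennreal_mult mult_ac)
   qed
   finally have le: "ennreal (2 powr (of_int k * s)) * (ennreal t0 * ?h (t0 * \<sigma>)) \<le> ennreal (2 powr (4 * \<bar>\<beta>\<bar>) * (2 powr (of_int k * s) * (t0 * (t0 powr (- d) * (t0 * 2 powi k) powr (- \<beta>)))) * \<sigma> powr (- d - \<beta>)) * S7 (xs \<beta> G) (dyad ?\<delta>)" .
   have de: "?\<delta> = \<sigma> * \<tau> * 2 powr (of_int k * (1 / m))" using tk_freq[of \<tau> k] by (simp add: t0_def mult_ac)
   have "ennreal (2 powr (of_int k * s)) * (ennreal t0 * ?h (t0 * \<sigma>)) \<le> ennreal (2 powr (4 * \<bar>\<beta>\<bar>) * \<tau> powr (1 - d - \<beta>) * \<sigma> powr (- d - \<beta>)) * S7 (xs \<beta> G) (dyad ?\<delta>)"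
    using le tk_weight_g[OF assms, of k, folded t0_def] by simp
   then show ?thesis using True unfolding de by simp
  qed
 qed
 finally show ?thesis unfolding t0_def .
qed

end

section \<open>Transport averaged over a time interval\<close>

lemma shear_time_measurable:
 fixes H :: "real \<Rightarrow> 'a::euclidean_space \<times> 'a \<Rightarrow> 'b::euclidean_space"
 assumes H: "(\<lambda>(s, z). H s z) \<in> borel_measurable borel"
 shows "(\<lambda>q. H (snd (fst q)) (fst (fst q) - snd (fst q) *\<^sub>R snd q, snd q)) \<in> borel_measurable ((borel \<Otimes>\<^sub>M lborel) \<Otimes>\<^sub>M lborel)"
proof -
 have "(\<lambda>q. (snd (fst q), (fst (fst q) - snd (fst q) *\<^sub>R snd q, snd q)) :: real \<times> ('a \<times> 'a)) \<in> borel_measurable (borel :: (('a \<times> real) \<times> 'a) measure)"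
  by (intro borel_measurable_continuous_onI continuous_intros)
 from measurable_compose[OF this H] show ?thesis
  by (simp add: borel_prod[symmetric] case_prod_unfold cong: measurable_cong_sets)
qed

text \<open>Fubini's theorem for \<open>(x, (s, v))\<close>: the absolute integrability is checked by integrating in \<open>x\<close> first, after
undoing the shear.\<close>

lemma shear_time:
 fixes H :: "real \<Rightarrow> 'a::euclidean_space \<times> 'a \<Rightarrow> complex" and a :: "'a \<Rightarrow> complex"
 assumes H: "(\<lambda>(s, z). H s z) \<in> borel_measurable borel" and a [measurable]: "a \<in> borel_measurable borel"
  and fin: "(INN s. INN z. enorm (H s z) * enorm (a (fst z + s *\<^sub>R snd z))) < \<infinity>"
  and int: "\<And>s. integrable lborel (\<lambda>z. H s z * a (fst z + s *\<^sub>R snd z))"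
 shows "AE x in lborel. integrable lborel (\<lambda>w. H (fst w) (x - fst w *\<^sub>R snd w, snd w) * a x)"
  and "integrable lborel (\<lambda>x. (LIN s. LIN v. H s (x - s *\<^sub>R v, v)) * a x)"
  and "(LIN x. (LIN s. LIN v. H s (x - s *\<^sub>R v, v)) * a x)
   = (LIN s. LIN z. H s z * a (fst z + s *\<^sub>R snd z))"
  and "(\<lambda>x. LIN s. LIN v. H s (x - s *\<^sub>R v, v)) \<in> borel_measurable borel"
proof -
 define \<Phi> where "\<Phi> x w = H (fst w) (x - fst w *\<^sub>R snd w, snd w) * a x" for x w
 have H1: "(\<lambda>q. H (fst q) (snd q)) \<in> borel_measurable borel" using H by (simp add: case_prod_unfold)
 have "(\<lambda>q. (fst (snd q), (fst q - fst (snd q) *\<^sub>R snd (snd q), snd (snd q))) :: real \<times> ('a \<times> 'a)) \<in> borel_measurable (borel :: ('a \<times> (real \<times> 'a)) measure)"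
  by (intro borel_measurable_continuous_onI continuous_intros)
 from measurable_compose[OF this H1]
 have m1 [measurable]: "(\<lambda>q. H (fst (snd q)) (fst q - fst (snd q) *\<^sub>R snd (snd q), snd (snd q))) \<in> borel_measurable (borel :: ('a \<times> (real \<times> 'a)) measure)" by simp
 have "(\<lambda>q. \<Phi> (fst q) (snd q)) \<in> borel_measurable borel" unfolding \<Phi>_def by measurable
 then have \<Phi>m [measurable]: "case_prod \<Phi> \<in> borel_measurable (lborel \<Otimes>\<^sub>M lborel)"
  unfolding borel_pair by (simp add: case_prod_unfold)
 note m2 [measurable] = shear_time_measurable[OF H]
 have zm: "(\<lambda>z. H s z) \<in> borel_measurable borel" for s
  by (rule measurable_compose[OF _ H1, of "\<lambda>z. (s, z)", simplified]) (intro borel_measurable_continuous_onI continuous_intros)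
 have "(\<integral>\<^sup>+q. enorm (case_prod \<Phi> q) \<partial>(lborel \<Otimes>\<^sub>M lborel)) = (INN w. INN x. enorm (\<Phi> x w))"
  by (subst lborel_pair.nn_integral_snd[symmetric]) auto
 also have "\<dots> = (INN s. INN v. INN x. enorm (\<Phi> x (s, v)))"
 proof -
  have [measurable]: "(\<lambda>w. INN x. enorm (\<Phi> x w)) \<in> borel_measurable (lborel \<Otimes>\<^sub>M lborel)"
   unfolding lborel_prod by measurable
  show ?thesis by (subst lborel_prod[symmetric], subst lborel.nn_integral_fst[symmetric]) auto
 qed
 also have "\<dots> = (INN s. INN z. enorm (H s z) * enorm (a (fst z + s *\<^sub>R snd z)))"
 proof (rule nn_integral_cong)
  fix s :: real
  note [measurable] = zm[of s]
  let ?f = "\<lambda>z. enorm (H s z) * enorm (a (fst z + s *\<^sub>R snd z))"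
  have fm: "?f \<in> borel_measurable borel" by measurable
  have "(INN z. ?f z) = (INN v. INN y. ?f (y, v))"
   unfolding lborel_prod[symmetric] by (rule lborel_pair.nn_integral_snd[symmetric]) (use fm in \<open>simp add: borel_pair\<close>)
  also have "\<dots> = (INN v. INN x. enorm (\<Phi> x (s, v)))"
  proof (rule nn_integral_cong)
   fix v :: 'a
   have "(\<lambda>x. (x - s *\<^sub>R v, v)) \<in> borel_measurable borel" by (intro borel_measurable_continuous_onI continuous_intros)
   from measurable_compose[OF this zm] have [measurable]: "(\<lambda>x. H s (x - s *\<^sub>R v, v)) \<in> borel_measurable borel" .
   have "(\<lambda>x. enorm (\<Phi> x (s, v))) \<in> borel_measurable borel" unfolding \<Phi>_def fst_conv snd_conv by measurable
   from nn_integral_affine[OF _ this, of 1 "s *\<^sub>R v"]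
   show "(INN y. ?f (y, v)) = (INN x. enorm (\<Phi> x (s, v)))"
    by (simp add: \<Phi>_def norm_mult ennreal_mult add.commute)
  qed
  finally show "(INN v. INN x. enorm (\<Phi> x (s, v))) = (INN z. ?f z)" ..
 qed
 finally have i: "integrable (lborel \<Otimes>\<^sub>M lborel) (case_prod \<Phi>)"
  using fin by (intro integrableI_bounded) auto
 have AE: "AE x in lborel. integrable lborel (\<Phi> x)" using lborel_pair.AE_integrable_fst[OF i] .
 then show "AE x in lborel. integrable lborel (\<lambda>w. H (fst w) (x - fst w *\<^sub>R snd w, snd w) * a x)" unfolding \<Phi>_def .
 let ?U = "\<lambda>x. (LIN s. LIN v. H s (x - s *\<^sub>R v, v)) * a x"
 have eq: "AE x in lborel. ?U x = (LIN w. \<Phi> x w)"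
  using AE
 proof eventually_elim
  case (elim x)
  have "(LIN w. \<Phi> x w) = (LIN s. LIN v. \<Phi> x (s, v))"
   using elim unfolding lborel_prod[symmetric] by (subst lborel_pair.integral_fst'[symmetric]) auto
  then show ?case by (simp only: \<Phi>_def fst_conv snd_conv integral_mult_left_zero)
 qed
 show Vm: "(\<lambda>x. LIN s. LIN v. H s (x - s *\<^sub>R v, v)) \<in> borel_measurable borel"
  by (intro lborel.borel_measurable_lebesgue_integral) (use m2 in \<open>simp add: case_prod_unfold\<close>)
 have Um: "?U \<in> borel_measurable lborel" using Vm by measurable
 have Jm: "(\<lambda>x. LIN w. \<Phi> x w) \<in> borel_measurable lborel" using lborel_pair.integrable_fst[OF i] by simp
 show "integrable lborel ?U"
  using lborel_pair.integrable_fst[OF i] integrable_cong_AE[OF Um Jm eq] by simp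
 have "(LIN x. ?U x) = (LIN x. LIN w. \<Phi> x w)"
  by (rule integral_cong_AE[OF Um Jm eq])
 also have "\<dots> = (LIN w. LIN x. \<Phi> x w)" using lborel_pair.Fubini_integral[OF i] by simp
 also have "\<dots> = (LIN s. LIN v. LIN x. \<Phi> x (s, v))"
  using lborel_pair.integrable_snd[OF i] unfolding lborel_prod[symmetric] by (subst lborel_pair.integral_fst'[symmetric]) auto
 also have "\<dots> = (LIN s. LIN z. H s z * a (fst z + s *\<^sub>R snd z))"
 proof (rule LINT_cong)
  fix s :: real
  let ?f = "\<lambda>z. H s z * a (fst z + s *\<^sub>R snd z)"
  have ip: "integrable (lborel \<Otimes>\<^sub>M lborel) (case_prod (\<lambda>y v. ?f (y, v)))"
   unfolding lborel_prod using int[of s] by (simp add: case_prod_unfold)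
  have "(LIN z. ?f z) = (LIN v. LIN y. ?f (y, v))"
   unfolding lborel_prod[symmetric] using lborel_pair.integral_snd[OF ip] by (simp add: case_prod_unfold)
  also have "\<dots> = (LIN v. LIN x. \<Phi> x (s, v))"
  proof (rule LINT_cong)
   fix v :: 'a
   have "(\<lambda>x. (x - s *\<^sub>R v, v)) \<in> borel_measurable borel" by (intro borel_measurable_continuous_onI continuous_intros)
   from measurable_compose[OF this zm] have [measurable]: "(\<lambda>x. H s (x - s *\<^sub>R v, v)) \<in> borel_measurable borel" .
   have "(\<lambda>x. \<Phi> x (s, v)) \<in> borel_measurable borel" unfolding \<Phi>_def fst_conv snd_conv by measurable
   from integral_shift[OF this, of "s *\<^sub>R v"]
   show "(LIN y. ?f (y, v)) = (LIN x. \<Phi> x (s, v))" by (simp add: \<Phi>_def add.commute)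
  qed
  finally show "(LIN v. LIN x. \<Phi> x (s, v)) = (LIN z. ?f z)" ..
 qed
 finally show "(LIN x. ?U x) = (LIN s. LIN z. H s z * a (fst z + s *\<^sub>R snd z))" .
qed

section \<open>The averaged functional at one frequency\<close>

context LPp begin

abbreviation PP :: "int \<Rightarrow> ('a \<Rightarrow> complex) \<Rightarrow> 'a \<Rightarrow> complex" where "PP k \<equiv> mop (lpsym \<phi> (2 powi k))"

abbreviation annk :: "int \<Rightarrow> ('a \<Rightarrow> complex) \<Rightarrow> bool" where "annk k \<equiv> ann (2 powi k / 2) (2 * 2 powi k)"

lemma annk_schwartz: "annk k a \<Longrightarrow> schwartz a" by (simp add: ann_def)

lemma annk_PP: assumes h: "schwartz h" shows "annk k (PP k h)"
proof -
 have q: "(2::real) powi k > 0" by simp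
 show ?thesis unfolding ann_def
  using schwartz_mop[OF slow_lpsym[OF q] h] lpsym_supp[OF q] inv_fourier_mop[OF slow_lpsym[OF q] h] by auto
qed

abbreviation near :: "int \<Rightarrow> real \<Rightarrow> int set" where
 "near k t \<equiv> {dyad (t * 2 powi k) - 3..dyad (t * 2 powi k) + 3}"

lemma Ilim_near:
 assumes T: "blocks T F" and a: "annk k a" and t: "t > 0"
 shows "Ilim T t a = (\<Sum>j\<in>near k t. pair t (F j) a)"
proof -
 have d: "t * 2 powi k > 0" using t by simp
 show ?thesis by (rule Ilim_eq[OF T a _ t]) (use dyad_powi_shift[OF d] in auto)
qed

lemma Ilim_sum:
 assumes T: "blocks T F" and a: "\<And>i. i \<in> I \<Longrightarrow> annk k (a i)" "annk k (\<lambda>x. \<Sum>i\<in>I. a i x)" and t: "t > 0"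
 shows "Ilim T t (\<lambda>x. \<Sum>i\<in>I. a i x) = (\<Sum>i\<in>I. Ilim T t (a i))"
proof -
 have "pair t (F j) (\<lambda>x. \<Sum>i\<in>I. a i x) = (\<Sum>i\<in>I. pair t (F j) (a i))" for j
  unfolding pair_def sum_distrib_left
  by (intro Bochner_Integration.integral_sum pair_integrable blocksD(3,4)[OF T] annk_schwartz[OF a(1)] t)
 then have "Ilim T t (\<lambda>x. \<Sum>i\<in>I. a i x) = (\<Sum>j\<in>near k t. \<Sum>i\<in>I. pair t (F j) (a i))"
  unfolding Ilim_near[OF T a(2) t] by simp
 also have "\<dots> = (\<Sum>i\<in>I. \<Sum>j\<in>near k t. pair t (F j) (a i))" by (rule sum.swap)
 also have "\<dots> = (\<Sum>i\<in>I. Ilim T t (a i))" by (intro sum.cong refl Ilim_near[OF T a(1) t, symmetric])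
 finally show ?thesis .
qed

lemma dyad_measurable [measurable]: "dyad \<in> borel \<rightarrow>\<^sub>M count_space UNIV"
 unfolding dyad_def[abs_def] by measurable

lemma Ilim_measurable:
 assumes T: "blocks T F" and a: "annk k a"
 shows "(\<lambda>s. indicator {0<..<t} s *\<^sub>R Ilim T s a) \<in> borel_measurable borel"
proof -
 note [measurable] = schwartz_measurable[OF annk_schwartz[OF a]] blocksD(4)[OF T]
 have [measurable]: "(\<lambda>s. pair s (F j) a) \<in> borel_measurable borel" for j unfolding pair_def[abs_def] by measurable
 have "(\<lambda>s. (\<lambda>i s. \<Sum>j\<in>{i - 3..i + 3}. pair s (F j) a) (dyad (s * 2 powi k)) s) \<in> borel_measurable borel"
  by (rule measurable_compose_countable) measurable
 then have "(\<lambda>s. indicator {0<..<t} s *\<^sub>R (\<Sum>j\<in>near k s. pair s (F j) a)) \<in> borel_measurable borel" by measurable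
 also have "(\<lambda>s. indicator {0<..<t} s *\<^sub>R (\<Sum>j\<in>near k s. pair s (F j) a)) = (\<lambda>s. indicator {0<..<t} s *\<^sub>R Ilim T s a)"
  by (auto simp: fun_eq_iff indicator_def Ilim_near[OF T a])
 finally show ?thesis .
qed

text \<open>The right-hand side of the averaging formula, tested with \<open>a\<close>.\<close>

definition Bt :: "(('a \<times> 'a \<Rightarrow> complex) \<Rightarrow> complex) \<Rightarrow> (('a \<times> 'a \<Rightarrow> complex) \<Rightarrow> complex) \<Rightarrow> real \<Rightarrow> ('a \<Rightarrow> complex) \<Rightarrow> complex" where
 "Bt f g t a = Ilim f t a + (LIN s. indicator {0<..<t} s *\<^sub>R Ilim g s a)"

end

context Avg begin

text \<open>\<open>W F k t\<close> and \<open>gW G k t\<close> bound, up to constants, the two terms of the averaging formula at frequency \<open>2\<^sup>k\<close>.\<close>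

definition W :: "(int \<Rightarrow> 'a \<times> 'a \<Rightarrow> complex) \<Rightarrow> int \<Rightarrow> real \<Rightarrow> ennreal" where
 "W F k t = ennreal (t powr (- d)) * (\<Sum>j\<in>near k t. mixp p (F j))"

lemma W_measurable [measurable]: "W F k \<in> borel_measurable borel"
proof -
 have "(\<lambda>s. (\<lambda>i. \<Sum>j\<in>{i - 3..i + 3}. mixp p (F j)) (dyad (s * 2 powi k))) \<in> borel_measurable borel"
  by (rule measurable_compose[of _ _ "count_space UNIV"]) measurable
 then show ?thesis unfolding W_def[abs_def] by measurable
qed

definition gW :: "(int \<Rightarrow> 'a \<times> 'a \<Rightarrow> complex) \<Rightarrow> int \<Rightarrow> real \<Rightarrow> ennreal" where
 "gW G k t = (INN s. indicator {0<..<t} s * W G k s)"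

lemma Ilim_bound:
 assumes T: "blocks T F" and a: "annk k a" and t: "t > 0"
  and b: "\<And>x. norm (a x) \<le> c" "(INN x. enorm (a x)) \<le> ennreal e" "0 < c" "0 < e"
 shows "enorm (Ilim T t a) \<le> ennreal (wnorm p e c) * W F k t"
proof -
 have "enorm (Ilim T t a) \<le> ennreal (\<Sum>j\<in>near k t. norm (pair t (F j) a))"
  unfolding Ilim_near[OF T a t] by (intro ennreal_leI norm_sum)
 also have "\<dots> = (\<Sum>j\<in>near k t. enorm (pair t (F j) a))" by (rule sum_ennreal[symmetric]) simp
 also have "\<dots> \<le> (\<Sum>j\<in>near k t. ennreal (wnorm p e c) * (ennreal (t powr (- d)) * mixp p (F j)))"
  unfolding cexp_d[symmetric]
  by (intro sum_mono norm_pair_le[OF blocksD(4)[OF T] t schwartz_measurable[OF annk_schwartz[OF a]] b])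
 also have "\<dots> = ennreal (wnorm p e c) * W F k t" by (simp add: W_def sum_distrib_left)
 finally show ?thesis .
qed

definition Nm :: real where "Nm = 7 * real (nat \<lceil>1 / (1 / m)\<rceil>)"

definition Cf :: real where "Cf = KK * (2 powr (4 * \<bar>\<alpha>\<bar>) * Nm)"

definition Cg :: real where "Cg = KK * (2 powr (4 * \<bar>\<beta>\<bar>) * Nm / (1 - d - \<beta>))"

lemma C_nonneg: "0 \<le> Nm" "0 \<le> Cf" "0 \<le> Cg"
 using KK_pos \<beta> by (auto simp: Nm_def Cf_def Cg_def)

lemma S7_lq_scale:
 assumes "c > 0" shows "glp CZ q (\<lambda>k. S7 x (dyad (c * 2 powr (of_int k * (1 / m))))) \<le> ennreal Nm * glp CZ q x"
 unfolding Nm_def by (rule S7_lq[OF q1 assms]) (use m_pos in simp)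

lemma lq_W:
 assumes \<tau>: "\<tau> > 0"
 shows "glp CZ q (\<lambda>k. ennreal (2 powr (of_int k * s)) * W F k (tk \<tau> k)) \<le> ennreal (2 powr (4 * \<bar>\<alpha>\<bar>) * \<tau> powr (- (\<alpha> + d))) * (ennreal Nm * glp CZ q (xs \<alpha> F))"
proof -
 let ?c = "ennreal (2 powr (4 * \<bar>\<alpha>\<bar>) * \<tau> powr (- (\<alpha> + d)))" and ?S = "\<lambda>k. S7 (xs \<alpha> F) (dyad (\<tau> * 2 powr (of_int k * (1 / m))))"
 have "glp CZ q (\<lambda>k. ennreal (2 powr (of_int k * s)) * W F k (tk \<tau> k)) \<le> glp CZ q (\<lambda>k. ?c * ?S k)"
  by (rule glp_mono_AE[OF q1]) (use f_term_le[OF \<tau>] in \<open>auto simp: W_def\<close>)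
 also have "\<dots> \<le> ?c * glp CZ q ?S" by (rule glp_cmult_le[OF q1]) simp
 also have "\<dots> \<le> ?c * (ennreal Nm * glp CZ q (xs \<alpha> F))" by (intro mult_left_mono S7_lq_scale \<tau>) simp
 finally show ?thesis .
qed

text \<open>Minkowski's inequality in the rescaled time reduces the sum over \<open>k\<close> to a fixed \<open>\<sigma>\<close>.\<close>

lemma lq_gW:
 assumes \<tau>: "\<tau> > 0"
 shows "glp CZ q (\<lambda>k. ennreal (2 powr (of_int k * s)) * gW G k (tk \<tau> k))
  \<le> ennreal (2 powr (4 * \<bar>\<beta>\<bar>) * \<tau> powr (1 - d - \<beta>)) * (ennreal Nm * glp CZ q (xs \<beta> G)) * ennreal (1 / (1 - d - \<beta>))"
proof -
 let ?S = "\<lambda>k \<sigma>. S7 (xs \<beta> G) (dyad (\<sigma> * \<tau> * 2 powr (of_int k * (1 / m))))"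
 let ?c = "\<lambda>\<sigma>. ennreal (2 powr (4 * \<bar>\<beta>\<bar>) * \<tau> powr (1 - d - \<beta>) * \<sigma> powr (- d - \<beta>))"
 let ?t = "\<lambda>k \<sigma>. indicator {0<..<1} \<sigma> * (?c \<sigma> * ?S k \<sigma>) :: ennreal"
 let ?B = "ennreal (2 powr (4 * \<bar>\<beta>\<bar>) * \<tau> powr (1 - d - \<beta>)) * (ennreal Nm * glp CZ q (xs \<beta> G))"
 have "glp CZ q (\<lambda>k. ennreal (2 powr (of_int k * s)) * gW G k (tk \<tau> k)) \<le> glp CZ q (\<lambda>k. INN \<sigma>. ?t k \<sigma>)"
  by (rule glp_mono_AE[OF q1]) (use g_term_le[OF \<tau>] in \<open>auto simp: W_def gW_def\<close>)
 also have "\<dots> \<le> (INN \<sigma>. glp CZ q (\<lambda>k. ?t k \<sigma>))"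
 proof (rule minkowski_integral[OF q1 sigma_finite_CZ sigma_finite_lborel], rule measurable_pair_measure_countable1)
  fix k :: int
  have [measurable]: "(\<lambda>\<sigma>. ?S k \<sigma>) \<in> borel_measurable borel"
   by (rule measurable_compose[of _ _ "count_space UNIV"]) measurable
  have "?t k \<in> borel_measurable lborel" by measurable
  then show "(\<lambda>\<sigma>. case (k, \<sigma>) of (k, \<sigma>) \<Rightarrow> ?t k \<sigma>) \<in> borel_measurable lborel" by simp
 qed simp
 also have "\<dots> \<le> (INN \<sigma>. ?B * (ennreal (\<sigma> powr (- d - \<beta>)) * indicator {0<..<1} \<sigma>))"
 proof (rule nn_integral_mono)
  fix \<sigma> :: real
  have "glp CZ q (\<lambda>k. ?t k \<sigma>) \<le> indicator {0<..<1} \<sigma> * (?c \<sigma> * (ennreal Nm * glp CZ q (xs \<beta> G)))"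
  proof -
   have "glp CZ q (\<lambda>k. ?t k \<sigma>) \<le> indicator {0<..<1} \<sigma> * glp CZ q (\<lambda>k. ?c \<sigma> * ?S k \<sigma>)"
    by (rule glp_cmult_le[OF q1]) simp
   also have "\<dots> \<le> indicator {0<..<1} \<sigma> * (?c \<sigma> * glp CZ q (\<lambda>k. ?S k \<sigma>))"
    by (intro mult_left_mono glp_cmult_le[OF q1]) auto
   also have "\<dots> \<le> indicator {0<..<1} \<sigma> * (?c \<sigma> * (ennreal Nm * glp CZ q (xs \<beta> G)))"
   proof (cases "\<sigma> \<in> {0<..<1}")
    case True
    then have "\<sigma> * \<tau> > 0" using \<tau> by simp
    then show ?thesis by (intro mult_left_mono S7_lq_scale) auto
   qed simp
   finally show ?thesis .
  qed
  also have "\<dots> = ?B * (ennreal (\<sigma> powr (- d - \<beta>)) * indicator {0<..<1} \<sigma>)" by (simp add: ennreal_mult mult_ac)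
  finally show "glp CZ q (\<lambda>k. ?t k \<sigma>) \<le> ?B * (ennreal (\<sigma> powr (- d - \<beta>)) * indicator {0<..<1} \<sigma>)" .
 qed
 also have "\<dots> = ?B * (INN \<sigma>. ennreal (\<sigma> powr (- d - \<beta>)) * indicator {0<..<1} \<sigma>)" by (rule nn_integral_cmult) measurable
 also have "\<dots> = ?B * ennreal (1 / (1 - d - \<beta>))"
  using nn_integral_powr_01[of "- d - \<beta>"] \<beta> by (simp add: algebra_simps)
 finally show ?thesis .
qed

lemma tk_ex: assumes "t > 0" obtains \<tau> where "\<tau> > 0" "t = tk \<tau> k"
 by (rule that[of "t / 2 powr (of_int k * (1 / m - 1))"]) (use assms in \<open>auto simp: tk_def\<close>)

end

locale Sol = Avg \<psi> \<phi> p q \<alpha> \<beta> d s for \<psi> \<phi> :: "'a::euclidean_space \<Rightarrow> real" and p q :: ennreal and \<alpha> \<beta> d s :: real +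
 fixes f g :: "('a \<times> 'a \<Rightarrow> complex) \<Rightarrow> complex" and F G :: "int \<Rightarrow> 'a \<times> 'a \<Rightarrow> complex"
 assumes f: "blocks f F" and g: "blocks g G" and tr: "transport_equation f g"
  and ffin: "glp CZ q (xs \<alpha> F) < \<infinity>" and gfin: "glp CZ q (xs \<beta> G) < \<infinity>"
begin

lemma gW_finite: assumes "t > 0" shows "gW G k t < \<infinity>"
proof -
 obtain \<tau> where t: "\<tau> > 0" "t = tk \<tau> k" using tk_ex[OF assms] .
 have "ennreal (2 powr (of_int k * s)) * gW G k t < \<infinity>"
  unfolding t(2) by (rule le_less_trans[OF order_trans[OF glp_CZ_ge[OF q1, of _ k] lq_gW[OF t(1)]]])
   (use gfin in \<open>simp add: ennreal_mult_less_top\<close>)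
 then show ?thesis by (auto simp: ennreal_mult_less_top)
qed

lemma Ilim_norm_integral:
 assumes a: "annk k a"
  and b: "\<And>x. norm (a x) \<le> c" "(INN x. enorm (a x)) \<le> ennreal e" "0 < c" "0 < e"
 shows "(INN s. enorm (indicator {0<..<t} s *\<^sub>R Ilim g s a)) \<le> ennreal (wnorm p e c) * gW G k t"
proof -
 have "(INN s. enorm (indicator {0<..<t} s *\<^sub>R Ilim g s a)) \<le> (INN s. ennreal (wnorm p e c) * (indicator {0<..<t} s * W G k s))"
  by (intro nn_integral_mono) (auto simp: indicator_def intro: Ilim_bound[OF g a _ b])
 also have "\<dots> = ennreal (wnorm p e c) * gW G k t" unfolding gW_def by (rule nn_integral_cmult) measurable
 finally show ?thesis .
qed

lemma Ilim_integrable: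
 assumes a: "annk k a" shows "integrable lborel (\<lambda>s. indicator {0<..<t} s *\<^sub>R Ilim g s a)"
proof (cases "t > 0")
 case True
 obtain c e where b: "c > 0" "e > 0" "\<And>x. norm (a x) \<le> c" "(INN x. enorm (a x)) \<le> ennreal e"
  using schwartz_wnorm[OF annk_schwartz[OF a]] by metis
 show ?thesis
 proof (rule integrableI_bounded)
  show "(INN s. enorm (indicator {0<..<t} s *\<^sub>R Ilim g s a)) < \<infinity>"
   by (rule le_less_trans[OF Ilim_norm_integral[OF a b(3,4,1,2)]]) (use gW_finite[OF True] in \<open>simp add: ennreal_mult_less_top\<close>)
 qed (use Ilim_measurable[OF g a] in simp)
qed simp

lemma Bt_bound:
 assumes a: "annk k a" and t: "t > 0"
  and b: "\<And>x. norm (a x) \<le> c" "(INN x. enorm (a x)) \<le> ennreal e" "0 < c" "0 < e"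
 shows "enorm (Bt f g t a) \<le> ennreal (wnorm p e c) * (W F k t + gW G k t)"
proof -
 have "enorm (Bt f g t a) \<le> enorm (Ilim f t a) + enorm (LIN s. indicator {0<..<t} s *\<^sub>R Ilim g s a)"
  unfolding Bt_def by (simp add: norm_triangle_ineq flip: ennreal_plus)
 also have "\<dots> \<le> ennreal (wnorm p e c) * W F k t + ennreal (wnorm p e c) * gW G k t"
  using order_trans[OF integral_norm_bound_ennreal[OF Ilim_integrable[OF a]] Ilim_norm_integral[OF a b]]
  by (intro add_mono Ilim_bound[OF f a t b])
 finally show ?thesis by (simp add: distrib_left)
qed

text \<open>Time independence is what allows a different time for every frequency.\<close>

lemma Bt_indep_le:
 assumes a: "annk k a" and t: "0 < t1" "t1 \<le> t2" shows "Bt f g t1 a = Bt f g t2 a"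
proof -
 note inc = transport_increment[OF f g tr a _ t]
 have "(LIN s. indicator {0<..<t2} s *\<^sub>R Ilim g s a) = (LIN s. indicator {0<..<t1} s *\<^sub>R Ilim g s a + indicator {t1..t2} s *\<^sub>R Ilim g s a)"
 proof (rule integral_cong_AE)
  show "AE s in lborel. indicator {0<..<t2} s *\<^sub>R Ilim g s a = indicator {0<..<t1} s *\<^sub>R Ilim g s a + indicator {t1..t2} s *\<^sub>R Ilim g s a"
   using AE_lborel_singleton[of t2] by eventually_elim (use t in \<open>auto simp: indicator_def\<close>)
 qed (use borel_measurable_integrable[OF Ilim_integrable[OF a]] borel_measurable_integrable[OF inc(2)] in auto)
 also have "\<dots> = (LIN s. indicator {0<..<t1} s *\<^sub>R Ilim g s a) + (LIN s. indicator {t1..t2} s *\<^sub>R Ilim g s a)"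
  by (intro Bochner_Integration.integral_add Ilim_integrable[OF a] inc(2)) simp
 finally show ?thesis using inc(1) unfolding Bt_def by (simp add: algebra_simps)
qed

lemma Bt_indep: assumes "annk k a" "0 < t1" "0 < t2" shows "Bt f g t1 a = Bt f g t2 a"
 using Bt_indep_le[OF assms(1)] assms(2,3) by (metis linear)

lemma Bt_sum:
 assumes a: "\<And>i. i \<in> I \<Longrightarrow> annk k (a i)" "annk k (\<lambda>x. \<Sum>i\<in>I. a i x)" and t: "t > 0"
 shows "Bt f g t (\<lambda>x. \<Sum>i\<in>I. a i x) = (\<Sum>i\<in>I. Bt f g t (a i))"
proof -
 have "indicator {0<..<t} s *\<^sub>R Ilim g s (\<lambda>x. \<Sum>i\<in>I. a i x) = (\<Sum>i\<in>I. indicator {0<..<t} s *\<^sub>R Ilim g s (a i))" for s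
  by (auto simp: indicator_def Ilim_sum[OF g a])
 then have "(LIN s. indicator {0<..<t} s *\<^sub>R Ilim g s (\<lambda>x. \<Sum>i\<in>I. a i x)) = (\<Sum>i\<in>I. LIN s. indicator {0<..<t} s *\<^sub>R Ilim g s (a i))"
  by (simp only: Bochner_Integration.integral_sum[OF Ilim_integrable[OF a(1)]])
 moreover have "Ilim f t (\<lambda>x. \<Sum>i\<in>I. a i x) = (\<Sum>i\<in>I. Ilim f t (a i))" by (rule Ilim_sum[OF f a(1) a(2) t])
 ultimately show ?thesis unfolding Bt_def by (simp only: sum.distrib)
qed

end

section \<open>Quantitative bounds on the blocks of a Schwartz function\<close>

text \<open>A common bound \<open>S\<close> for the seminorms; the majorant \<open>S\<close> is strictly positive where \<open>schwartz_norm\<close> may vanish.\<close>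

definition sbd :: "nat \<Rightarrow> real \<Rightarrow> ('a::euclidean_space \<Rightarrow> complex) \<Rightarrow> bool" where
 "sbd M S h \<longleftrightarrow> schwartz h \<and> 0 < S \<and> (\<forall>bs\<in>lists Basis. length bs \<le> M \<longrightarrow> (\<forall>x. (1 + norm x) ^ M * norm (iter_deriv bs h x) \<le> S))"

lemma schwartz_norm_ge:
 fixes h :: "'a::euclidean_space \<Rightarrow> complex"
 assumes h: "schwartz h" and bs: "bs \<in> lists Basis" "length bs \<le> M"
 shows "(1 + norm x) ^ M * norm (iter_deriv bs h x) \<le> schwartz_norm M h"
proof -
 let ?n = "\<lambda>cs x. (1 + norm x) ^ M * norm (iter_deriv cs h x)"
 have bdd: "bdd_above (range (?n cs))" if "cs \<in> lists Basis" for cs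
 proof -
  have "bounded (range (\<lambda>x. (1 + norm x) ^ M *\<^sub>R iter_deriv cs h x))" using h that unfolding schwartz_def by blast
  then obtain B where "\<forall>x. norm ((1 + norm x) ^ M *\<^sub>R iter_deriv cs h x) \<le> B" unfolding bounded_iff by blast
  then show ?thesis by (intro bdd_aboveI[of _ B]) auto
 qed
 have nn: "0 \<le> (SUP x. ?n cs x)" if "cs \<in> lists Basis" for cs
  by (rule order_trans[OF _ cSUP_upper[OF UNIV_I[of 0] bdd[OF that]]]) simp
 have "?n bs x \<le> (SUP x. ?n bs x)" by (rule cSUP_upper[OF UNIV_I bdd[OF bs(1)]])
 also have "\<dots> \<le> schwartz_norm M h" unfolding schwartz_norm_def
  by (rule member_le_sum) (use bs nn finite_multi_indices[of M, where 'e='a] in auto)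
 finally show ?thesis .
qed

lemma sbd_norm: "schwartz h \<Longrightarrow> 0 < S \<Longrightarrow> schwartz_norm M h \<le> S \<Longrightarrow> sbd M S h"
 unfolding sbd_def using schwartz_norm_ge order_trans by blast

lemma schwartz_norm_nonneg: "schwartz h \<Longrightarrow> 0 \<le> schwartz_norm M h"
 by (rule order_trans[OF _ schwartz_norm_ge[of h "[]" M 0]]) auto

lemma sbd_exists: assumes "schwartz h" obtains S where "sbd M S h"
 using sbd_norm[OF assms, of "schwartz_norm M h + 1" M] schwartz_norm_nonneg[OF assms, of M] by force

lemma schwartz_iter_deriv: "schwartz h \<Longrightarrow> bs \<in> lists Basis \<Longrightarrow> schwartz (iter_deriv bs h)"
 by (induction bs) (auto simp: iter_deriv_def intro: schwartz_dir_deriv)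

definition Wt :: "'a::euclidean_space itself \<Rightarrow> real" where "Wt _ = 1 + (LIN x. weight (x::'a))"

lemma Wt_pos: "1 \<le> Wt TYPE('a::euclidean_space)"
 unfolding Wt_def using weight_pos[where 'a='a] by (simp add: less_imp_le)

lemma nn_weight: "(INN x. ennreal (weight (x::'a::euclidean_space))) \<le> ennreal (Wt TYPE('a))"
 unfolding Wt_def by (subst nn_integral_eq_integral[OF integrable_weight]) (auto intro!: less_imp_le[OF weight_pos] ennreal_leI)

lemma weight_le_1: "weight (x::'a::euclidean_space) \<le> 1"
 unfolding weight_def by (rule prod_le_1) (auto simp: divide_le_eq_1 add_pos_nonneg)

context
 fixes M :: nat and S :: real and h :: "'a::euclidean_space \<Rightarrow> complex"
 assumes h: "sbd M S h" and M: "M = 4 * DIM('a)"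
begin

lemma sbd_weight:
 assumes "bs \<in> lists Basis" "length bs \<le> M" shows "norm (iter_deriv bs h x) \<le> S * weight x"
proof (rule decay_le_weight)
 have "(1 + norm x) ^ (2 * DIM('a)) * norm (iter_deriv bs h x) \<le> (1 + norm x) ^ M * norm (iter_deriv bs h x)"
  using M by (intro mult_right_mono power_increasing) auto
 also have "\<dots> \<le> S" using h assms by (simp add: sbd_def)
 finally show "(1 + norm x) ^ (2 * DIM('a)) * norm (iter_deriv bs h x) \<le> S" .
qed simp

lemma sbd_L1:
 assumes "bs \<in> lists Basis" "length bs \<le> M" shows "(LIN x. norm (iter_deriv bs h x)) \<le> S * Wt TYPE('a)"
proof -
 have S: "S > 0" "schwartz h" using h by (auto simp: sbd_def)
 have "(LIN x. norm (iter_deriv bs h x)) \<le> (LIN x. S * weight (x :: 'a))"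
 proof (rule integral_mono)
  show "integrable lborel (\<lambda>x. norm (iter_deriv bs h x))"
   by (intro integrable_norm schwartz_integrable schwartz_iter_deriv S assms(1))
  show "integrable lborel (\<lambda>x. S * weight (x :: 'a))" by (rule integrable_mult_right[OF integrable_weight])
 qed (rule sbd_weight[OF assms])
 also have "\<dots> \<le> S * Wt TYPE('a)" using S by (simp add: Wt_def)
 finally show ?thesis .
qed

lemma sbd_inv_fourier:
 assumes b: "b \<in> Basis" and n: "n \<le> M"
 shows "\<bar>\<xi> \<bullet> b\<bar> ^ n * norm (inv_fourier h \<xi>) \<le> S * Wt TYPE('a)"
proof -
 have sh: "schwartz h" using h by (simp add: sbd_def)
 have bs: "replicate n b \<in> lists Basis" for n using b by (auto simp: in_lists_conv_set)
 have F: "fourier (iter_deriv (replicate n b) h) \<xi> = (\<i> * of_real (\<xi> \<bullet> b)) ^ n * fourier h \<xi>" for n \<xi>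
 proof (induction n)
  case (Suc n)
  have "iter_deriv (replicate (Suc n) b) h = dir_deriv b (iter_deriv (replicate n b) h)" by (simp add: iter_deriv_def)
  then show ?case using Suc fourier_dir_deriv[OF schwartz_iter_deriv[OF sh bs] b] by (simp add: mult.assoc)
 qed simp
 have "norm (inv_fourier h \<xi>) \<le> norm (fourier h (- \<xi>))"
 proof -
  have "1 \<le> (2 * pi) ^ DIM('a)" using pi_gt3 by (intro one_le_power) auto
  then have "1 / (2 * pi) ^ DIM('a) \<le> 1" by simp
  then show ?thesis unfolding inv_fourier_eq_fourier norm_mult norm_of_real by (intro mult_left_le_one_le) auto
 qed
 then have "\<bar>\<xi> \<bullet> b\<bar> ^ n * norm (inv_fourier h \<xi>) \<le> \<bar>\<xi> \<bullet> b\<bar> ^ n * norm (fourier h (- \<xi>))" by (intro mult_left_mono) auto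
 also have "\<dots> = norm (fourier (iter_deriv (replicate n b) h) (- \<xi>))"
  unfolding F by (simp add: norm_mult norm_power)
 also have "\<dots> \<le> S * Wt TYPE('a)" by (rule order_trans[OF norm_fourier_le sbd_L1]) (use bs n in auto)
 finally show ?thesis .
qed

lemma sbd_inv_fourier_annulus:
 assumes r: "r > 0" "r \<le> norm \<xi>" and n: "n \<le> M"
 shows "norm (inv_fourier h \<xi>) \<le> S * Wt TYPE('a) * (DIM('a) / r) ^ n"
proof -
 have "\<exists>b\<in>Basis. r / DIM('a) \<le> \<bar>\<xi> \<bullet> b\<bar>"
 proof (rule ccontr)
  assume "\<not> ?thesis"
  then have "(\<Sum>b\<in>Basis. \<bar>\<xi> \<bullet> b\<bar>) < (\<Sum>b\<in>(Basis::'a set). r / DIM('a))" by (intro sum_strict_mono) (auto simp: not_le)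
  then show False using norm_le_l1[of \<xi>] r by simp
 qed
 then obtain b where b: "b \<in> Basis" "r / DIM('a) \<le> \<bar>\<xi> \<bullet> b\<bar>" by blast
 have p: "0 < r / DIM('a)" using r by simp
 have "(r / DIM('a)) ^ n * norm (inv_fourier h \<xi>) \<le> \<bar>\<xi> \<bullet> b\<bar> ^ n * norm (inv_fourier h \<xi>)"
  using b p by (intro mult_right_mono power_mono) auto
 also have "\<dots> \<le> S * Wt TYPE('a)" by (rule sbd_inv_fourier[OF b(1) n])
 finally show ?thesis using p r by (simp add: field_simps power_divide)
qed

end

context LP begin

lemma norm_LINT_le:
 fixes f :: "'b \<Rightarrow> 'c::{banach, second_countable_topology}"
 assumes "integrable M g" "\<And>x. norm (f x) \<le> g x" shows "norm (LINT x|M. f x) \<le> (LINT x|M. g x)"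
proof (cases "integrable M f")
 case True
 then show ?thesis by (rule order_trans[OF integral_norm_bound integral_mono[OF integrable_norm assms]])
next
 case False
 have "0 \<le> (LINT x|M. g x)" by (rule integral_nonneg_AE) (use assms(2) norm_ge_zero order_trans in blast)
 with False show ?thesis by (simp add: not_integrable_integral_eq)
qed

lemma mop_lpsym_bound:
 assumes \<delta>: "\<delta> > 0" and h: "schwartz (h :: 'a \<Rightarrow> complex)"
 shows "norm (mop (lpsym \<phi> \<delta>) h x) \<le> (LIN w. norm (kern (lpsym \<phi> \<delta>) w) * norm (h (x - w)))"
 unfolding mop_lpsym[OF \<delta> h] by (rule order_trans[OF integral_norm_bound]) (simp add: norm_mult)

lemma phi_L1: "0 < (1 + (LIN w. \<phi> w))"
 by (intro add_pos_nonneg) (auto simp: phi_nonneg)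

text \<open>Integrating by parts in the transform bounds the block uniformly by \<open>2\<^sup>-\<^sup>2\<^sup>k\<^sup>D\<close>, the kernel gives decay of order
\<open>4 D\<close> in \<open>x\<close> without gain in \<open>k\<close>, and the geometric mean of the two bounds has both decay and gain.\<close>

lemma block_high:
 "\<exists>C>0. \<forall>k\<ge>0. \<forall>h S x. sbd (4 * DIM('a)) S h \<longrightarrow> norm (mop (lpsym \<phi> (2 powi k)) h x) \<le> C * S * 2 powr (- (of_int k * real DIM('a))) * weight (x :: 'a)"
proof -
 define D where "D = DIM('a)"
 define C1 where "C1 = Wt TYPE('a) * (2 * D) ^ (3 * D) * (1 + (LIN w. \<phi> w))"
 define C2 where "C2 = 1 + (LIN w. norm (Kphi w) * (1 + norm w) ^ (4 * D))"
 have C1: "C1 > 0" unfolding C1_def using Wt_pos[where 'a='a] phi_L1 by (simp add: D_def)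
 have sK: "schwartz Kphi" by (rule schwartz_kern[OF schwartz_phi])
 note [measurable] = schwartz_measurable[OF sK]
 have iK: "integrable lborel (\<lambda>w. norm (Kphi w) * (1 + norm w) ^ (4 * D))"
 proof -
  obtain C where C: "C > 0" "\<And>x. (1 + norm x) ^ (6 * D) * norm (Kphi x) \<le> C" using schwartz_decay[OF sK] by blast
  show ?thesis
  proof (rule integrable_dominated[OF integrable_mult_right[OF integrable_weight, of C]])
   show "AE w in lborel. norm (norm (Kphi w) * (1 + norm w) ^ (4 * D)) \<le> norm (C * weight w)"
   proof (rule AE_I2)
    fix w :: 'a
    have "norm (Kphi w) * (1 + norm w) ^ (4 * D) \<le> C * weight w"
     by (rule decay_le_weight) (use C(2)[of w] in \<open>simp_all add: D_def mult.left_commute power_add[symmetric] mult.commute flip: mult.assoc\<close>)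
    then show "norm (norm (Kphi w) * (1 + norm w) ^ (4 * D)) \<le> norm (C * weight w)" by simp
   qed
  qed measurable
 qed
 have C2: "C2 > 0" unfolding C2_def by (intro add_pos_nonneg) auto
 have main: "norm (mop (lpsym \<phi> (2 powi k)) h x) \<le> sqrt (C1 * C2) * S * 2 powr (- (of_int k * real D)) * weight x"
  if k: "k \<ge> 0" and h: "sbd (4 * D) S h" for k :: int and h :: "'a \<Rightarrow> complex" and S and x :: 'a
 proof -
  have sh: "schwartz h" and S: "S > 0" using h by (auto simp: sbd_def)
  define \<delta> where "\<delta> = (2::real) powi k"
  have \<delta>: "\<delta> > 0" "\<delta> \<ge> 1" using k by (auto simp: \<delta>_def intro: one_le_power_int)
  let ?y = "norm (mop (lpsym \<phi> \<delta>) h x)"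
  have h': "sbd (4 * DIM('a)) S h" using h by (simp add: D_def)
  have y1: "?y \<le> C1 * S * (1 / \<delta>) ^ (2 * D)"
  proof -
   have li: "integrable lborel (lpsym \<phi> \<delta>)" by (intro schwartz_integrable schwartz_lpsym \<delta>)
   let ?K = "S * Wt TYPE('a) * (2 * D / \<delta>) ^ (3 * D)"
   have "?y \<le> (LIN \<xi>. (?K) * norm (lpsym \<phi> \<delta> \<xi>))"
    unfolding mop_def fourier_def
   proof (rule norm_LINT_le[OF integrable_mult_right[OF integrable_norm[OF li]]])
    fix \<xi> :: 'a
    show "norm (exp (- (\<i> * of_real (x \<bullet> \<xi>))) * (lpsym \<phi> \<delta> \<xi> * inv_fourier h \<xi>)) \<le> (?K) * norm (lpsym \<phi> \<delta> \<xi>)"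
    proof (cases "lpsym \<phi> \<delta> \<xi> = 0")
     case False
     then have "\<delta> / 2 \<le> norm \<xi>" using lpsym_supp[OF \<delta>(1)] by blast
     from sbd_inv_fourier_annulus[OF h' refl _ this, of "3 * D"] \<delta>
     have "norm (inv_fourier h \<xi>) \<le> S * Wt TYPE('a) * (2 * D / \<delta>) ^ (3 * D)" by (simp add: D_def mult.commute)
     then have "norm (lpsym \<phi> \<delta> \<xi>) * norm (inv_fourier h \<xi>) \<le> norm (lpsym \<phi> \<delta> \<xi>) * (?K)"
      by (rule mult_left_mono) simp
     then show ?thesis unfolding norm_mult norm_exp_minus_i by (simp only: mult.commute mult_1_right)
    qed simp
   qed
   also have "\<dots> = (?K) * (LIN \<xi>. norm (lpsym \<phi> \<delta> \<xi>))" by simp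
   also have "(LIN \<xi>. norm (lpsym \<phi> \<delta> \<xi>)) = \<delta> ^ D * (LIN w. \<phi> w)"
   proof -
    have m: "(\<lambda>\<xi>. \<phi> \<xi>) \<in> borel_measurable borel"
     using measurable_compose[OF schwartz_measurable[OF schwartz_phi], of Re borel] by simp
    have "\<bar>inverse \<delta>\<bar> ^ DIM('a) *\<^sub>R (LIN \<xi>. \<phi> (0 + inverse \<delta> *\<^sub>R \<xi>)) = (LIN w. \<phi> w)"
     by (rule integral_affine) (use \<delta> m in auto)
    then show ?thesis using \<delta> phi_nonneg by (simp add: lpsym_def D_def field_simps)
   qed
   also have "(?K) * (\<delta> ^ D * (LIN w. \<phi> w)) \<le> (?K) * (\<delta> ^ D * (1 + (LIN w. \<phi> w)))"
    using S \<delta> Wt_pos[where 'a='a] by (intro mult_left_mono) auto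
   also have "\<dots> = C1 * S * ((1 / \<delta>) ^ (3 * D) * \<delta> ^ D)" by (simp add: C1_def power_divide)
   also have "(1 / \<delta>) ^ (3 * D) * \<delta> ^ D = (1 / \<delta>) ^ (2 * D)"
   proof -
    have "(1 / \<delta>) ^ (3 * D) = (1 / \<delta>) ^ (2 * D) * (1 / \<delta>) ^ D" by (simp add: power_add[symmetric] del: power_one_over)
    then show ?thesis using \<delta> by (simp add: power_divide)
   qed
   finally show ?thesis .
  qed
  have y2: "(1 + norm x) ^ (4 * D) * ?y \<le> C2 * S"
  proof -
   let ?k = "\<lambda>w. \<delta> ^ D * (norm (Kphi (\<delta> *\<^sub>R w)) * (1 + norm (\<delta> *\<^sub>R w)) ^ (4 * D))"
   have ik: "integrable lborel ?k"
    using integrable_affine[OF _ iK, of \<delta> 0] \<delta> by (intro integrable_mult_right) simp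
   have kk: "norm (kern (lpsym \<phi> \<delta>) w) = \<delta> ^ D * norm (Kphi (\<delta> *\<^sub>R w))" for w
    using \<delta> by (simp add: kern_lpsym norm_mult norm_power D_def)
   have pw: "(1 + norm x) ^ (4 * D) * (norm (kern (lpsym \<phi> \<delta>) w) * norm (h (x - w))) \<le> S * ?k w" for w
   proof -
    have "(1 + norm x) \<le> (1 + norm (\<delta> *\<^sub>R w)) * (1 + norm (x - w))"
    proof -
     have "norm w \<le> norm (\<delta> *\<^sub>R w)" using \<delta> by (simp add: mult_le_cancel_right1)
     moreover have "norm x \<le> norm w + norm (x - w)" using norm_triangle_ineq[of w "x - w"] by simp
     moreover have "0 \<le> norm (\<delta> *\<^sub>R w) * norm (x - w)" by simp
     ultimately show ?thesis unfolding ring_distribs by linarith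
    qed
    then have "(1 + norm x) ^ (4 * D) \<le> (1 + norm (\<delta> *\<^sub>R w)) ^ (4 * D) * (1 + norm (x - w)) ^ (4 * D)"
     unfolding power_mult_distrib[symmetric] by (intro power_mono) auto
    then have "(1 + norm x) ^ (4 * D) * (norm (kern (lpsym \<phi> \<delta>) w) * norm (h (x - w)))
     \<le> ((1 + norm (\<delta> *\<^sub>R w)) ^ (4 * D) * (1 + norm (x - w)) ^ (4 * D)) * (norm (kern (lpsym \<phi> \<delta>) w) * norm (h (x - w)))"
     by (rule mult_right_mono) simp
    also have "\<dots> = ?k w * ((1 + norm (x - w)) ^ (4 * D) * norm (iter_deriv [] h (x - w)))" unfolding kk by simp
    also have "\<dots> \<le> ?k w * S"
    proof (rule mult_left_mono)
     have "\<forall>y. (1 + norm y) ^ (4 * D) * norm (iter_deriv [] h y) \<le> S" using h unfolding sbd_def by (fastforce simp del: iter_deriv_Nil)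
     then show "(1 + norm (x - w)) ^ (4 * D) * norm (iter_deriv [] h (x - w)) \<le> S" by blast
    qed (use \<delta> in simp)
    finally show ?thesis by (simp only: mult.commute)
   qed
   have px: "0 < (1 + norm x) ^ (4 * D)" by (intro zero_less_power add_pos_nonneg) auto
   have "?y \<le> (LIN w. S / (1 + norm x) ^ (4 * D) * ?k w)" unfolding mop_lpsym[OF \<delta>(1) sh]
   proof (rule norm_LINT_le[OF integrable_mult_right[OF ik]])
    show "norm (kern (lpsym \<phi> \<delta>) w * h (x - w)) \<le> S / (1 + norm x) ^ (4 * D) * ?k w" for w
    proof -
     have "norm (kern (lpsym \<phi> \<delta>) w) * norm (h (x - w)) * (1 + norm x) ^ (4 * D) \<le> S * ?k w"
      using pw[of w] by (simp only: mult.commute[of _ "(1 + norm x) ^ (4 * D)"])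
     then show ?thesis unfolding norm_mult times_divide_eq_left pos_le_divide_eq[OF px] .
    qed
   qed
   also have "\<dots> = S / (1 + norm x) ^ (4 * D) * (LIN w. ?k w)" by (rule integral_mult_right_zero)
   finally have "(1 + norm x) ^ (4 * D) * ?y \<le> S * (LIN w. ?k w)"
    by (simp only: times_divide_eq_left pos_le_divide_eq[OF px] mult.commute[of _ "(1 + norm x) ^ (4 * D)"])
   also have "\<dots> = S * (LIN w. norm (Kphi w) * (1 + norm w) ^ (4 * D))"
   proof -
    have "\<bar>\<delta>\<bar> ^ DIM('a) *\<^sub>R (LIN w. norm (Kphi (0 + \<delta> *\<^sub>R w)) * (1 + norm (0 + \<delta> *\<^sub>R w)) ^ (4 * D)) = (LIN w. norm (Kphi w) * (1 + norm w) ^ (4 * D))"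
     by (rule integral_affine) (use \<delta> in auto)
    then show ?thesis using \<delta> by (simp add: D_def)
   qed
   also have "\<dots> \<le> C2 * S" using S by (simp add: C2_def)
   finally show ?thesis .
  qed
  have "((1 + norm x) ^ (2 * D) * ?y)\<^sup>2 = ((1 + norm x) ^ (4 * D) * ?y) * ?y"
   by (simp add: power2_eq_square power_add[symmetric] mult_ac)
  also have "\<dots> \<le> (C2 * S) * (C1 * S * (1 / \<delta>) ^ (2 * D))"
   by (rule mult_mono[OF y2 y1]) (use C2 S in auto)
  also have "\<dots> = (sqrt (C1 * C2) * S * (1 / \<delta>) ^ D)\<^sup>2"
  proof -
   have e: "(sqrt (C1 * C2))\<^sup>2 = C1 * C2" "((1 / \<delta>) ^ D)\<^sup>2 = (1 / \<delta>) ^ (2 * D)"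
    using C1 C2 by (simp, simp only: power_mult[symmetric] mult.commute)
   show ?thesis unfolding power_mult_distrib e by (simp only: power2_eq_square mult_ac)
  qed
  finally have "(1 + norm x) ^ (2 * D) * ?y \<le> sqrt (C1 * C2) * S * (1 / \<delta>) ^ D"
   by (rule power2_le_imp_le) (use C1 C2 S \<delta> in auto)
  then have "?y \<le> sqrt (C1 * C2) * S * (1 / \<delta>) ^ D * weight x"
   unfolding D_def by (rule decay_le_weight) simp
  also have "(1 / \<delta>) ^ D = 2 powr (- (of_int k * real D))"
  proof -
   have "\<delta> ^ D = 2 powr (of_int k * real D)" unfolding \<delta>_def
    by (simp add: powr_real_of_int'[symmetric] powr_powr[symmetric] powr_realpow)
   then show ?thesis by (simp add: power_inverse powr_minus divide_inverse)
  qed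
  finally show ?thesis by (simp add: \<delta>_def)
 qed
 have pos: "sqrt (C1 * C2) > 0" using C1 C2 by simp
 show ?thesis by (intro exI[of _ "sqrt (C1 * C2)"] conjI pos allI impI main[unfolded D_def])
qed

end

context LPp begin

text \<open>Young's inequality: the block kernel has a bounded integral and supremum of size \<open>2\<^sup>k\<^sup>D\<close>.\<close>

lemma block_low:
 "\<exists>C>0. \<forall>k. \<forall>h S x. sbd (4 * DIM('a)) S h \<longrightarrow> norm (mop (lpsym \<phi> (2 powi k)) h x) \<le> C * S * 2 powr (of_int k * real DIM('a))
  \<and> (INN x. enorm (mop (lpsym \<phi> (2 powi k)) h (x :: 'a))) \<le> ennreal (C * S)"
proof -
 have sK: "schwartz Kphi" by (rule schwartz_kern[OF schwartz_phi])
 obtain B where B: "B > 0" "\<And>x. norm (Kphi x) \<le> B" using schwartz_bounded[OF sK] by blast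
 define C where "C = (B + KK) * Wt TYPE('a)"
 have C: "C > 0" unfolding C_def using B KK_pos Wt_pos[where 'a='a] by (intro mult_pos_pos) auto
 have "norm (mop (lpsym \<phi> (2 powi k)) h x) \<le> C * S * 2 powr (of_int k * real DIM('a))
  \<and> (INN x. enorm (mop (lpsym \<phi> (2 powi k)) h x)) \<le> ennreal (C * S)"
  if h: "sbd (4 * DIM('a)) S h" for k and h :: "'a \<Rightarrow> complex" and S and x :: 'a
 proof
  have sh: "schwartz h" and S: "S > 0" using h by (auto simp: sbd_def)
  define \<delta> where "\<delta> = (2::real) powi k"
  have \<delta>: "\<delta> > 0" by (simp add: \<delta>_def)
  have sk: "schwartz (kern (lpsym \<phi> \<delta>))" by (intro schwartz_kern schwartz_lpsym \<delta>)
  note [measurable] = schwartz_measurable[OF sh] schwartz_measurable[OF sk] schwartz_measurable[OF sK]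
  have \<delta>D: "\<delta> ^ DIM('a) = 2 powr (of_int k * real DIM('a))" unfolding \<delta>_def
   by (simp add: powr_real_of_int'[symmetric] powr_powr[symmetric] powr_realpow)
  have hi: "integrable lborel (\<lambda>w. norm (h (x - w)))" for x
   using integrable_affine[of "-1" "\<lambda>w. norm (h w)" x] integrable_norm[OF schwartz_integrable[OF sh]] by simp
  have hL: "(LIN w. norm (h (x - w))) \<le> S * Wt TYPE('a)" for x
  proof -
   have "\<bar>- 1\<bar> ^ DIM('a) *\<^sub>R (LIN w. norm (h (x + (- 1) *\<^sub>R w))) = (LIN w. norm (h w))"
    by (rule integral_affine) auto
   then show ?thesis using sbd_L1[OF h refl, of "[]"] by simp
  qed
  have kb: "norm (kern (lpsym \<phi> \<delta>) w) \<le> B * \<delta> ^ DIM('a)" for w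
   using \<delta> B by (simp add: kern_lpsym norm_mult norm_power mult.commute[of B])
  have "norm (mop (lpsym \<phi> \<delta>) h x) \<le> (LIN w. (B * \<delta> ^ DIM('a)) * norm (h (x - w)))"
   unfolding mop_lpsym[OF \<delta> sh]
   by (rule norm_LINT_le[OF integrable_mult_right[OF hi]]) (unfold norm_mult, rule mult_right_mono[OF kb norm_ge_zero])
  also have "\<dots> = (B * \<delta> ^ DIM('a)) * (LIN w. norm (h (x - w)))" by simp
  also have "\<dots> \<le> (B * \<delta> ^ DIM('a)) * (S * Wt TYPE('a))" using B \<delta> by (intro mult_left_mono hL) auto
  also have "\<dots> \<le> C * S * \<delta> ^ DIM('a)"
   using KK_pos S \<delta> Wt_pos[where 'a='a] by (simp add: C_def algebra_simps)
  finally show "norm (mop (lpsym \<phi> (2 powi k)) h x) \<le> C * S * 2 powr (of_int k * real DIM('a))" unfolding \<delta>D \<delta>_def[symmetric] .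
  have "(INN x. enorm (mop (lpsym \<phi> \<delta>) h x)) \<le> (INN x. INN w. enorm (kern (lpsym \<phi> \<delta>) w) * enorm (h (x - w)))"
  proof (rule nn_integral_mono)
   fix x
   have "enorm (mop (lpsym \<phi> \<delta>) h x) \<le> ennreal (LIN w. norm (kern (lpsym \<phi> \<delta>) w) * norm (h (x - w)))"
    by (intro ennreal_leI mop_lpsym_bound[OF \<delta> sh])
   also have "\<dots> \<le> (INN w. ennreal (norm (kern (lpsym \<phi> \<delta>) w) * norm (h (x - w))))"
    by (subst integral_eq_nn_integral) (auto simp: less_top[symmetric] intro!: ennreal_enn2real_if[THEN eq_refl, THEN order_trans])
   finally show "enorm (mop (lpsym \<phi> \<delta>) h x) \<le> (INN w. enorm (kern (lpsym \<phi> \<delta>) w) * enorm (h (x - w)))"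
    by (simp add: ennreal_mult)
  qed
  also have "\<dots> = (INN w. INN x. enorm (kern (lpsym \<phi> \<delta>) w) * enorm (h (x - w)))"
   by (rule lborel_pair.Fubini') measurable
  also have "\<dots> = (INN w. enorm (kern (lpsym \<phi> \<delta>) w) * (INN x. enorm (h x)))"
  proof (rule nn_integral_cong)
   fix w :: 'a
   have "(INN x. enorm (h (x - w))) = (INN x. enorm (h x))"
    using nn_integral_affine[of 1 "\<lambda>x. enorm (h x)" "- w"] by (simp add: add.commute)
   then show "(INN x. enorm (kern (lpsym \<phi> \<delta>) w) * enorm (h (x - w))) = enorm (kern (lpsym \<phi> \<delta>) w) * (INN x. enorm (h x))"
    by (subst nn_integral_cmult) auto
  qed
  also have "\<dots> = (INN w. enorm (kern (lpsym \<phi> \<delta>) w)) * (INN x. enorm (h x))"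
   by (rule nn_integral_multc) measurable
  also have "\<dots> \<le> ennreal KK * ennreal (S * Wt TYPE('a))"
  proof (rule mult_mono[OF kern_L1[OF \<delta>]])
   have "(INN x. enorm (h x)) = ennreal (LIN x. norm (h x))"
    using schwartz_integrable[OF sh] by (intro nn_integral_eq_integral) auto
   then show "(INN x. enorm (h x)) \<le> ennreal (S * Wt TYPE('a))"
    using sbd_L1[OF h refl, of "[]"] by (simp add: ennreal_leI)
  qed auto
  also have "\<dots> = ennreal (KK * (S * Wt TYPE('a)))" using KK_pos S Wt_pos[where 'a='a] by (simp add: ennreal_mult)
  also have "\<dots> \<le> ennreal (C * S)"
   using B S Wt_pos[where 'a='a] by (intro ennreal_leI) (simp add: C_def algebra_simps)
  finally show "(INN x. enorm (mop (lpsym \<phi> (2 powi k)) h x)) \<le> ennreal (C * S)" by (simp add: \<delta>_def)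
 qed
 then show ?thesis using C by blast
qed

end

section \<open>Construction of a velocity average\<close>

lemma integrable_geometric_int:
 assumes "\<epsilon> > 0" shows "integrable CZ (\<lambda>k. 2 powr (- \<epsilon> * \<bar>of_int k\<bar>) :: real)"
proof (rule integrableI_bounded)
 define r :: real where "r = 2 powr (- \<epsilon>)"
 have r: "0 < r" "r < 1" using assms by (auto simp: r_def powr_less_one)
 have e: "2 powr (- \<epsilon> * \<bar>of_int k\<bar>) = r ^ nat \<bar>k\<bar>" for k :: int
  using r(1) by (simp add: r_def powr_powr powr_realpow[symmetric])
 let ?t = "\<lambda>n k. ennreal (r ^ n) * (indicator {int n} k + indicator {- int n} k) :: ennreal"
 have "(\<integral>\<^sup>+k. enorm (2 powr (- \<epsilon> * \<bar>of_int k\<bar>) :: real) \<partial>CZ) \<le> (\<integral>\<^sup>+k. (\<Sum>n. ?t n k) \<partial>CZ)"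
 proof (rule nn_integral_mono)
  fix k :: int
  have "ennreal (r ^ nat \<bar>k\<bar>) * 1 \<le> ?t (nat \<bar>k\<bar>) k" by (rule mult_left_mono) (auto simp: indicator_def)
  also have "\<dots> = (\<Sum>n\<in>{nat \<bar>k\<bar>}. ?t n k)" by simp
  also have "\<dots> \<le> (\<Sum>n. ?t n k)" by (rule sum_le_suminf) auto
  finally show "enorm (2 powr (- \<epsilon> * \<bar>of_int k\<bar>) :: real) \<le> (\<Sum>n. ?t n k)" unfolding e using r by simp
 qed
 also have "\<dots> = (\<Sum>n. \<integral>\<^sup>+k. ?t n k \<partial>CZ)" by (rule nn_integral_suminf) simp
 also have "\<dots> = (\<Sum>n. ennreal (2 * r ^ n))"
 proof (rule suminf_cong)
  fix n
  have "(\<integral>\<^sup>+k. ?t n k \<partial>CZ) = ennreal (r ^ n) * ((\<integral>\<^sup>+k. indicator {int n} k \<partial>CZ) + (\<integral>\<^sup>+k. indicator {- int n} k \<partial>CZ))"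
   by (subst nn_integral_cmult, simp, subst nn_integral_add) auto
  also have "\<dots> = ennreal (2 * r ^ n)" using r by (simp add: one_add_one ennreal_mult mult.commute)
  finally show "(\<integral>\<^sup>+k. ?t n k \<partial>CZ) = ennreal (2 * r ^ n)" .
 qed
 also have "\<dots> = ennreal (\<Sum>n. 2 * r ^ n)"
  by (rule suminf_ennreal2) (use r in \<open>auto intro!: summable_mult summable_geometric\<close>)
 finally show "(\<integral>\<^sup>+k. enorm (2 powr (- \<epsilon> * \<bar>of_int k\<bar>) :: real) \<partial>CZ) < \<infinity>" by (simp add: le_less_trans)
qed simp

context Avg begin

text \<open>These two strict inequalities are the reason why the series of blocks converges at low and at high
frequencies.\<close>

lemma s_bounds: "s < DIM('a) * enn2real (inverse p)" "0 < s + DIM('a)"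
proof -
 have th: "0 \<le> enn2real (inverse p)" using enn2real_inverse_bounds[OF p1] by blast
 have D: "1 \<le> real DIM('a)" using DIM_positive[where 'a='a] by linarith
 have d2: "d = real DIM('a) - DIM('a) * enn2real (inverse p)" using d by (simp add: right_diff_distrib)
 have "(\<alpha> + d) / m < 1" using m_pos \<beta> by (simp add: m_def)
 then show "s < DIM('a) * enn2real (inverse p)" using s_eq d2 D by linarith
 have "0 < (\<alpha> + d) / m" using m_pos \<alpha> by simp
 moreover have "d \<le> DIM('a)" using d2 th by simp
 ultimately show "0 < s + DIM('a)" using s_eq by linarith
qed

lemma block_wnorm:
 "\<exists>C>0. \<exists>\<epsilon>>0. \<forall>k h S. sbd (4 * DIM('a)) S h \<longrightarrow> (\<exists>c>0. \<exists>e>0. (\<forall>x. norm (PP k h x) \<le> c) \<and>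
  (INN x. enorm (PP k h x)) \<le> ennreal e \<and> wnorm p e c \<le> C * S * 2 powr (of_int k * s) * 2 powr (- \<epsilon> * \<bar>of_int k\<bar>))"
proof -
 define D where "D = real DIM('a)"
 define \<theta> where "\<theta> = enn2real (inverse p)"
 (* the gain at low and at high frequencies, respectively *)
 define \<epsilon> where "\<epsilon> = min (D * \<theta> - s) (s + D)"
 have \<epsilon>: "\<epsilon> > 0" "\<epsilon> \<le> D * \<theta> - s" "\<epsilon> \<le> s + D" using s_bounds by (auto simp: \<epsilon>_def D_def \<theta>_def)
 obtain C1 where C1: "C1 > 0" "\<And>k h S x. k \<ge> 0 \<Longrightarrow> sbd (4 * DIM('a)) S h \<Longrightarrow> norm (PP k h x) \<le> C1 * S * 2 powr (- (of_int k * D)) * weight x"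
  using block_high unfolding D_def by metis
 obtain C2 where C2: "C2 > 0" "\<And>k h S x. sbd (4 * DIM('a)) S h \<Longrightarrow> norm (PP k h x) \<le> C2 * S * 2 powr (of_int k * D)"
   "\<And>k h S. sbd (4 * DIM('a)) S h \<Longrightarrow> (INN x. enorm (PP k h x)) \<le> ennreal (C2 * S)"
  using block_low unfolding D_def by metis
 have wn: "wnorm p e (e * r) = e * r powr \<theta>" if "e > 0" "r > 0" for e r
  using that by (simp add: wnorm_def \<theta>_def powr_mult mult.assoc[symmetric] powr_add[symmetric])
 define C3 where "C3 = C1 * Wt TYPE('a)"
 have C3: "C3 > 0" using C1 Wt_pos[where 'a='a] by (simp add: C3_def)
 have "\<exists>c>0. \<exists>e>0. (\<forall>x. norm (PP k h x) \<le> c) \<and> (INN x. enorm (PP k h x)) \<le> ennreal e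
  \<and> wnorm p e c \<le> (C2 + C3) * S * 2 powr (of_int k * s) * 2 powr (- \<epsilon> * \<bar>of_int k\<bar>)"
  if h: "sbd (4 * DIM('a)) S h" for k h S
 proof -
  have S: "S > 0" using h by (simp add: sbd_def)
  have fin: "A * S * 2 powr y \<le> (C2 + C3) * S * 2 powr (of_int k * s) * 2 powr (- \<epsilon> * \<bar>of_int k\<bar>)"
   if "A \<le> C2 + C3" "y \<le> of_int k * s + - \<epsilon> * \<bar>of_int k\<bar>" for A y
  proof -
   have "A * S * 2 powr y \<le> (C2 + C3) * S * 2 powr (of_int k * s + - \<epsilon> * \<bar>of_int k\<bar>)"
    using that S C2 C3 by (intro mult_mono powr_mono) auto
   then show ?thesis by (simp only: powr_add mult.assoc)
  qed
  show ?thesis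
  proof (cases "k \<ge> 0")
   case True
   define E0 where "E0 = C1 * S * 2 powr (- (of_int k * D))"
   have E0: "E0 > 0" using C1 S by (simp add: E0_def)
   define E where "E = C3 * S * 2 powr (- (of_int k * D))"
   have EE: "E = E0 * Wt TYPE('a)" by (simp add: E_def E0_def C3_def)
   have E: "E > 0" using C3 S by (simp add: E_def)
   have b: "norm (PP k h x) \<le> E0 * weight x" for x using C1(2)[OF True h] by (simp add: E0_def)
   have "norm (PP k h x) \<le> E" for x
   proof -
    have "E0 * weight x \<le> E0 * Wt TYPE('a)" using E0 weight_le_1[of x] Wt_pos[where 'a='a] by (intro mult_left_mono) auto
    then show ?thesis using b[of x] EE by linarith
   qed
   moreover have "(INN x. enorm (PP k h x)) \<le> ennreal E"
   proof -
    have "(INN x. enorm (PP k h x)) \<le> (INN x. ennreal E0 * ennreal (weight (x :: 'a)))"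
     using ennreal_leI[OF b] E0 by (intro nn_integral_mono) (simp add: ennreal_mult less_imp_le[OF weight_pos])
    also have "\<dots> = ennreal E0 * (INN x. ennreal (weight (x :: 'a)))" by (rule nn_integral_cmult) measurable
    also have "\<dots> \<le> ennreal E0 * ennreal (Wt TYPE('a))" by (intro mult_left_mono nn_weight) auto
    also have "\<dots> = ennreal E" using E0 Wt_pos[where 'a='a] by (simp add: EE ennreal_mult)
    finally show ?thesis .
   qed
   moreover have "wnorm p E E \<le> (C2 + C3) * S * 2 powr (of_int k * s) * 2 powr (- \<epsilon> * \<bar>of_int k\<bar>)"
   proof -
    have "of_int k * \<epsilon> \<le> of_int k * (s + D)" using True \<epsilon> by (intro mult_left_mono) auto
    then have "- (of_int k * D) \<le> of_int k * s + - \<epsilon> * \<bar>of_int k\<bar>" using True by (simp add: algebra_simps)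
    from fin[OF _ this, of C3] C2 show ?thesis using wn[OF E, of 1] by (simp add: E_def)
   qed
   ultimately show ?thesis using E by blast
  next
   case False
   define e where "e = C2 * S"
   have e: "e > 0" using C2 S by (simp add: e_def)
   have "wnorm p e (e * 2 powr (of_int k * D)) \<le> (C2 + C3) * S * 2 powr (of_int k * s) * 2 powr (- \<epsilon> * \<bar>of_int k\<bar>)"
   proof -
    have "of_int (- k) * \<epsilon> \<le> of_int (- k) * (D * \<theta> - s)" using False \<epsilon> by (intro mult_left_mono) auto
    then have "of_int k * D * \<theta> \<le> of_int k * s + - \<epsilon> * \<bar>of_int k\<bar>" using False by (simp add: algebra_simps)
    from fin[OF _ this, of C2] C3 show ?thesis using wn[OF e, of "2 powr (of_int k * D)"] by (simp add: e_def powr_powr)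
   qed
   moreover have "\<forall>x. norm (PP k h x) \<le> e * 2 powr (of_int k * D)" using C2(2)[OF h] by (simp add: e_def)
   moreover have "(INN x. enorm (PP k h x)) \<le> ennreal e" using C2(3)[OF h] by (simp add: e_def)
   ultimately show ?thesis using e by (intro exI[of _ "e * 2 powr (of_int k * D)"] exI[of _ e] conjI) auto
  qed
 qed
 then show ?thesis using C2 C3 \<epsilon>(1) by (intro exI[of _ "C2 + C3"] exI[of _ \<epsilon>] conjI) auto
qed

end

context Sol begin

lemma Bt_decay:
 "\<exists>C\<ge>0. \<exists>\<epsilon>>0. \<forall>k h S. sbd (4 * DIM('a)) S h \<longrightarrow> norm (Bt f g (tk 1 k) (PP k h)) \<le> C * S * 2 powr (- \<epsilon> * \<bar>of_int k\<bar>)"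
proof -
 obtain C \<epsilon> where C: "C > 0" "\<epsilon> > 0" and b: "\<And>k h S. sbd (4 * DIM('a)) S h \<Longrightarrow> \<exists>c>0. \<exists>e>0. (\<forall>x. norm (PP k h x) \<le> c) \<and>
  (INN x. enorm (PP k h x)) \<le> ennreal e \<and> wnorm p e c \<le> C * S * 2 powr (of_int k * s) * 2 powr (- \<epsilon> * \<bar>of_int k\<bar>)"
  using block_wnorm by metis
 define X where "X = glp CZ q (\<lambda>k. ennreal (2 powr (of_int k * s)) * W F k (tk 1 k)) + glp CZ q (\<lambda>k. ennreal (2 powr (of_int k * s)) * gW G k (tk 1 k))"
 have "X < \<infinity>"
  unfolding X_def using le_less_trans[OF lq_W[of 1 F]] le_less_trans[OF lq_gW[of 1 G]] ffin gfin
  by (simp add: ennreal_mult_less_top)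
 then obtain A where A: "X = ennreal A" "A \<ge> 0" by (cases X) auto
 have XA: "ennreal (2 powr (of_int k * s)) * (W F k (tk 1 k) + gW G k (tk 1 k)) \<le> ennreal A" for k
  unfolding A(1)[symmetric] X_def distrib_left by (intro add_mono glp_CZ_ge[OF q1, of _ k])
 have "norm (Bt f g (tk 1 k) (PP k h)) \<le> C * A * S * 2 powr (- \<epsilon> * \<bar>of_int k\<bar>)" if h: "sbd (4 * DIM('a)) S h" for k h S
 proof -
  have sh: "schwartz h" "S > 0" using h by (auto simp: sbd_def)
  obtain c e where ce: "c > 0" "e > 0" "\<And>x. norm (PP k h x) \<le> c" "(INN x. enorm (PP k h x)) \<le> ennreal e"
   "wnorm p e c \<le> C * S * 2 powr (of_int k * s) * 2 powr (- \<epsilon> * \<bar>of_int k\<bar>)" using b[OF h, of k] by blast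
  have "enorm (Bt f g (tk 1 k) (PP k h)) \<le> ennreal (wnorm p e c) * (W F k (tk 1 k) + gW G k (tk 1 k))"
   by (rule Bt_bound[OF annk_PP[OF sh(1)] tk_pos ce(3,4,1,2)]) simp
  also have "\<dots> \<le> ennreal (C * S * 2 powr (of_int k * s) * 2 powr (- \<epsilon> * \<bar>of_int k\<bar>)) * (W F k (tk 1 k) + gW G k (tk 1 k))"
   by (intro mult_right_mono ennreal_leI ce(5)) auto
  also have "\<dots> = ennreal (C * S * 2 powr (- \<epsilon> * \<bar>of_int k\<bar>)) * (ennreal (2 powr (of_int k * s)) * (W F k (tk 1 k) + gW G k (tk 1 k)))"
   using C sh by (simp add: ennreal_mult mult_ac)
  also have "\<dots> \<le> ennreal (C * S * 2 powr (- \<epsilon> * \<bar>of_int k\<bar>)) * ennreal A" by (intro mult_left_mono XA) auto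
  also have "\<dots> = ennreal (C * A * S * 2 powr (- \<epsilon> * \<bar>of_int k\<bar>))" using C sh A by (simp add: ennreal_mult[symmetric] mult_ac)
  finally show ?thesis using C sh A by (subst (asm) ennreal_le_iff) auto
 qed
 then show ?thesis using C A(2) by (intro exI[of _ "C * A"] exI[of _ \<epsilon>] conjI) auto
qed

text \<open>The velocity average, summed from its blocks, each of them evaluated at the time \<open>tk 1 k\<close>.\<close>

definition uu :: "('a \<Rightarrow> complex) \<Rightarrow> complex" where "uu h = (LINT k|CZ. Bt f g (tk 1 k) (PP k h))"

lemma uu_integrable: assumes h: "schwartz h" shows "integrable CZ (\<lambda>k. Bt f g (tk 1 k) (PP k h))"
proof -
 obtain C \<epsilon> where C: "C \<ge> 0" "\<epsilon> > 0" "\<And>k h S. sbd (4 * DIM('a)) S h \<Longrightarrow> norm (Bt f g (tk 1 k) (PP k h)) \<le> C * S * 2 powr (- \<epsilon> * \<bar>of_int k\<bar>)"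
  using Bt_decay by metis
 obtain S where S: "sbd (4 * DIM('a)) S h" using sbd_exists[OF h] .
 show ?thesis
  by (rule integrable_dominated[OF integrable_mult_right[OF integrable_geometric_int[OF C(2)], of "C * S"]])
   (use C(3)[OF S] in \<open>auto simp: AE_count_space intro: order_trans[OF _ abs_ge_self]\<close>)
qed

lemma Bt_PP:
 assumes h: "schwartz h" and t: "t > 0"
 shows "Bt f g t (PP k h) = pair t (Fd F (t * 2 powi k)) h + (LIN s. indicator {0<..<t} s *\<^sub>R pair s (Fd G (s * 2 powi k)) h)"
  and "integrable lborel (\<lambda>s. indicator {0<..<t} s *\<^sub>R pair s (Fd G (s * 2 powi k)) h)"
proof -
 have e: "indicator {0<..<t} s *\<^sub>R pair s (Fd G (s * 2 powi k)) h = indicator {0<..<t} s *\<^sub>R Ilim g s (PP k h)" for s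
  by (auto simp: indicator_def Fd_pair[OF g _ h])
 show "integrable lborel (\<lambda>s. indicator {0<..<t} s *\<^sub>R pair s (Fd G (s * 2 powi k)) h)"
  unfolding e by (rule Ilim_integrable[OF annk_PP[OF h]])
 show "Bt f g t (PP k h) = pair t (Fd F (t * 2 powi k)) h + (LIN s. indicator {0<..<t} s *\<^sub>R pair s (Fd G (s * 2 powi k)) h)"
  unfolding e Bt_def Fd_pair[OF f t h] ..
qed

lemma pair_Fd_linear:
 assumes T: "blocks T H" and t: "t > 0" and h: "schwartz h1" "schwartz h2"
 shows "pair t (Fd H (t * 2 powi k)) (\<lambda>x. h1 x + h2 x) = pair t (Fd H (t * 2 powi k)) h1 + pair t (Fd H (t * 2 powi k)) h2"
  and "pair t (Fd H (t * 2 powi k)) (\<lambda>x. c * h1 x) = c * pair t (Fd H (t * 2 powi k)) h1"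
proof -
 have d: "t * 2 powi k > 0" using t by simp
 note i = pair_integrable[OF measurable_Fd[OF T d] mixp_Fd_finite[OF T d] _ t]
 show "pair t (Fd H (t * 2 powi k)) (\<lambda>x. h1 x + h2 x) = pair t (Fd H (t * 2 powi k)) h1 + pair t (Fd H (t * 2 powi k)) h2"
  unfolding pair_def distrib_left by (intro Bochner_Integration.integral_add i h)
 show "pair t (Fd H (t * 2 powi k)) (\<lambda>x. c * h1 x) = c * pair t (Fd H (t * 2 powi k)) h1"
  unfolding pair_def mult.left_commute[of _ c] by (rule integral_mult_right_zero)
qed

lemma Bt_PP_linear:
 assumes h: "schwartz h1" "schwartz h2" and t: "t > 0"
 shows "Bt f g t (PP k (\<lambda>x. h1 x + h2 x)) = Bt f g t (PP k h1) + Bt f g t (PP k h2)"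
  and "Bt f g t (PP k (\<lambda>x. c * h1 x)) = c * Bt f g t (PP k h1)"
proof -
 have "indicator {0<..<t} s *\<^sub>R pair s (Fd G (s * 2 powi k)) (\<lambda>x. h1 x + h2 x)
  = indicator {0<..<t} s *\<^sub>R pair s (Fd G (s * 2 powi k)) h1 + indicator {0<..<t} s *\<^sub>R pair s (Fd G (s * 2 powi k)) h2" for s
  by (auto simp: indicator_def pair_Fd_linear(1)[OF g _ h])
 then show "Bt f g t (PP k (\<lambda>x. h1 x + h2 x)) = Bt f g t (PP k h1) + Bt f g t (PP k h2)"
  unfolding Bt_PP(1)[OF schwartz_add[OF h] t] Bt_PP(1)[OF h(1) t] Bt_PP(1)[OF h(2) t] pair_Fd_linear(1)[OF f t h]
  by (simp add: Bochner_Integration.integral_add[OF Bt_PP(2)[OF h(1) t] Bt_PP(2)[OF h(2) t]])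
 have "indicator {0<..<t} s *\<^sub>R pair s (Fd G (s * 2 powi k)) (\<lambda>x. c * h1 x) = c * (indicator {0<..<t} s *\<^sub>R pair s (Fd G (s * 2 powi k)) h1)" for s
  by (auto simp: indicator_def pair_Fd_linear(2)[OF g _ h])
 then show "Bt f g t (PP k (\<lambda>x. c * h1 x)) = c * Bt f g t (PP k h1)"
  unfolding Bt_PP(1)[OF schwartz_cmult[OF h(1)] t] Bt_PP(1)[OF h(1) t] pair_Fd_linear(2)[OF f t h]
  by (simp only: distrib_left integral_mult_right_zero)
qed

lemma uu_td: "tempered_distribution uu"
 unfolding tempered_distribution_def
proof (intro conjI allI impI)
 fix h1 h2 :: "'a \<Rightarrow> complex" assume h: "schwartz h1" "schwartz h2"
 show "uu (\<lambda>x. h1 x + h2 x) = uu h1 + uu h2"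
  unfolding uu_def Bt_PP_linear(1)[OF h tk_pos[OF zero_less_one]]
  by (rule Bochner_Integration.integral_add[OF uu_integrable[OF h(1)] uu_integrable[OF h(2)]])
next
 fix c and h :: "'a \<Rightarrow> complex" assume h: "schwartz h"
 show "uu (\<lambda>x. c * h x) = c * uu h"
  unfolding uu_def Bt_PP_linear(2)[OF h h tk_pos[OF zero_less_one]] by (rule integral_mult_right_zero)
next
 obtain C \<epsilon> where C: "C \<ge> 0" "\<epsilon> > 0" "\<And>k h S. sbd (4 * DIM('a)) S h \<Longrightarrow> norm (Bt f g (tk 1 k) (PP k h)) \<le> C * S * 2 powr (- \<epsilon> * \<bar>of_int k\<bar>)"
  using Bt_decay by metis
 define B where "B = (LINT k|CZ. 2 powr (- \<epsilon> * \<bar>of_int k\<bar>) :: real)"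
 have B: "B \<ge> 0" unfolding B_def by simp
 have S: "norm (uu h) \<le> C * B * S" if S: "sbd (4 * DIM('a)) S h" for S h
 proof -
  have h: "schwartz h" using S by (simp add: sbd_def)
  have "norm (uu h) \<le> (LINT k|CZ. norm (Bt f g (tk 1 k) (PP k h)))" unfolding uu_def by (rule integral_norm_bound)
  also have "\<dots> \<le> (LINT k|CZ. (C * S) * 2 powr (- \<epsilon> * \<bar>of_int k\<bar>))"
   by (rule integral_mono[OF integrable_norm[OF uu_integrable[OF h]] integrable_mult_right[OF integrable_geometric_int[OF C(2)]]]) (rule C(3)[OF S])
  also have "\<dots> = C * B * S" unfolding B_def by (simp add: mult_ac)
  finally show ?thesis .
 qed
 have "norm (uu h) \<le> C * B * schwartz_norm (4 * DIM('a)) h" if h: "schwartz h" for h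
 proof -
  let ?n = "schwartz_norm (4 * DIM('a)) h"
  have n: "0 \<le> ?n" by (rule schwartz_norm_nonneg[OF h])
  have "(\<lambda>i. C * B * (?n + inverse (real (Suc i)))) \<longlonglongrightarrow> C * B * (?n + 0)"
   by (intro tendsto_intros LIMSEQ_inverse_real_of_nat)
  moreover have "norm (uu h) \<le> C * B * (?n + inverse (real (Suc i)))" for i
   by (rule S, rule sbd_norm[OF h]) (use n in \<open>auto intro: add_nonneg_pos\<close>)
  ultimately have "norm (uu h) \<le> C * B * (?n + 0)" by (intro LIMSEQ_le_const) auto
  then show ?thesis by simp
 qed
 then show "\<exists>N C. \<forall>h. schwartz h \<longrightarrow> norm (uu h) \<le> C * schwartz_norm N h" by blast
qed

lemma Bt_zero: "Bt f g t (\<lambda>x. 0) = 0"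
proof -
 have "Ilim T t (\<lambda>x. 0) = 0" if "tempered_distribution T" for T t
  unfolding Ilim_def Htest_def using td_zero[OF that] by (auto intro: limI)
 then show ?thesis using blocksD(1)[OF f] blocksD(1)[OF g] by (simp add: Bt_def)
qed

text \<open>Only five blocks of \<open>uu\<close> meet the frequency \<open>2\<^sup>j\<close>. Moving all of them to the common time \<open>t\<close> makes them add up
to the block of the test function.\<close>

lemma uu_block:
 assumes h: "schwartz h" and t: "t > 0"
 shows "LP_block \<phi> (2 powi j) uu h = Bt f g t (PP j h)"
proof -
 have q: "(2::real) powi k > 0" for k :: int by simp
 let ?a = "PP j h"
 have sa: "schwartz ?a" by (rule annk_schwartz[OF annk_PP[OF h]])
 have supp: "2 powi (j - 2) < norm \<xi> \<and> norm \<xi> < 2 powi (j + 2)" if "inv_fourier ?a \<xi> \<noteq> 0" for \<xi>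
 proof -
  have "2 powi j / 2 \<le> norm \<xi> \<and> norm \<xi> \<le> 2 * 2 powi j" using annk_PP[OF h, of j] that unfolding ann_def by blast
  moreover have "(2::real) powi (j - 2) = 2 powi j / 4" "(2::real) powi (j + 2) = 2 powi j * 4"
   by (simp_all add: power_int_diff power_int_add)
  ultimately show ?thesis using q[of j] by linarith
 qed
 have z: "PP k ?a = (\<lambda>x. 0)" if "k \<notin> {j - 2..j + 2}" for k
 proof -
  have "lpsym \<phi> (2 powi k) \<xi> = 0" if nz: "inv_fourier ?a \<xi> \<noteq> 0" for \<xi>
  proof (rule ccontr)
   assume "lpsym \<phi> (2 powi k) \<xi> \<noteq> 0"
   from lpsym_supp[OF q this] have l: "2 powi k / 2 \<le> norm \<xi>" "norm \<xi> \<le> 2 * 2 powi k" by auto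
   have r: "2 powi j / 2 \<le> norm \<xi> \<and> norm \<xi> \<le> 2 * 2 powi j" using annk_PP[OF h, of j] nz unfolding ann_def by blast
   consider "k \<le> j - 3" | "j + 3 \<le> k" using \<open>k \<notin> _\<close> by force
   then show False
   proof cases
    case 1
    then have "(2::real) powi k \<le> 2 powi (j - 3)" by (intro power_int_increasing) auto
    then show False using l r q[of j] by (simp add: power_int_diff)
   next
    case 2
    then have "(2::real) powi (j + 3) \<le> 2 powi k" by (intro power_int_increasing) auto
    then show False using l r q[of j] by (simp add: power_int_add)
   qed
  qed
  then have "mop (lpsym \<phi> (2 powi k)) ?a = mop (\<lambda>\<zeta>. 0) ?a" by (rule mop_cong)
  then show ?thesis by (simp add: mop_def fourier_def fun_eq_iff)
 qed
 have sum: "(\<lambda>x. \<Sum>k\<in>{j - 2..j + 2}. PP k ?a x) = ?a"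
 proof -
  have "?a = mop (\<lambda>\<zeta>. \<Sum>k\<in>{j - 2..j + 2}. lpsym \<phi> (2 powi k) \<zeta>) ?a"
   by (rule mop_eq_self[OF sa, symmetric], rule sum_lpsym_eq_1) (use supp in auto)
  also have "\<dots> = (\<lambda>x. \<Sum>k\<in>{j - 2..j + 2}. PP k ?a x)" by (rule mop_sum[OF sa]) (rule slow_lpsym[OF q])
  finally show ?thesis ..
 qed
 have aj: "annk j (PP k ?a)" for k
  using annk_PP[OF sa, of k] annk_PP[OF h, of j] inv_fourier_mop[OF slow_lpsym[OF q] sa, of k] unfolding ann_def by auto
 have "LP_block \<phi> (2 powi j) uu h = (LINT k|CZ. Bt f g (tk 1 k) (PP k ?a))" unfolding LP_block_eq uu_def ..
 also have "\<dots> = (LINT k|CZ. Bt f g t (PP k ?a))"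
  by (intro Bochner_Integration.integral_cong refl Bt_indep[OF annk_PP[OF sa] _ t] tk_pos) simp
 also have "\<dots> = (\<Sum>k\<in>{j - 2..j + 2}. Bt f g t (PP k ?a))"
 proof -
  have sub: "{k. Bt f g t (PP k ?a) \<noteq> 0} \<subseteq> {j - 2..j + 2}" using z Bt_zero by force
  have "(LINT k|CZ. Bt f g t (PP k ?a)) = (\<Sum>k | k \<in> UNIV \<and> Bt f g t (PP k ?a) \<noteq> 0. Bt f g t (PP k ?a))"
   by (rule lebesgue_integral_count_space_finite_support) (use finite_subset[OF sub] in simp)
  also have "\<dots> = (\<Sum>k\<in>{j - 2..j + 2}. Bt f g t (PP k ?a))"
   by (rule sum.mono_neutral_left) (use sub in auto)
  finally show ?thesis .
 qed
 also have "\<dots> = Bt f g t (\<lambda>x. \<Sum>k\<in>{j - 2..j + 2}. PP k ?a x)"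
  by (rule Bt_sum[symmetric, where k=j]) (use aj annk_PP[OF h] t in \<open>simp_all add: sum\<close>)
 finally show ?thesis unfolding sum .
qed

end

section \<open>The averaging formula\<close>

lemma ennreal_norm_integral_le:
 fixes f :: "'b \<Rightarrow> 'c::{banach, second_countable_topology}"
 shows "enorm (integral\<^sup>L M f) \<le> (\<integral>\<^sup>+x. enorm (f x) \<partial>M)"
 by (cases "integrable M f") (auto simp: integral_norm_bound_ennreal not_integrable_integral_eq)

context Sol begin

lemma integrable_mult_leftD:
 fixes H :: "'b \<Rightarrow> complex"
 assumes "integrable M (\<lambda>v. H v * c)" "c \<noteq> 0" shows "integrable M H"
proof -
 have "integrable M (\<lambda>v. H v * c * inverse c)" by (rule integrable_mult_left) (rule assms(1))
 then show ?thesis using assms(2) by (simp add: mult.assoc)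
qed

lemma pair_integrable_bounded:
 assumes H: "H \<in> borel_measurable borel" "mixp p H < \<infinity>" and t: "t > 0" and a: "a \<in> borel_measurable borel"
  and b: "\<And>x. norm (a x :: complex) \<le> c" "(INN x. enorm (a (x :: 'a))) \<le> ennreal e" "0 < c" "0 < e"
 shows "integrable lborel (\<lambda>z. H z * a (fst z + t *\<^sub>R snd z))"
proof (rule mixp_integrable_gen[OF H(1) _ H(2)])
 note [measurable] = a
 show "(\<lambda>z. a (fst z + t *\<^sub>R snd z)) \<in> borel_measurable borel" by measurable
 show "(INN z. enorm (H z) * enorm (a (fst z + t *\<^sub>R snd z))) \<le> ennreal (wnorm p e c * t powr (- cexp TYPE('a) p)) * mixp p H"
  using transported_pairing_le[OF p1 t H(1) a b] by (simp add: ennreal_mult wnorm_def mult.assoc)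
qed

text \<open>The functions representing the blocks are \<open>Fd\<close> at the required frequencies. Integrability in \<open>v\<close> and in \<open>(s, v)\<close>
is tested against the positive function \<open>weight\<close> and then holds for almost every \<open>x\<close>.\<close>

lemma velocity_block_of:
 assumes u: "\<And>h. schwartz h \<Longrightarrow> LP_block \<phi> (2 powi k) u h = Bt f g t (PP k h)" and t: "t > 0"
 shows "velocity_block \<phi> f g u k t"
proof -
 define F' where "F' = Fd F (t * 2 powi k)"
 (* extended by 0, so that the integral over (0, t) becomes one over all times *)
 define G' where "G' s z = (if s \<in> {0<..<t} then Fd G (s * 2 powi k) z else 0)" for s z
 have d: "t * 2 powi k > 0" using t by simp
 have F': "F' \<in> borel_measurable borel" "mixp p F' < \<infinity>"
  unfolding F'_def by (rule measurable_Fd[OF f d], rule mixp_Fd_finite[OF f d])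
 have G1: "G' s \<in> borel_measurable borel" "mixp p (G' s) < \<infinity>" if "s \<in> {0<..<t}" for s
  using that measurable_Fd[OF g, of "s * 2 powi k"] mixp_Fd_finite[OF g, of "s * 2 powi k"] by (auto simp: G'_def[abs_def])
 have GW: "ennreal (s powr (- d)) * mixp p (G' s) \<le> ennreal KK * W G k s" if "s \<in> {0<..<t}" for s
 proof -
  have "mixp p (G' s) \<le> ennreal KK * (\<Sum>j\<in>near k s. mixp p (G j))"
   using that mixp_Fd[OF g, of "s * 2 powi k"] by (simp add: G'_def[abs_def])
  then have "ennreal (s powr (- d)) * mixp p (G' s) \<le> ennreal (s powr (- d)) * (ennreal KK * (\<Sum>j\<in>near k s. mixp p (G j)))"
   by (rule mult_left_mono) simp
  then show ?thesis by (simp add: W_def mult_ac)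
 qed
 have Gm: "(\<lambda>(s, z). G' s z) \<in> borel_measurable borel"
 proof -
  note [measurable] = schwartz_measurable[OF schwartz_kern[OF schwartz_phi]] blocksD(4)[OF g]
  define V where "V i q = (\<Sum>j\<in>{i - 3..i + 3}. LIN w. G j (fst (snd q), snd (snd q) + w) * (complex_of_real ((fst q * 2 powi k) ^ DIM('a)) * Kphi ((fst q * 2 powi k) *\<^sub>R w)))"
   for i and q :: "real \<times> ('a \<times> 'a)"
  have Vm: "V i \<in> borel_measurable borel" for i unfolding V_def[abs_def] by measurable
  have dm: "(\<lambda>q :: real \<times> ('a \<times> 'a). dyad (fst q * 2 powi k)) \<in> borel \<rightarrow>\<^sub>M count_space UNIV"
   by (rule measurable_compose[OF _ dyad_measurable]) measurable
  have [measurable]: "(\<lambda>q. V (dyad (fst q * 2 powi k)) q) \<in> borel_measurable borel"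
   by (rule measurable_compose_countable[OF Vm dm])
  have "(\<lambda>(s, z). G' s z) = (\<lambda>q. indicator {0<..<t} (fst q) *\<^sub>R V (dyad (fst q * 2 powi k)) q)"
   by (auto simp: fun_eq_iff G'_def V_def Fd_def vconv_def kern_lpsym)
  moreover have "(\<lambda>q. indicator {0<..<t} (fst q) *\<^sub>R V (dyad (fst q * 2 powi k)) q) \<in> borel_measurable borel" by measurable
  ultimately show ?thesis by simp
 qed
 have Ga: "(INN s. INN z. enorm (G' s z) * enorm (a (fst z + s *\<^sub>R snd z))) < \<infinity>"
  "\<And>s. integrable lborel (\<lambda>z. G' s z * a (fst z + s *\<^sub>R snd z))"
  if a: "a \<in> borel_measurable borel" and b: "\<And>x. norm (a x :: complex) \<le> c" "(INN x. enorm (a (x :: 'a))) \<le> ennreal e" "0 < c" "0 < e" for a c e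
 proof -
  have "(INN s. INN z. enorm (G' s z) * enorm (a (fst z + s *\<^sub>R snd z)))
   \<le> (INN s. (ennreal (wnorm p e c) * ennreal KK) * (indicator {0<..<t} s * W G k s))"
  proof (rule nn_integral_mono)
   fix s :: real
   show "(INN z. enorm (G' s z) * enorm (a (fst z + s *\<^sub>R snd z))) \<le> (ennreal (wnorm p e c) * ennreal KK) * (indicator {0<..<t} s * W G k s)"
   proof (cases "s \<in> {0<..<t}")
    case True
    then have s: "s > 0" by simp
    have "(INN z. enorm (G' s z) * enorm (a (fst z + s *\<^sub>R snd z))) \<le> ennreal (wnorm p e c) * (ennreal (s powr (- d)) * mixp p (G' s))"
     using transported_pairing_le[OF p1 s G1(1)[OF True] a b] by (simp add: cexp_d)
    also have "\<dots> \<le> ennreal (wnorm p e c) * (ennreal KK * W G k s)" by (intro mult_left_mono GW True) auto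
    finally show ?thesis using True by (simp add: mult.assoc)
   next
    case False
    then have "G' s = (\<lambda>z. 0)" by (auto simp: G'_def fun_eq_iff)
    then show ?thesis by simp
   qed
  qed
  also have "\<dots> = (ennreal (wnorm p e c) * ennreal KK) * gW G k t" unfolding gW_def by (rule nn_integral_cmult) measurable
  also have "\<dots> < \<infinity>" using gW_finite[OF t] by (simp add: ennreal_mult_less_top)
  finally show "(INN s. INN z. enorm (G' s z) * enorm (a (fst z + s *\<^sub>R snd z))) < \<infinity>" .
  show "integrable lborel (\<lambda>z. G' s z * a (fst z + s *\<^sub>R snd z))" for s
  proof (cases "s \<in> {0<..<t}")
   case True
   then show ?thesis using pair_integrable_bounded[OF G1[OF True] _ a b] by simp
  next
   case False
   then have "G' s = (\<lambda>z. 0)" by (auto simp: G'_def fun_eq_iff)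
   then show ?thesis by simp
  qed
 qed
 let ?w = "\<lambda>x :: 'a. complex_of_real (weight x)"
 have wm: "?w \<in> borel_measurable borel" by measurable
 have w: "norm (?w x) \<le> 1" "(INN x. enorm (?w x)) \<le> ennreal (Wt TYPE('a))" for x
  using weight_le_1[of x] nn_weight[where 'a='a] weight_pos[where 'a='a] by (simp_all add: less_imp_le)
 have w0: "0 < Wt TYPE('a)" using Wt_pos[where 'a='a] by linarith
 note Gw = Ga[OF wm w zero_less_one w0]
 have AE1: "AE x in lborel. integrable lborel (\<lambda>v. F' (x - t *\<^sub>R v, v))"
 proof -
  have "integrable lborel (\<lambda>z. F' z * ?w (fst z + t *\<^sub>R snd z))" by (rule pair_integrable_bounded[OF F' t wm w zero_less_one w0])
  from shear_integral(2)[OF this, of t] show ?thesis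
  proof eventually_elim
   case (elim x)
   then have "integrable lborel (\<lambda>v. F' (x - t *\<^sub>R v, v) * ?w x)" by simp
   then show ?case by (rule integrable_mult_leftD) (use weight_pos[of x] in simp)
  qed
 qed
 have AE2: "AE x in lborel. set_integrable lborel ({0<..<t} \<times> UNIV) (\<lambda>(s, v). G' s (x - s *\<^sub>R v, v))"
  using shear_time(1)[OF Gm wm Gw]
 proof eventually_elim
  case (elim x)
  then have "integrable lborel (\<lambda>w. G' (fst w) (x - fst w *\<^sub>R snd w, snd w))" by (rule integrable_mult_leftD) (use weight_pos[of x] in simp)
  moreover have "(\<lambda>w. indicator ({0<..<t} \<times> UNIV) w *\<^sub>R (case w of (s, v) \<Rightarrow> G' s (x - s *\<^sub>R v, v))) = (\<lambda>w. G' (fst w) (x - fst w *\<^sub>R snd w, snd w))"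
   by (auto simp: fun_eq_iff indicator_def G'_def)
  ultimately show ?case unfolding set_integrable_def by simp
 qed
 let ?U1 = "\<lambda>x. LIN v. F' (x - t *\<^sub>R v, v)" and ?U2 = "\<lambda>x. LIN s. LIN v. G' s (x - s *\<^sub>R v, v)"
 have U2: "(LINT s:{0<..<t}|lborel. LIN v. G' s (x - s *\<^sub>R v, v)) = ?U2 x" for x
  unfolding set_lebesgue_integral_def by (rule LINT_cong) (auto simp: indicator_def G'_def)
 note [measurable] = F'(1) shear_time(4)[OF Gm wm Gw]
 have "represents (LP_block \<phi> (2 powi k) u) (\<lambda>x. ?U1 x + ?U2 x)"
  unfolding represents_def
 proof (intro conjI allI impI)
  show "(\<lambda>x. ?U1 x + ?U2 x) \<in> borel_measurable borel" by measurable
  fix h :: "'a \<Rightarrow> complex" assume h: "schwartz h"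
  obtain c e where b: "c > 0" "e > 0" "\<And>x. norm (h x) \<le> c" "(INN x. enorm (h x)) \<le> ennreal e"
   using schwartz_wnorm[OF h] by metis
  note ti = shear_time(2,3)[OF Gm schwartz_measurable[OF h] Ga[OF schwartz_measurable[OF h] b(3,4,1,2)]]
  note pi = pair_eq_iterated[OF F' h t]
  show "integrable lborel (\<lambda>x. (?U1 x + ?U2 x) * h x)" unfolding distrib_right by (intro Bochner_Integration.integrable_add pi(2) ti(1))
  have "indicator {0<..<t} s *\<^sub>R pair s (Fd G (s * 2 powi k)) h = (LIN z. G' s z * h (fst z + s *\<^sub>R snd z))" for s
  proof (cases "s \<in> {0<..<t}")
   case False
   then have "G' s = (\<lambda>z. 0)" by (auto simp: G'_def fun_eq_iff)
   with False show ?thesis by simp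
  qed (simp add: G'_def pair_def)
  then have "LP_block \<phi> (2 powi k) u h = pair t F' h + (LIN s. LIN z. G' s z * h (fst z + s *\<^sub>R snd z))"
   unfolding u[OF h] Bt_PP(1)[OF h t] F'_def by simp
  also have "\<dots> = (LIN x. (?U1 x + ?U2 x) * h x)"
   unfolding pi(1) ti(2)[symmetric] distrib_right by (rule Bochner_Integration.integral_add[symmetric, OF pi(2) ti(1)])
  finally show "LP_block \<phi> (2 powi k) u h = (LIN x. (?U1 x + ?U2 x) * h x)" .
 qed
 moreover have "represents (LP_block_v \<phi> (t * 2 powi k) f) F'" unfolding F'_def by (rule Fd_represents[OF f d])
 moreover have "\<forall>s\<in>{0<..<t}. represents (LP_block_v \<phi> (s * 2 powi k) g) (G' s)"
 proof
  fix s assume s: "s \<in> {0<..<t}"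
  then have "G' s = Fd G (s * 2 powi k)" by (auto simp: G'_def fun_eq_iff)
  then show "represents (LP_block_v \<phi> (s * 2 powi k) g) (G' s)" using Fd_represents[OF g, of "s * 2 powi k"] s by simp
 qed
 ultimately show ?thesis unfolding velocity_block_def using Gm AE1 AE2 U2
  by (intro exI[of _ F'] exI[of _ G']) simp
qed

text \<open>For integrable \<open>f\<close> the actual velocity integral is the limit of the formula as the time tends to zero.\<close>

lemma integrable_average_block:
 assumes i: "integrable lborel F0" and rf: "represents f F0" and ru: "represents u (\<lambda>x. LIN v. F0 (x, v))"
  and h: "schwartz h" and t: "t > 0"
 shows "LP_block \<phi> (2 powi k) u h = Bt f g t (PP k h)"
proof -
 define a where "a = PP k h"
 have a: "annk k a" unfolding a_def by (rule annk_PP[OF h])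
 have sa: "schwartz a" by (rule annk_schwartz[OF a])
 obtain c where c: "c > 0" "\<And>x. norm (a x) \<le> c" using schwartz_bounded[OF sa] by blast
 have F0m: "F0 \<in> borel_measurable borel" using rf by (simp add: represents_def)
 note [measurable] = schwartz_measurable[OF sa] F0m
 have dom: "norm (F0 z * a y) \<le> norm (c * norm (F0 z))" for z y
  using c mult_left_mono[OF c(2)[of y], of "norm (F0 z)"] by (simp add: norm_mult mult.commute)
 have ic: "integrable lborel (\<lambda>z. c * norm (F0 z))" using i by simp
 have im: "integrable lborel (\<lambda>z. F0 z * a (fst z + r *\<^sub>R snd z))" for r
  by (rule integrable_dominated[OF ic]) (use dom in auto)
 have I: "Ilim f r a = pair r F0 a" for r
 proof -
  have "f (Htest vcut r (rad n) a) = (LIN z. F0 z * (a (fst z + r *\<^sub>R snd z) * vcut (snd z /\<^sub>R rad n)))" for n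
   using rf schwartz_Htest[OF schwartz_vcut rad(1) sa] unfolding represents_def Htest_def by blast
  moreover have "(\<lambda>n. LIN z. F0 z * (a (fst z + r *\<^sub>R snd z) * vcut (snd z /\<^sub>R rad n))) \<longlonglongrightarrow> pair r F0 a"
   unfolding pair_def by (rule cutoff_limit[OF im]) measurable
  ultimately show ?thesis unfolding Ilim_def by (auto intro: limI)
 qed
 have l1: "(\<lambda>n. Ilim f (1 / rad n) a) \<longlonglongrightarrow> (LIN z. F0 z * a (fst z))"
  unfolding I pair_def
 proof (rule integral_dominated_convergence[OF _ _ ic])
  show "AE z in lborel. (\<lambda>n. F0 z * a (fst z + (1 / rad n) *\<^sub>R snd z)) \<longlonglongrightarrow> F0 z * a (fst z)"
  proof (rule AE_I2)
   fix z :: "'a \<times> 'a"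
   have "isCont a (fst z)" using schwartz_continuous[OF sa, of UNIV] by (simp add: continuous_on_eq_continuous_at)
   moreover have "(\<lambda>n. fst z + (1 / rad n) *\<^sub>R snd z) \<longlonglongrightarrow> fst z + 0 *\<^sub>R snd z" by (intro tendsto_intros rad(2))
   ultimately show "(\<lambda>n. F0 z * a (fst z + (1 / rad n) *\<^sub>R snd z)) \<longlonglongrightarrow> F0 z * a (fst z)"
    by (intro tendsto_mult tendsto_const isCont_tendsto_compose[of "fst z" a]) auto
  qed
  show "AE z in lborel. norm (F0 z * a (fst z + (1 / rad n) *\<^sub>R snd z)) \<le> c * norm (F0 z)" for n
   using dom c by (auto intro: order_trans)
 qed measurable
 have l2: "(\<lambda>n. LIN s. indicator {0<..<1 / rad n} s *\<^sub>R Ilim g s a) \<longlonglongrightarrow> (LINT s::real|lborel. 0)"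
 proof (rule integral_dominated_convergence[OF _ _ integrable_norm[OF Ilim_integrable[OF a, of 1]]])
  show "AE s in lborel. (\<lambda>n. indicator {0<..<1 / rad n} s *\<^sub>R Ilim g s a) \<longlonglongrightarrow> 0"
  proof (rule AE_I2)
   fix s :: real
   show "(\<lambda>n. indicator {0<..<1 / rad n} s *\<^sub>R Ilim g s a) \<longlonglongrightarrow> 0"
   proof (cases "s > 0")
    case True
    have "eventually (\<lambda>n. indicator {0<..<1 / rad n} s *\<^sub>R Ilim g s a = 0) sequentially"
     using rad_small[OF True] by eventually_elim (auto simp: indicator_def)
    then show ?thesis by (simp add: tendsto_eventually)
   qed simp
  qed
  show "AE s in lborel. norm (indicator {0<..<1 / rad n} s *\<^sub>R Ilim g s a) \<le> norm (indicator {0<..<1} s *\<^sub>R Ilim g s a)" for n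
  proof -
   have "1 / rad n \<le> 1" by (simp add: rad_def)
   then show ?thesis by (auto simp: indicator_def)
  qed
 qed (use Ilim_measurable[OF g a] in auto)
 have "LP_block \<phi> (2 powi k) u h = u a" unfolding LP_block_eq a_def ..
 also have "\<dots> = (LIN x. (LIN v. F0 (x, v)) * a x)" using ru sa unfolding represents_def by blast
 also have "\<dots> = (LIN z. F0 z * a (fst z))" using shear_integral(1)[OF im[of 0], of 0] by simp
 finally have U: "LP_block \<phi> (2 powi k) u h = (LIN z. F0 z * a (fst z))" .
 have "Bt f g t a = Ilim f (1 / rad n) a + (LIN s. indicator {0<..<1 / rad n} s *\<^sub>R Ilim g s a)" for n
  using Bt_indep[OF a t, of "1 / rad n"] rad(1)[of n] by (simp add: Bt_def)
 with tendsto_add[OF l1 l2] have "(\<lambda>n. Bt f g t a) \<longlonglongrightarrow> LP_block \<phi> (2 powi k) u h" unfolding U by simp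
 then show ?thesis unfolding a_def by (simp add: LIMSEQ_const_iff)
qed

lemma velocity_average_blocks:
 assumes u: "velocity_average \<phi> f g u" and t: "t > 0" shows "velocity_block \<phi> f g u k t"
 using u unfolding velocity_average_def
proof (elim conjE disjE exE)
 fix F0 assume "integrable lborel F0" "represents f F0" "represents u (\<lambda>x. LIN v. F0 (x, v))"
 then show ?thesis using integrable_average_block t by (intro velocity_block_of) auto
qed (use t in blast)

lemma velocity_average_exists: "velocity_average \<phi> f g uu"
 unfolding velocity_average_def using uu_td velocity_block_of[OF uu_block] by blast

end

section \<open>The estimate\<close>

context Avg begin

text \<open>A finite seminorm provides a representing function for every block, and by uniqueness the infimum in the
definition of the norm is attained at each of them.\<close>

lemma mixed_besov_blocks:
 assumes T: "T \<in> mixed_besov_space \<phi> 1 a p q"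
 shows "\<exists>F. blocks T F \<and> glp CZ q (xs a F) = mixed_besov_seminorm \<phi> 1 a p q T \<and> glp CZ q (xs a F) < \<infinity>"
proof -
 let ?N = "\<lambda>k. dist_mixed_norm 1 p (LP_block_v \<phi> (2 powi k) T)"
 have td: "tempered_distribution T" and fin: "mixed_besov_seminorm \<phi> 1 a p q T < \<infinity>"
  using T by (auto simp: mixed_besov_space_def)
 have sn: "mixed_besov_seminorm \<phi> 1 a p q T = glp CZ q (\<lambda>k. ennreal (2 powr (of_int k * a)) * ?N k)"
  unfolding mixed_besov_seminorm_def lq_norm_glp ..
 have "\<exists>F. represents (LP_block_v \<phi> (2 powi k) T) F \<and> mixp p F < \<infinity>" for k
 proof -
  have "ennreal (2 powr (of_int k * a)) * ?N k < \<infinity>"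
   using glp_CZ_ge[OF q1, of "\<lambda>k. ennreal (2 powr (of_int k * a)) * ?N k" k] fin unfolding sn by (rule le_less_trans)
  then have "?N k < \<infinity>" by (auto simp: ennreal_mult_less_top)
  then show ?thesis unfolding dist_mixed_norm_def mixed_norm_eq INF_less_iff by auto
 qed
 then obtain F where F: "\<And>k. represents (LP_block_v \<phi> (2 powi k) T) (F k)" "\<And>k. mixp p (F k) < \<infinity>" by metis
 have "?N k = mixp p (F k)" for k
 proof -
  have eq: "mixp p H = mixp p (F k)" if H: "represents (LP_block_v \<phi> (2 powi k) T) H" for H
   using H F(1)[of k] represents_unique[OF bump_Psi H F(1)[of k]] unfolding represents_def by (intro mixp_cong_AE[OF p1]) auto
  have "?N k = (INF H\<in>{H. represents (LP_block_v \<phi> (2 powi k) T) H}. mixp p (F k))"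
   unfolding dist_mixed_norm_def mixed_norm_eq by (intro INF_cong refl) (use eq in auto)
  also have "\<dots> = mixp p (F k)" by (rule cINF_const) (use F(1)[of k] in blast)
  finally show ?thesis .
 qed
 then have "glp CZ q (xs a F) = mixed_besov_seminorm \<phi> 1 a p q T" unfolding sn xs_def[abs_def] by simp
 then show ?thesis using td F fin unfolding blocks_def by (intro exI[of _ F]) simp
qed

end

context Sol begin

text \<open>Whatever functions represent the blocks, they agree almost everywhere with those of \<open>Fd\<close>, whose mixed norms
are controlled.\<close>

lemma block_estimate:
 assumes vb: "velocity_block \<phi> f g u k t" and t: "t > 0"
 shows "dist_Lp_norm p (LP_block \<phi> (2 powi k) u) \<le> ennreal KK * (W F k t + gW G k t)"
proof -
 obtain F' G' where rF: "represents (LP_block_v \<phi> (t * 2 powi k) f) F'" and Gm: "(\<lambda>(s, z). G' s z) \<in> borel_measurable borel"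
  and rG: "\<And>s. s \<in> {0<..<t} \<Longrightarrow> represents (LP_block_v \<phi> (s * 2 powi k) g) (G' s)"
  and rU: "represents (LP_block \<phi> (2 powi k) u) (\<lambda>x. (LIN v. F' (x - t *\<^sub>R v, v)) + (LINT s:{0<..<t}|lborel. LIN v. G' s (x - s *\<^sub>R v, v)))"
  using vb unfolding velocity_block_def by blast
 let ?V = "\<lambda>x. LINT s:{0<..<t}|lborel. LIN v. G' s (x - s *\<^sub>R v, v)" and ?Z = "\<lambda>x. INN s. indicator {0<..<t} s * tmass s (G' s) x"
 have mix: "ennreal (r powr (- d)) * mixp p H' \<le> ennreal KK * W H k r"
  if T: "blocks T H" and r: "r > 0" and rep: "represents (LP_block_v \<phi> (r * 2 powi k) T) H'" for T H H' r
 proof -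
  have d: "r * 2 powi k > 0" using r by simp
  note rep' = Fd_represents[OF T d]
  have "mixp p H' = mixp p (Fd H (r * 2 powi k))"
   using rep rep' represents_unique[OF bump_Psi rep rep'] unfolding represents_def by (intro mixp_cong_AE[OF p1]) auto
  also have "\<dots> \<le> ennreal KK * (\<Sum>j\<in>near k r. mixp p (H j))" by (rule mixp_Fd[OF T d])
  finally have "ennreal (r powr (- d)) * mixp p H' \<le> ennreal (r powr (- d)) * (ennreal KK * (\<Sum>j\<in>near k r. mixp p (H j)))"
   by (rule mult_left_mono) simp
  then show ?thesis by (simp add: W_def mult_ac)
 qed
 let ?U = "\<lambda>x. (LIN v. F' (x - t *\<^sub>R v, v)) + (?V x)"
 have Um [measurable]: "?U \<in> borel_measurable borel" using rU unfolding represents_def by blast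
 have Fm [measurable]: "F' \<in> borel_measurable borel" using rF unfolding represents_def by blast
 have jm [measurable]: "(\<lambda>(x, s). indicator {0<..<t} s * tmass s (G' s) x) \<in> borel_measurable (lborel \<Otimes>\<^sub>M lborel)"
 proof -
  note [measurable] = shear_time_measurable[OF Gm]
  have "(\<lambda>q. INN v. enorm (G' (snd q) (fst q - snd q *\<^sub>R v, v))) \<in> borel_measurable (borel \<Otimes>\<^sub>M lborel)"
   by (rule lborel.borel_measurable_nn_integral) (simp add: case_prod_unfold)
  then show ?thesis unfolding tmass_def case_prod_unfold by measurable
 qed
 have tm [measurable]: "tmass t F' \<in> borel_measurable borel" by (rule measurable_tmass[OF Fm])
 have "dist_Lp_norm p (LP_block \<phi> (2 powi k) u) \<le> glp lborel p (\<lambda>x. enorm (?U x))"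
  unfolding dist_Lp_norm_def Lp_norm_glp using rU by (intro INF_lower) simp
 also have "\<dots> \<le> glp lborel p (\<lambda>x. tmass t F' x + (?Z x))"
 proof (rule glp_mono_AE[OF p1])
  show "(\<lambda>x. enorm (?U x)) \<in> borel_measurable lborel" by measurable
  show "AE x in lborel. enorm (?U x) \<le> tmass t F' x + (?Z x)"
  proof (rule AE_I2)
   fix x
   have "enorm (?U x) \<le> enorm (LIN v. F' (x - t *\<^sub>R v, v)) + enorm (?V x)"
    by (simp add: norm_triangle_ineq flip: ennreal_plus)
   also have "\<dots> \<le> tmass t F' x + (?Z x)"
   proof (rule add_mono)
    show "enorm (LIN v. F' (x - t *\<^sub>R v, v)) \<le> tmass t F' x"
     unfolding tmass_def by (rule ennreal_norm_integral_le)
    have "enorm (?V x) \<le> (INN s. enorm (indicator {0<..<t} s *\<^sub>R (LIN v. G' s (x - s *\<^sub>R v, v))))"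
     unfolding set_lebesgue_integral_def by (rule ennreal_norm_integral_le)
    also have "\<dots> \<le> (?Z x)"
     by (intro nn_integral_mono) (auto simp: indicator_def tmass_def intro: ennreal_norm_integral_le)
    finally show "enorm (?V x) \<le> (?Z x)" .
   qed
   finally show "enorm (?U x) \<le> tmass t F' x + (?Z x)" .
  qed
 qed
 also have "\<dots> \<le> glp lborel p (tmass t F') + glp lborel p (\<lambda>x. ?Z x)"
  by (rule glp_triangle[OF p1 sigma_finite_lborel]) (use jm in \<open>auto intro!: lborel.borel_measurable_nn_integral\<close>)
 also have "\<dots> \<le> ennreal KK * W F k t + ennreal KK * gW G k t"
 proof (rule add_mono)
  show "glp lborel p (tmass t F') \<le> ennreal KK * W F k t"
   using order_trans[OF glp_tmass[OF p1 t Fm, unfolded cexp_d] mix[OF f t rF]] .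
  have "glp lborel p (\<lambda>x. ?Z x) \<le> (INN s. glp lborel p (\<lambda>x. indicator {0<..<t} s * tmass s (G' s) x))"
   by (rule minkowski_integral[OF p1 sigma_finite_lborel sigma_finite_lborel jm])
  also have "\<dots> \<le> (INN s. ennreal KK * (indicator {0<..<t} s * W G k s))"
  proof (rule nn_integral_mono)
   fix s :: real
   have G's: "G' s \<in> borel_measurable borel" if "s \<in> {0<..<t}" using rG[OF that] unfolding represents_def by blast
   show "glp lborel p (\<lambda>x. indicator {0<..<t} s * tmass s (G' s) x) \<le> ennreal KK * (indicator {0<..<t} s * W G k s)"
   proof (cases "s \<in> {0<..<t}")
    case True
    then have s: "s > 0" by simp
    show ?thesis
     using order_trans[OF glp_tmass[OF p1 s G's[OF True], unfolded cexp_d] mix[OF g s rG[OF True]]] True by simp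
   next
    case False
    then show ?thesis using glp_cmult_le[OF p1, of "\<lambda>_. 0" lborel 0] by simp
   qed
  qed
  also have "\<dots> = ennreal KK * gW G k t" unfolding gW_def by (rule nn_integral_cmult) measurable
  finally show "glp lborel p (\<lambda>x. ?Z x) \<le> ennreal KK * gW G k t" .
 qed
 finally show ?thesis by (simp add: distrib_left)
qed

lemma besov_estimate:
 assumes vb: "\<And>k t. t > 0 \<Longrightarrow> velocity_block \<phi> f g u k t"
 shows "besov_seminorm \<phi> s p q u \<le> ennreal (Cf + Cg) * ennpowr (glp CZ q (xs \<alpha> F)) ((1 - \<beta> - d) / (1 + \<alpha> - \<beta>)) * ennpowr (glp CZ q (xs \<beta> G)) ((\<alpha> + d) / (1 + \<alpha> - \<beta>))"
proof -
 let ?w = "\<lambda>k::int. ennreal (2 powr (of_int k * s))"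
 have "besov_seminorm \<phi> s p q u \<le> ennreal (Cf * \<tau> powr (- (\<alpha> + d))) * glp CZ q (xs \<alpha> F) + ennreal (Cg * \<tau> powr (1 - d - \<beta>)) * glp CZ q (xs \<beta> G)"
  if \<tau>: "\<tau> > 0" for \<tau>
 proof -
  have "besov_seminorm \<phi> s p q u = glp CZ q (\<lambda>k. ?w k * dist_Lp_norm p (LP_block \<phi> (2 powi k) u))"
   unfolding besov_seminorm_def lq_norm_glp ..
  also have "\<dots> \<le> glp CZ q (\<lambda>k. ennreal KK * (?w k * W F k (tk \<tau> k) + ?w k * gW G k (tk \<tau> k)))"
  proof (rule glp_mono_AE[OF q1])
   have "?w k * dist_Lp_norm p (LP_block \<phi> (2 powi k) u) \<le> ?w k * (ennreal KK * (W F k (tk \<tau> k) + gW G k (tk \<tau> k)))" for k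
    by (intro mult_left_mono block_estimate vb tk_pos \<tau>) simp
   then show "AE k in CZ. ?w k * dist_Lp_norm p (LP_block \<phi> (2 powi k) u) \<le> ennreal KK * (?w k * W F k (tk \<tau> k) + ?w k * gW G k (tk \<tau> k))"
    by (simp add: AE_count_space distrib_left mult_ac)
  qed simp
  also have "\<dots> \<le> ennreal KK * glp CZ q (\<lambda>k. ?w k * W F k (tk \<tau> k) + ?w k * gW G k (tk \<tau> k))"
   by (rule glp_cmult_le[OF q1]) simp
  also have "\<dots> \<le> ennreal KK * (glp CZ q (\<lambda>k. ?w k * W F k (tk \<tau> k)) + glp CZ q (\<lambda>k. ?w k * gW G k (tk \<tau> k)))"
   by (intro mult_left_mono glp_triangle[OF q1 sigma_finite_CZ]) auto
  also have "\<dots> \<le> ennreal KK * (ennreal (2 powr (4 * \<bar>\<alpha>\<bar>) * \<tau> powr (- (\<alpha> + d))) * (ennreal Nm * glp CZ q (xs \<alpha> F))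
   + ennreal (2 powr (4 * \<bar>\<beta>\<bar>) * \<tau> powr (1 - d - \<beta>)) * (ennreal Nm * glp CZ q (xs \<beta> G)) * ennreal (1 / (1 - d - \<beta>)))"
   by (intro mult_left_mono add_mono lq_W[OF \<tau>] lq_gW[OF \<tau>]) simp
  also have "\<dots> = ennreal (Cf * \<tau> powr (- (\<alpha> + d))) * glp CZ q (xs \<alpha> F) + ennreal (Cg * \<tau> powr (1 - d - \<beta>)) * glp CZ q (xs \<beta> G)"
  proof -
   have b: "0 \<le> 1 / (1 - d - \<beta>)" using \<beta> by simp
   have "ennreal (Cf * \<tau> powr (- (\<alpha> + d))) = ennreal KK * (ennreal (2 powr (4 * \<bar>\<alpha>\<bar>) * \<tau> powr (- (\<alpha> + d))) * ennreal Nm)"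
    using KK_pos C_nonneg(1) by (simp add: Cf_def ennreal_mult[symmetric] mult_ac)
   moreover have "ennreal (Cg * \<tau> powr (1 - d - \<beta>)) = ennreal KK * (ennreal (2 powr (4 * \<bar>\<beta>\<bar>) * \<tau> powr (1 - d - \<beta>)) * ennreal Nm * ennreal (1 / (1 - d - \<beta>)))"
    using KK_pos C_nonneg(1) b by (simp add: Cg_def ennreal_mult[symmetric] mult_ac)
   ultimately show ?thesis by (simp only: distrib_left mult_ac)
  qed
  finally show ?thesis .
 qed
 from optimize_scale[OF _ _ C_nonneg(2,3) ffin gfin this]
 have "besov_seminorm \<phi> s p q u \<le> ennreal (Cf + Cg) * ennpowr (glp CZ q (xs \<alpha> F)) ((1 - d - \<beta>) / (\<alpha> + d + (1 - d - \<beta>))) * ennpowr (glp CZ q (xs \<beta> G)) ((\<alpha> + d) / (\<alpha> + d + (1 - d - \<beta>)))"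
  using \<alpha> \<beta> by simp
 moreover have "\<alpha> + d + (1 - d - \<beta>) = 1 + \<alpha> - \<beta>" "1 - d - \<beta> = 1 - \<beta> - d" by simp_all
 ultimately show ?thesis by (simp only:)
qed

end

theorem theorem3p3:
  fixes \<psi> \<phi> :: "'a::euclidean_space \<Rightarrow> real"
    and p q :: ennreal and \<alpha> \<beta> d s :: real
  assumes "littlewood_paley \<psi> \<phi>"
    and "1 \<le> p" and "1 \<le> q"
    and "d = real DIM('a) * (1 - enn2real (inverse p))"
    and "\<alpha> > - d" and "\<beta> < 1 - d"
    and "s = (\<alpha> + d) / (1 + \<alpha> - \<beta>) - d"
  shows "\<exists>C>0. \<forall>f g.
    f \<in> mixed_besov_space \<phi> 1 \<alpha> p q \<longrightarrow>
    g \<in> mixed_besov_space \<phi> 1 \<beta> p q \<longrightarrow>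
    transport_equation f g \<longrightarrow>
      (\<exists>u. velocity_average \<phi> f g u) \<and>
      (\<forall>u. velocity_average \<phi> f g u \<longrightarrow>
         u \<in> besov_space \<phi> s p q \<and>
         besov_seminorm \<phi> s p q u \<le>
           ennreal C *
           ennpowr (mixed_besov_seminorm \<phi> 1 \<alpha> p q f) ((1 - \<beta> - d) / (1 + \<alpha> - \<beta>)) *
           ennpowr (mixed_besov_seminorm \<phi> 1 \<beta> p q g) ((\<alpha> + d) / (1 + \<alpha> - \<beta>)))"
proof -
 interpret Avg \<psi> \<phi> p q \<alpha> \<beta> d s by unfold_locales (use assms in auto)
 have *: "(\<exists>u. velocity_average \<phi> f g u) \<and> (\<forall>u. velocity_average \<phi> f g u \<longrightarrow> u \<in> besov_space \<phi> s p q \<and>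
   besov_seminorm \<phi> s p q u \<le> ennreal (Cf + Cg + 1) *
    ennpowr (mixed_besov_seminorm \<phi> 1 \<alpha> p q f) ((1 - \<beta> - d) / (1 + \<alpha> - \<beta>)) *
    ennpowr (mixed_besov_seminorm \<phi> 1 \<beta> p q g) ((\<alpha> + d) / (1 + \<alpha> - \<beta>)))"
  if fM: "f \<in> mixed_besov_space \<phi> 1 \<alpha> p q" and gM: "g \<in> mixed_besov_space \<phi> 1 \<beta> p q" and tr: "transport_equation f g" for f g
 proof -
  obtain F where F: "blocks f F" "glp CZ q (xs \<alpha> F) = mixed_besov_seminorm \<phi> 1 \<alpha> p q f" "glp CZ q (xs \<alpha> F) < \<infinity>"
   using mixed_besov_blocks[OF fM] by blast
  obtain G where G: "blocks g G" "glp CZ q (xs \<beta> G) = mixed_besov_seminorm \<phi> 1 \<beta> p q g" "glp CZ q (xs \<beta> G) < \<infinity>"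
   using mixed_besov_blocks[OF gM] by blast
  interpret Sol \<psi> \<phi> p q \<alpha> \<beta> d s f g F G by unfold_locales (use F G tr in auto)
  let ?X = "ennpowr (mixed_besov_seminorm \<phi> 1 \<alpha> p q f) ((1 - \<beta> - d) / (1 + \<alpha> - \<beta>))"
  let ?Y = "ennpowr (mixed_besov_seminorm \<phi> 1 \<beta> p q g) ((\<alpha> + d) / (1 + \<alpha> - \<beta>))"
  have fin: "?X < \<infinity>" "?Y < \<infinity>" using F(2,3) G(2,3) by (auto simp: ennpowr_def)
  have "u \<in> besov_space \<phi> s p q \<and> besov_seminorm \<phi> s p q u \<le> ennreal (Cf + Cg + 1) * ?X * ?Y"
   if u: "velocity_average \<phi> f g u" for u
  proof -
   have "besov_seminorm \<phi> s p q u \<le> ennreal (Cf + Cg) * ?X * ?Y"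
    using besov_estimate[OF velocity_average_blocks[OF u]] unfolding F(2) G(2) .
   also have "\<dots> \<le> ennreal (Cf + Cg + 1) * ?X * ?Y" by (intro mult_right_mono ennreal_leI) auto
   finally have le: "besov_seminorm \<phi> s p q u \<le> ennreal (Cf + Cg + 1) * ?X * ?Y" .
   moreover have "\<dots> < \<infinity>" using fin by (simp add: ennreal_mult_less_top)
   ultimately show ?thesis using u by (auto simp: besov_space_def velocity_average_def intro: le_less_trans)
  qed
  then show ?thesis using velocity_average_exists by blast
 qed
 have "0 < Cf + Cg + 1" using C_nonneg by simp
 with * show ?thesis by blast
qed

end
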